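(* Let $M_\ell=\Gamma_\ell\backslash\mathbb H$ be a degenerating family of hyperbolic Riemann surfaces of finite volume, with limit surface $M_0$ (compact or non-compact family, as described in the context). Let $s\in\mathbb C$ with $\operatorname{Re}(s)>1$, and let $z\in M_0$, also regarded as a point of $M_\ell$. (i) Let $E_{\mathrm{hyp};M_\ell,\gamma}(s,z)$ be the hyperbolic Eisenstein series on $M_\ell$ associated to the hyperbolic element $\gamma$. If $\gamma$ corresponds to a non-degenerating hyperbolic element, then $$\lim_{\ell\to0}E_{\mathrm{hyp};M_\ell,\gamma}(s,z)=E_{\mathrm{hyp};M_0,\gamma}(s,z).$$ (ii) Let $E_{\mathrm{par};M_\ell,P}(s,z)$ be the parabolic Eisenstein series on $M_\ell$ associated to the cusp $P$ of $M_\ell$. Then $$\lim_{\ell\to0}E_{\mathrm{par};M_\ell,P}(s,z)=E_{\mathrm{par};M_0,P}(s,z).$$ (iii) Let $E_{\mathrm{hyp};M_\ell,\gamma}(s,z)$ be the hyperbolic Eisenstein series on $M_\ell$ associated to the hyperbolic element $\gamma$ whose geodesic has length $\ell_\gamma$. If $\gamma$ corresponds to a degenerating hyperbolic element, which results in the two new cusps $P_1,P_2$ of $M_0$, then $$\lim_{\ell\to0}\ell_\gamma^{-s}E_{\mathrm{hyp};M_\ell,\gamma}(s,z)=\sum_{j}E_{\mathrm{par};M_0,P_j}(s,z),$$ where the sum is over those $j\in\{1,2\}$ for which $P_j$ lies on the connected component of $M_0$ containing $z$. (Thus, when there is a single pinching geodesic: if it is separating and $M_0=M_{0;1}\sqcup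 M_{0;2}$ with $P_j$ on $M_{0;j}$, the limit is $E_{\mathrm{par};M_{0;j},P_j}(s,z)$ for $z\in M_{0;j}$; if it is non-separating, the limit is $E_{\mathrm{par};M_0,P_1}(s,z)+E_{\mathrm{par};M_0,P_2}(s,z)$.) In all instances, the convergence is uniform for $z$ in compact subsets of $M_0$ bounded away from the developing cusps, and for $s$ in half-planes of the form $\operatorname{Re}(s)\ge1+\delta$ for any $\delta>0$.
   Context: **Surfaces.** A finite volume hyperbolic Riemann surface is $M=\Gamma\backslash\mathbb H$ with $\Gamma\subset\mathrm{PSL}_2(\mathbb R)$ a Fuchsian group of the first kind and $\mathbb H=\{z=x+iy: y>0\}$ with metric $(dx^2+dy^2)/y^2$. A (possibly disconnected) limit surface is a finite disjoint union of such. Points of $M$ are identified with lifts to $\mathbb H$. **Degenerating family.** $M_\ell$ is a family of connected finite volume hyperbolic Riemann surfaces of fixed topological type with $p$ pairwise disjoint simple closed geodesics (the degenerating, or pinching, geodesics); $\ell$ is the $p$-tuple of their lengths, and $\ell\to0$ means that all of these lengths tend to zero. For $\ell>0$ let $\mathcal C_\ell$ be the infinite hyperbolic cylinder with simple closed geodesic of length $\ell$, with fundamental domain $\{re^{i\alpha}:1\le r<e^{\ell},\,0<\alpha<\pi\}$ in $\mathbb H$, and let $\mathcal C_{\ell,\varepsilon}\subset\mathcal C_\ell$ be the symmetric neighborhood of the geodesic of total area $\varepsilon$, given by $\cot^{-1}(\varepsilon/(2\ell))<\alpha<\pi-\cot^{-1}(\varepsilon/(2\ell))$. For $0<\varepsilon<1/2$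 such a collar embeds isometrically in $M_\ell$ around each degenerating geodesic. The limit surface $M_0$ is a finite volume hyperbolic surface, possibly disconnected, whose cusps are the cusps of $M_\ell$ together with $2p$ new ("developing") cusps, two for each degenerating geodesic; $\mathcal C_{0,\varepsilon}\subset M_0$, the limit of the collars $\mathcal C_{\ell,\varepsilon}$, consists of a pair of cusp neighborhoods, each of area $\varepsilon/2$, for each degenerating geodesic. $M_0$ is identified diffeomorphically with the complement of the degenerating geodesics in $M_\ell$ (so a point $z\in M_0$ is also a point of $M_\ell$, and homotopy classes and cusps are tracked), in such a way that for each small $\varepsilon>0$ the hyperbolic metrics of $M_\ell$ converge to that of $M_0$ uniformly on the complement of $\mathcal C_{0,\varepsilon}$. A (primitive) hyperbolic element $\gamma\in\Gamma_\ell$ is *degenerating* if its closed geodesic is one of the degenerating geodesics, so that its length tends to $0$. It is *non-degenerating* if it converges to a hyperbolic element, again denoted $\gamma$, of the Fuchsian group of (a component of) $M_0$, i.e. the corresponding free homotopy class in $M_0$ is that of a closed geodesic. **Hyperbolic Eisenstein series.** Let $\gamma\in\Gamma$ be primitive hyperbolic with closed geodesic of length $\ell_\gamma$, and let $\Gamma_\gamma$ be its stabilizer in $\Gamma$, assumed generated by $\gamma$. Conjugate $\Gamma$ so that $\gamma=\mathrm{diag}(e^{\ell_\gamma/2},e^{-\ell_\gamma/2})$. Writing $z=e^{\rho}e^{i\theta}$ with $\theta(z)=\theta\in(0,\pi)$, for $\operatorname{Re}(s)>1$, $$E_{\mathrm{hyp};M,\gamma}(s,z)=\sum_{\eta\in\Gamma_\gamma\backslash\Gamma}(\sin\theta(\eta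 z))^s .$$ **Parabolic Eisenstein series.** Let $P$ be a cusp of $M$. Conjugate $\Gamma$ so that $P$ is at $\infty$ and its stabilizer $\Gamma_\infty$ is generated by $z\mapsto z+\omega$, where $\omega>0$ is the width. For $\operatorname{Re}(s)>1$, $$E_{\mathrm{par};M,P}(s,z)=\omega^{-s}\sum_{\eta\in\Gamma_\infty\backslash\Gamma}(\operatorname{Im}\eta z)^s .$$ If $M_0$ is disconnected, an Eisenstein series on $M_0$ attached to $\gamma$ or $P$ is the series of the component of $M_0$ containing $\gamma$ or $P$, and is taken to be $0$ at points $z$ of the other components.
   Formalization: Uniformity in s is stated on compact subsets of the half-planes Re(s) ≥ 1+δ (jointly with z), since uniformity on a whole half-plane is false: as Im(s) is unbounded, t^s does not depend uniformly on t; pointwise convergence is for all Re(s) > 1. *)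

theory Defs
  imports "HOL-Analysis.Analysis" "HOL-Algebra.Generated_Groups"
begin

section \<open>Fuchsian groups and the upper half-plane\<close>

text \<open>
  A subgroup of \<open>PSL\<^sub>2(\<real>)\<close> is represented by its full preimage in \<open>SL\<^sub>2(\<real>)\<close>, i.e. by a
  subgroup of \<open>SL\<^sub>2(\<real>)\<close> containing \<open>-1\<close>; equality in \<open>PSL\<^sub>2(\<real>)\<close> is \<open>psl_eq\<close>.  If
  \<open>\<Delta> \<subseteq> \<Gamma>\<close> both contain \<open>-1\<close>, the coset space \<open>\<Delta>\<setminus>\<Gamma>\<close> is the same for the preimages
  as for the groups in \<open>PSL\<^sub>2(\<real>)\<close>.
\<close>

type_synonym mat22 = "real^2^2"

definition SL2R :: "mat22 monoid" where
  "SL2R = \<lparr>carrier = {A. det A = 1}, monoid.mult = (**), one = mat 1\<rparr>"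

definition mat22 :: "real \<Rightarrow> real \<Rightarrow> real \<Rightarrow> real \<Rightarrow> mat22" where
  "mat22 a b c d = vector [vector [a, b], vector [c, d]]"

definition psl_eq :: "mat22 \<Rightarrow> mat22 \<Rightarrow> bool" where
  "psl_eq A B \<longleftrightarrow> A = B \<or> A = - B"

definition uhp :: "complex set" where
  "uhp = {z. 0 < Im z}"

definition mob :: "mat22 \<Rightarrow> complex \<Rightarrow> complex" where
  "mob A z = (of_real (A$1$1) * z + of_real (A$1$2)) / (of_real (A$2$1) * z + of_real (A$2$2))"

text \<open>
  Fuchsian groups of the first kind: every boundary point is a limit point (for
  \<open>\<infinity>\<close> this follows from the statement for the real points).
\<close>

definition fuchsian_first_kind :: "mat22 set \<Rightarrow> bool" where
  "fuchsian_first_kind \<Gamma> \<longleftrightarrow>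
     subgroup \<Gamma> SL2R \<and> - mat 1 \<in> \<Gamma> \<and> discrete \<Gamma> \<and>
     (\<forall>z\<in>uhp. \<forall>x::real. of_real x \<in> closure ((\<lambda>g. mob g z) ` \<Gamma>))"

definition hyp_area :: "complex set \<Rightarrow> ennreal" where
  "hyp_area D = (\<integral>\<^sup>+z\<in>D. ennreal (1 / (Im z)\<^sup>2) \<partial>lborel)"

definition finite_volume :: "mat22 set \<Rightarrow> bool" where
  "finite_volume \<Gamma> \<longleftrightarrow>
     (\<exists>D\<in>sets borel. D \<subseteq> uhp \<and> (\<forall>z\<in>uhp. \<exists>!w. w \<in> D \<and> (\<exists>g\<in>\<Gamma>. w = mob g z)) \<and>
        hyp_area D < \<infinity>)"


section \<open>Hyperbolic elements and hyperbolic Eisenstein series\<close>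

definition hyperbolic :: "mat22 \<Rightarrow> bool" where
  "hyperbolic \<gamma> \<longleftrightarrow> \<gamma> \<in> carrier SL2R \<and> \<bar>trace \<gamma>\<bar> > 2"

definition hyp_frame :: "mat22 \<Rightarrow> mat22 \<Rightarrow> real \<Rightarrow> bool" where
  "hyp_frame \<gamma> \<sigma> l \<longleftrightarrow> \<sigma> \<in> carrier SL2R \<and> 0 < l \<and>
     psl_eq (\<sigma> ** \<gamma> ** matrix_inv \<sigma>) (mat22 (exp (l/2)) 0 0 (exp (-l/2)))"

definition geod_length :: "mat22 \<Rightarrow> real" where
  "geod_length \<gamma> = (THE l. \<exists>\<sigma>. hyp_frame \<gamma> \<sigma> l)"

definition geod_axis :: "mat22 \<Rightarrow> complex set" where
  "geod_axis \<gamma> = {z\<in>uhp. \<exists>\<sigma> l. hyp_frame \<gamma> \<sigma> l \<and> Re (mob \<sigma> z) = 0}"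

definition axis_stab :: "mat22 set \<Rightarrow> mat22 \<Rightarrow> mat22 set" where
  "axis_stab \<Gamma> \<gamma> = {\<eta>\<in>\<Gamma>. mob \<eta> ` geod_axis \<gamma> = geod_axis \<gamma>}"

definition primitive_hyp :: "mat22 set \<Rightarrow> mat22 \<Rightarrow> bool" where
  "primitive_hyp \<Gamma> \<gamma> \<longleftrightarrow> \<gamma> \<in> \<Gamma> \<and> hyperbolic \<gamma> \<and> axis_stab \<Gamma> \<gamma> = generate SL2R {\<gamma>, - mat 1}"

text \<open>
  Instead of replacing \<open>\<Gamma>\<close> by \<open>\<sigma>\<Gamma>\<sigma>\<^sup>-\<^sup>1\<close> and \<open>z\<close> by \<open>\<sigma>z\<close>, the cosets are taken in \<open>\<Gamma>\<close> itself and
  \<open>\<sigma>\<close> is applied to \<open>\<eta>z\<close>: for \<open>\<eta>' = \<sigma>\<eta>\<sigma>\<^sup>-\<^sup>1\<close> one has \<open>\<eta>'(\<sigma>z) = \<sigma>(\<eta>z)\<close>.  The summand depends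
  neither on the frame \<open>\<sigma>\<close>, which is unique up to a diagonal matrix, nor on the coset
  representative, because positive dilations do not change the angle.  On the upper
  half-plane \<open>Arg\<close> is the polar angle \<open>\<theta> \<in> (0, \<pi>)\<close>.
\<close>

definition E_hyp :: "mat22 set \<Rightarrow> mat22 \<Rightarrow> complex \<Rightarrow> complex \<Rightarrow> complex" where
  "E_hyp \<Gamma> \<gamma> s z =
     (let \<sigma> = (SOME \<sigma>. \<exists>l. hyp_frame \<gamma> \<sigma> l) in
      \<Sum>\<^sub>\<infinity>C\<in>rcosets\<^bsub>SL2R\<lparr>carrier := \<Gamma>\<rparr>\<^esub> (axis_stab \<Gamma> \<gamma>).
        of_real (sin (Arg (mob \<sigma> (mob (SOME \<eta>. \<eta> \<in> C) z)))) powr s)"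


section \<open>Cusps and parabolic Eisenstein series\<close>

text \<open>
  A cusp is given by a parabolic element \<open>p\<close>; the point \<open>P\<close> is the fixed point of \<open>p\<close>.
  In \<open>SL\<^sub>2(\<real>)\<close> the translations by \<open>\<omega>\<close> and by \<open>-\<omega>\<close> are not conjugate, so a frame may send
  \<open>p\<close> to either of the two generators of the group generated by \<open>z \<mapsto> z + \<omega>\<close>.
\<close>

definition parabolic :: "mat22 \<Rightarrow> bool" where
  "parabolic p \<longleftrightarrow> p \<in> carrier SL2R \<and> \<bar>trace p\<bar> = 2 \<and> \<not> psl_eq p (mat 1)"

definition par_frame :: "mat22 \<Rightarrow> mat22 \<Rightarrow> real \<Rightarrow> bool" where
  "par_frame p \<sigma> \<omega> \<longleftrightarrow> \<sigma> \<in> carrier SL2R \<and> 0 < \<omega> \<and>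
     (psl_eq (\<sigma> ** p ** matrix_inv \<sigma>) (mat22 1 \<omega> 0 1) \<or>
      psl_eq (\<sigma> ** p ** matrix_inv \<sigma>) (mat22 1 (-\<omega>) 0 1))"

text \<open>A matrix fixes \<open>\<infinity>\<close> iff its lower left entry vanishes.\<close>

definition cusp_stab :: "mat22 set \<Rightarrow> mat22 \<Rightarrow> mat22 set" where
  "cusp_stab \<Gamma> p = {\<eta>\<in>\<Gamma>. \<exists>\<sigma> \<omega>. par_frame p \<sigma> \<omega> \<and> (\<sigma> ** \<eta> ** matrix_inv \<sigma>)$2$1 = 0}"

definition cusp_gen :: "mat22 set \<Rightarrow> mat22 \<Rightarrow> bool" where
  "cusp_gen \<Gamma> p \<longleftrightarrow> p \<in> \<Gamma> \<and> parabolic p \<and> cusp_stab \<Gamma> p = generate SL2R {p, - mat 1}"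

text \<open>Two parabolic elements define the same cusp of \<open>\<Gamma>\<setminus>\<H>\<close> if their fixed points are \<open>\<Gamma>\<close>-equivalent.\<close>

definition same_cusp :: "mat22 set \<Rightarrow> mat22 \<Rightarrow> mat22 \<Rightarrow> bool" where
  "same_cusp \<Gamma> p p' \<longleftrightarrow> (\<exists>g\<in>\<Gamma>. g ** p ** matrix_inv g \<in> cusp_stab \<Gamma> p')"

text \<open>
  The (lift of the) cusp neighborhood of area \<open>a\<close>: in a frame of width \<open>\<omega>\<close> the region
  \<open>Im > y\<close> modulo \<open>z \<mapsto> z + \<omega>\<close> has area \<open>\<omega>/y\<close>.
\<close>

definition cusp_nbhd :: "mat22 set \<Rightarrow> mat22 \<Rightarrow> real \<Rightarrow> complex set" where
  "cusp_nbhd \<Gamma> p a = {z\<in>uhp. \<exists>g\<in>\<Gamma>. \<exists>\<sigma> \<omega>. par_frame p \<sigma> \<omega> \<and> Im (mob \<sigma> (mob g z)) > \<omega> / a}"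

text \<open>The summand times \<open>\<omega>\<^sup>-\<^sup>s\<close> does not depend on the frame: rescaling by \<open>a\<close> multiplies \<open>Im\<close> and \<open>\<omega>\<close> by \<open>a\<close>.\<close>

definition E_par :: "mat22 set \<Rightarrow> mat22 \<Rightarrow> complex \<Rightarrow> complex \<Rightarrow> complex" where
  "E_par \<Gamma> p s z =
     (let (\<sigma>, \<omega>) = (SOME (\<sigma>, \<omega>). par_frame p \<sigma> \<omega>) in
      of_real \<omega> powr (- s) *
      (\<Sum>\<^sub>\<infinity>C\<in>rcosets\<^bsub>SL2R\<lparr>carrier := \<Gamma>\<rparr>\<^esub> (cusp_stab \<Gamma> p).
        of_real (Im (mob \<sigma> (mob (SOME \<eta>. \<eta> \<in> C) z))) powr s))"


section \<open>Degenerating families\<close>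

text \<open>
  The limit surface is the disjoint union, over a finite type \<open>'c\<close> of components, of the
  surfaces \<open>\<Gamma>0 c\<setminus>\<H>\<close>.  The identification of \<open>M\<^sub>0\<close> with the complement of the degenerating
  geodesics in \<open>M\<^sub>\<l>\<close> is given on each component by a lift \<open>\<phi> \<l> c\<close> of it to \<open>\<H>\<close>.  Since the
  components of the preimage in \<open>\<H>\<close> of that complement are convex, such a lift is an
  equivariant embedding.  The group elements \<open>g\<close> and \<open>h\<close> represent the same unoriented
  free homotopy class if \<open>f\<close> intertwines \<open>g\<close> with a conjugate of \<open>h\<close> or of its inverse.
\<close>

definition corresponds :: "mat22 set \<Rightarrow> (complex \<Rightarrow> complex) \<Rightarrow> mat22 \<Rightarrow> mat22 \<Rightarrow> bool" where
  "corresponds \<Gamma> f g h \<longleftrightarrow>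
     (\<exists>k\<in>\<Gamma>. \<exists>h'\<in>{h, matrix_inv h}. \<forall>z\<in>uhp. f (mob g z) = mob (k ** h' ** matrix_inv k) (f z))"

text \<open>
  The part of \<open>C\<^sub>0\<^sub>,\<^sub>\<epsilon>\<close> on the component \<open>c\<close>.  The geodesic \<open>j\<close> develops into the cusps
  \<open>q j 1\<close>, \<open>q j 2\<close>, which lie on the components \<open>cmp j 1\<close>, \<open>cmp j 2\<close>.
\<close>

definition developing_nbhd ::
  "('c \<Rightarrow> mat22 set) \<Rightarrow> ('p \<Rightarrow> 2 \<Rightarrow> 'c) \<Rightarrow> ('p \<Rightarrow> 2 \<Rightarrow> mat22) \<Rightarrow> real \<Rightarrow> 'c \<Rightarrow> complex set" where
  "developing_nbhd \<Gamma>0 cmp q \<epsilon> c = (\<Union>j. \<Union>k\<in>{k. cmp j k = c}. cusp_nbhd (\<Gamma>0 c) (q j k) (\<epsilon>/2))"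

text \<open>
  The family is indexed by a set \<open>L\<close> of length vectors, one coordinate for each degenerating
  geodesic; \<open>\<l> \<rightarrow> 0\<close> is the filter \<open>at 0 within L\<close>.
\<close>

locale degenerating_family =
  fixes L :: "(real^'p::finite) set"
    and \<Gamma> :: "real^'p \<Rightarrow> mat22 set"
    and d :: "real^'p \<Rightarrow> 'p \<Rightarrow> mat22"
    and \<Gamma>0 :: "'c::finite \<Rightarrow> mat22 set"
    and \<phi> :: "real^'p \<Rightarrow> 'c \<Rightarrow> complex \<Rightarrow> complex"
    and cmp :: "'p \<Rightarrow> 2 \<Rightarrow> 'c"
    and q :: "'p \<Rightarrow> 2 \<Rightarrow> mat22"
  assumes surface: "l \<in> L \<Longrightarrow> fuchsian_first_kind (\<Gamma> l) \<and> finite_volume (\<Gamma> l)"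
    and limit_surface: "fuchsian_first_kind (\<Gamma>0 c) \<and> finite_volume (\<Gamma>0 c)"
    \<comment> \<open>the degenerating geodesics are simple, pairwise disjoint and have lengths \<open>l$j\<close>\<close>
    and lengths_pos: "l \<in> L \<Longrightarrow> 0 < l$j"
    and geodesics: "l \<in> L \<Longrightarrow> primitive_hyp (\<Gamma> l) (d l j) \<and> geod_length (d l j) = l$j"
    and simple: "l \<in> L \<Longrightarrow> g \<in> \<Gamma> l \<Longrightarrow>
          mob g ` geod_axis (d l j) = geod_axis (d l j) \<or>
          mob g ` geod_axis (d l j) \<inter> geod_axis (d l j) = {}"
    and disjoint: "l \<in> L \<Longrightarrow> g \<in> \<Gamma> l \<Longrightarrow> i \<noteq> j \<Longrightarrow>
          mob g ` geod_axis (d l i) \<inter> geod_axis (d l j) = {}"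
    \<comment> \<open>\<open>\<phi> l\<close> is (a lift of) a diffeomorphism of the limit surface onto the complement of the geodesics\<close>
    and phi_equivariant: "l \<in> L \<Longrightarrow> g \<in> \<Gamma>0 c \<Longrightarrow>
          \<exists>h\<in>\<Gamma> l. \<forall>z\<in>uhp. \<phi> l c (mob g z) = mob h (\<phi> l c z)"
    and phi_inj: "l \<in> L \<Longrightarrow> inj_on (\<phi> l c) uhp"
    and phi_quotient_inj: "l \<in> L \<Longrightarrow> h \<in> \<Gamma> l \<Longrightarrow> z \<in> uhp \<Longrightarrow> w \<in> uhp \<Longrightarrow>
          \<phi> l c' w = mob h (\<phi> l c z) \<Longrightarrow> c' = c \<and> (\<exists>g\<in>\<Gamma>0 c. w = mob g z)"
    and phi_image: "l \<in> L \<Longrightarrow>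
          (\<Union>c. \<Union>h\<in>\<Gamma> l. mob h ` \<phi> l c ` uhp) = uhp - (\<Union>j. \<Union>h\<in>\<Gamma> l. mob h ` geod_axis (d l j))"
    and phi_diff: "l \<in> L \<Longrightarrow> z \<in> uhp \<Longrightarrow>
          \<phi> l c differentiable (at z) \<and> bij (frechet_derivative (\<phi> l c) (at z))"
    and phi_C1: "l \<in> L \<Longrightarrow> continuous_on uhp (\<lambda>z. frechet_derivative (\<phi> l c) (at z) v)"
    \<comment> \<open>two distinct developing cusps for each degenerating geodesic\<close>
    and developing: "cusp_gen (\<Gamma>0 (cmp j k)) (q j k)"
    and developing_corresponds: "l \<in> L \<Longrightarrow>
          corresponds (\<Gamma> l) (\<phi> l (cmp j k)) (q j k) (d l j)"
    and developing_distinct: "(j, k) \<noteq> (j', k') \<Longrightarrow> cmp j k = cmp j' k' \<Longrightarrow>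
          \<not> same_cusp (\<Gamma>0 (cmp j k)) (q j k) (q j' k')"
    \<comment> \<open>the other cusps of the limit surface are the cusps of \<open>\<Gamma> l\<close>\<close>
    and old_cusps: "l \<in> L \<Longrightarrow> cusp_gen (\<Gamma>0 c) p \<Longrightarrow>
          (\<And>j k. cmp j k = c \<Longrightarrow> \<not> same_cusp (\<Gamma>0 c) p (q j k)) \<Longrightarrow>
          \<exists>p'. cusp_gen (\<Gamma> l) p' \<and> corresponds (\<Gamma> l) (\<phi> l c) p p'"
    and old_cusps_surj: "l \<in> L \<Longrightarrow> cusp_gen (\<Gamma> l) p' \<Longrightarrow>
          \<exists>c p. cusp_gen (\<Gamma>0 c) p \<and> corresponds (\<Gamma> l) (\<phi> l c) p p'"
    \<comment> \<open>uniform convergence of the pulled back metrics, as quadratic forms, off \<open>C\<^sub>0\<^sub>,\<^sub>\<epsilon>\<close>\<close>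
    and metric_convergence: "0 < \<epsilon> \<Longrightarrow> \<epsilon> < 1/2 \<Longrightarrow> 0 < e \<Longrightarrow>
          \<forall>\<^sub>F l in at 0 within L. \<forall>c. \<forall>z \<in> uhp - developing_nbhd \<Gamma>0 cmp q \<epsilon> c. \<forall>v.
            \<bar>(norm (frechet_derivative (\<phi> l c) (at z) v))\<^sup>2 / (Im (\<phi> l c z))\<^sup>2 - (norm v)\<^sup>2 / (Im z)\<^sup>2\<bar>
              \<le> e * ((norm v)\<^sup>2 / (Im z)\<^sup>2)"

text \<open>
  For functions \<open>F l\<close> on \<open>M\<^sub>l\<close> and \<open>F0\<close> on \<open>M\<^sub>0\<close>, both depending on \<open>s\<close>: pointwise convergence,
  and uniform convergence for \<open>z\<close> in compact sets (given by a compact set of lifts on a component)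
  bounded away from the developing cusps and \<open>s\<close> in compact parts of half-planes \<open>Re s \<ge> 1 + \<delta>\<close>.
  Uniformity on a whole half-plane fails: \<open>t powr s\<close> is not continuous
  in \<open>t > 0\<close> uniformly in \<open>Im s\<close>.
\<close>

definition converges_pointwise ::
  "(real^'p::finite) set \<Rightarrow> (real^'p \<Rightarrow> 'c \<Rightarrow> complex \<Rightarrow> complex) \<Rightarrow>
   (real^'p \<Rightarrow> complex \<Rightarrow> complex \<Rightarrow> complex) \<Rightarrow> ('c \<Rightarrow> complex \<Rightarrow> complex \<Rightarrow> complex) \<Rightarrow> bool" where
  "converges_pointwise L \<phi> F F0 \<longleftrightarrow>
     (\<forall>c. \<forall>z\<in>uhp. \<forall>s. Re s > 1 \<longrightarrow> ((\<lambda>l. F l s (\<phi> l c z)) \<longlongrightarrow> F0 c s z) (at 0 within L))"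

definition converges_uniformly ::
  "(real^'p::finite) set \<Rightarrow> ('c \<Rightarrow> mat22 set) \<Rightarrow> (real^'p \<Rightarrow> 'c \<Rightarrow> complex \<Rightarrow> complex) \<Rightarrow>
   ('p \<Rightarrow> 2 \<Rightarrow> 'c) \<Rightarrow> ('p \<Rightarrow> 2 \<Rightarrow> mat22) \<Rightarrow>
   (real^'p \<Rightarrow> complex \<Rightarrow> complex \<Rightarrow> complex) \<Rightarrow> ('c \<Rightarrow> complex \<Rightarrow> complex \<Rightarrow> complex) \<Rightarrow> bool" where
  "converges_uniformly L \<Gamma>0 \<phi> cmp q F F0 \<longleftrightarrow>
     (\<forall>c K S \<epsilon> \<delta>. compact K \<longrightarrow> 0 < \<epsilon> \<longrightarrow> K \<subseteq> uhp - developing_nbhd \<Gamma>0 cmp q \<epsilon> c \<longrightarrow>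
        compact S \<longrightarrow> 0 < \<delta> \<longrightarrow> S \<subseteq> {s. Re s \<ge> 1 + \<delta>} \<longrightarrow>
        uniform_limit (K \<times> S) (\<lambda>l (z, s). F l s (\<phi> l c z)) (\<lambda>(z, s). F0 c s z) (at 0 within L))"

end

(*
  For A in SL(2,R) let disp A z = 2 sinh (d(z, A z) / 2).  If A is hyperbolic of length l and z is at angle
  theta from its axis, then disp A z = 2 sinh (l/2) / sin theta; if A is parabolic of width w with fixed
  point at infinity, then disp A z = w / Im z.  Hence up to the factor (2 sinh (l/2))^s both kinds of
  Eisenstein series are the sum of (disp h z)^(-s) over the conjugates h of one group element, and
  l^(-s) (2 sinh (l/2))^s tends to 1 as l tends to 0.

  Convergence of the metrics on compact sets gives convergence of distances, hence of every single term.
  It also shows that every element of the group of M_l of bounded displacement at a point of a compact set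
  comes from the limit group.  The terms of size about 1/N are O(N) in number, uniformly in l: modulo its
  centralizer the orbit points lie in a strip covered by O(N) boxes of bounded diameter, so the tails are
  uniformly small.  Two points at bounded displacement on the same side of the axis of a short element are
  close modulo its centralizer; so conjugacy in the group of M_l of elements of the limit groups that move
  the given points boundedly implies conjugacy in a limit group, and a pinching geodesic contributes one
  cusp for each of its two sides.
*)

theory Submission
  imports Defs
begin

section \<open>Matrices in SL(2,R) and Moebius transformations\<close>

text \<open>Nothing in the hypotheses says that the groups converge as sets of matrices, and the
  lifts \<open>\<phi>\<close> come with no frames, so every invariant has to be read off from
  distances between points \<open>\<phi> l c z\<close>. This is why angles, heights and widths are
  eliminated in favour of \<open>disp\<close>, and why even the trace is recovered from two
  displacements. Metric convergence controls tangent vectors, which bounds distances from above at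
  once; for the reverse bound, geodesics have to be pulled back through a map whose image is only
  part of the half-plane, hence a lifting argument. A term of a series is a conjugate up to sign and
  inverse: sign because matrices represent elements of PSL(2,R), inverse because homotopy classes
  are unoriented. The tail estimate must not deteriorate as the length tends to 0: measured in
  periods along the axis, a piece of length 1/a of the strip where \<open>disp\<close> is about a
  has a diameter bounded by \<open>box_radius\<close>, whatever the length. For the finitely many
  remaining terms, uniformity in s comes from the uniform continuity of x powr s on compact
  sets.\<close>

lemma SL2R_iff: "A \<in> carrier SL2R \<longleftrightarrow> A$1$1 * A$2$2 - A$1$2 * A$2$1 = 1"
  by (simp add: SL2R_def det_2)

lemma mat22_entry [simp]:
  "mat22 a b c d $1$1 = a" "mat22 a b c d $1$2 = b" "mat22 a b c d $2$1 = c" "mat22 a b c d $2$2 = d"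
  by (simp_all add: mat22_def)

lemma mult_entry:
  fixes A B :: mat22
  shows "(A ** B)$1$1 = A$1$1 * B$1$1 + A$1$2 * B$2$1" "(A ** B)$1$2 = A$1$1 * B$1$2 + A$1$2 * B$2$2"
    "(A ** B)$2$1 = A$2$1 * B$1$1 + A$2$2 * B$2$1" "(A ** B)$2$2 = A$2$1 * B$1$2 + A$2$2 * B$2$2"
  by (simp_all add: matrix_matrix_mult_def sum_2)

lemma mat_entry [simp]:
  "(mat 1 :: mat22)$1$1 = 1" "(mat 1 :: mat22)$1$2 = 0" "(mat 1 :: mat22)$2$1 = 0" "(mat 1 :: mat22)$2$2 = 1"
  by (simp_all add: mat_def)

lemma mat22_eqI:
  fixes A B :: mat22
  assumes "A$1$1 = B$1$1" "A$1$2 = B$1$2" "A$2$1 = B$2$1" "A$2$2 = B$2$2"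
  shows "A = B"
  using assms by (simp add: vec_eq_iff forall_2)

lemma trace_mat22: "trace (A :: mat22) = A$1$1 + A$2$2"
  by (simp add: trace_def sum_2)

lemma SL2R_mult_matrix_inv:
  assumes "A \<in> carrier SL2R"
  shows "A ** matrix_inv A = mat 1" "matrix_inv A ** A = mat 1"
proof -
  have "invertible A"
    using assms by (simp add: SL2R_def invertible_det_nz)
  then have "\<exists>B. A ** B = mat 1 \<and> B ** A = mat 1"
    by (simp add: invertible_def)
  then have "A ** matrix_inv A = mat 1 \<and> matrix_inv A ** A = mat 1"
    unfolding matrix_inv_def by (rule someI_ex)
  then show "A ** matrix_inv A = mat 1" "matrix_inv A ** A = mat 1" by auto
qed

lemma SL2R_inv_unique:
  assumes "A \<in> carrier SL2R" "A ** B = mat 1"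
  shows "matrix_inv A = B"
  by (metis SL2R_mult_matrix_inv(2) assms matrix_mul_assoc matrix_mul_lid matrix_mul_rid)

lemma matrix_inv_SL2R:
  assumes "A \<in> carrier SL2R"
  shows "matrix_inv A = mat22 (A$2$2) (- A$1$2) (- A$2$1) (A$1$1)"
proof (rule SL2R_inv_unique[OF assms], rule mat22_eqI)
qed (use assms in \<open>simp_all add: SL2R_iff mult_entry mult.commute\<close>)

lemma SL2R_mult: "A \<in> carrier SL2R \<Longrightarrow> B \<in> carrier SL2R \<Longrightarrow> A ** B \<in> carrier SL2R"
  by (simp add: SL2R_def det_mul)

lemma SL2R_inv: "A \<in> carrier SL2R \<Longrightarrow> matrix_inv A \<in> carrier SL2R"
  by (simp add: matrix_inv_SL2R SL2R_iff mult.commute)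

lemma SL2R_one: "mat 1 \<in> carrier SL2R"
  by (simp add: SL2R_iff)

lemma SL2R_minus: "A \<in> carrier SL2R \<Longrightarrow> - A \<in> carrier SL2R"
  by (simp add: SL2R_iff)

lemma SL2R_sel: "\<one>\<^bsub>SL2R\<^esub> = mat 1" "A \<otimes>\<^bsub>SL2R\<^esub> B = A ** B"
  by (simp_all add: SL2R_def)

lemma group_SL2R: "group SL2R"
proof (rule groupI)
  show "\<And>x y. x \<in> carrier SL2R \<Longrightarrow> y \<in> carrier SL2R \<Longrightarrow> x \<otimes>\<^bsub>SL2R\<^esub> y \<in> carrier SL2R"
    by (simp add: SL2R_sel SL2R_mult)
  show "\<And>x. x \<in> carrier SL2R \<Longrightarrow> \<exists>y\<in>carrier SL2R. y \<otimes>\<^bsub>SL2R\<^esub> x = \<one>\<^bsub>SL2R\<^esub>"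
    by (metis SL2R_inv SL2R_mult_matrix_inv(2) SL2R_sel)
qed (simp_all add: SL2R_sel SL2R_one matrix_mul_assoc)

lemma m_inv_SL2R: "A \<in> carrier SL2R \<Longrightarrow> inv\<^bsub>SL2R\<^esub> A = matrix_inv A"
  by (metis SL2R_inv SL2R_mult_matrix_inv(1) SL2R_sel group.inv_solve_right' group.is_monoid
      group_SL2R group.inv_equality SL2R_mult_matrix_inv(2))

lemma matrix_inv_inv: "A \<in> carrier SL2R \<Longrightarrow> matrix_inv (matrix_inv A) = A"
  by (simp add: SL2R_inv SL2R_mult_matrix_inv(2) SL2R_inv_unique)

lemma matrix_inv_mult:
  assumes "A \<in> carrier SL2R" "B \<in> carrier SL2R"
  shows "matrix_inv (A ** B) = matrix_inv B ** matrix_inv A"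
  by (rule SL2R_inv_unique)
     (metis SL2R_mult assms, metis SL2R_mult_matrix_inv(1) assms matrix_mul_assoc matrix_mul_rid)

lemma mult_minus_mat22 [simp]:
  fixes A B :: mat22
  shows "(- A) ** B = - (A ** B)" "A ** (- B) = - (A ** B)"
  by (simp_all add: mat22_eqI mult_entry)

lemma matrix_inv_minus: "A \<in> carrier SL2R \<Longrightarrow> matrix_inv (- A) = - matrix_inv A"
  by (rule SL2R_inv_unique) (simp_all add: SL2R_minus SL2R_mult_matrix_inv)

lemma SL2R_cancel:
  assumes "A \<in> carrier SL2R"
  shows "matrix_inv A ** (A ** B) = B" "A ** (matrix_inv A ** B) = B"
    "B ** A ** matrix_inv A = B" "B ** matrix_inv A ** A = B"
  by (metis SL2R_mult_matrix_inv assms matrix_mul_assoc matrix_mul_lid matrix_mul_rid)+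

lemma uhp_denom_nz:
  assumes "A \<in> carrier SL2R" "z \<in> uhp"
  shows "of_real (A$2$1) * z + of_real (A$2$2) \<noteq> (0::complex)"
proof
  assume h: "of_real (A$2$1) * z + of_real (A$2$2) = (0::complex)"
  then have "A$2$1 * Im z = 0" "A$2$1 * Re z + A$2$2 = 0"
    by (simp_all add: complex_eq_iff)
  then have "A$2$1 = 0" "A$2$2 = 0"
    using assms(2) by (auto simp: uhp_def)
  then show False using assms(1) by (simp add: SL2R_iff)
qed

text \<open>With determinant 1 the cross terms of the two fractions reduce to z - w. Together with
  \<open>Im_mob\<close> this makes |z - w|^2 / (Im z Im w) invariant, hence
  \<open>hdist_mob\<close>.\<close>

lemma mob_diff:
  assumes "A \<in> carrier SL2R" "z \<in> uhp" "w \<in> uhp"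
  shows "mob A z - mob A w = (z - w) / ((of_real (A$2$1) * z + of_real (A$2$2)) * (of_real (A$2$1) * w + of_real (A$2$2)))"
proof -
  have d: "of_real (A$1$1) * of_real (A$2$2) - of_real (A$1$2) * of_real (A$2$1) = (1::complex)"
    using assms(1) unfolding SL2R_iff by (metis of_real_1 of_real_diff of_real_mult)
  show ?thesis
    using uhp_denom_nz[OF assms(1,2)] uhp_denom_nz[OF assms(1,3)] unfolding mob_def
    apply (simp add: divide_simps)
    using d by algebra
qed

lemma Im_mob:
  assumes "A \<in> carrier SL2R" "z \<in> uhp"
  shows "Im (mob A z) = Im z / (cmod (of_real (A$2$1) * z + of_real (A$2$2)))\<^sup>2"
proof -
  have d: "A$1$1 * A$2$2 = 1 + A$1$2 * A$2$1"
    using assms(1) by (simp add: SL2R_iff)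
  have "(A$1$1 * Im z) * (A$2$1 * Re z + A$2$2) - (A$1$1 * Re z + A$1$2) * (A$2$1 * Im z) = (A$1$1 * A$2$2 - A$1$2 * A$2$1) * Im z"
    by (simp add: algebra_simps)
  also have "\<dots> = Im z" using d by simp
  finally have e: "(A$1$1 * Im z) * (A$2$1 * Re z + A$2$2) - (A$1$1 * Re z + A$1$2) * (A$2$1 * Im z) = Im z" .
  show ?thesis
    unfolding mob_def Im_divide' using e by simp
qed

lemma mob_uhp: "A \<in> carrier SL2R \<Longrightarrow> z \<in> uhp \<Longrightarrow> mob A z \<in> uhp"
  using Im_mob[of A z] uhp_denom_nz[of A z] by (simp add: uhp_def)

lemma mob_mult:
  assumes "A \<in> carrier SL2R" "B \<in> carrier SL2R" "z \<in> uhp"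
  shows "mob (A ** B) z = mob A (mob B z)"
proof -
  have "of_real ((A ** B)$2$1) * z + of_real ((A ** B)$2$2) \<noteq> (0::complex)"
    using uhp_denom_nz[OF SL2R_mult] assms by blast
  then show ?thesis
  using uhp_denom_nz[OF assms(2,3)] uhp_denom_nz[OF assms(1) mob_uhp[OF assms(2,3)]]
  unfolding mob_def mult_entry
  apply (simp add: divide_simps)
  apply (simp add: algebra_simps)
  done
qed

lemma mob_one [simp]: "mob (mat 1) z = z"
  by (simp add: mob_def)

lemma mob_minus [simp]: "mob (- A) z = mob A z"
proof -
  have "mob (- A) z = (- (of_real (A$1$1) * z + of_real (A$1$2))) / (- (of_real (A$2$1) * z + of_real (A$2$2)))"
    unfolding mob_def by (simp add: algebra_simps)
  then show ?thesis unfolding mob_def by (simp only: minus_divide_divide)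
qed

lemma mob_inv_cancel:
  assumes "A \<in> carrier SL2R" "z \<in> uhp"
  shows "mob (matrix_inv A) (mob A z) = z" "mob A (mob (matrix_inv A) z) = z"
  by (metis SL2R_inv SL2R_mult_matrix_inv assms mob_mult mob_one)+

text \<open>A fixed point is a root of a real quadratic. Nonreal roots form a conjugate pair, so two
  different roots in the upper half-plane force all its coefficients to vanish, and A is
  scalar.\<close>

lemma mob_fix2_imp:
  assumes "A \<in> carrier SL2R" "z \<in> uhp" "w \<in> uhp" "z \<noteq> w" "mob A z = z" "mob A w = w"
  shows "A = mat 1 \<or> A = - mat 1"
proof -
  have quad: "A$2$1 * ((Re u)\<^sup>2 - (Im u)\<^sup>2) + (A$2$2 - A$1$1) * Re u - A$1$2 = 0 \<and>
     (2 * A$2$1 * Re u + (A$2$2 - A$1$1)) * Im u = 0" if "u \<in> uhp" "mob A u = u" for u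
  proof -
    have "of_real (A$1$1) * u + of_real (A$1$2) = u * (of_real (A$2$1) * u + of_real (A$2$2))"
      using that uhp_denom_nz[OF assms(1) that(1)] unfolding mob_def by (simp add: divide_simps mult.commute split: if_splits)
    then have "Re (of_real (A$1$1) * u + of_real (A$1$2)) = Re (u * (of_real (A$2$1) * u + of_real (A$2$2)))"
       "Im (of_real (A$1$1) * u + of_real (A$1$2)) = Im (u * (of_real (A$2$1) * u + of_real (A$2$2)))"
      by simp_all
    then show ?thesis by (simp add: algebra_simps power2_eq_square)
  qed
  have z: "2 * A$2$1 * Re z + (A$2$2 - A$1$1) = 0" and w: "2 * A$2$1 * Re w + (A$2$2 - A$1$1) = 0"
    using quad[OF assms(2,5)] quad[OF assms(3,6)] assms(2,3) by (auto simp: uhp_def)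
  have c: "A$2$1 = 0"
  proof (rule ccontr)
    assume c: "A$2$1 \<noteq> 0"
    have "A$2$1 * Re z = A$2$1 * Re w" using z w by linarith
    then have re: "Re z = Re w" using c by simp
    have "A$2$1 * (Im z)\<^sup>2 = A$2$1 * (Im w)\<^sup>2"
      using quad[OF assms(2,5)] quad[OF assms(3,6)]
      unfolding re right_diff_distrib by linarith
    then have "(Im z)\<^sup>2 = (Im w)\<^sup>2" using c by simp
    then have "Im z = Im w" using assms(2,3) by (simp add: uhp_def power2_eq_iff)
    then show False using re assms(4) by (simp add: complex_eq_iff)
  qed
  then have "A$2$2 = A$1$1" "A$1$2 = 0" using quad[OF assms(2,5)] z by auto
  moreover have "A$1$1 * A$1$1 = 1" using assms(1) c calculation by (simp add: SL2R_iff)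
  then have "A$1$1 = 1 \<or> A$1$1 = -1" by (simp add: square_eq_1_iff)
  ultimately show ?thesis using c by (auto simp: mat22_eqI)
qed

lemma mob_eq2_imp:
  assumes "A \<in> carrier SL2R" "B \<in> carrier SL2R" "z \<in> uhp" "w \<in> uhp" "z \<noteq> w"
    "mob A z = mob B z" "mob A w = mob B w"
  shows "A = B \<or> A = - B"
proof -
  have "mob (matrix_inv B ** A) z = z" "mob (matrix_inv B ** A) w = w"
    using assms by (simp_all add: mob_mult SL2R_inv mob_inv_cancel)
  then have "matrix_inv B ** A = mat 1 \<or> matrix_inv B ** A = - mat 1"
    using mob_fix2_imp[of "matrix_inv B ** A" z w] assms by (simp add: SL2R_mult SL2R_inv)
  then show ?thesis
    by (metis SL2R_cancel(2) assms(2) matrix_mul_rid mult_minus_mat22(2))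
qed

section \<open>The hyperbolic distance\<close>

definition hdist :: "complex \<Rightarrow> complex \<Rightarrow> real" where
  "hdist z w = arcosh (1 + (cmod (z - w))\<^sup>2 / (2 * Im z * Im w))"

text \<open>This is 2 sinh of half the displacement of z (\<open>disp_eq_hdist\<close>), written
  algebraically in the entries: the numerator is the quadratic whose zeros are the fixed points of
  A. Invariance under sign and inverse and the effect of squaring are visible in its
  coefficients.\<close>

definition disp :: "mat22 \<Rightarrow> complex \<Rightarrow> real" where
  "disp A z = cmod (of_real (A$2$1) * z\<^sup>2 + of_real (A$2$2 - A$1$1) * z - of_real (A$1$2)) / Im z"

lemma cosh_hdist:
  assumes "z \<in> uhp" "w \<in> uhp"
  shows "cosh (hdist z w) = 1 + (cmod (z - w))\<^sup>2 / (2 * Im z * Im w)"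
  unfolding hdist_def using assms by (subst cosh_arcosh_real) (auto simp: uhp_def)

lemma hdist_nonneg: "z \<in> uhp \<Longrightarrow> w \<in> uhp \<Longrightarrow> 0 \<le> hdist z w"
  unfolding hdist_def uhp_def by (rule arcosh_nonneg_real) simp

lemma hdist_commute: "hdist z w = hdist w z"
  unfolding hdist_def by (simp add: norm_minus_commute mult.commute mult.left_commute)

lemma hdist_self [simp]: "hdist z z = 0"
  by (simp add: hdist_def)

lemma hdist_eq_0_iff: "z \<in> uhp \<Longrightarrow> w \<in> uhp \<Longrightarrow> hdist z w = 0 \<longleftrightarrow> z = w"
  unfolding hdist_def uhp_def by (subst arcosh_eq_0_iff_real) (auto)

lemma hdist_mob:
  assumes "A \<in> carrier SL2R" "z \<in> uhp" "w \<in> uhp"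
  shows "hdist (mob A z) (mob A w) = hdist z w"
  using uhp_denom_nz[OF assms(1,2)] uhp_denom_nz[OF assms(1,3)]
  unfolding hdist_def mob_diff[OF assms] Im_mob[OF assms(1,2)] Im_mob[OF assms(1,3)]
  by (simp add: norm_divide norm_mult power_divide power_mult_distrib)

lemma hdist_mob_inv:
  assumes "A \<in> carrier SL2R" "z \<in> uhp" "w \<in> uhp"
  shows "hdist (mob (matrix_inv A) z) w = hdist z (mob A w)"
  by (metis SL2R_inv assms hdist_mob mob_inv_cancel(1) mob_uhp)

lemma cosh_sinh_half: "cosh (x::real) = 1 + 2 * (sinh (x/2))\<^sup>2"
  using cosh_double[of "x/2"] cosh_square_eq[of "x/2"] by simp

lemma two_sinh_half_hdist:
  assumes "z \<in> uhp" "w \<in> uhp"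
  shows "2 * sinh (hdist z w / 2) = cmod (z - w) / sqrt (Im z * Im w)"
proof -
  have "(2 * sinh (hdist z w / 2))\<^sup>2 = (cmod (z - w) / sqrt (Im z * Im w))\<^sup>2"
    using cosh_hdist[OF assms] cosh_sinh_half[of "hdist z w"] assms
    by (simp add: power_mult_distrib power_divide uhp_def)
  moreover have "0 \<le> 2 * sinh (hdist z w / 2)" using hdist_nonneg[OF assms] by simp
  moreover have "0 \<le> cmod (z - w) / sqrt (Im z * Im w)" using assms by (simp add: uhp_def)
  ultimately show ?thesis by (rule power2_eq_imp_eq)
qed

text \<open>With q the denominator of the fraction, z - A z is the fixed-point quadratic divided by
  q, and sqrt (Im z Im (A z)) is Im z / |q|, so q cancels.\<close>

lemma disp_eq_hdist:
  assumes "A \<in> carrier SL2R" "z \<in> uhp"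
  shows "disp A z = 2 * sinh (hdist z (mob A z) / 2)"
proof -
  define q where "q = of_real (A$2$1) * z + of_real (A$2$2)"
  have q0: "q \<noteq> 0" using uhp_denom_nz[OF assms] by (simp add: q_def)
  have "z - mob A z = (of_real (A$2$1) * z\<^sup>2 + of_real (A$2$2 - A$1$1) * z - of_real (A$1$2)) / q"
    using q0 unfolding mob_def q_def by (simp add: divide_simps power2_eq_square) (simp add: algebra_simps)
  moreover have "sqrt (Im z * Im (mob A z)) = Im z / cmod q"
    unfolding Im_mob[OF assms] q_def using assms(2)
    by (simp add: real_sqrt_divide real_sqrt_mult uhp_def)
  ultimately show ?thesis
    unfolding two_sinh_half_hdist[OF assms(2) mob_uhp[OF assms]] disp_def using q0 by (simp add: norm_divide)
qed

lemma disp_pos_iff: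
  assumes "A \<in> carrier SL2R" "z \<in> uhp"
  shows "0 < disp A z \<longleftrightarrow> mob A z \<noteq> z"
  using hdist_nonneg[OF assms(2) mob_uhp[OF assms]] hdist_eq_0_iff[OF assms(2) mob_uhp[OF assms]]
  by (auto simp: disp_eq_hdist[OF assms])

lemma disp_minus [simp]: "disp (- A) z = disp A z"
proof -
  have "of_real (- A$2$1) * z\<^sup>2 + of_real (- A$2$2 - - A$1$1) * z - of_real (- A$1$2) =
    - (of_real (A$2$1) * z\<^sup>2 + of_real (A$2$2 - A$1$1) * z - of_real (A$1$2))"
    by (simp add: algebra_simps)
  then show ?thesis unfolding disp_def vector_uminus_component by (metis norm_minus_cancel)
qed

lemma disp_inv [simp]: "A \<in> carrier SL2R \<Longrightarrow> disp (matrix_inv A) z = disp A z"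
proof -
  assume A: "A \<in> carrier SL2R"
  have "of_real (- A$2$1) * z\<^sup>2 + of_real (A$1$1 - A$2$2) * z - of_real (- A$1$2) =
    - (of_real (A$2$1) * z\<^sup>2 + of_real (A$2$2 - A$1$1) * z - of_real (A$1$2))"
    by (simp add: algebra_simps)
  then show ?thesis unfolding disp_def matrix_inv_SL2R[OF A] mat22_entry by (metis norm_minus_cancel)
qed

lemma disp_conj:
  assumes "A \<in> carrier SL2R" "B \<in> carrier SL2R" "z \<in> uhp"
  shows "disp (matrix_inv B ** A ** B) z = disp A (mob B z)"
  using assms by (simp add: disp_eq_hdist mob_mult SL2R_mult SL2R_inv mob_uhp hdist_mob_inv hdist_commute
      [of z] hdist_commute[of "mob A _"])

lemma continuous_on_hdist:
  assumes "continuous_on S f" "continuous_on S g" "f ` S \<subseteq> uhp" "g ` S \<subseteq> uhp"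
  shows "continuous_on S (\<lambda>x. hdist (f x) (g x))"
proof -
  have pos: "0 < Im (f x)" "0 < Im (g x)" if "x \<in> S" for x
    using assms(3,4) that by (auto simp: uhp_def)
  have "continuous_on S (\<lambda>x. 1 + (cmod (f x - g x))\<^sup>2 / (2 * Im (f x) * Im (g x)))"
    using pos by (intro continuous_intros assms(1,2)) (auto simp: less_imp_neq[symmetric])
  then show ?thesis
    unfolding hdist_def
    by (rule continuous_on_compose2[OF continuous_on_arcosh[OF order_refl]]) (use pos in \<open>auto simp: less_imp_le\<close>)
qed

text \<open>
  \<open>arcosh\<close> is not differentiable at \<open>1\<close>, so the distance from \<open>p\<close> is replaced by
  \<open>arcosh (cosh (hdist p _) + \<kappa>)\<close>, whose derivative along the path is still at most \<open>v\<close>.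
\<close>

lemma hdist_path_le:
  fixes c :: "real \<Rightarrow> complex"
  assumes p: "p \<in> uhp" and ab: "a \<le> b" and cont: "continuous_on {a..b} c"
    and uhp: "\<And>t. t \<in> {a..b} \<Longrightarrow> c t \<in> uhp"
    and der: "\<And>t. t \<in> {a<..<b} \<Longrightarrow> (c has_vector_derivative c' t) (at t)"
    and speed: "\<And>t. t \<in> {a<..<b} \<Longrightarrow> cmod (c' t) \<le> v * Im (c t)"
  shows "hdist p (c b) \<le> hdist p (c a) + v * (b - a)"
proof -
  define F where "F t = 1 + (cmod (p - c t))\<^sup>2 / (2 * Im p * Im (c t))" for t
  have Im0: "0 < Im p" "\<And>t. t \<in> {a..b} \<Longrightarrow> 0 < Im (c t)" using p uhp by (auto simp: uhp_def)
  have F1: "1 \<le> F t" if "t \<in> {a..b}" for t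
    using Im0 that unfolding F_def by (simp add: less_imp_le)
  have contF: "continuous_on {a..b} F"
    unfolding F_def using Im0 by (intro continuous_intros cont) (auto simp: less_imp_neq[symmetric])
  \<comment> \<open>F is the cosh of the distance from p, and arcosh has derivative 1 / sqrt (F^2 -
    1); the bound says that the distance grows at speed at most v.\<close>
  have derF: "\<exists>D. (F has_real_derivative D) (at t) \<and> \<bar>D\<bar> \<le> v * sqrt ((F t)\<^sup>2 - 1)" if t: "t \<in> {a<..<b}" for t
  proof -
    have y: "0 < Im (c t)" using Im0(2) t by auto
    define q where "q = Im p"
    have q: "0 < q" using Im0 by (simp add: q_def)
    define X where "X = Re (c t) - Re p"
    define Y where "Y = Im (c t)"
    define x' where "x' = Re (c' t)"
    define y' where "y' = Im (c' t)"
    define D where "D = X / (q * Y) * x' + ((Y - q) / (q * Y) - (X\<^sup>2 + (Y-q)\<^sup>2) / (2 * q * Y\<^sup>2)) * y'"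
    have Y: "0 < Y" using y by (simp add: Y_def)
    define xr where "xr t = Re (c t)" for t
    define yr where "yr t = Im (c t)" for t
    have dRe: "(xr has_real_derivative x') (at t)" and dIm: "(yr has_real_derivative y') (at t)"
      using der[OF t] unfolding x'_def y'_def xr_def [abs_def] yr_def [abs_def] by (auto simp: has_vector_derivative_complex_iff)
    have Feq: "F = (\<lambda>t. 1 + ((Re p - xr t)\<^sup>2 + (q - yr t)\<^sup>2) / (2 * q * yr t))"
      unfolding F_def q_def xr_def yr_def by (simp add: cmod_power2)
    have dF: "(F has_real_derivative D) (at t)"
    proof -
      have xy: "xr t = X + Re p" "yr t = Y" by (simp_all add: xr_def yr_def X_def Y_def)
      have "((\<lambda>t. (Re p - xr t)\<^sup>2 + (q - yr t)\<^sup>2) has_real_derivative 2 * X * x' + 2 * (Y - q) * y') (at t)"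
        by (rule derivative_eq_intros dRe dIm refl)+ (simp add: xy algebra_simps)
      from DERIV_divide[OF this DERIV_cmult[OF dIm, of "2 * q"]] q Y
      have "((\<lambda>t. ((Re p - xr t)\<^sup>2 + (q - yr t)\<^sup>2) / (2 * q * yr t)) has_real_derivative
         ((2 * X * x' + 2 * (Y - q) * y') * (2 * q * Y) - (X\<^sup>2 + (Y - q)\<^sup>2) * (2 * q * y')) / (2 * q * Y * (2 * q * Y))) (at t)"
        by (simp add: xy power2_commute[of q Y])
      moreover have "((2 * X * x' + 2 * (Y - q) * y') * (2 * q * Y) - (X\<^sup>2 + (Y - q)\<^sup>2) * (2 * q * y')) / (2 * q * Y * (2 * q * Y)) = D"
      proof -
        define N where "N = X\<^sup>2 + (Y-q)\<^sup>2"
        have "((2 * X * x' + 2 * (Y - q) * y') * (2 * q * Y) - N * (2 * q * y')) / (2 * q * Y * (2 * q * Y))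
           = (2 * X * x' + 2 * (Y - q) * y') / (2 * q * Y) - N * y' / (2 * q * Y\<^sup>2)"
        proof -
          have "(a * k - N * (2 * q * y')) / (k * k) = a / k - N * (2 * q * y') / (k * k)" if "k \<noteq> 0" for a k :: real
            using that by (simp add: diff_divide_distrib)
          from this[of "2 * q * Y" "2 * X * x' + 2 * (Y - q) * y'"] show ?thesis using q Y by (simp add: power2_eq_square mult_ac)
        qed
        also have "\<dots> = D"
        proof -
          have "(2 * X * x' + 2 * (Y - q) * y') / (2 * q * Y) = X / (q * Y) * x' + (Y - q) / (q * Y) * y'"
            using q Y by (simp add: divide_simps)
          then show ?thesis unfolding D_def N_def[symmetric] by (simp add: left_diff_distrib)
        qed
        finally show ?thesis unfolding N_def .
      qed
      ultimately show ?thesis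
        unfolding Feq using DERIV_add[OF DERIV_const] by fastforce
    qed
    have Ft: "F t = 1 + (X\<^sup>2 + (Y-q)\<^sup>2) / (2 * q * Y)"
      unfolding Feq X_def Y_def xr_def yr_def by (simp add: power2_commute)
    define g1 where "g1 = X / (q * Y)"
    define g2 where "g2 = (Y - q) / (q * Y) - (X\<^sup>2 + (Y-q)\<^sup>2) / (2 * q * Y\<^sup>2)"
    \<comment> \<open>\<open>g1\<close> and \<open>g2\<close> are the partial derivatives of F in
      the real and the imaginary direction. The identity says that the hyperbolic gradient of the
      cosh of the distance has length sinh of the distance.\<close>
    have id: "Y\<^sup>2 * (g1\<^sup>2 + g2\<^sup>2) = (F t)\<^sup>2 - 1"
    proof -
      define N where "N = X\<^sup>2 + (Y-q)\<^sup>2"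
      have g1: "Y * g1 = X / q" using Y q by (simp add: g1_def)
      have g2: "Y * g2 = (Y - q) / q - N / (2 * q * Y)"
      proof -
        have "Y * ((Y - q) / (q * Y)) = (Y - q) / q" "Y * (N / (2 * q * Y\<^sup>2)) = N / (2 * q * Y)"
          using Y q by (simp_all add: power2_eq_square)
        then show ?thesis unfolding g2_def N_def[symmetric] right_diff_distrib[of Y] by (simp only:)
      qed
      have "Y\<^sup>2 * (g1\<^sup>2 + g2\<^sup>2) = (Y * g1)\<^sup>2 + (Y * g2)\<^sup>2"
        by (simp add: power_mult_distrib distrib_left)
      also have "\<dots> = N / q\<^sup>2 - N * (Y - q) / (q\<^sup>2 * Y) + (N / (2 * q * Y))\<^sup>2"
      proof -
        have *: "2 * (u / q) * (N / (2 * q * Y)) = N * u / (q\<^sup>2 * Y)" for u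
          using Y q by (simp add: power2_eq_square mult_ac)
        have "(X / q)\<^sup>2 + ((Y - q) / q)\<^sup>2 = N / q\<^sup>2"
          by (simp add: N_def power_divide add_divide_distrib)
        then show ?thesis using *[of "Y - q"] unfolding g1 g2 power2_diff[of "_ / q"] by linarith
      qed
      also have "N / q\<^sup>2 - N * (Y - q) / (q\<^sup>2 * Y) = N / (q * Y)"
        
      proof -
        have "N / q\<^sup>2 = N * Y / (q\<^sup>2 * Y)" using Y by simp
        then have "N / q\<^sup>2 - N * (Y - q) / (q\<^sup>2 * Y) = (N * Y - N * (Y - q)) / (q\<^sup>2 * Y)"
          by (simp only: diff_divide_distrib)
        also have "\<dots> = (q * N) / (q * (q * Y))" by (simp add: right_diff_distrib power2_eq_square mult_ac)
        finally show ?thesis using q by simp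
      qed
      also have "N / (q * Y) + (N / (2 * q * Y))\<^sup>2 = (F t)\<^sup>2 - 1"
        unfolding Ft N_def[symmetric] power2_sum by simp
      finally show ?thesis .
    qed
    have "\<bar>D\<bar> \<le> sqrt (g1\<^sup>2 + g2\<^sup>2) * sqrt (x'\<^sup>2 + y'\<^sup>2)"
    proof (rule power2_le_imp_le)
      have "(g1 * x' + g2 * y')\<^sup>2 \<le> (g1\<^sup>2 + g2\<^sup>2) * (x'\<^sup>2 + y'\<^sup>2)"
        using zero_le_power2[of "g1 * y' - g2 * x'"] by (simp add: power2_eq_square algebra_simps)
      then show "\<bar>D\<bar>\<^sup>2 \<le> (sqrt (g1\<^sup>2 + g2\<^sup>2) * sqrt (x'\<^sup>2 + y'\<^sup>2))\<^sup>2"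
        unfolding D_def g1_def[symmetric] g2_def[symmetric] by (simp add: power_mult_distrib)
    qed simp
    also have "\<dots> \<le> sqrt (g1\<^sup>2 + g2\<^sup>2) * (v * Y)"
      using speed[OF t] unfolding x'_def y'_def Y_def cmod_def by (intro mult_left_mono) auto
    also have "\<dots> = v * (sqrt (Y\<^sup>2) * sqrt (g1\<^sup>2 + g2\<^sup>2))" using Y by simp
    also have "\<dots> = v * sqrt ((F t)\<^sup>2 - 1)"
      unfolding id[symmetric] real_sqrt_mult ..
    finally show ?thesis using dF by blast
  qed
  have v0: "0 \<le> v" if ab': "a < b"
  proof -
    obtain t where t: "t \<in> {a<..<b}" using dense[OF ab'] by auto
    have "0 \<le> v * Im (c t)" using speed[OF t] norm_ge_zero order_trans by blast
    then show ?thesis using Im0(2)[of t] t by (auto simp: zero_le_mult_iff)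
  qed
  have step: "arcosh (F b + \<kappa>) \<le> arcosh (F a + \<kappa>) + v * (b - a)" if k: "0 < \<kappa>" for \<kappa>
  proof -
    have "arcosh (F b + \<kappa>) - v * b \<le> arcosh (F a + \<kappa>) - v * a"
    proof (rule DERIV_nonpos_imp_decreasing_open[OF ab])
      fix t assume t: "a < t" "t < b"
      then obtain D where D: "(F has_real_derivative D) (at t)" "\<bar>D\<bar> \<le> v * sqrt ((F t)\<^sup>2 - 1)"
        using derF[of t] by auto
      have F: "1 \<le> F t" using F1 t by auto
      have "((\<lambda>t. arcosh (F t + \<kappa>) - v * t) has_real_derivative (1 / sqrt ((F t + \<kappa>)\<^sup>2 - 1) * D - v)) (at t)"
      proof -
        have "((\<lambda>t. F t + \<kappa>) has_real_derivative D) (at t)"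
          using D(1) by (auto intro!: derivative_eq_intros)
        then have "((\<lambda>t. arcosh (F t + \<kappa>)) has_real_derivative (1 / sqrt ((F t + \<kappa>)\<^sup>2 - 1) * D)) (at t)"
          using F k by (intro DERIV_chain2[OF arcosh_real_has_field_derivative]) auto
        then show ?thesis by (auto intro!: derivative_eq_intros)
      qed
      \<comment> \<open>Replacing F by F + \<kappa> only enlarges the square root, so the bound on D
        survives the division by it.\<close>
      moreover have "1 / sqrt ((F t + \<kappa>)\<^sup>2 - 1) * D - v \<le> 0"
      proof -
        have le: "(F t)\<^sup>2 - 1 \<le> (F t + \<kappa>)\<^sup>2 - 1" using F k by (simp add: power_mono)
        have "1 < F t + \<kappa>" using F k by simp
        then have pos: "0 < sqrt ((F t + \<kappa>)\<^sup>2 - 1)" by (simp add: one_less_power)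
        have "D \<le> v * sqrt ((F t)\<^sup>2 - 1)" using D(2) by simp
        also have "\<dots> \<le> v * sqrt ((F t + \<kappa>)\<^sup>2 - 1)" using v0 t le by (intro mult_left_mono) auto
        finally show ?thesis using pos by (simp add: divide_simps)
      qed
      ultimately show "\<exists>y. ((\<lambda>t. arcosh (F t + \<kappa>) - v * t) has_real_derivative y) (at t) \<and> y \<le> 0" by blast
    next
      show "continuous_on {a..b} (\<lambda>t. arcosh (F t + \<kappa>) - v * t)"
        using F1 k by (intro continuous_intros continuous_on_arcosh' contF) (auto intro: add_increasing2)
    qed
    then show ?thesis by (simp add: algebra_simps)
  qed
  have lim: "((\<lambda>\<kappa>. arcosh (F t + \<kappa>)) \<longlongrightarrow> arcosh (F t)) (at_right 0)" if "t \<in> {a..b}" for t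
    using F1[OF that] by (intro tendsto_arcosh_strong)
       (auto intro!: tendsto_eq_intros eventually_at_right_less[THEN eventually_mono])
  have "arcosh (F b) \<le> arcosh (F a) + v * (b - a)"
  proof (rule tendsto_le[of "at_right (0::real)"])
    show "((\<lambda>\<kappa>. arcosh (F a + \<kappa>) + v * (b - a)) \<longlongrightarrow> arcosh (F a) + v * (b - a)) (at_right 0)"
      using ab by (intro tendsto_intros lim) auto
    show "((\<lambda>\<kappa>. arcosh (F b + \<kappa>)) \<longlongrightarrow> arcosh (F b)) (at_right 0)"
      using ab by (intro lim) auto
    show "\<forall>\<^sub>F \<kappa> in at_right 0. arcosh (F b + \<kappa>) \<le> arcosh (F a + \<kappa>) + v * (b - a)"
      using step by (auto intro!: eventually_at_right_less[THEN eventually_mono])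
  qed simp
  then show ?thesis unfolding F_def hdist_def .
qed

section \<open>Geodesic arcs, and distortion of distances under maps\<close>

lemma mob_has_field_derivative:
  assumes "A \<in> carrier SL2R" "z \<in> uhp"
  shows "(mob A has_field_derivative 1 / (of_real (A$2$1) * z + of_real (A$2$2))\<^sup>2) (at z)"
proof -
  have d: "of_real (A$1$1) * of_real (A$2$2) - of_real (A$1$2) * of_real (A$2$1) = (1::complex)"
    using assms(1) unfolding SL2R_iff by (metis of_real_1 of_real_diff of_real_mult)
  show ?thesis
    unfolding mob_def [abs_def] using uhp_denom_nz[OF assms]
    apply (auto intro!: derivative_eq_intros)
    apply (simp add: divide_simps power2_eq_square)
    using d apply (simp add: algebra_simps)
    done
qed

text \<open>T moves \<open>\<i>\<close> to z, and the rotation matrices \<open>k \<theta>\<close>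
  fix \<open>\<i>\<close>. At \<theta> = pi/2 the point u goes to -1/u, which reverses the sign of
  its real part, so by the intermediate value theorem some \<theta> puts u on the imaginary
  axis.\<close>

lemma SL2R_to_imaginary_axis:
  assumes z: "z \<in> uhp" and w: "w \<in> uhp"
  obtains A y where "A \<in> carrier SL2R" "mob A \<i> = z" "0 < y" "mob A (\<i> * of_real y) = w"
proof -
  have Imz: "0 < Im z" using z by (simp add: uhp_def)
  define T where "T = mat22 (sqrt (Im z)) (Re z / sqrt (Im z)) 0 (1 / sqrt (Im z))"
  have T: "T \<in> carrier SL2R" using Imz by (simp add: T_def SL2R_iff)
  have Ti: "mob T \<i> = z"
  proof -
    have "mob T \<i> = of_real (sqrt (Im z)) * of_real (sqrt (Im z)) * \<i> + of_real (Re z)"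
    proof -
      define r where "r = complex_of_real (sqrt (Im z))"
      have "r \<noteq> 0" using Imz by (simp add: r_def)
      then show ?thesis
        by (simp add: mob_def T_def r_def[symmetric] distrib_right)
    qed
    also have "\<dots> = of_real (Im z) * \<i> + of_real (Re z)"
      using Imz by (metis abs_of_pos of_real_mult real_sqrt_mult_self)
    finally show ?thesis by (simp add: complex_eq_iff)
  qed
  define k where "k \<theta> = mat22 (cos \<theta>) (sin \<theta>) (- sin \<theta>) (cos \<theta>)" for \<theta> :: real
  have k: "k \<theta> \<in> carrier SL2R" for \<theta>
    by (simp add: k_def SL2R_iff power2_eq_square[symmetric] add.commute)
  have i: "\<i> \<in> uhp" by (simp add: uhp_def)
  have ki: "mob (k \<theta>) \<i> = \<i>" for \<theta>
  proof -
    have "of_real (- sin \<theta>) * \<i> + of_real (cos \<theta>) \<noteq> (0::complex)"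
      using uhp_denom_nz[OF k[of \<theta>] i] by (simp add: k_def)
    then show ?thesis by (simp add: mob_def k_def divide_simps) (simp add: algebra_simps)
  qed
  define u where "u = mob (matrix_inv T) w"
  have u: "u \<in> uhp" by (simp add: u_def mob_uhp SL2R_inv T w)
  define f where "f \<theta> = Re (mob (k \<theta>) u)" for \<theta>
  have contf: "continuous_on {0..pi/2} f"
  proof -
    have "of_real (- sin \<theta>) * u + of_real (cos \<theta>) \<noteq> (0::complex)" for \<theta>
      using uhp_denom_nz[OF k[of \<theta>] u] by (simp add: k_def)
    then show ?thesis unfolding f_def mob_def k_def mat22_entry by (intro continuous_intros) auto
  qed
  have f0: "f 0 = Re u" by (simp add: f_def mob_def k_def)
  have f1: "f (pi/2) = - Re u / (cmod u)\<^sup>2"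
  proof -
    have "mob (k (pi/2)) u = - (1 / u)" by (simp add: mob_def k_def)
    then show ?thesis by (simp add: f_def Re_divide' cmod_power2)
  qed
  have "\<exists>\<theta>. f \<theta> = 0"
  proof (cases "Re u \<le> 0")
    case True
    then have "0 \<le> f (pi/2)" by (simp add: f1 divide_nonpos_nonneg)
    then show ?thesis using IVT'[of f 0 0 "pi/2"] contf f0 True by auto
  next
    case False
    then have "f (pi/2) \<le> 0" by (simp add: f1)
    then show ?thesis using IVT2'[of f "pi/2" 0 0] contf f0 False by auto
  qed
  then obtain \<theta> where \<theta>: "f \<theta> = 0" by blast
  define y where "y = Im (mob (k \<theta>) u)"
  have y: "0 < y" using mob_uhp[OF k u] by (simp add: y_def uhp_def)
  have kv: "mob (k \<theta>) u = \<i> * of_real y" using \<theta> by (simp add: complex_eq_iff f_def y_def)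
  have iy: "\<i> * of_real y \<in> uhp" using y by (simp add: uhp_def)
  show thesis
  proof
    show "T ** matrix_inv (k \<theta>) \<in> carrier SL2R" by (simp add: SL2R_mult T k SL2R_inv)
    show "mob (T ** matrix_inv (k \<theta>)) \<i> = z"
      by (metis T Ti i k ki mob_inv_cancel(1) mob_mult SL2R_inv)
    show "0 < y" by (rule y)
    show "mob (T ** matrix_inv (k \<theta>)) (\<i> * of_real y) = w"
      unfolding kv[symmetric]
      by (metis T k u u_def mob_inv_cancel mob_mult SL2R_inv iy kv w)
  qed
qed

lemma geodesic_exists:
  assumes z: "z \<in> uhp" and w: "w \<in> uhp"
  obtains c c' where "c 0 = z" "c (hdist z w) = w" "\<And>t. c t \<in> uhp"
    "\<And>t. (c has_vector_derivative c' t) (at t)" "\<And>t. cmod (c' t) = Im (c t)"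
proof -
  obtain A y where A: "A \<in> carrier SL2R" "mob A \<i> = z" "0 < y" "mob A (\<i> * of_real y) = w"
    using SL2R_to_imaginary_axis[OF z w] by blast
  \<comment> \<open>The sign makes the vertical ray run from \<open>\<i>\<close> towards
    \<open>\<i> * of_real y\<close>, whether y lies above or below 1.\<close>
  define e :: real where "e = (if y \<ge> 1 then 1 else -1)"
  define \<beta> where "\<beta> t = \<i> * of_real (exp (e * t))" for t :: real
  have i: "\<i> \<in> uhp" "\<i> * of_real y \<in> uhp" "\<And>t. \<beta> t \<in> uhp" using A(3) by (simp_all add: uhp_def \<beta>_def)
  have "cosh (hdist z w) = cosh (ln y)"
  proof -
    have "hdist z w = hdist \<i> (\<i> * of_real y)"
      using hdist_mob[OF A(1) i(1,2)] A by simp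
    then have "cosh (hdist z w) = 1 + (1 - y)\<^sup>2 / (2 * y)"
      using cosh_hdist[OF i(1,2)] by (simp add: cmod_def)
    also have "\<dots> = cosh (ln y)"
      using A(3) by (simp add: cosh_ln_real divide_simps power2_eq_square algebra_simps)
    finally show ?thesis .
  qed
  then have "cosh (hdist z w) = cosh \<bar>ln y\<bar>" by (simp add: abs_if)
  then have "hdist z w = \<bar>ln y\<bar>"
    using hdist_nonneg[OF z w] by (metis abs_ge_zero arcosh_cosh_real)
  then have ey: "e * hdist z w = ln y"
    using A(3) ln_less_zero[of y] ln_ge_zero[of y] by (auto simp: e_def)
  define c where "c t = mob A (\<beta> t)" for t
  define c' where "c' t = of_real (e * exp (e * t)) * (\<i> * (1 / (of_real (A$2$1) * \<beta> t + of_real (A$2$2))\<^sup>2))" for t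
  have e1: "\<bar>e\<bar> = 1" by (simp add: e_def)
  show thesis
  proof
    show "c 0 = z" using A(2) by (simp add: c_def \<beta>_def)
    show "c (hdist z w) = w" using A(3,4) by (simp add: c_def \<beta>_def ey)
    show "c t \<in> uhp" for t using mob_uhp[OF A(1) i(3)] by (simp add: c_def)
    show "(c has_vector_derivative c' t) (at t)" for t
    proof -
      have "((\<lambda>t. exp (e * t)) has_real_derivative (e * exp (e * t))) (at t)"
        by (auto intro!: derivative_eq_intros)
      then have "((\<lambda>t. of_real (exp (e * t)) :: complex) has_vector_derivative of_real (e * exp (e * t))) (at t)"
        unfolding has_real_derivative_iff_has_vector_derivative by (rule bounded_linear.has_vector_derivative[OF bounded_linear_of_real])
      then have "(\<beta> has_vector_derivative \<i> * of_real (e * exp (e * t))) (at t)"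
        unfolding \<beta>_def by (rule has_vector_derivative_mult_right)
      from field_vector_diff_chain_at[OF this mob_has_field_derivative[OF A(1) i(3)]]
      show ?thesis unfolding c_def c'_def by (simp add: o_def mult_ac)
    qed
    show "cmod (c' t) = Im (c t)" for t
    proof -
      have "cmod (c' t) = \<bar>e\<bar> * exp (e * t) / (cmod (of_real (A$2$1) * \<beta> t + of_real (A$2$2)))\<^sup>2"
        unfolding c'_def by (simp add: norm_mult norm_divide norm_power)
      then show ?thesis unfolding c_def Im_mob[OF A(1) i(3)] e1 by (simp add: \<beta>_def)
    qed
  qed
qed

text \<open>The cosh formula gives |z - w|^2 <= 2 Im z Im w (cosh R - 1), and the square of Im z -
  Im w is no larger. The constant 2 cosh R is crude but serves all three bounds.\<close>

lemma hdist_le_bounds: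
  assumes z: "z \<in> uhp" and w: "w \<in> uhp" and R: "hdist z w \<le> R"
  shows "Im z \<le> 2 * cosh R * Im w" "Im w \<le> 2 * cosh R * Im z" "cmod (z - w) \<le> 2 * cosh R * Im z"
proof -
  define a where "a = Im z"
  define b where "b = Im w"
  define C where "C = cosh R"
  have ab: "0 < a" "0 < b" using z w by (auto simp: uhp_def a_def b_def)
  have R0: "0 \<le> R" using hdist_nonneg[OF z w] R by linarith
  have C1: "1 \<le> C" by (simp add: C_def cosh_real_ge_1)
  have "cosh (hdist z w) \<le> C"
    unfolding C_def using R R0 hdist_nonneg[OF z w] by (simp add: cosh_real_nonneg_le_iff)
  then have "1 + (cmod (z - w))\<^sup>2 / (2 * a * b) \<le> C" unfolding cosh_hdist[OF z w] a_def b_def .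
  then have N: "(cmod (z - w))\<^sup>2 \<le> 2 * a * b * (C - 1)" using ab by (simp add: field_simps)
  have "(a - b)\<^sup>2 \<le> (cmod (z - w))\<^sup>2" unfolding a_def b_def cmod_power2 by simp
  then have q: "a\<^sup>2 + b\<^sup>2 \<le> 2 * a * b * C" using N by (simp add: power2_eq_square algebra_simps)
  have "b * b \<le> b * (2 * C * a)" 
  proof -
    have "b * (2 * C * a) = 2 * a * b * C" by simp
    then show ?thesis using q zero_le_power2[of a] unfolding power2_eq_square[symmetric] by linarith
  qed
  then have b: "b \<le> 2 * C * a" using ab by simp
  have "a * a \<le> a * (2 * C * b)" 
  proof -
    have "a * (2 * C * b) = 2 * a * b * C" by simp
    then show ?thesis using q zero_le_power2[of b] unfolding power2_eq_square[symmetric] by linarith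
  qed
  then have a: "a \<le> 2 * C * b" using ab by simp
  have "(cmod (z - w))\<^sup>2 \<le> 2 * a * (2 * C * a) * (C - 1)"
    using N mult_right_mono[OF mult_left_mono[OF b, of "2 * a"], of "C - 1"] ab C1 by linarith
  also have "\<dots> \<le> (2 * C * a)\<^sup>2" 
  proof -
    have "(2 * C * a)\<^sup>2 - 2 * a * (2 * C * a) * (C - 1) = 4 * a * a * C" by algebra
    moreover have "0 \<le> 4 * a * a * C" using ab C1 by simp
    ultimately show ?thesis by linarith
  qed
  finally have sq: "(cmod (z - w))\<^sup>2 \<le> (2 * C * a)\<^sup>2" .
  have "cmod (z - w) \<le> 2 * C * a" by (rule power2_le_imp_le[OF sq]) (use ab C1 in simp)
  then show "Im z \<le> 2 * cosh R * Im w" "Im w \<le> 2 * cosh R * Im z" "cmod (z - w) \<le> 2 * cosh R * Im z"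
    using a b by (simp_all add: a_def b_def C_def)
qed

lemma uhp_compact_bounds:
  assumes "compact K" "K \<subseteq> uhp"
  obtains m M where "0 < m" "0 < M" "\<And>z. z \<in> K \<Longrightarrow> m \<le> Im z" "\<And>z. z \<in> K \<Longrightarrow> cmod z \<le> M"
proof (cases "K = {}")
  case True then show ?thesis using that[of 1 1] by auto
next
  case False
  obtain z0 where z0: "z0 \<in> K" "\<And>z. z \<in> K \<Longrightarrow> Im z0 \<le> Im z"
    using continuous_attains_inf[OF assms(1) False, of Im] continuous_on_Im[OF continuous_on_id] by blast
  obtain M where "0 < M" "\<And>z. z \<in> K \<Longrightarrow> cmod z \<le> M"
    using compact_imp_bounded[OF assms(1)] by (auto simp: bounded_pos)
  with that[of "Im z0" M] z0 assms(2) show ?thesis by (auto simp: uhp_def)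
qed

text \<open>Points within R of K keep a positive lower bound on Im and an upper bound on the
  modulus, so a closed disc cut off by a horizontal line contains them. This extends estimates on
  compact sets along geodesics that start in K.\<close>

lemma hdist_neighborhood_compact:
  assumes K: "compact K" "K \<subseteq> uhp"
  obtains K' where "compact K'" "K' \<subseteq> uhp" "\<And>z w. z \<in> K \<Longrightarrow> w \<in> uhp \<Longrightarrow> hdist z w \<le> R \<Longrightarrow> w \<in> K'"
proof -
  obtain m M where m: "0 < m" "0 < M" "\<And>z. z \<in> K \<Longrightarrow> m \<le> Im z" "\<And>z. z \<in> K \<Longrightarrow> cmod z \<le> M"
    using uhp_compact_bounds[OF K] by blast
  define C where "C = cosh R"
  have C1: "1 \<le> C" by (simp add: C_def cosh_real_ge_1)
  define K' where "K' = cball 0 (M + 2 * C * M) \<inter> {w. m / (2 * C) \<le> Im w}"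
  show thesis
  proof
    show "compact K'" unfolding K'_def
      by (intro compact_Int_closed compact_cball closed_Collect_le continuous_intros)
    have "0 < m / (2 * C)" using m C1 by simp
    then show "K' \<subseteq> uhp" unfolding K'_def uhp_def by force
    fix z w assume z: "z \<in> K" and w: "w \<in> uhp" and R: "hdist z w \<le> R"
    have zu: "z \<in> uhp" using z K by blast
    note b = hdist_le_bounds[OF zu w R, folded C_def]
    have "m / (2 * C) \<le> Im w" using m(3)[OF z] b(1) C1 by (simp add: field_simps)
    moreover have "cmod w \<le> M + 2 * C * M"
    proof -
      have "cmod w \<le> cmod z + cmod (z - w)" by (metis add.commute norm_minus_commute norm_triangle_sub)
      also have "\<dots> \<le> M + 2 * C * M"
        using b(3) m(4)[OF z] C1 abs_Im_le_cmod[of z] by (smt (verit) mult_left_mono)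
      finally show ?thesis .
    qed
    ultimately show "w \<in> K'" by (simp add: K'_def)
  qed
qed

lemma compact_hdist_ball:
  assumes "z \<in> uhp"
  shows "compact {w \<in> uhp. hdist z w \<le> R}"
proof -
  obtain K' where K': "compact K'" "K' \<subseteq> uhp" "\<And>w. w \<in> uhp \<Longrightarrow> hdist z w \<le> R \<Longrightarrow> w \<in> K'"
    using hdist_neighborhood_compact[of "{z}"] assms by (metis compact_sing empty_subsetI insert_subset singletonI)
  have "{w \<in> uhp. hdist z w \<le> R} = {w \<in> K'. hdist z w \<le> R}" using K' by auto
  moreover have "closed {w \<in> K'. hdist z w \<le> R}"
    using K' assms compact_imp_closed
    by (intro continuous_closed_preimage_constant closed_Collect_le continuous_on_closed_Collect_le continuous_on_hdist continuous_intros) auto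
  ultimately show ?thesis
    by (metis (no_types, lifting) K'(1) compact_Int_closed inf.absorb_iff2 mem_Collect_eq subsetI)
qed

lemma open_uhp: "open uhp"
  unfolding uhp_def by (intro open_Collect_less continuous_intros)

text \<open>A geodesic arc from z to w stays within R of z, so its image under f has speed at most
  M. The image need not be geodesic, but its length bounds the distance of its endpoints.\<close>

lemma hdist_image_le:
  assumes z: "z \<in> uhp" and w: "w \<in> uhp" and R: "hdist z w \<le> R"
    and f: "\<And>u. u \<in> uhp \<Longrightarrow> hdist z u \<le> R \<Longrightarrow> f u \<in> uhp \<and> f differentiable (at u)"
    and M: "\<And>u v. u \<in> uhp \<Longrightarrow> hdist z u \<le> R \<Longrightarrow>
      cmod (frechet_derivative f (at u) v) / Im (f u) \<le> M * (cmod v / Im u)"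
  shows "hdist (f z) (f w) \<le> M * hdist z w"
proof -
  define D where "D = hdist z w"
  have D0: "0 \<le> D" using hdist_nonneg[OF z w] by (simp add: D_def)
  obtain c c' where c: "c 0 = z" "c D = w" "\<And>t. c t \<in> uhp"
    "\<And>t. (c has_vector_derivative c' t) (at t)" "\<And>t. cmod (c' t) = Im (c t)"
    using geodesic_exists[OF z w] unfolding D_def by blast
  have near: "hdist z (c t) \<le> R" if t: "t \<in> {0..D}" for t
  proof -
    have "hdist z (c t) \<le> hdist z (c 0) + 1 * (t - 0)"
      using c(3-5) z t by (intro hdist_path_le[where c'=c'])
        (auto intro!: continuous_at_imp_continuous_on has_vector_derivative_continuous)
    then show ?thesis using t R c(1) by (simp add: D_def)
  qed
  have fc: "((\<lambda>t. f (c t)) has_vector_derivative frechet_derivative f (at (c t)) (c' t)) (at t)"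
    if t: "t \<in> {0..D}" for t
  proof -
    have "f differentiable (at (c t))" using f[OF c(3) near[OF t]] by simp
    then have d: "(f has_derivative frechet_derivative f (at (c t))) (at (c t))"
      by (simp add: frechet_derivative_works)
    have "((\<lambda>t. f (c t)) has_derivative (\<lambda>x. frechet_derivative f (at (c t)) (x *\<^sub>R c' t))) (at t)"
      using has_derivative_compose[OF c(4)[of t, unfolded has_vector_derivative_def] d] .
    then show ?thesis
      unfolding has_vector_derivative_def using linear_frechet_derivative[OF \<open>f differentiable _\<close>]
      by (simp add: linear_scale)
  qed
  have "hdist (f z) (f (c D)) \<le> hdist (f z) (f (c 0)) + M * (D - 0)"
  proof (rule hdist_path_le[where c' = "\<lambda>t. frechet_derivative f (at (c t)) (c' t)"])
    show "f z \<in> uhp" using f[OF z] near[of 0] D0 c(1) by simp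
    show "continuous_on {0..D} (\<lambda>t. f (c t))"
      using has_vector_derivative_continuous[OF fc] by (auto intro!: continuous_at_imp_continuous_on)
    show "cmod (frechet_derivative f (at (c t)) (c' t)) \<le> M * Im (f (c t))" if "t \<in> {0<..<D}" for t
    proof -
      have t: "t \<in> {0..D}" using that by auto
      have "0 < Im (f (c t))" "0 < Im (c t)" using f[OF c(3) near[OF t]] c(3)[of t] by (auto simp: uhp_def)
      then show ?thesis using M[OF c(3) near[OF t], of "c' t"] c(5)[of t] by (simp add: divide_simps)
    qed
  qed (use D0 fc f c near in auto)
  then show ?thesis using c by (simp add: D_def)
qed

text \<open>
  A geodesic starting at \<open>f z\<close> is pulled back by \<open>f\<close>; at the first time at which it could leave the
  image of the open \<open>R\<close>-ball, the pulled back path is still inside a compact smaller ball.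
\<close>

lemma hdist_lift:
  assumes z: "z \<in> uhp" and x: "x \<in> uhp" and R: "M * hdist (f z) x < R" and M0: "0 \<le> M"
    and fu: "f ` uhp \<subseteq> uhp" and inj: "inj_on f uhp"
    and diff: "\<And>u. u \<in> uhp \<Longrightarrow> f differentiable (at u) \<and> bij (frechet_derivative f (at u))"
    and M: "\<And>u v. u \<in> uhp \<Longrightarrow> hdist z u \<le> R \<Longrightarrow>
      cmod v / Im u \<le> M * (cmod (frechet_derivative f (at u) v) / Im (f u))"
  obtains w where "w \<in> uhp" "f w = x" "hdist z w \<le> M * hdist (f z) x"
proof -
  define D where "D = hdist (f z) x"
  have fz: "f z \<in> uhp" using fu z by blast
  have D0: "0 \<le> D" using hdist_nonneg[OF fz x] by (simp add: D_def)
  obtain c c' where c: "c 0 = f z" "c D = x" "\<And>t. c t \<in> uhp"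
    "\<And>t. (c has_vector_derivative c' t) (at t)" "\<And>t. cmod (c' t) = Im (c t)"
    using geodesic_exists[OF fz x] unfolding D_def by blast
  have contc: "continuous_on S c" for S
    using c(4) by (auto intro!: continuous_at_imp_continuous_on has_vector_derivative_continuous)
  have contf: "continuous_on uhp f"
    using diff by (auto intro!: continuous_at_imp_continuous_on differentiable_imp_continuous_within)
  define g where "g = inv_into uhp f"
  have gf: "g (f u) = u" if "u \<in> uhp" for u using that inj by (simp add: g_def)
  \<comment> \<open>B is compact and lies in the open set U because M * D < R. The image of B is
    closed and that of U is open; the argument about the first exit time uses both.\<close>
  define B where "B = {w \<in> uhp. hdist z w \<le> M * D}"
  define U where "U = {w \<in> uhp. hdist z w < R}"
  have BU: "B \<subseteq> U" using R by (auto simp: B_def U_def D_def)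
  have closedB: "closed (f ` B)"
  proof -
    have "compact B" unfolding B_def by (rule compact_hdist_ball[OF z])
    then show ?thesis
      using compact_continuous_image[of B f] continuous_on_subset[OF contf, of B] compact_imp_closed
      by (auto simp: B_def)
  qed
  have openU: "open (f ` U)"
  proof -
    have "openin (top_of_set uhp) (uhp \<inter> (\<lambda>w. hdist z w) -` {..<R})"
      by (intro continuous_openin_preimage_gen continuous_on_hdist continuous_intros) (use z in auto)
    then have "open (uhp \<inter> (\<lambda>w. hdist z w) -` {..<R})" using open_uhp openin_open_eq by blast
    moreover have "U = uhp \<inter> (\<lambda>w. hdist z w) -` {..<R}" by (auto simp: U_def)
    ultimately have "open U" by simp
    then show ?thesis
      by (intro invariance_of_domain) (auto simp: U_def intro: continuous_on_subset[OF contf] inj_on_subset[OF inj])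
  qed
  \<comment> \<open>As long as the geodesic stays in the image of U, the inverse of f is
    differentiable along it with derivative \<open>h\<close>, and the reverse metric bound gives the
    pulled back path speed at most M.\<close>
  have lift: "g (c t) \<in> uhp \<and> f (g (c t)) = c t \<and> hdist z (g (c t)) \<le> M * t"
    if t0: "0 \<le> t" and t: "\<And>r. r \<in> {0..t} \<Longrightarrow> c r \<in> f ` U" for t
  proof -
    define h where "h r = inv_into UNIV (frechet_derivative f (at (g (c r))))" for r
    have gU: "g (c r) \<in> U \<and> f (g (c r)) = c r" if "r \<in> {0..t}" for r
      using t[OF that] gf unfolding U_def by auto
    have gc: "((\<lambda>t. g (c t)) has_vector_derivative h r (c' r)) (at r)" if r: "r \<in> {0..t}" for r
    proof -
      define u where "u = g (c r)"
      have u: "u \<in> uhp" "f u = c r" using gU[OF r] by (auto simp: U_def u_def)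
      have du: "(f has_derivative frechet_derivative f (at u)) (at u)" and bu: "bij (frechet_derivative f (at u))"
        using diff[OF u(1)] by (simp_all add: frechet_derivative_works)
      have "frechet_derivative f (at u) \<circ> h r = id"
        unfolding h_def u_def[symmetric] using bu by (auto simp: fun_eq_iff bij_is_surj surj_f_inv_f)
      then have "(g has_derivative h r) (at (f u))"
        using has_derivative_inverse_strong[OF open_uhp u(1) contf _ du] gf by blast
      then have gd: "(g has_derivative h r) (at (c r))" using u by simp
      have "((\<lambda>t. g (c t)) has_derivative (\<lambda>x. h r (x *\<^sub>R c' r))) (at r)"
        using has_derivative_compose[OF c(4)[of r, unfolded has_vector_derivative_def] gd] .
      then show ?thesis
        unfolding has_vector_derivative_def using has_derivative_linear[OF gd] by (simp add: linear_scale)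
    qed
    have "hdist z (g (c t)) \<le> hdist z (g (c 0)) + M * (t - 0)"
    proof (rule hdist_path_le[where c' = "\<lambda>r. h r (c' r)"])
      show "continuous_on {0..t} (\<lambda>t. g (c t))"
        using has_vector_derivative_continuous[OF gc] by (auto intro!: continuous_at_imp_continuous_on)
      show "cmod (h r (c' r)) \<le> M * Im (g (c r))" if r: "r \<in> {0<..<t}" for r
      proof -
        have r': "r \<in> {0..t}" using r by auto
        have u: "g (c r) \<in> uhp" "hdist z (g (c r)) \<le> R" "f (g (c r)) = c r"
          using gU[OF r'] by (auto simp: U_def)
        have "bij (frechet_derivative f (at (g (c r))))" using diff[OF u(1)] by simp
        then have "frechet_derivative f (at (g (c r))) (h r (c' r)) = c' r"
          unfolding h_def by (simp add: bij_is_surj surj_f_inv_f)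
        then have "cmod (h r (c' r)) / Im (g (c r)) \<le> M * (cmod (c' r) / Im (c r))"
          using M[OF u(1,2), of "h r (c' r)"] u(3) by simp
        then show ?thesis using c(5)[of r] c(3)[of r] u(1) by (simp add: uhp_def divide_simps)
      qed
    qed (use t0 z gU gc in \<open>auto simp: U_def\<close>)
    then show ?thesis using gU[of t] t0 by (auto simp: c(1) gf z U_def)
  qed
  have "c t \<in> f ` U" if t: "t \<in> {0..D}" for t
  proof (rule ccontr)
    assume "c t \<notin> f ` U"
    \<comment> \<open>The times at which the geodesic is outside the image of U. This set is
      compact, so it has a least element t0. Before t0 the path runs in the image of B, which is
      closed, so its point at t0 lies there too, a contradiction.\<close>
    define E where "E = {0..D} \<inter> c -` (- f ` U)"
    have "closed E"
      unfolding E_def using openU contc by (intro continuous_closed_preimage) auto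
    then have "compact E" using compact_Int_closed[OF compact_Icc[of 0 D], of E] by (simp add: E_def)
    have "t \<in> E" using t \<open>c t \<notin> f ` U\<close> by (simp add: E_def)
    then have "E \<noteq> {}" by (metis empty_iff)
    then have "\<exists>s\<in>E. \<forall>r\<in>E. s \<le> r" by (rule compact_attains_inf[OF \<open>compact E\<close>])
    then obtain t0 where t0: "t0 \<in> E" "\<And>r. r \<in> E \<Longrightarrow> t0 \<le> r" by metis
    have t0D: "0 \<le> t0" "t0 \<le> D" using t0 by (auto simp: E_def)
    have before: "c r \<in> f ` U" if "0 \<le> r" "r < t0" for r
      using t0(2)[of r] that t0D by (force simp: E_def)
    have "z \<in> B" using z M0 D0 by (simp add: B_def)
    then have "c 0 \<in> f ` U" using BU c(1) by auto
    then have "0 < t0" using t0 t0D by (cases "t0 = 0") (auto simp: E_def)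
    have inB: "c r \<in> f ` B" if "r \<in> {0..<t0}" for r
    proof -
      have "g (c r) \<in> uhp \<and> f (g (c r)) = c r \<and> hdist z (g (c r)) \<le> M * r"
        using that by (intro lift before) auto
      moreover have "M * r \<le> M * D" using that t0D M0 by (intro mult_left_mono) auto
      ultimately show ?thesis unfolding B_def by (intro image_eqI[of _ _ "g (c r)"]) auto
    qed
    have "c t0 \<in> closure (c ` {0..<t0})"
    proof -
      have "t0 \<in> closure {0..<t0}" using \<open>0 < t0\<close> by simp
      then show ?thesis using image_closure_subset[OF contc[of "closure {0..<t0}"] closed_closure closure_subset] by blast
    qed
    moreover have "closure (c ` {0..<t0}) \<subseteq> f ` B" using inB closedB by (intro closure_minimal) auto
    ultimately have "c t0 \<in> f ` U" using BU by blast
    then show False using t0 by (auto simp: E_def)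
  qed
  then show thesis using lift[of D] D0 c(2) that[of "g (c D)"] by (auto simp: D_def)
qed

section \<open>Discrete groups\<close>

lemma subgroup_SL2R_D:
  assumes "subgroup \<Gamma> SL2R"
  shows "\<And>g. g \<in> \<Gamma> \<Longrightarrow> g \<in> carrier SL2R" "mat 1 \<in> \<Gamma>"
    "\<And>g h. g \<in> \<Gamma> \<Longrightarrow> h \<in> \<Gamma> \<Longrightarrow> g ** h \<in> \<Gamma>" "\<And>g. g \<in> \<Gamma> \<Longrightarrow> matrix_inv g \<in> \<Gamma>"
proof -
  show "mat 1 \<in> \<Gamma>" using subgroup.one_closed[OF assms] by (simp add: SL2R_sel)
  show "\<And>g h. g \<in> \<Gamma> \<Longrightarrow> h \<in> \<Gamma> \<Longrightarrow> g ** h \<in> \<Gamma>"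
    using subgroup.m_closed[OF assms] by (simp add: SL2R_sel)
  show c: "\<And>g. g \<in> \<Gamma> \<Longrightarrow> g \<in> carrier SL2R" using subgroup.subset[OF assms] by blast
  show "\<And>g. g \<in> \<Gamma> \<Longrightarrow> matrix_inv g \<in> \<Gamma>"
    using subgroup.m_inv_closed[OF assms] c m_inv_SL2R by metis
qed

lemma tendsto_mat_mult:
  fixes A B :: "nat \<Rightarrow> mat22"
  assumes "A \<longlonglongrightarrow> a" "B \<longlonglongrightarrow> b"
  shows "(\<lambda>n. A n ** B n) \<longlonglongrightarrow> a ** b"
  unfolding matrix_matrix_mult_def by (intro tendsto_intros assms)

text \<open>Discreteness isolates the elements from each other, which for a general set does not
  exclude accumulation at a point outside it. In a group, a convergent sequence of distinct elements
  has quotients of consecutive terms tending to 1, and 1 is isolated.\<close>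

lemma discrete_subgroup_finite:
  fixes S :: "mat22 set"
  assumes G: "subgroup \<Gamma> SL2R" "discrete \<Gamma>" and S: "S \<subseteq> \<Gamma>" "bounded S"
  shows "finite S"
proof (rule ccontr)
  assume inf: "infinite S"
  note sub = subgroup_SL2R_D[OF G(1)]
  have "mat 1 isolated_in \<Gamma>" using G(2) sub(2) by (simp add: discrete_def)
  then obtain e where e: "e > 0" "\<And>y. y \<in> \<Gamma> \<Longrightarrow> dist (mat 1) y < e \<Longrightarrow> y = mat 1"
    unfolding isolated_in_dist_Ex_iff by blast
  obtain f :: "nat \<Rightarrow> mat22" where f: "inj f" "range f \<subseteq> S"
    using infinite_countable_subset[OF inf] by blast
  then have "bounded (range f)" using S(2) bounded_subset by blast
  then obtain a r where r: "strict_mono r" "(f \<circ> r) \<longlonglongrightarrow> a"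
    using bounded_imp_convergent_subsequence by blast
  define A where "A n = f (r n)" for n
  have A: "\<And>n. A n \<in> S" "A \<longlonglongrightarrow> a" "inj A"
    using f r strict_mono_eq[OF r(1)] by (auto simp: A_def[abs_def] o_def inj_def dest!: injD[OF f(1)])
  have AS: "A n \<in> carrier SL2R" "A n \<in> \<Gamma>" for n using A(1) S sub by auto
  have "(\<lambda>n. matrix_inv (A n) ** A (Suc n)) \<longlonglongrightarrow> mat22 (a$2$2) (- a$1$2) (- a$2$1) (a$1$1) ** a"
  proof (rule tendsto_mat_mult)
    show "(\<lambda>n. matrix_inv (A n)) \<longlonglongrightarrow> mat22 (a$2$2) (- a$1$2) (- a$2$1) (a$1$1)"
      unfolding matrix_inv_SL2R[OF AS(1)]
    proof (rule vec_tendstoI, rule vec_tendstoI)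
      fix i j :: 2
      show "(\<lambda>n. mat22 (A n$2$2) (- A n$1$2) (- A n$2$1) (A n$1$1) $ i $ j)
        \<longlonglongrightarrow> mat22 (a$2$2) (- a$1$2) (- a$2$1) (a$1$1) $ i $ j"
        using exhaust_2[of i] exhaust_2[of j] by (elim disjE) (simp_all, (intro tendsto_intros A(2))+)
    qed
    show "(\<lambda>n. A (Suc n)) \<longlonglongrightarrow> a" using A(2) by (rule LIMSEQ_Suc)
  qed
  moreover have "mat22 (a$2$2) (- a$1$2) (- a$2$1) (a$1$1) ** a = mat 1"
  proof -
    have "(\<lambda>n. A n $1$1 * A n $2$2 - A n $1$2 * A n $2$1) \<longlonglongrightarrow> a$1$1 * a$2$2 - a$1$2 * a$2$1"
      by (intro tendsto_intros A(2))
    moreover have "A n $1$1 * A n $2$2 - A n $1$2 * A n $2$1 = 1" for n using AS(1) by (simp add: SL2R_iff)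
    ultimately have "a$1$1 * a$2$2 - a$1$2 * a$2$1 = 1" by (simp add: LIMSEQ_const_iff)
    then show ?thesis by (intro mat22_eqI) (simp_all add: mult_entry mult.commute)
  qed
  ultimately have "(\<lambda>n. matrix_inv (A n) ** A (Suc n)) \<longlonglongrightarrow> mat 1" by simp
  then obtain n where "dist (matrix_inv (A n) ** A (Suc n)) (mat 1) < e"
    using e(1) unfolding lim_sequentially by blast
  then have "matrix_inv (A n) ** A (Suc n) = mat 1"
    using e(2) AS(2) sub by (simp add: dist_commute)
  then have "A (Suc n) = A n" by (metis AS(1) SL2R_cancel(2) matrix_mul_rid)
  then show False using A(3) by (simp add: inj_eq)
qed

text \<open>If g moves a point z of K by at most R, then Im (g z) is bounded below and |g z| above.
  The first bounds the denominator of g z, the second then bounds the numerator, and together they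
  bound all four entries.\<close>

lemma discrete_displacement_finite:
  assumes G: "subgroup \<Gamma> SL2R" "discrete \<Gamma>" and K: "compact K" "K \<subseteq> uhp"
  shows "finite {g \<in> \<Gamma>. \<exists>z\<in>K. hdist z (mob g z) \<le> R}"
proof (rule discrete_subgroup_finite[OF G])
  show "{g \<in> \<Gamma>. \<exists>z\<in>K. hdist z (mob g z) \<le> R} \<subseteq> \<Gamma>" by auto
  obtain K' where K': "compact K'" "K' \<subseteq> uhp" "\<And>z w. z \<in> K \<Longrightarrow> w \<in> uhp \<Longrightarrow> hdist z w \<le> R \<Longrightarrow> w \<in> K'"
    using hdist_neighborhood_compact[OF K] by metis
  obtain m M where m: "0 < m" "0 < M" "\<And>z. z \<in> K \<union> K' \<Longrightarrow> m \<le> Im z" "\<And>z. z \<in> K \<union> K' \<Longrightarrow> cmod z \<le> M"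
    using uhp_compact_bounds[of "K \<union> K'"] K K' by (metis Un_least compact_Un)
  define Q where "Q = sqrt (M / m)"
  have Q0: "0 \<le> Q" using m by (simp add: Q_def)
  define B where "B = Q / m + (Q + Q / m * M) + (M * Q / m + (M * Q + M * Q / m * M))"
  have "norm g \<le> B" if gR: "g \<in> {g \<in> \<Gamma>. \<exists>z\<in>K. hdist z (mob g z) \<le> R}" for g
  proof -
    have g: "g \<in> carrier SL2R" using gR subgroup_SL2R_D(1)[OF G(1)] by auto
    obtain z where z: "z \<in> K" "hdist z (mob g z) \<le> R" using gR by auto
    have zu: "z \<in> uhp" using z K by blast
    have gz: "mob g z \<in> K'" using K'(3)[OF z(1) mob_uhp[OF g zu] z(2)] .
    define q where "q = of_real (g$2$1) * z + of_real (g$2$2)"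
    define r where "r = of_real (g$1$1) * z + of_real (g$1$2)"
    have q0: "q \<noteq> 0" using uhp_denom_nz[OF g zu] by (simp add: q_def)
    have Imz: "m \<le> Im z" "cmod z \<le> M" "Im z \<le> M"
      using m(3,4)[of z] z(1) abs_Im_le_cmod[of z] by auto
    have "m \<le> Im z / (cmod q)\<^sup>2" using Im_mob[OF g zu] m(3)[of "mob g z"] gz by (simp add: q_def)
    then have "m * (cmod q)\<^sup>2 \<le> M" using q0 Imz by (simp add: field_simps)
    then have "(cmod q)\<^sup>2 \<le> Q\<^sup>2" using m by (simp add: Q_def field_simps)
    then have qQ: "cmod q \<le> Q" using Q0 power2_le_imp_le by blast
    have "mob g z = r / q" by (simp add: mob_def r_def q_def)
    then have "cmod r = cmod (mob g z) * cmod q" using q0 by (simp add: norm_divide)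
    also have "\<dots> \<le> M * Q" using m(4)[of "mob g z"] gz qQ m by (intro mult_mono) auto
    finally have rQ: "cmod r \<le> M * Q" .
    \<comment> \<open>Since Im z >= m, the imaginary part of the real linear form bounds its
      coefficient a, and then b is bounded as well.\<close>
    have row: "\<bar>a\<bar> \<le> C / m \<and> \<bar>b\<bar> \<le> C + C / m * M" if "cmod (of_real a * z + of_real b) \<le> C" for a b C
    proof -
      have "\<bar>a\<bar> * m \<le> \<bar>a\<bar> * Im z" using Imz by (intro mult_left_mono) auto
      also have "\<dots> = \<bar>Im (of_real a * z + of_real b)\<bar>" using Imz m by (simp add: abs_mult)
      also have "\<dots> \<le> C" using abs_Im_le_cmod that order_trans by blast
      finally have a: "\<bar>a\<bar> \<le> C / m" using m by (simp add: field_simps)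
      have "\<bar>b\<bar> = cmod ((of_real a * z + of_real b) - of_real a * z)" by simp
      also have "\<dots> \<le> cmod (of_real a * z + of_real b) + cmod (of_real a * z)" by (rule norm_triangle_ineq4)
      also have "\<dots> \<le> C + C / m * M"
        using that mult_mono[OF a, of "cmod z" M] a Imz m by (intro add_mono) (simp_all add: norm_mult)
      finally show ?thesis using a by simp
    qed
    have e: "\<bar>g$2$1\<bar> \<le> Q / m" "\<bar>g$2$2\<bar> \<le> Q + Q / m * M" "\<bar>g$1$1\<bar> \<le> M * Q / m" "\<bar>g$1$2\<bar> \<le> M * Q + M * Q / m * M"
      using row[of "g$2$1" "g$2$2" Q] row[of "g$1$1" "g$1$2" "M * Q"] qQ rQ by (simp_all add: q_def r_def)
    have "norm g \<le> (\<Sum>i\<in>UNIV. norm (g$i))" unfolding norm_vec_def[of g] by (rule L2_set_le_sum) simp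
    also have "\<dots> \<le> (\<Sum>i\<in>UNIV. \<Sum>j\<in>UNIV. \<bar>g$i$j\<bar>)" by (intro sum_mono norm_le_l1_cart)
    also have "\<dots> \<le> B" using e unfolding B_def sum_2 by linarith
    finally show ?thesis .
  qed
  then show "bounded {g \<in> \<Gamma>. \<exists>z\<in>K. hdist z (mob g z) \<le> R}" unfolding bounded_iff by blast
qed

text \<open>Countability is what allows a single group element to be extracted from an open set of
  points in \<open>rel_from_point\<close>.\<close>

lemma discrete_countable:
  assumes G: "subgroup \<Gamma> SL2R" "discrete \<Gamma>"
  shows "countable \<Gamma>"
proof -
  have "\<Gamma> = (\<Union>n::nat. {g \<in> \<Gamma>. norm g \<le> real n})" using real_arch_simple by auto
  moreover have "finite {g \<in> \<Gamma>. norm g \<le> real n}" for n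
    by (rule discrete_subgroup_finite[OF G]) (auto simp: bounded_iff)
  ultimately show ?thesis using countable_UN[of UNIV "\<lambda>n::nat. {g \<in> \<Gamma>. norm g \<le> real n}"] countable_finite by auto
qed

lemma continuous_on_mob: "A \<in> carrier SL2R \<Longrightarrow> S \<subseteq> uhp \<Longrightarrow> continuous_on S (mob A)"
  using mob_has_field_derivative
  by (meson DERIV_isCont continuous_at_imp_continuous_on subsetD)

text \<open>Only finitely many elements move a point of K by at most 1, and each fixed-point free
  one among them has a positive minimal displacement on K.\<close>

lemma discrete_displacement_lower_bound:
  assumes G: "subgroup \<Gamma> SL2R" "discrete \<Gamma>" and K: "compact K" "K \<subseteq> uhp"
  obtains b where "0 < b" "\<And>g z. g \<in> \<Gamma> \<Longrightarrow> \<forall>u\<in>uhp. mob g u \<noteq> u \<Longrightarrow> z \<in> K \<Longrightarrow> b \<le> hdist z (mob g z)"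
proof (cases "K = {}")
  case True then show ?thesis using that[of 1] by auto
next
  case False
  define A where "A = {g \<in> \<Gamma>. (\<exists>z\<in>K. hdist z (mob g z) \<le> 1) \<and> (\<forall>u\<in>uhp. mob g u \<noteq> u)}"
  have finA: "finite A"
    by (rule finite_subset[OF _ discrete_displacement_finite[OF G K, of 1]]) (auto simp: A_def)
  have AG: "g \<in> carrier SL2R" if "g \<in> A" for g using that subgroup_SL2R_D(1)[OF G(1)] by (auto simp: A_def)
  have "\<exists>b>0. \<forall>z\<in>K. b \<le> hdist z (mob g z)" if g: "g \<in> A" for g
  proof -
    have "continuous_on K (\<lambda>z. hdist z (mob g z))"
      using K mob_uhp AG[OF g] by (intro continuous_on_hdist continuous_on_mob) (auto intro: continuous_intros)
    then obtain z0 where z0: "z0 \<in> K" "\<And>z. z \<in> K \<Longrightarrow> hdist z0 (mob g z0) \<le> hdist z (mob g z)"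
      using continuous_attains_inf[OF K(1) False] by blast
    have "z0 \<in> uhp" using z0 K by blast
    then have "0 < hdist z0 (mob g z0)"
      using hdist_nonneg[of z0 "mob g z0"] hdist_eq_0_iff[of z0 "mob g z0"] mob_uhp[OF AG[OF g]] g
      by (fastforce simp: A_def less_le)
    then show ?thesis using z0 by blast
  qed
  then obtain \<beta> where \<beta>: "\<And>g. g \<in> A \<Longrightarrow> 0 < \<beta> g \<and> (\<forall>z\<in>K. \<beta> g \<le> hdist z (mob g z))" by metis
  define b where "b = Min (insert 1 (\<beta> ` A))"
  show thesis
  proof
    show "0 < b" unfolding b_def using finA \<beta> by (subst Min_gr_iff) auto
    fix g z assume g: "g \<in> \<Gamma>" "\<forall>u\<in>uhp. mob g u \<noteq> u" and z: "z \<in> K"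
    show "b \<le> hdist z (mob g z)"
    proof (cases "g \<in> A")
      case True
      then have "b \<le> \<beta> g" unfolding b_def using finA by (intro Min_le) auto
      then show ?thesis using \<beta>[OF True] z by force
    next
      case False
      have "b \<le> 1" unfolding b_def using finA by (intro Min_le) auto
      then show ?thesis using False g z by (force simp: A_def)
    qed
  qed
qed

section \<open>Normal forms and strip coordinates\<close>

lemma psl_eq_minus: "psl_eq (- A) B \<longleftrightarrow> psl_eq A B"
  unfolding psl_eq_def by (metis minus_minus)

lemma conj_eq_iff:
  assumes "P \<in> carrier SL2R"
  shows "matrix_inv P ** A ** matrix_inv (matrix_inv P) = D \<longleftrightarrow> A ** P = P ** D"
proof -
  have "matrix_inv P ** A ** P = D \<longleftrightarrow> A ** P = P ** D"
    by (metis SL2R_cancel(1,2) assms matrix_mul_assoc)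
  then show ?thesis by (simp add: matrix_inv_inv[OF assms])
qed

text \<open>Diagonalization with a conjugating matrix of determinant 1. A negative trace is reduced
  to a positive one by passing to the negative matrix, which is the same element of
  PSL(2,R).\<close>

lemma hyp_frame_exists:
  assumes "hyperbolic \<gamma>"
  shows "\<exists>\<sigma> l. hyp_frame \<gamma> \<sigma> l"
proof -
  have pos: "\<exists>\<sigma> l. hyp_frame \<gamma> \<sigma> l" if g: "\<gamma> \<in> carrier SL2R" "2 < trace \<gamma>" for \<gamma>
  proof -
    define a where "a = \<gamma>$1$1"
    define b where "b = \<gamma>$1$2"
    define c where "c = \<gamma>$2$1"
    define d where "d = \<gamma>$2$2"
    define T where "T = a + d"
    have det: "a * d - b * c = 1" using g by (simp add: SL2R_iff a_def b_def c_def d_def)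
    have T: "2 < T" using g by (simp add: trace_mat22 T_def a_def d_def)
    \<comment> \<open>The larger root of the characteristic polynomial; the other root is its
      inverse because the determinant is 1.\<close>
    define \<alpha> where "\<alpha> = (T + sqrt (T\<^sup>2 - 4)) / 2"
    have "2\<^sup>2 < T\<^sup>2" using T by (intro power_strict_mono) auto
    then have sq: "(sqrt (T\<^sup>2 - 4))\<^sup>2 = T\<^sup>2 - 4" "0 \<le> sqrt (T\<^sup>2 - 4)" by simp_all
    have l1: "1 < \<alpha>" 
    proof -
      have "2 + 0 < T + sqrt (T\<^sup>2 - 4)" by (rule add_less_le_mono[OF T sq(2)])
      then show ?thesis by (simp add: \<alpha>_def)
    qed
    have l2: "\<alpha> * \<alpha> - T * \<alpha> + 1 = 0"
      using sq(1) unfolding \<alpha>_def by (simp add: power2_eq_square field_simps)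
    define \<beta> where "\<beta> = 1 / \<alpha>"
    have lm: "\<alpha> * \<beta> = 1" using l1 by (simp add: \<beta>_def)
    have neq: "\<alpha> \<noteq> \<beta>" using less_1_mult[OF l1 l1] lm by auto
    have sum: "\<alpha> + \<beta> = T" using l2 l1 by (simp add: \<beta>_def field_simps)
    have m2: "\<beta> * \<beta> - T * \<beta> + 1 = 0" unfolding sum[symmetric] using lm by (simp add: algebra_simps)
    define l where "l = 2 * ln \<alpha>"
    have l0: "0 < l" using l1 by (simp add: l_def)
    have e: "exp (l/2) = \<alpha>" "exp (- l/2) = \<beta>" using l1 by (simp_all add: l_def \<beta>_def exp_minus inverse_eq_divide)
    have fin: "\<exists>\<sigma> l. hyp_frame \<gamma> \<sigma> l" if "P \<in> carrier SL2R" "\<gamma> ** P = P ** mat22 \<alpha> 0 0 \<beta>" for P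
    proof -
      have "hyp_frame \<gamma> (matrix_inv P) l"
        unfolding hyp_frame_def psl_eq_def e using that l0 conj_eq_iff[OF that(1)] by (simp add: SL2R_inv)
      then show ?thesis by blast
    qed
    have from_vecs: "\<exists>\<sigma> l. hyp_frame \<gamma> \<sigma> l"
      if v: "a * v1 + b * v2 = \<alpha> * v1" "c * v1 + d * v2 = \<alpha> * v2"
        and w: "a * w1 + b * w2 = \<beta> * w1" "c * w1 + d * w2 = \<beta> * w2" and nz: "v1 * w2 - w1 * v2 \<noteq> 0"
      for v1 v2 w1 w2
    proof -
      define k where "k = v1 * w2 - w1 * v2"
      \<comment> \<open>Only the first eigenvector is rescaled, which is enough to normalize the
        determinant.\<close>
      define P where "P = mat22 (v1 / k) w1 (v2 / k) w2"
      have k: "k \<noteq> 0" using nz by (simp add: k_def)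
      show ?thesis
      proof (rule fin)
        have "v1 / k * w2 - w1 * (v2 / k) = (v1 * w2 - w1 * v2) / k" by (simp add: diff_divide_distrib)
        then show "P \<in> carrier SL2R" using k by (simp add: SL2R_iff P_def k_def[symmetric])
        have "a * (v1 / k) + b * (v2 / k) = (a * v1 + b * v2) / k" "c * (v1 / k) + d * (v2 / k) = (c * v1 + d * v2) / k"
          by (simp_all add: add_divide_distrib)
        then show "\<gamma> ** P = P ** mat22 \<alpha> 0 0 \<beta>"
          using v w by (intro mat22_eqI) (simp_all add: mult_entry P_def a_def b_def c_def d_def mult.commute)
      qed
    qed
    show ?thesis
    proof (cases "c = 0")
      case False
      have *: "a * (x - d) + b * c = x * (x - d)" if "x * x - T * x + 1 = 0" for x
        using det that unfolding T_def by (simp add: algebra_simps)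
      have "(\<alpha> - d) * c - (\<beta> - d) * c = (\<alpha> - \<beta>) * c" by (simp add: algebra_simps)
      then show ?thesis using False lm neq *[OF l2] *[OF m2]
        by (intro from_vecs[of "\<alpha> - d" c "\<beta> - d" c]) (simp_all add: algebra_simps)
    next
      case True
      then have ad: "a * d = 1" using det by simp
      have "(\<alpha> - a) * (\<alpha> - d) = 0" using l2 ad by (simp add: T_def algebra_simps)
      then consider "\<alpha> = a" "\<beta> = d" | "\<alpha> = d" "\<beta> = a" using sum T_def by fastforce
      then show ?thesis
      proof cases
        case 1
        then show ?thesis using True lm neq by (intro from_vecs[of 1 0 b "d - a"]) (simp_all add: algebra_simps)
      next
        case 2
        then show ?thesis using True lm neq by (intro from_vecs[of b "d - a" 1 0]) (simp_all add: algebra_simps)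
      qed
    qed
  qed
  show ?thesis
  proof (cases "2 < trace \<gamma>")
    case True then show ?thesis using pos assms by (simp add: hyperbolic_def)
  next
    case False
    have "trace (- \<gamma>) = - trace \<gamma>" by (simp add: trace_mat22)
    then have "2 < trace (- \<gamma>)" using False assms unfolding hyperbolic_def by linarith
    then obtain \<sigma> l where "hyp_frame (- \<gamma>) \<sigma> l" using pos[of "- \<gamma>"] assms SL2R_minus by (auto simp: hyperbolic_def)
    then show ?thesis unfolding hyp_frame_def by (auto simp: psl_eq_minus)
  qed
qed

text \<open>For trace 2 the determinant condition reads (a - 1)^2 = -bc. If c is nonzero, the vector
  with entries -(a - 1)/c and -1 is fixed by p; as first column of the conjugating matrix it turns p
  into the translation by -c.\<close>

lemma par_frame_exists:
  assumes "parabolic p"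
  shows "\<exists>\<sigma> \<omega>. par_frame p \<sigma> \<omega>"
proof -
  have pos: "\<exists>\<sigma> \<omega>. par_frame p \<sigma> \<omega>" if g: "p \<in> carrier SL2R" "trace p = 2" "p \<noteq> mat 1" for p
  proof -
    define a where "a = p$1$1"
    define b where "b = p$1$2"
    define c where "c = p$2$1"
    define m where "m = a - 1"
    have ad: "p$2$2 = 2 - a" using g by (simp add: trace_mat22 a_def)
    have det: "a * (2 - a) - b * c = 1" using g ad by (simp add: SL2R_iff a_def b_def c_def)
    then have mbc: "- (m * m) = b * c" by (simp add: m_def algebra_simps)
    have fin: "\<exists>\<sigma> \<omega>. par_frame p \<sigma> \<omega>" if "P \<in> carrier SL2R" "p ** P = P ** mat22 1 k 0 1" "k \<noteq> 0" for P k
    proof -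
      have "par_frame p (matrix_inv P) \<bar>k\<bar>"
        unfolding par_frame_def psl_eq_def using that conj_eq_iff[OF that(1)] by (auto simp: SL2R_inv abs_if)
      then show ?thesis by blast
    qed
    show ?thesis
    proof (cases "c = 0")
      case True
      then have "a = 1" using mbc by (simp add: m_def)
      moreover from this have "b \<noteq> 0" using True g(3) ad by (auto simp: a_def b_def c_def intro: mat22_eqI)
      ultimately show ?thesis using True ad
        by (intro fin[of "mat 1" b]) (auto simp: SL2R_one a_def b_def c_def intro!: mat22_eqI)
    next
      case False
      have "b = - (m * m / c)" using mbc False by (simp add: field_simps)
      then have "p ** mat22 (- m / c) 1 (- 1) 0 = mat22 (- m / c) 1 (- 1) 0 ** mat22 1 (- c) 0 1"
        using False by (intro mat22_eqI) (simp_all add: mult_entry ad a_def[symmetric] b_def[symmetric] c_def[symmetric] m_def divide_simps, (simp add: algebra_simps)+)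
      then show ?thesis using False by (intro fin[of "mat22 (- m / c) 1 (-1) 0" "- c"]) (auto simp: SL2R_iff)
    qed
  qed
  have p: "p \<in> carrier SL2R" "p \<noteq> mat 1" "- p \<noteq> mat 1"
    using assms unfolding parabolic_def psl_eq_def by (auto simp: minus_equation_iff[of p])
  have "trace p = 2 \<or> trace (- p) = 2" using assms by (auto simp: parabolic_def trace_mat22)
  then show ?thesis
  proof
    assume "trace p = 2" then show ?thesis using pos p by simp
  next
    assume "trace (- p) = 2"
    then obtain \<sigma> \<omega> where "par_frame (- p) \<sigma> \<omega>" using pos[of "- p"] p SL2R_minus by auto
    then show ?thesis unfolding par_frame_def by (auto simp: psl_eq_minus)
  qed
qed

lemma mob_conj:
  assumes "A \<in> carrier SL2R" "\<sigma> \<in> carrier SL2R" "x \<in> uhp" "psl_eq (\<sigma> ** A ** matrix_inv \<sigma>) D"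
  shows "mob \<sigma> (mob A x) = mob D (mob \<sigma> x)" "disp A x = disp D (mob \<sigma> x)"
proof -
  define B where "B = \<sigma> ** A ** matrix_inv \<sigma>"
  have B: "B \<in> carrier SL2R" using assms by (simp add: B_def SL2R_mult SL2R_inv)
  have BD: "mob D y = mob B y" "disp D y = disp B y" for y
    using assms(4) unfolding B_def[symmetric] psl_eq_def by auto
  have "\<sigma> ** A = B ** \<sigma>" unfolding B_def by (simp add: assms(2) SL2R_cancel)
  then show "mob \<sigma> (mob A x) = mob D (mob \<sigma> x)" using assms B unfolding BD by (metis mob_mult)
  have "A = matrix_inv \<sigma> ** B ** \<sigma>"
    unfolding B_def by (metis SL2R_cancel(1,4) assms(2) matrix_mul_assoc)
  then show "disp A x = disp D (mob \<sigma> x)" using disp_conj[OF B assms(2,3)] by (simp add: BD)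
qed

lemma trace_conj: "\<sigma> \<in> carrier SL2R \<Longrightarrow> trace (\<sigma> ** A ** matrix_inv \<sigma>) = trace A"
  by (metis SL2R_cancel(4) trace_mul_sym matrix_mul_assoc)

lemma trace_minus_mat22: "trace (- A :: mat22) = - trace A"
  by (simp add: trace_mat22)

text \<open>Frames are not unique, but the length is a function of |trace|, which makes the
  description in \<open>geod_length\<close> well defined. The number sqrt (trace^2 - 4) = 2 sinh
  (l/2) is also the least value of \<open>disp \<gamma>\<close>.\<close>

lemma hyp_frame_trace:
  assumes "hyp_frame \<gamma> \<sigma> l"
  shows "\<bar>trace \<gamma>\<bar> = 2 * cosh (l/2)" "0 < 2 * sinh (l/2)" "sqrt ((trace \<gamma>)\<^sup>2 - 4) = 2 * sinh (l/2)"
proof -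
  have "\<bar>trace (\<sigma> ** \<gamma> ** matrix_inv \<sigma>)\<bar> = 2 * cosh (l/2)"
    using assms unfolding hyp_frame_def psl_eq_def
    by (auto simp: trace_minus_mat22 trace_mat22 cosh_def abs_if exp_gt_zero add_pos_pos not_less)
       (smt (verit) exp_gt_zero)+
  then show t: "\<bar>trace \<gamma>\<bar> = 2 * cosh (l/2)" using assms trace_conj by (simp add: hyp_frame_def)
  show s: "0 < 2 * sinh (l/2)" using assms by (simp add: hyp_frame_def)
  have "(trace \<gamma>)\<^sup>2 - 4 = (2 * sinh (l/2))\<^sup>2"
  proof -
    have "(trace \<gamma>)\<^sup>2 = (2 * cosh (l/2))\<^sup>2" unfolding t[symmetric] by simp
    then show ?thesis by (simp add: power_mult_distrib cosh_square_eq)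
  qed
  then show "sqrt ((trace \<gamma>)\<^sup>2 - 4) = 2 * sinh (l/2)" using s by (simp only: real_sqrt_abs abs_of_pos)
qed

lemma geod_length_eq:
  assumes "hyp_frame \<gamma> \<sigma> l"
  shows "geod_length \<gamma> = l"
  unfolding geod_length_def
proof (rule the_equality)
  show "\<exists>\<sigma>. hyp_frame \<gamma> \<sigma> l" using assms by blast
  fix l' assume "\<exists>\<sigma>. hyp_frame \<gamma> \<sigma> l'"
  then obtain \<sigma>' where "hyp_frame \<gamma> \<sigma>' l'" by blast
  then have "sinh (l'/2) = sinh (l/2)" using hyp_frame_trace(3)[of \<gamma> \<sigma>' l'] hyp_frame_trace(3)[OF assms] by simp
  then show "l' = l" by (simp add: sinh_real_eq_iff)
qed

lemma hyp_frame_coords: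
  assumes "hyp_frame \<gamma> \<sigma> l" "\<gamma> \<in> carrier SL2R" "x \<in> uhp"
  shows "mob \<sigma> (mob \<gamma> x) = of_real (exp l) * mob \<sigma> x"
    "disp \<gamma> x = 2 * sinh (l/2) * cmod (mob \<sigma> x) / Im (mob \<sigma> x)"
proof -
  have f: "\<sigma> \<in> carrier SL2R" "psl_eq (\<sigma> ** \<gamma> ** matrix_inv \<sigma>) (mat22 (exp (l/2)) 0 0 (exp (-l/2)))" "0 < l"
    using assms by (auto simp: hyp_frame_def)
  have "exp (l/2) / exp (- l/2) = exp l" by (simp add: exp_minus field_simps flip: exp_add)
  then have "of_real (exp (l/2)) / of_real (exp (- l/2)) = (of_real (exp l) :: complex)"
    by (metis of_real_divide)
  then show "mob \<sigma> (mob \<gamma> x) = of_real (exp l) * mob \<sigma> x"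
    unfolding mob_conj(1)[OF assms(2) f(1) assms(3) f(2)] by (simp add: mob_def[of "mat22 _ _ _ _"] mult.commute[of _ "mob _ _"] flip: times_divide_eq_right)
  have "exp (- l/2) - exp (l/2) = - (2 * sinh (l/2))" by (simp add: sinh_field_def field_simps)
  then have "cmod (of_real (exp (- l/2) - exp (l/2))) = 2 * sinh (l/2)" using f(3) by (simp only: norm_of_real) simp
  then show "disp \<gamma> x = 2 * sinh (l/2) * cmod (mob \<sigma> x) / Im (mob \<sigma> x)"
    unfolding mob_conj(2)[OF assms(2) f(1) assms(3) f(2)]
    by (subst disp_def) (simp only: mat22_entry norm_mult of_real_0 mult_zero_left add_0 diff_zero)
qed

text \<open>A frame may turn p into a translation in either direction. The sign e records which, so
  that the coordinate \<open>\<tau>\<close> in \<open>parabolic_strip_coords\<close> can be oriented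
  to increase by 1 under p.\<close>

lemma par_frame_coords:
  assumes "par_frame p \<sigma> \<omega>" "p \<in> carrier SL2R"
  obtains e where "e \<in> {1, -1::real}"
    "\<And>x. x \<in> uhp \<Longrightarrow> mob \<sigma> (mob p x) = mob \<sigma> x + of_real (e * \<omega>)"
    "\<And>x. x \<in> uhp \<Longrightarrow> disp p x = \<omega> / Im (mob \<sigma> x)"
proof -
  have f: "\<sigma> \<in> carrier SL2R" "0 < \<omega>" using assms by (auto simp: par_frame_def)
  obtain e where e: "e \<in> {1, -1::real}" "psl_eq (\<sigma> ** p ** matrix_inv \<sigma>) (mat22 1 (e * \<omega>) 0 1)"
    using assms unfolding par_frame_def by fastforce
  have "\<bar>e * \<omega>\<bar> = \<omega>" using e f by auto
  then show thesis
    using e(1) that[OF e(1)] mob_conj[OF assms(2) f(1) _ e(2)]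
    by (auto simp: mob_def[of "mat22 _ _ _ _"] disp_def[of "mat22 _ _ _ _"])
qed

text \<open>
  The coordinates \<open>\<tau>\<close> (along the geodesic or horocycle, in units of one period) and \<open>side\<close> (of the
  geodesic) of a point.  Points of a strip \<open>a \<le> disp \<gamma> \<le> \<kappa> a\<close> on the same side whose \<open>\<tau>\<close> differ by at
  most \<open>1/a\<close> are close, with a bound independent of \<open>\<gamma>\<close>, even if its length tends to \<open>0\<close>.
\<close>

definition box_radius :: "real \<Rightarrow> real" where
  "box_radius \<kappa> = arcosh (1 + \<kappa>\<^sup>2 * (2 + (cosh \<kappa>)\<^sup>2))"

definition strip_coords :: "mat22 set \<Rightarrow> mat22 \<Rightarrow> (complex \<Rightarrow> bool) \<Rightarrow> (complex \<Rightarrow> real) \<Rightarrow> bool" where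
  "strip_coords \<Gamma> \<gamma> side \<tau> \<longleftrightarrow>
     (\<forall>n::int. \<exists>g\<in>\<Gamma>. g ** \<gamma> = \<gamma> ** g \<and>
        (\<forall>x\<in>uhp. \<tau> (mob g x) = \<tau> x + of_int n \<and> side (mob g x) = side x)) \<and>
     (\<forall>a>0. \<forall>\<kappa>\<ge>1. \<forall>x\<in>uhp. \<forall>y\<in>uhp. side x = side y \<longrightarrow>
        disp \<gamma> x \<in> {a..\<kappa> * a} \<longrightarrow> disp \<gamma> y \<in> {a..\<kappa> * a} \<longrightarrow> \<bar>\<tau> x - \<tau> y\<bar> \<le> 1 / a \<longrightarrow>
        hdist x y \<le> box_radius \<kappa>)"

lemma hdist_le_arcosh:
  assumes "x \<in> uhp" "y \<in> uhp" "(cmod (x - y))\<^sup>2 / (2 * Im x * Im y) \<le> B"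
  shows "hdist x y \<le> arcosh (1 + B)"
proof -
  have "0 \<le> (cmod (x - y))\<^sup>2 / (2 * Im x * Im y)" using assms(1,2) by (simp add: uhp_def)
  then have B0: "0 \<le> B" using assms(3) by linarith
  have "\<not> arcosh (1 + B) < hdist x y"
    unfolding hdist_def using assms B0 \<open>0 \<le> (cmod _)\<^sup>2 / _\<close> by (subst arcosh_less_iff_real) auto
  then show ?thesis by simp
qed

text \<open>The witness is the n-th power of \<open>\<gamma>\<close>, reached by induction over the
  integers in both directions.\<close>

lemma iterate_shift:
  assumes G: "subgroup \<Gamma> SL2R" and g: "\<gamma> \<in> \<Gamma>"
    and t: "\<And>x. x \<in> uhp \<Longrightarrow> \<tau> (mob \<gamma> x) = \<tau> x + (1::real) \<and> side (mob \<gamma> x) = (side x :: bool)"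
  shows "\<exists>h\<in>\<Gamma>. h ** \<gamma> = \<gamma> ** h \<and> (\<forall>x\<in>uhp. \<tau> (mob h x) = \<tau> x + of_int n \<and> side (mob h x) = side x)"
proof (induction n rule: int_induct[where k = 0])
  case base
  show ?case using subgroup_SL2R_D(2)[OF G] by (intro bexI[of _ "mat 1"]) (auto simp: matrix_mul_lid matrix_mul_rid)
next
  case (step1 i)
  then obtain h where h: "h \<in> \<Gamma>" "h ** \<gamma> = \<gamma> ** h" "\<forall>x\<in>uhp. \<tau> (mob h x) = \<tau> x + of_int i \<and> side (mob h x) = side x" by blast
  have c: "h \<in> carrier SL2R" "\<gamma> \<in> carrier SL2R" using h g subgroup_SL2R_D(1)[OF G] by auto
  show ?case
  proof (intro bexI[of _ "\<gamma> ** h"] conjI ballI)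
    show "\<gamma> ** h ** \<gamma> = \<gamma> ** (\<gamma> ** h)" using h(2) by (simp add: matrix_mul_assoc[symmetric])
    show "\<gamma> ** h \<in> \<Gamma>" using subgroup_SL2R_D(3)[OF G g h(1)] .
  qed (use h(3) t c mob_uhp[OF c(1)] in \<open>auto simp: mob_mult\<close>)
next
  case (step2 i)
  then obtain h where h: "h \<in> \<Gamma>" "h ** \<gamma> = \<gamma> ** h" "\<forall>x\<in>uhp. \<tau> (mob h x) = \<tau> x + of_int i \<and> side (mob h x) = side x" by blast
  have c: "h \<in> carrier SL2R" "\<gamma> \<in> carrier SL2R" using h g subgroup_SL2R_D(1)[OF G] by auto
  have tinv: "\<tau> (mob (matrix_inv \<gamma>) y) = \<tau> y - 1 \<and> side (mob (matrix_inv \<gamma>) y) = side y" if "y \<in> uhp" for y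
    using t[OF mob_uhp[OF SL2R_inv[OF c(2)] that]] by (simp add: mob_inv_cancel c that)
  show ?case
  proof (intro bexI[of _ "matrix_inv \<gamma> ** h"] conjI ballI)
    show "matrix_inv \<gamma> ** h ** \<gamma> = \<gamma> ** (matrix_inv \<gamma> ** h)"
      by (metis SL2R_cancel(1,2) c(2) h(2) matrix_mul_assoc)
    show "matrix_inv \<gamma> ** h \<in> \<Gamma>" using subgroup_SL2R_D(3,4)[OF G] g h(1) by blast
  qed (use h(3) tinv c mob_uhp[OF c(1)] in \<open>auto simp: mob_mult SL2R_inv\<close>)
qed

text \<open>Here s and c are sine and cosine of the polar angle. In logarithmic polar coordinates
  the moduli enter only through the difference of their logarithms, which is the coordinate along
  the axis.\<close>

lemma cmod_diff_polar:
  assumes x: "x \<in> uhp" and y: "y \<in> uhp"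
  defines "s \<equiv> Im x / cmod x" and "s' \<equiv> Im y / cmod y" and "c \<equiv> Re x / cmod x" and "c' \<equiv> Re y / cmod y"
  shows "(cmod (x - y))\<^sup>2 / (2 * Im x * Im y) = (cosh (ln (cmod x) - ln (cmod y)) - c * c' - s * s') / (s * s')"
    and "c\<^sup>2 + s\<^sup>2 = 1" "c'\<^sup>2 + s'\<^sup>2 = 1" "0 < s" "0 < s'"
proof -
  define r where "r = cmod x"
  define r' where "r' = cmod y"
  have nz: "x \<noteq> 0" "y \<noteq> 0" and Im: "0 < Im x" "0 < Im y" using x y by (auto simp: uhp_def)
  then have r: "0 < r" "0 < r'" by (simp_all add: r_def r'_def)
  show "0 < s" "0 < s'" using r Im by (simp_all add: s_def s'_def r_def r'_def)
  show "c\<^sup>2 + s\<^sup>2 = 1" "c'\<^sup>2 + s'\<^sup>2 = 1"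
    using nz unfolding c_def s_def c'_def s'_def
    by (simp_all add: power_divide cmod_power2 flip: add_divide_distrib) (simp_all add: complex_eq_iff sum_power2_eq_zero_iff)
  have "cosh (ln r - ln r') = (r / r' + r' / r) / 2"
    using r by (simp add: cosh_field_def exp_diff)
  then have ch: "r * r' * cosh (ln r - ln r') = (r\<^sup>2 + r'\<^sup>2) / 2"
    using r by (simp add: field_simps power2_eq_square)
  have "(cmod (x - y))\<^sup>2 = r\<^sup>2 + r'\<^sup>2 - 2 * (Re x * Re y) - 2 * (Im x * Im y)"
    unfolding r_def r'_def cmod_power2 by (simp add: power2_eq_square algebra_simps)
  also have "\<dots> = 2 * (r * r') * (cosh (ln r - ln r') - c * c' - s * s')"
    using ch r by (simp add: c_def c'_def s_def s'_def r_def[symmetric] r'_def[symmetric] right_diff_distrib)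
  finally have "(cmod (x - y))\<^sup>2 = 2 * (r * r') * (cosh (ln r - ln r') - c * c' - s * s')" .
  moreover have "2 * Im x * Im y = 2 * (r * r') * (s * s')"
    using r by (simp add: s_def s'_def r_def[symmetric] r'_def[symmetric])
  ultimately show "(cmod (x - y))\<^sup>2 / (2 * Im x * Im y) = (cosh (ln (cmod x) - ln (cmod y)) - c * c' - s * s') / (s * s')"
    using r unfolding r_def[symmetric] r'_def[symmetric] by simp
qed

text \<open>From cosh v - 1 = 2 sinh (v/2)^2 and sinh u <= u cosh u. The quadratic factor in v is
  needed to cancel the product of two small sines in \<open>hyperbolic_strip_coords\<close>.\<close>

lemma cosh_minus_one_le:
  assumes "\<bar>v\<bar> \<le> (k::real)"
  shows "cosh v - 1 \<le> v\<^sup>2 * (cosh k)\<^sup>2"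
proof -
  have sinh_le: "sinh u \<le> u * cosh u" if "0 \<le> u" for u :: real
  proof -
    have "sinh u - u * cosh u \<le> sinh 0 - 0 * cosh (0::real)"
    proof (rule DERIV_nonpos_imp_nonincreasing[OF that])
      fix x :: real assume x: "0 \<le> x"
      have "((\<lambda>u. sinh u - u * cosh u) has_real_derivative - (x * sinh x)) (at x)"
        by (auto intro!: derivative_eq_intros)
      then show "\<exists>y. ((\<lambda>u. sinh u - u * cosh u) has_real_derivative y) (at x) \<and> y \<le> 0"
        using x by (intro exI[of _ "- (x * sinh x)"]) simp
    qed
    then show ?thesis by simp
  qed
  define u where "u = \<bar>v\<bar> / 2"
  have u: "0 \<le> u" "u \<le> k" "v\<^sup>2 = (2 * u)\<^sup>2" using assms by (simp_all add: u_def)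
  have "cosh v = cosh (2 * u)" by (simp add: u_def abs_if)
  then have "cosh v - 1 = 2 * (sinh u)\<^sup>2" using cosh_sinh_half[of "2 * u"] by simp
  also have "\<dots> \<le> 2 * (u * cosh u)\<^sup>2"
    using sinh_le[OF u(1)] u(1) by (intro mult_left_mono power_mono) auto
  also have "\<dots> \<le> 2 * (u * cosh k)\<^sup>2"
    using u cosh_real_ge_1[of u] by (intro mult_left_mono power_mono) (auto simp: cosh_real_nonneg_le_iff intro: mult_nonneg_nonneg)
  also have "\<dots> \<le> v\<^sup>2 * (cosh k)\<^sup>2" by (simp add: u(3) power_mult_distrib)
  finally show ?thesis .
qed

lemma le_sinh:
  assumes "0 \<le> (u::real)"
  shows "u \<le> sinh u"
proof -
  have "u - sinh u \<le> 0 - sinh (0::real)"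
  proof (rule DERIV_nonpos_imp_nonincreasing[OF assms])
    fix x :: real
    have "((\<lambda>u. u - sinh u) has_real_derivative 1 - cosh x) (at x)"
      by (auto intro!: derivative_eq_intros)
    then show "\<exists>y. ((\<lambda>u. u - sinh u) has_real_derivative y) (at x) \<and> y \<le> 0"
      using cosh_real_ge_1[of x] by (intro exI[of _ "1 - cosh x"]) simp
  qed
  then show ?thesis by simp
qed

text \<open>The second conclusion does not ask for equal sides and pays for it with the term 4 /
  (trace^2 - 4), which grows as the length shrinks. It is meant for elements whose length stays
  bounded below, the first one for pinching elements.\<close>

lemma hyperbolic_strip_coords:
  assumes G: "subgroup \<Gamma> SL2R" and g: "\<gamma> \<in> \<Gamma>" and h: "hyperbolic \<gamma>"
  obtains side \<tau> where "strip_coords \<Gamma> \<gamma> side \<tau>"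
    "\<And>x y b. x \<in> uhp \<Longrightarrow> y \<in> uhp \<Longrightarrow> disp \<gamma> x \<le> b \<Longrightarrow> disp \<gamma> y \<le> b \<Longrightarrow> \<bar>\<tau> x - \<tau> y\<bar> \<le> 1 \<Longrightarrow>
       hdist x y \<le> arcosh (1 + b\<^sup>2 / 2 * (1 + 4 / ((trace \<gamma>)\<^sup>2 - 4)))"
proof -
  have gc: "\<gamma> \<in> carrier SL2R" using subgroup_SL2R_D(1)[OF G g] .
  obtain \<sigma> l where f: "hyp_frame \<gamma> \<sigma> l" using hyp_frame_exists[OF h] by blast
  have s: "\<sigma> \<in> carrier SL2R" "0 < l" using f by (auto simp: hyp_frame_def)
  define t where "t = 2 * sinh (l/2)"
  have t0: "0 < t" using hyp_frame_trace(2)[OF f] by (simp add: t_def)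
  define w where "w x = mob \<sigma> x" for x
  have wu: "w x \<in> uhp" if "x \<in> uhp" for x using mob_uhp[OF s(1) that] by (simp add: w_def)
  have wg: "w (mob \<gamma> x) = of_real (exp l) * w x" "disp \<gamma> x = t * cmod (w x) / Im (w x)" if "x \<in> uhp" for x
    using hyp_frame_coords[OF f gc that] by (simp_all add: w_def t_def)
  \<comment> \<open>\<open>\<gamma>\<close> multiplies w by exp l, so dividing the logarithm by l
    measures it in periods.\<close>
  define \<tau> where "\<tau> x = ln (cmod (w x)) / l" for x
  define side where "side x \<longleftrightarrow> Re (w x) \<ge> 0" for x
  define sn where "sn x = Im (w x) / cmod (w x)" for x
  define cs where "cs x = Re (w x) / cmod (w x)" for x
  have nz: "0 < cmod (w x)" if "x \<in> uhp" for x using wu[OF that] by (auto simp: uhp_def)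
  have dsn: "sn x = t / disp \<gamma> x" if "x \<in> uhp" for x
    using wg(2)[OF that] nz[OF that] wu[OF that] t0 by (simp add: sn_def uhp_def)
  have dt: "t \<le> disp \<gamma> x" if "x \<in> uhp" for x
  proof -
    have "Im (w x) \<le> cmod (w x)" using abs_Im_le_cmod[of "w x"] by linarith
    then have "1 \<le> cmod (w x) / Im (w x)" using wu[OF that] by (simp add: uhp_def)
    then show ?thesis using wg(2)[OF that] mult_left_mono[of 1 "cmod (w x) / Im (w x)" t] t0 by simp
  qed
  have lt: "l \<le> t"
  proof -
    have "l / 2 \<le> sinh (l / 2)" using s(2) by (intro le_sinh) simp
    then show ?thesis by (simp add: t_def)
  qed
  have ratio: "(cmod (w x - w y))\<^sup>2 / (2 * Im (w x) * Im (w y)) =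
      (cosh (l * (\<tau> x - \<tau> y)) - cs x * cs y - sn x * sn y) / (sn x * sn y)"
      and pol: "(cs x)\<^sup>2 + (sn x)\<^sup>2 = 1" "(cs y)\<^sup>2 + (sn y)\<^sup>2 = 1" "0 < sn x" "0 < sn y"
      and hd: "hdist x y = hdist (w x) (w y)"
      if "x \<in> uhp" "y \<in> uhp" for x y
  proof -
    have "l * (\<tau> x - \<tau> y) = ln (cmod (w x)) - ln (cmod (w y))"
      using s(2) by (simp add: \<tau>_def field_simps)
    then show "(cmod (w x - w y))\<^sup>2 / (2 * Im (w x) * Im (w y)) =
      (cosh (l * (\<tau> x - \<tau> y)) - cs x * cs y - sn x * sn y) / (sn x * sn y)"
      "(cs x)\<^sup>2 + (sn x)\<^sup>2 = 1" "(cs y)\<^sup>2 + (sn y)\<^sup>2 = 1" "0 < sn x" "0 < sn y"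
      using cmod_diff_polar[OF wu[OF that(1)] wu[OF that(2)]] by (simp_all add: cs_def sn_def)
    show "hdist x y = hdist (w x) (w y)" using hdist_mob[OF s(1) that] by (simp add: w_def)
  qed
  show thesis
  proof
    show "strip_coords \<Gamma> \<gamma> side \<tau>"
      unfolding strip_coords_def
    proof (intro conjI allI impI ballI)
      fix n :: int
      show "\<exists>g\<in>\<Gamma>. g ** \<gamma> = \<gamma> ** g \<and> (\<forall>x\<in>uhp. \<tau> (mob g x) = \<tau> x + of_int n \<and> side (mob g x) = side x)"
      proof (rule iterate_shift[OF G g])
        fix x assume x: "x \<in> uhp"
        show "\<tau> (mob \<gamma> x) = \<tau> x + 1 \<and> side (mob \<gamma> x) = side x"
          using nz[OF x] s(2) by (simp add: \<tau>_def side_def wg(1)[OF x] norm_mult ln_mult add_divide_distrib zero_le_mult_iff)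
      qed
    next
      fix a \<kappa> :: real and x y
      assume a: "0 < a" and k: "1 \<le> \<kappa>" and x: "x \<in> uhp" and y: "y \<in> uhp" and side: "side x = side y"
        and dx: "disp \<gamma> x \<in> {a..\<kappa> * a}" and dy: "disp \<gamma> y \<in> {a..\<kappa> * a}" and \<tau>: "\<bar>\<tau> x - \<tau> y\<bar> \<le> 1 / a"
      \<comment> \<open>The common scale of the estimate: both sines lie between q / \<kappa> and q,
        and since l <= t, the bound 1 / a on the difference of \<tau> becomes the bound q on the
        difference v of the logarithms. The powers of q cancel at the end, and with them the
        length.\<close>
      define q where "q = t / a"
      have q0: "0 < q" using a t0 by (simp add: q_def)
      have qk: "q \<le> \<kappa>" using dt[OF x] dx a by (simp add: q_def field_simps)
      have snb: "q / \<kappa> \<le> sn u \<and> sn u \<le> q" if "u \<in> uhp" "disp \<gamma> u \<in> {a..\<kappa> * a}" for u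
        unfolding dsn[OF that(1)] q_def using that(2) a k t0 by (auto simp: divide_simps mult.commute mult_le_cancel_left)
      define v where "v = l * (\<tau> x - \<tau> y)"
      have vq: "\<bar>v\<bar> \<le> q"
      proof -
        have "\<bar>v\<bar> \<le> l * (1 / a)" unfolding v_def using \<tau> s(2) by (simp add: abs_mult del: times_divide_eq_right)
        also have "\<dots> \<le> q" using lt a by (simp add: q_def divide_right_mono)
        finally show ?thesis .
      qed
      have "cosh v - 1 \<le> v\<^sup>2 * (cosh \<kappa>)\<^sup>2" using vq qk by (intro cosh_minus_one_le) simp
      also have "\<dots> \<le> q\<^sup>2 * (cosh \<kappa>)\<^sup>2" using vq q0 by (intro mult_right_mono) (auto simp: abs_le_square_iff[symmetric])
      finally have cv: "cosh v - 1 \<le> q\<^sup>2 * (cosh \<kappa>)\<^sup>2" .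
      \<comment> \<open>Here the sides enter: the cosines do not have opposite signs, which makes 1
        - cs x * cs y of order q^2 instead of order 1.\<close>
      have cc0: "0 \<le> cs x * cs y" 
      proof -
        have "0 \<le> Re (w x) * Re (w y)"
          using side unfolding side_def by (cases "0 \<le> Re (w x)") (auto simp: mult_nonneg_nonneg mult_nonpos_nonpos)
        then show ?thesis by (simp add: cs_def)
      qed
      note p = pol[OF x y]
      have cc1: "cs x * cs y \<le> 1"
        using zero_le_power2[of "cs x - cs y"] p zero_le_power2[of "sn x"] zero_le_power2[of "sn y"] unfolding power2_diff by linarith
      have "1 - cs x * cs y \<le> 1 - (cs x * cs y) * (cs x * cs y)"
        using mult_left_le[OF cc1 cc0] by simp
      also have "\<dots> = 1 - (1 - (sn x)\<^sup>2) * (1 - (sn y)\<^sup>2)" using p(1,2) by (simp add: power2_eq_square algebra_simps) algebra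
      also have "\<dots> \<le> (sn x)\<^sup>2 + (sn y)\<^sup>2" by (simp add: algebra_simps)
      also have "\<dots> \<le> q\<^sup>2 + q\<^sup>2" using snb[OF x dx] snb[OF y dy] p by (intro add_mono power_mono) auto
      finally have cc: "1 - cs x * cs y \<le> 2 * q\<^sup>2" by simp
      have ss: "q\<^sup>2 / \<kappa>\<^sup>2 \<le> sn x * sn y"
      proof -
        have "q / \<kappa> * (q / \<kappa>) \<le> sn x * sn y" using snb[OF x dx] snb[OF y dy] q0 k p by (intro mult_mono) auto
        then show ?thesis by (simp add: power2_eq_square)
      qed
      have num: "cosh v - cs x * cs y - sn x * sn y \<le> q\<^sup>2 * (2 + (cosh \<kappa>)\<^sup>2)"
        using cv cc mult_pos_pos[OF p(3,4)] by (simp add: algebra_simps)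
      \<comment> \<open>Numerator and denominator are bounded by multiples of q^2; the quotient of
        the two multiples is the constant in \<open>box_radius\<close>.\<close>
      have "(cosh v - cs x * cs y - sn x * sn y) / (sn x * sn y) \<le> q\<^sup>2 * (2 + (cosh \<kappa>)\<^sup>2) / (q\<^sup>2 / \<kappa>\<^sup>2)"
        using num ss q0 k by (intro frac_le) auto
      also have "\<dots> = \<kappa>\<^sup>2 * (2 + (cosh \<kappa>)\<^sup>2)" using q0 k by simp
      finally show "hdist x y \<le> box_radius \<kappa>"
        unfolding box_radius_def hd[OF x y] using ratio[OF x y]
        by (intro hdist_le_arcosh wu x y) (simp add: v_def)
    qed
  next
    fix x y b assume x: "x \<in> uhp" and y: "y \<in> uhp" and b: "disp \<gamma> x \<le> b" "disp \<gamma> y \<le> b" and \<tau>: "\<bar>\<tau> x - \<tau> y\<bar> \<le> 1"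
    have b0: "0 < b" using dt[OF x] b t0 by linarith
    have snb: "t / b \<le> sn u" if "u \<in> uhp" "disp \<gamma> u \<le> b" for u
      unfolding dsn[OF that(1)] using that(2) dt[OF that(1)] t0 by (intro divide_left_mono) auto
    have ss: "(t / b)\<^sup>2 \<le> sn x * sn y"
      unfolding power2_eq_square using snb x y b t0 b0 by (intro mult_mono) (auto intro: order_trans[OF _ snb])
    note p = pol[OF x y]
    \<comment> \<open>Without a condition on the sides only this trivial bound is available; it
      produces the summand 4 in t^2 + 4 below.\<close>
    have ncc: "- (cs x * cs y) \<le> 1"
      using zero_le_power2[of "cs x + cs y"] p zero_le_power2[of "sn x"] zero_le_power2[of "sn y"] unfolding power2_sum by linarith
    have "\<bar>l * (\<tau> x - \<tau> y)\<bar> \<le> \<bar>l\<bar>" using \<tau> s(2) by (simp add: abs_mult)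
    then have "cosh (l * (\<tau> x - \<tau> y)) \<le> cosh l"
      using s(2) cosh_real_nonneg_le_iff[of "\<bar>l * (\<tau> x - \<tau> y)\<bar>" l] by (simp add: cosh_real_abs)
    also have "cosh l = 1 + t\<^sup>2 / 2" using cosh_sinh_half[of l] by (simp add: t_def power_mult_distrib)
    finally have num: "cosh (l * (\<tau> x - \<tau> y)) - cs x * cs y - sn x * sn y \<le> (t\<^sup>2 + 4) / 2"
      using ncc mult_pos_pos[OF p(3,4)] by (simp add: field_simps)
    have "(cosh (l * (\<tau> x - \<tau> y)) - cs x * cs y - sn x * sn y) / (sn x * sn y) \<le> (t\<^sup>2 + 4) / 2 / (t / b)\<^sup>2"
      using num ss t0 b0 by (intro frac_le) auto
    also have "\<dots> = b\<^sup>2 / 2 * (1 + 4 / t\<^sup>2)" using t0 b0 by (simp add: field_simps power2_eq_square)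
    also have "t\<^sup>2 = (trace \<gamma>)\<^sup>2 - 4"
    proof -
      have "sqrt ((trace \<gamma>)\<^sup>2 - 4) = t" using hyp_frame_trace(3)[OF f] by (simp add: t_def)
      then show ?thesis using t0 by (metis less_le real_sqrt_gt_0_iff real_sqrt_pow2)
    qed
    finally show "hdist x y \<le> arcosh (1 + b\<^sup>2 / 2 * (1 + 4 / ((trace \<gamma>)\<^sup>2 - 4)))"
      unfolding hd[OF x y] using ratio[OF x y] by (intro hdist_le_arcosh wu x y) simp
  qed
qed

lemma parabolic_strip_coords:
  assumes G: "subgroup \<Gamma> SL2R" and g: "p \<in> \<Gamma>" and h: "parabolic p"
  obtains \<tau> where "strip_coords \<Gamma> p (\<lambda>_. True) \<tau>"
proof -
  have gc: "p \<in> carrier SL2R" using subgroup_SL2R_D(1)[OF G g] .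
  obtain \<sigma> \<omega> where f: "par_frame p \<sigma> \<omega>" using par_frame_exists[OF h] by blast
  have s: "\<sigma> \<in> carrier SL2R" "0 < \<omega>" using f by (auto simp: par_frame_def)
  define w where "w x = mob \<sigma> x" for x
  obtain e where e: "e \<in> {1, -1::real}" and
    wg: "\<And>x. x \<in> uhp \<Longrightarrow> w (mob p x) = w x + of_real (e * \<omega>)" "\<And>x. x \<in> uhp \<Longrightarrow> disp p x = \<omega> / Im (w x)"
    using par_frame_coords[OF f gc] unfolding w_def by metis
  have wu: "w x \<in> uhp" if "x \<in> uhp" for x using mob_uhp[OF s(1) that] by (simp add: w_def)
  define \<tau> where "\<tau> x = e * Re (w x) / \<omega>" for x
  have ee: "e * e = 1" "\<bar>e\<bar> = 1" using e by auto
  show thesis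
  proof
    show "strip_coords \<Gamma> p (\<lambda>_. True) \<tau>"
      unfolding strip_coords_def
    proof (intro conjI allI impI ballI)
      fix n :: int
      show "\<exists>g\<in>\<Gamma>. g ** p = p ** g \<and> (\<forall>x\<in>uhp. \<tau> (mob g x) = \<tau> x + of_int n \<and> True = True)"
      proof (rule iterate_shift[OF G g])
        fix x assume x: "x \<in> uhp"
        have "e * (Re (w x) + e * \<omega>) = e * Re (w x) + e * e * \<omega>" by (simp add: algebra_simps)
        then show "\<tau> (mob p x) = \<tau> x + 1 \<and> True = True"
          using s(2) ee(1) by (simp add: \<tau>_def wg(1)[OF x] add_divide_distrib)
      qed
    next
      fix a \<kappa> :: real and x y
      assume a: "0 < a" and k: "1 \<le> \<kappa>" and x: "x \<in> uhp" and y: "y \<in> uhp"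
        and dx: "disp p x \<in> {a..\<kappa> * a}" and dy: "disp p y \<in> {a..\<kappa> * a}" and \<tau>: "\<bar>\<tau> x - \<tau> y\<bar> \<le> 1 / a"
      \<comment> \<open>Heights lie between q / \<kappa> and q, and the horizontal distance is at
        most q, so the width cancels just as the length does in the hyperbolic case.\<close>
      define q where "q = \<omega> / a"
      have q0: "0 < q" using a s by (simp add: q_def)
      have Imb: "q / \<kappa> \<le> Im (w u) \<and> Im (w u) \<le> q" if "u \<in> uhp" "disp p u \<in> {a..\<kappa> * a}" for u
        using that(2) wu[OF that(1)] a k s(2) unfolding wg(2)[OF that(1)] q_def
        by (auto simp: uhp_def field_simps)
      have re: "\<bar>Re (w x) - Re (w y)\<bar> \<le> q"
      proof -
        have "\<tau> x - \<tau> y = e * (Re (w x) - Re (w y)) / \<omega>" by (simp add: \<tau>_def right_diff_distrib diff_divide_distrib)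
        then have "\<bar>\<tau> x - \<tau> y\<bar> = \<bar>Re (w x) - Re (w y)\<bar> / \<omega>" using ee s(2) by (simp add: abs_mult)
        then have "\<bar>Re (w x) - Re (w y)\<bar> = \<omega> * \<bar>\<tau> x - \<tau> y\<bar>" using s(2) by simp
        also have "\<dots> \<le> \<omega> * (1 / a)" using \<tau> s(2) by (intro mult_left_mono) auto
        finally show ?thesis by (simp add: q_def)
      qed
      have "\<bar>Im (w x) - Im (w y)\<bar> \<le> q" using Imb[OF x dx] Imb[OF y dy] q0 k
        by (smt (verit) divide_pos_pos)
      then have num: "(cmod (w x - w y))\<^sup>2 \<le> q\<^sup>2 + q\<^sup>2"
        unfolding cmod_power2 using re q0 by (intro add_mono) (auto simp: abs_le_square_iff[symmetric])
      have den: "2 * (q / \<kappa>)\<^sup>2 \<le> 2 * Im (w x) * Im (w y)"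
      proof -
        have "q / \<kappa> * (q / \<kappa>) \<le> Im (w x) * Im (w y)"
          using Imb[OF x dx] Imb[OF y dy] q0 k wu[OF x] by (intro mult_mono) (auto simp: uhp_def)
        then show ?thesis by (simp add: power2_eq_square)
      qed
      have "(cmod (w x - w y))\<^sup>2 / (2 * Im (w x) * Im (w y)) \<le> (q\<^sup>2 + q\<^sup>2) / (2 * (q / \<kappa>)\<^sup>2)"
        using num den q0 k by (intro frac_le) auto
      also have "\<dots> = \<kappa>\<^sup>2 * 1" using q0 k by (simp add: power_divide)
      \<comment> \<open>Weakened so that hyperbolic and parabolic elements share one radius.\<close>
      also have "\<dots> \<le> \<kappa>\<^sup>2 * (2 + (cosh \<kappa>)\<^sup>2)" by (intro mult_left_mono) auto
      finally have "hdist (w x) (w y) \<le> box_radius \<kappa>"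
        unfolding box_radius_def by (intro hdist_le_arcosh wu x y)
      then show "hdist x y \<le> box_radius \<kappa>" using hdist_mob[OF s(1) x y] by (simp add: w_def)
    qed
  qed
qed

section \<open>Eisenstein series as sums over conjugacy classes\<close>

text \<open>The inverse stands on the left, so that the displacement of \<open>cj k h\<close> at z
  is that of h at k z, and so that conjugates of an element correspond to the right cosets of its
  stabilizer, over which the series are summed.\<close>

definition cj :: "mat22 \<Rightarrow> mat22 \<Rightarrow> mat22" where
  "cj k h = matrix_inv k ** h ** k"

text \<open>The four matrices that represent an element of PSL(2,R) or its inverse.
  \<open>disp\<close> does not distinguish them, and \<open>corresponds\<close> determines its
  partner only up to these changes and conjugation.\<close>

definition quad :: "mat22 \<Rightarrow> mat22 set" where
  "quad h = {h, - h, matrix_inv h, - matrix_inv h}"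

definition cls :: "mat22 set \<Rightarrow> mat22 \<Rightarrow> mat22 set set" where
  "cls \<Gamma> \<gamma> = (\<lambda>\<eta>. quad (cj \<eta> \<gamma>)) ` \<Gamma>"

text \<open>On the classes that occur the choice is harmless: by \<open>val_quad\<close> every
  representative gives the same value.\<close>

definition val :: "mat22 set \<Rightarrow> complex \<Rightarrow> real" where
  "val X z = disp (SOME h. h \<in> X) z"

definition esum :: "mat22 set set \<Rightarrow> complex \<Rightarrow> complex \<Rightarrow> complex" where
  "esum I s z = (\<Sum>\<^sub>\<infinity>X\<in>I. of_real (val X z) powr (- s))"

lemma cj_carrier: "k \<in> carrier SL2R \<Longrightarrow> h \<in> carrier SL2R \<Longrightarrow> cj k h \<in> carrier SL2R"
  by (simp add: cj_def SL2R_mult SL2R_inv)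

lemma cj_mult: "k \<in> carrier SL2R \<Longrightarrow> m \<in> carrier SL2R \<Longrightarrow> cj (k ** m) h = cj m (cj k h)"
  by (simp add: cj_def matrix_inv_mult matrix_mul_assoc)

lemma cj_one [simp]: "cj (mat 1) h = h"
  by (simp add: cj_def SL2R_inv_unique[OF SL2R_one] matrix_mul_lid matrix_mul_rid)

lemma cj_inv_cancel:
  "k \<in> carrier SL2R \<Longrightarrow> cj k (cj (matrix_inv k) h) = h"
  "k \<in> carrier SL2R \<Longrightarrow> cj (matrix_inv k) (cj k h) = h"
  using cj_mult[of "matrix_inv k" k h] cj_mult[of k "matrix_inv k" h]
  by (simp_all add: SL2R_inv SL2R_mult_matrix_inv)

lemma cj_minus: "cj k (- h) = - cj k h"
  by (simp add: cj_def)

lemma cj_inverse: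
  assumes "k \<in> carrier SL2R" "h \<in> carrier SL2R"
  shows "cj k (matrix_inv h) = matrix_inv (cj k h)"
  unfolding cj_def using assms
  by (simp add: matrix_inv_mult SL2R_mult SL2R_inv matrix_inv_inv matrix_mul_assoc)

lemma cj_commute: "k \<in> carrier SL2R \<Longrightarrow> k ** h = h ** k \<Longrightarrow> cj k h = h"
  unfolding cj_def by (metis SL2R_cancel(1) matrix_mul_assoc)

lemma trace_cj: "k \<in> carrier SL2R \<Longrightarrow> trace (cj k h) = trace h"
  using trace_conj[OF SL2R_inv, of k h] by (simp add: cj_def matrix_inv_inv)

lemma disp_cj: "h \<in> carrier SL2R \<Longrightarrow> k \<in> carrier SL2R \<Longrightarrow> z \<in> uhp \<Longrightarrow> disp (cj k h) z = disp h (mob k z)"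
  by (simp add: cj_def disp_conj)

lemma cj_subgroup: "subgroup \<Gamma> SL2R \<Longrightarrow> k \<in> \<Gamma> \<Longrightarrow> h \<in> \<Gamma> \<Longrightarrow> cj k h \<in> \<Gamma>"
  by (simp add: cj_def subgroup_SL2R_D)

lemma quad_self [simp]: "h \<in> quad h"
  by (simp add: quad_def)

lemma quad_eq: "h \<in> carrier SL2R \<Longrightarrow> h' \<in> quad h \<Longrightarrow> quad h' = quad h"
  by (auto simp: quad_def matrix_inv_minus matrix_inv_inv SL2R_inv)

lemma quad_cj: "k \<in> carrier SL2R \<Longrightarrow> h \<in> carrier SL2R \<Longrightarrow> h' \<in> quad h \<Longrightarrow> cj k h' \<in> quad (cj k h)"
  by (auto simp: quad_def cj_minus cj_inverse)

lemma quad_cj_eq: "k \<in> carrier SL2R \<Longrightarrow> h \<in> carrier SL2R \<Longrightarrow> h' \<in> quad h \<Longrightarrow> quad (cj k h') = quad (cj k h)"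
  using quad_eq[OF cj_carrier quad_cj] by blast

lemma disp_quad: "h \<in> carrier SL2R \<Longrightarrow> h' \<in> quad h \<Longrightarrow> disp h' z = disp h z"
  by (auto simp: quad_def)

lemma val_quad: "h \<in> carrier SL2R \<Longrightarrow> val (quad h) z = disp h z"
proof -
  assume h: "h \<in> carrier SL2R"
  have "(SOME h'. h' \<in> quad h) \<in> quad h" by (rule someI[of _ h]) simp
  then show ?thesis unfolding val_def by (rule disp_quad[OF h])
qed

lemma cls_memD:
  assumes "subgroup \<Gamma> SL2R" "\<gamma> \<in> \<Gamma>" "quad h \<in> cls \<Gamma> \<gamma>"
  shows "\<exists>\<eta>\<in>\<Gamma>. h \<in> quad (cj \<eta> \<gamma>)"
  using assms unfolding cls_def by (metis (no_types, lifting) imageE quad_self)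

lemma strip_coordsD:
  assumes "strip_coords \<Gamma> \<gamma> side \<tau>"
  shows "\<exists>g\<in>\<Gamma>. g ** \<gamma> = \<gamma> ** g \<and> (\<forall>x\<in>uhp. \<tau> (mob g x) = \<tau> x + of_int n \<and> side (mob g x) = side x)"
    and "0 < a \<Longrightarrow> 1 \<le> \<kappa> \<Longrightarrow> x \<in> uhp \<Longrightarrow> y \<in> uhp \<Longrightarrow> side x = side y \<Longrightarrow>
      disp \<gamma> x \<in> {a..\<kappa> * a} \<Longrightarrow> disp \<gamma> y \<in> {a..\<kappa> * a} \<Longrightarrow> \<bar>\<tau> x - \<tau> y\<bar> \<le> 1 / a \<Longrightarrow> hdist x y \<le> box_radius \<kappa>"
  using assms unfolding strip_coords_def by simp_all

text \<open>
  Modulo the centralizer of \<open>\<gamma>\<close> the points \<open>\<eta> x\<close> lie in one period of the strip, which is cut into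
  \<open>2 N\<close> boxes of bounded diameter; the points in one box differ by boundedly many group elements.
\<close>

lemma cls_count:
  assumes sc: "strip_coords \<Gamma> \<gamma> side \<tau>" and G: "subgroup \<Gamma> SL2R" and g: "\<gamma> \<in> \<Gamma>" and x: "x \<in> uhp"
    and fin: "finite {h \<in> \<Gamma>. hdist x (mob h x) \<le> box_radius 2}"
    and m: "card {h \<in> \<Gamma>. hdist x (mob h x) \<le> box_radius 2} \<le> m" and N: "1 \<le> (N::nat)"
  defines "A \<equiv> {X \<in> cls \<Gamma> \<gamma>. val X x \<in> {real N..2 * real N}}"
  shows "finite A \<and> card A \<le> 2 * N * m"
proof -
  note sub = subgroup_SL2R_D[OF G]
  have gc: "\<gamma> \<in> carrier SL2R" using sub g by blast
  \<comment> \<open>A centralizing element with an integral shift moves the orbit point into the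
    period from 0 to 1 without changing the conjugate.\<close>
  have "\<exists>\<eta>\<in>\<Gamma>. X = quad (cj \<eta> \<gamma>) \<and> 0 \<le> \<tau> (mob \<eta> x) \<and> \<tau> (mob \<eta> x) < 1" if X: "X \<in> A" for X
  proof -
    obtain \<eta> where e: "\<eta> \<in> \<Gamma>" "X = quad (cj \<eta> \<gamma>)" using X by (auto simp: A_def cls_def)
    note strip_coordsD(1)[OF sc, of "- \<lfloor>\<tau> (mob \<eta> x)\<rfloor>"]
    then obtain h where h: "h \<in> \<Gamma>" "h ** \<gamma> = \<gamma> ** h"
      "\<And>y. y \<in> uhp \<Longrightarrow> \<tau> (mob h y) = \<tau> y + of_int (- \<lfloor>\<tau> (mob \<eta> x)\<rfloor>)" by meson
    have c: "h \<in> carrier SL2R" "\<eta> \<in> carrier SL2R" using h e sub by auto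
    have sh: "\<tau> (mob h (mob \<eta> x)) = \<tau> (mob \<eta> x) + of_int (- \<lfloor>\<tau> (mob \<eta> x)\<rfloor>)"
      by (rule h(3)[OF mob_uhp[OF c(2) x]])
    show ?thesis
    proof (intro bexI[of _ "h ** \<eta>"] conjI)
      show "X = quad (cj (h ** \<eta>) \<gamma>)" using c h(2) by (simp add: cj_mult cj_commute e(2))
      show "0 \<le> \<tau> (mob (h ** \<eta>) x)" "\<tau> (mob (h ** \<eta>) x) < 1"
        using sh by (simp_all add: mob_mult c x) linarith+
      show "h ** \<eta> \<in> \<Gamma>" using sub h e by blast
    qed
  qed
  then obtain \<eta> where e: "\<And>X. X \<in> A \<Longrightarrow> \<eta> X \<in> \<Gamma>" "\<And>X. X \<in> A \<Longrightarrow> X = quad (cj (\<eta> X) \<gamma>)"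
    "\<And>X. X \<in> A \<Longrightarrow> 0 \<le> \<tau> (mob (\<eta> X) x)" "\<And>X. X \<in> A \<Longrightarrow> \<tau> (mob (\<eta> X) x) < 1" by metis
  have ec: "\<eta> X \<in> carrier SL2R" if "X \<in> A" for X using e(1)[OF that] sub by blast
  define H where "H = {h \<in> \<Gamma>. hdist x (mob h x) \<le> box_radius 2}"
  \<comment> \<open>The box of X: one of two sides and one of N subintervals of the period, which
    accounts for the factor 2 * N.\<close>
  define b where "b X = (side (mob (\<eta> X) x), nat \<lfloor>real N * \<tau> (mob (\<eta> X) x)\<rfloor>)" for X
  define B where "B \<beta> = {X \<in> A. b X = \<beta>}" for \<beta>
  have box: "finite (B \<beta>) \<and> card (B \<beta>) \<le> m" for \<beta>
  proof (cases "B \<beta> = {}")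
    case False
    then obtain X0 where X0: "X0 \<in> B \<beta>" by blast
    have "B \<beta> \<subseteq> (\<lambda>h. quad (cj h (cj (\<eta> X0) \<gamma>))) ` H"
    proof
      fix X assume X: "X \<in> B \<beta>"
      have XA: "X \<in> A" "X0 \<in> A" "b X = b X0" using X X0 by (auto simp: B_def)
      \<comment> \<open>The quotient of two representatives in one box moves x by at most
        \<open>box_radius 2\<close>; the ratio is 2 because values lie between N and 2 N. As X is
        recovered from this quotient and X0, a box holds at most m classes.\<close>
      define h where "h = matrix_inv (\<eta> X0) ** \<eta> X"
      have hG: "h \<in> \<Gamma>" using sub e(1) XA by (simp add: h_def)
      have dN: "disp \<gamma> (mob (\<eta> Y) x) \<in> {real N..2 * real N}" if "Y \<in> A" for Y
      proof -
        have "val Y x = disp \<gamma> (mob (\<eta> Y) x)"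
          using e(2)[OF that] by (metis val_quad cj_carrier ec[OF that] gc disp_cj x)
        then show ?thesis using that by (simp add: A_def)
      qed
      have "\<lfloor>real N * \<tau> (mob (\<eta> X) x)\<rfloor> = \<lfloor>real N * \<tau> (mob (\<eta> X0) x)\<rfloor>"
        using XA(3) e(3)[OF XA(1)] e(3)[OF XA(2)] by (simp add: b_def eq_nat_nat_iff)
      then have "\<bar>real N * \<tau> (mob (\<eta> X) x) - real N * \<tau> (mob (\<eta> X0) x)\<bar> \<le> 1" by linarith
      then have "real N * \<bar>\<tau> (mob (\<eta> X) x) - \<tau> (mob (\<eta> X0) x)\<bar> \<le> 1"
        by (simp add: abs_mult flip: right_diff_distrib)
      then have "\<bar>\<tau> (mob (\<eta> X0) x) - \<tau> (mob (\<eta> X) x)\<bar> \<le> 1 / real N"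
        using N by (simp add: field_simps abs_minus_commute)
      moreover have "side (mob (\<eta> X0) x) = side (mob (\<eta> X) x)" using XA(3) by (simp add: b_def)
      ultimately have "hdist (mob (\<eta> X0) x) (mob (\<eta> X) x) \<le> box_radius 2"
        using N dN[OF XA(1)] dN[OF XA(2)] mob_uhp[OF ec x] XA
        by (intro strip_coordsD(2)[OF sc, of "real N" 2]) auto
      then have "h \<in> H"
        using hG by (simp add: H_def h_def mob_mult SL2R_inv ec XA x mob_uhp hdist_commute[of x] hdist_mob_inv)
          (simp add: hdist_commute)
      moreover have "X = quad (cj h (cj (\<eta> X0) \<gamma>))"
        using e(2)[OF XA(1)] by (simp add: h_def SL2R_cancel ec XA SL2R_mult SL2R_inv flip: cj_mult)
      ultimately show "X \<in> (\<lambda>h. quad (cj h (cj (\<eta> X0) \<gamma>))) ` H" by blast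
    qed
    moreover have "finite H" "card H \<le> m" using fin m by (simp_all add: H_def)
    ultimately show ?thesis
      by (meson card_image_le card_mono finite_imageI finite_subset le_trans)
  qed simp
  have AU: "A = (\<Union>\<beta>\<in>UNIV \<times> {..<N}. B \<beta>)"
  proof -
    have "b X \<in> UNIV \<times> {..<N}" if "X \<in> A" for X
    proof -
      have "real N * \<tau> (mob (\<eta> X) x) < real N" using e(4)[OF that] N by simp
      then have "\<lfloor>real N * \<tau> (mob (\<eta> X) x)\<rfloor> < int N" by (simp add: floor_less_iff)
      then show ?thesis using N by (simp add: b_def nat_less_iff)
    qed
    then show ?thesis by (auto simp: B_def)
  qed
  have "card A \<le> (\<Sum>\<beta>\<in>(UNIV :: bool set) \<times> {..<N}. card (B \<beta>))"
    unfolding AU by (rule card_UN_le) simp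
  also have "\<dots> \<le> (\<Sum>\<beta>\<in>(UNIV :: bool set) \<times> {..<N}. m)" using box by (intro sum_mono) auto
  also have "\<dots> = 2 * N * m" by simp
  finally show ?thesis using box by (auto simp: AU)
qed

text \<open>The shell of values between 2^k and 2^(k+1) has at most C 2^k members, each contributing
  at most 2^(-k(1+\<delta>)). The products C 2^(-\<delta> k) form a geometric series starting at
  k0.\<close>

lemma dyadic_tail:
  fixes v :: "'a \<Rightarrow> real"
  assumes cnt: "\<And>k. k0 \<le> k \<Longrightarrow> card {X \<in> A. v X \<in> {2 ^ k..2 * 2 ^ k}} \<le> C * 2 ^ k"
    and F: "finite F" "F \<subseteq> A" "\<And>X. X \<in> F \<Longrightarrow> 2 ^ k0 \<le> v X" and \<delta>: "0 < \<delta>"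
    and fin: "\<And>k. k0 \<le> k \<Longrightarrow> finite {X \<in> A. v X \<in> {2 ^ k..2 * 2 ^ k}}"
  shows "(\<Sum>X\<in>F. v X powr - (1 + \<delta>)) \<le> real C * (2 powr - \<delta>) ^ k0 / (1 - 2 powr - \<delta>)"
proof -
  define \<kappa> where "\<kappa> X = nat \<lfloor>log 2 (v X)\<rfloor>" for X
  define r where "r = (2::real) powr - \<delta>"
  have r: "0 < r" "r < 1" using \<delta> by (auto simp: r_def powr_less_one)
  have k: "k0 \<le> \<kappa> X \<and> v X \<in> {2 ^ \<kappa> X..2 * 2 ^ \<kappa> X}" if "X \<in> F" for X
  proof -
    have "(1::real) \<le> 2 ^ k0" by simp
    then have v1: "1 \<le> v X" using F(3)[OF that] by linarith
    have "log 2 (2 ^ k0) \<le> log 2 (v X)" using F(3)[OF that] v1 by (subst log_le_cancel_iff) auto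
    then have lk: "real k0 \<le> log 2 (v X)" by (simp add: log_nat_power)
    have f: "real (\<kappa> X) \<le> log 2 (v X)" "log 2 (v X) < real (\<kappa> X) + 1"
    proof -
      have "real (\<kappa> X) = of_int \<lfloor>log 2 (v X)\<rfloor>" using lk by (simp add: \<kappa>_def)
      then show "real (\<kappa> X) \<le> log 2 (v X)" "log 2 (v X) < real (\<kappa> X) + 1" by linarith+
    qed
    have v: "v X = 2 powr log 2 (v X)" using v1 by simp
    have "2 powr real (\<kappa> X) \<le> v X" "v X \<le> 2 powr (real (\<kappa> X) + 1)"
      using f by (subst v, intro powr_mono; simp)+
    moreover have "k0 \<le> \<kappa> X" using lk f by (simp add: \<kappa>_def le_nat_floor)
    ultimately show ?thesis by (simp add: powr_realpow powr_add)
  qed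
  define K where "K = \<kappa> ` F"
  have "(\<Sum>X\<in>F. v X powr - (1 + \<delta>)) = (\<Sum>k\<in>K. \<Sum>X\<in>{X \<in> F. \<kappa> X = k}. v X powr - (1 + \<delta>))"
    using F(1) by (intro sum.group[symmetric]) (auto simp: K_def)
  also have "\<dots> \<le> (\<Sum>k\<in>K. real C * r ^ k)"
  proof (rule sum_mono)
    fix k assume kK: "k \<in> K"
    then have k0: "k0 \<le> k" using k by (auto simp: K_def)
    have "(\<Sum>X\<in>{X \<in> F. \<kappa> X = k}. v X powr - (1 + \<delta>)) \<le> (\<Sum>X\<in>{X \<in> F. \<kappa> X = k}. (2 ^ k) powr - (1 + \<delta>))"
      using k \<delta> by (intro sum_mono powr_mono2') auto
    also have "\<dots> = real (card {X \<in> F. \<kappa> X = k}) * (2 ^ k) powr - (1 + \<delta>)" by simp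
    also have "\<dots> \<le> real (C * 2 ^ k) * (2 ^ k) powr - (1 + \<delta>)"
    proof -
      have "{X \<in> F. \<kappa> X = k} \<subseteq> {X \<in> A. v X \<in> {2 ^ k..2 * 2 ^ k}}" using k F(2) by auto
      then have "card {X \<in> F. \<kappa> X = k} \<le> C * 2 ^ k" using cnt[OF k0] card_mono[OF fin[OF k0]] order_trans by blast
      then have "real (card {X \<in> F. \<kappa> X = k}) \<le> real (C * 2 ^ k)" by (rule of_nat_mono)
      then show ?thesis by (intro mult_right_mono) auto
    qed
    also have "\<dots> = real C * r ^ k"
    proof -
      have "(2 ^ k) powr - (1 + \<delta>) = ((2::real) powr real k) powr - (1 + \<delta>)" by (simp add: powr_realpow)
      also have "\<dots> = 2 powr (- real k) * 2 powr (- \<delta> * real k)" by (simp add: powr_powr flip: powr_add) (simp add: algebra_simps)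
      also have "2 powr (- \<delta> * real k) = r ^ k" unfolding r_def by (simp add: powr_powr flip: powr_realpow)
      also have "2 powr (- real k) = 1 / 2 ^ k" by (simp add: powr_minus powr_realpow divide_inverse)
      finally show ?thesis by simp
    qed
    finally show "(\<Sum>X\<in>{X \<in> F. \<kappa> X = k}. v X powr - (1 + \<delta>)) \<le> real C * r ^ k" .
  qed
  also have "\<dots> = real C * (\<Sum>k\<in>K. r ^ k)" by (simp add: sum_distrib_left)
  also have "(\<Sum>k\<in>K. r ^ k) \<le> r ^ k0 / (1 - r)"
  proof -
    have finK: "finite K" using F(1) by (simp add: K_def)
    obtain n where n: "K \<subseteq> {k0..<k0 + n}"
    proof
      show "K \<subseteq> {k0..<k0 + (Max (insert 0 K) + 1)}"
        using finK k by (auto simp: K_def less_Suc_eq_le intro!: trans_le_add2 Max_ge)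
    qed
    have "(\<Sum>k\<in>K. r ^ k) \<le> (\<Sum>k\<in>{k0..<k0 + n}. r ^ k)" using n r by (intro sum_mono2) auto
    also have "\<dots> = (\<Sum>i<n. r ^ (i + k0))"
      by (rule sum.reindex_bij_witness[of _ "\<lambda>i. i + k0" "\<lambda>k. k - k0"]) auto
    also have "\<dots> = r ^ k0 * (\<Sum>i<n. r ^ i)" by (simp add: power_add sum_distrib_left mult.commute)
    also have "(\<Sum>i<n. r ^ i) = (1 - r ^ n) / (1 - r)" using r by (subst sum_gp_strict) auto
    also have "r ^ k0 * ((1 - r ^ n) / (1 - r)) \<le> r ^ k0 * (1 / (1 - r))"
      using r by (intro mult_left_mono divide_right_mono) auto
    finally show ?thesis by simp
  qed
  finally show ?thesis unfolding r_def by (simp add: mult_left_mono)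
qed

text \<open>For x > 0 the modulus of x powr -s is x powr -Re s, so the bound sees s only through
  \<delta>. Bounded finite partial sums give the summability and the estimate together.\<close>

lemma dyadic_tail_powr:
  fixes v :: "'a \<Rightarrow> real"
  assumes cnt: "\<And>k. k0 \<le> k \<Longrightarrow> finite {X \<in> A. v X \<in> {2 ^ k..2 * 2 ^ k}} \<and> card {X \<in> A. v X \<in> {2 ^ k..2 * 2 ^ k}} \<le> C * 2 ^ k"
    and B: "B \<subseteq> A" "\<And>X. X \<in> B \<Longrightarrow> 2 ^ k0 \<le> v X" and \<delta>: "0 < \<delta>" and s: "1 + \<delta> \<le> Re s"
  shows "(\<lambda>X. of_real (v X) powr - s) summable_on B"
    "cmod (\<Sum>\<^sub>\<infinity>X\<in>B. of_real (v X) powr - s) \<le> real C * (2 powr - \<delta>) ^ k0 / (1 - 2 powr - \<delta>)"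
proof -
  define b where "b = real C * (2 powr - \<delta>) ^ k0 / (1 - 2 powr - \<delta>)"
  have nrm: "cmod (of_real (v X) powr - s) \<le> v X powr - (1 + \<delta>)" if "X \<in> B" for X
  proof -
    have "(1::real) \<le> 2 ^ k0" by simp
    then have v1: "1 \<le> v X" using B(2)[OF that] by linarith
    then have "cmod (of_real (v X) powr - s) = v X powr - Re s" by (simp add: norm_powr_real_powr)
    then show ?thesis using v1 s by (simp add: powr_mono)
  qed
  have part: "(\<Sum>X\<in>F. cmod (of_real (v X) powr - s)) \<le> b" if F: "finite F" "F \<subseteq> B" for F
  proof -
    have "(\<Sum>X\<in>F. cmod (of_real (v X) powr - s)) \<le> (\<Sum>X\<in>F. v X powr - (1 + \<delta>))"
      using nrm F by (intro sum_mono) auto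
    also have "\<dots> \<le> b" unfolding b_def using cnt F B \<delta> by (intro dyadic_tail[where A = A]) auto
    finally show ?thesis .
  qed
  have abs: "(\<lambda>X. cmod (of_real (v X) powr - s)) summable_on B"
    by (rule nonneg_bdd_above_summable_on) (use part in \<open>auto intro!: bdd_aboveI[of _ b]\<close>)
  then show "(\<lambda>X. of_real (v X) powr - s) summable_on B" by (rule abs_summable_summable)
  have "cmod (\<Sum>\<^sub>\<infinity>X\<in>B. of_real (v X) powr - s) \<le> (\<Sum>\<^sub>\<infinity>X\<in>B. cmod (of_real (v X) powr - s))"
    by (rule norm_infsum_bound[OF abs])
  also have "\<dots> \<le> b" using abs part by (intro infsum_le_finite_sums) auto
  finally show "cmod (\<Sum>\<^sub>\<infinity>X\<in>B. of_real (v X) powr - s) \<le> real C * (2 powr - \<delta>) ^ k0 / (1 - 2 powr - \<delta>)"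
    unfolding b_def .
qed

section \<open>Stabilizers of axes and cusps; from cosets to conjugates\<close>

lemma generate_commute:
  assumes g: "\<gamma> \<in> carrier SL2R" and e: "\<eta> \<in> generate SL2R {\<gamma>, - mat 1}"
  shows "\<eta> \<in> carrier SL2R \<and> \<eta> ** \<gamma> = \<gamma> ** \<eta>"
  using e
proof (induction rule: generate.induct)
  case one
  show ?case by (simp add: SL2R_sel SL2R_one matrix_mul_lid matrix_mul_rid)
next
  case (incl h)
  then show ?case using g SL2R_minus[OF SL2R_one] by (auto simp: matrix_mul_lid matrix_mul_rid)
next
  case (inv h)
  then have h: "h \<in> carrier SL2R" "h ** \<gamma> = \<gamma> ** h"
    using g SL2R_minus[OF SL2R_one] by (auto simp: matrix_mul_lid matrix_mul_rid)
  then have "matrix_inv h ** \<gamma> = \<gamma> ** matrix_inv h" by (metis SL2R_cancel(1,3) matrix_mul_assoc)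
  then show ?case using h(1) by (simp add: m_inv_SL2R SL2R_inv)
next
  case (eng h1 h2)
  then show ?case by (simp add: SL2R_sel SL2R_mult) (metis matrix_mul_assoc)
qed

lemma hyperbolic_disp_pos:
  assumes "hyperbolic \<gamma>" "x \<in> uhp"
  shows "0 < disp \<gamma> x"
proof -
  have c: "\<gamma> \<in> carrier SL2R" using assms(1) by (simp add: hyperbolic_def)
  obtain \<sigma> l where f: "hyp_frame \<gamma> \<sigma> l" using hyp_frame_exists[OF assms(1)] by blast
  have "mob \<sigma> x \<in> uhp" using f mob_uhp[OF _ assms(2)] by (auto simp: hyp_frame_def)
  then have "0 < Im (mob \<sigma> x)" "0 < cmod (mob \<sigma> x)" by (auto simp: uhp_def)
  then show ?thesis using hyp_frame_coords(2)[OF f c assms(2)] hyp_frame_trace(2)[OF f] by simp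
qed

lemma par_frame_disp:
  assumes "par_frame p \<sigma> \<omega>" "p \<in> carrier SL2R" "x \<in> uhp"
  shows "disp p x = \<omega> / Im (mob \<sigma> x)" "0 < \<omega>" "0 < Im (mob \<sigma> x)"
proof -
  show "disp p x = \<omega> / Im (mob \<sigma> x)" using par_frame_coords[OF assms(1,2)] assms(3) by metis
  show "0 < \<omega>" "0 < Im (mob \<sigma> x)"
    using assms(1) mob_uhp[OF _ assms(3), of \<sigma>] by (auto simp: par_frame_def uhp_def)
qed

lemma parabolic_disp_pos:
  assumes "parabolic p" "x \<in> uhp"
  shows "0 < disp p x"
proof -
  obtain \<sigma> \<omega> where f: "par_frame p \<sigma> \<omega>" using par_frame_exists[OF assms(1)] by blast
  show ?thesis using par_frame_disp[OF f _ assms(2)] assms(1) by (simp add: parabolic_def)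
qed

text \<open>The axis is the locus of minimal displacement: in a frame, cmod w = Im w exactly on the
  imaginary axis. This description is free of frames, so the axis transforms under conjugation as
  \<open>disp\<close> does.\<close>

lemma geod_axis_eq:
  assumes h: "hyperbolic \<gamma>"
  shows "geod_axis \<gamma> = {z \<in> uhp. disp \<gamma> z = sqrt ((trace \<gamma>)\<^sup>2 - 4)}"
proof -
  have c: "\<gamma> \<in> carrier SL2R" using h by (simp add: hyperbolic_def)
  have *: "Re (mob \<sigma> z) = 0 \<longleftrightarrow> disp \<gamma> z = sqrt ((trace \<gamma>)\<^sup>2 - 4)" if f: "hyp_frame \<gamma> \<sigma> l" and z: "z \<in> uhp" for \<sigma> l z
  proof -
    have "mob \<sigma> z \<in> uhp" using f mob_uhp[OF _ z] by (auto simp: hyp_frame_def)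
    then have i: "0 < Im (mob \<sigma> z)" by (simp add: uhp_def)
    have "disp \<gamma> z = sqrt ((trace \<gamma>)\<^sup>2 - 4) \<longleftrightarrow> cmod (mob \<sigma> z) = Im (mob \<sigma> z)"
      unfolding hyp_frame_trace(3)[OF f] hyp_frame_coords(2)[OF f c z]
      using i hyp_frame_trace(2)[OF f] by (simp add: field_simps)
    also have "\<dots> \<longleftrightarrow> (cmod (mob \<sigma> z))\<^sup>2 = (Im (mob \<sigma> z))\<^sup>2"
      using i by (simp add: power2_eq_iff_nonneg)
    also have "\<dots> \<longleftrightarrow> Re (mob \<sigma> z) = 0" by (simp add: cmod_power2)
    finally show ?thesis by simp
  qed
  show ?thesis using hyp_frame_exists[OF h] * unfolding geod_axis_def by blast
qed

lemma axis_image: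
  assumes h: "hyperbolic \<gamma>" and e: "\<eta> \<in> carrier SL2R"
  shows "hyperbolic (cj \<eta> \<gamma>)" "mob \<eta> ` geod_axis (cj \<eta> \<gamma>) = geod_axis \<gamma>"
proof -
  have gc: "\<gamma> \<in> carrier SL2R" using h by (simp add: hyperbolic_def)
  show h': "hyperbolic (cj \<eta> \<gamma>)" using h by (simp add: hyperbolic_def cj_carrier e trace_cj)
  have inax: "mob \<eta> z \<in> geod_axis \<gamma> \<longleftrightarrow> z \<in> geod_axis (cj \<eta> \<gamma>)" if z: "z \<in> uhp" for z
    using z mob_uhp[OF e z] by (simp add: geod_axis_eq[OF h] geod_axis_eq[OF h'] disp_cj gc e trace_cj)
  have ax: "geod_axis \<gamma> \<subseteq> uhp" "geod_axis (cj \<eta> \<gamma>) \<subseteq> uhp" by (auto simp: geod_axis_def)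
  show "mob \<eta> ` geod_axis (cj \<eta> \<gamma>) = geod_axis \<gamma>"
  proof
    show "mob \<eta> ` geod_axis (cj \<eta> \<gamma>) \<subseteq> geod_axis \<gamma>" using inax ax by blast
    show "geod_axis \<gamma> \<subseteq> mob \<eta> ` geod_axis (cj \<eta> \<gamma>)"
    proof
      fix w assume w: "w \<in> geod_axis \<gamma>"
      then have wu: "w \<in> uhp" using ax by blast
      have "mob (matrix_inv \<eta>) w \<in> geod_axis (cj \<eta> \<gamma>)"
        using inax[OF mob_uhp[OF SL2R_inv[OF e] wu]] w by (simp add: mob_inv_cancel e wu)
      then show "w \<in> mob \<eta> ` geod_axis (cj \<eta> \<gamma>)" using mob_inv_cancel(2)[OF e wu] by (metis image_eqI)
    qed
  qed
qed

text \<open>The orbit-stabilizer bijection for conjugation on \<open>quad\<close> classes: S1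
  identifies S as the stabilizer of \<open>quad \<gamma>\<close>, and S2 makes the class independent
  of the representative picked from a coset.\<close>

lemma rcosets_cls_bij:
  assumes G: "subgroup \<Gamma> SL2R" and g: "\<gamma> \<in> \<Gamma>" and S: "S \<subseteq> \<Gamma>"
    and S1: "\<And>\<eta>. \<eta> \<in> \<Gamma> \<Longrightarrow> \<eta> \<in> S \<longleftrightarrow> quad (cj \<eta> \<gamma>) = quad \<gamma>" and S2: "\<And>\<eta>. \<eta> \<in> S \<Longrightarrow> cj \<eta> \<gamma> = \<gamma>"
  shows "bij_betw (\<lambda>C. quad (cj (SOME \<eta>. \<eta> \<in> C) \<gamma>)) (rcosets\<^bsub>SL2R\<lparr>carrier := \<Gamma>\<rparr>\<^esub> S) (cls \<Gamma> \<gamma>)"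
    and "\<And>C. C \<in> rcosets\<^bsub>SL2R\<lparr>carrier := \<Gamma>\<rparr>\<^esub> S \<Longrightarrow> (SOME \<eta>. \<eta> \<in> C) \<in> \<Gamma>"
proof -
  note sub = subgroup_SL2R_D[OF G]
  have gc: "\<gamma> \<in> carrier SL2R" using sub g by blast
  define R where "R a = (\<lambda>s. s ** a) ` S" for a :: mat22
  have RC: "rcosets\<^bsub>SL2R\<lparr>carrier := \<Gamma>\<rparr>\<^esub> S = R ` \<Gamma>"
    unfolding RCOSETS_def r_coset_def R_def by (auto simp: SL2R_def)
  have one: "mat 1 \<in> S" using S1[OF sub(2)] by simp
  have Sc: "s \<in> carrier SL2R" if "s \<in> S" for s using that S sub by blast
  have some: "(SOME \<eta>. \<eta> \<in> R a) \<in> R a" if "a \<in> \<Gamma>" for a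
  proof (rule someI)
    show "a \<in> R a" unfolding R_def using one by (intro image_eqI[of _ _ "mat 1"]) (auto simp: matrix_mul_lid)
  qed
  show "(SOME \<eta>. \<eta> \<in> C) \<in> \<Gamma>" if "C \<in> rcosets\<^bsub>SL2R\<lparr>carrier := \<Gamma>\<rparr>\<^esub> S" for C
    using that some S sub(3) unfolding RC by (fastforce simp: R_def)
  have q: "quad (cj (SOME \<eta>. \<eta> \<in> R a) \<gamma>) = quad (cj a \<gamma>)" if a: "a \<in> \<Gamma>" for a
  proof -
    obtain s where "s \<in> S" "(SOME \<eta>. \<eta> \<in> R a) = s ** a" using some[OF a] by (auto simp: R_def)
    then show ?thesis using S2 Sc a sub(1) by (simp add: cj_mult)
  qed
  have RR: "R a \<subseteq> R b" if ab: "a \<in> \<Gamma>" "b \<in> \<Gamma>" and eq: "quad (cj a \<gamma>) = quad (cj b \<gamma>)" for a b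
  proof
    fix x assume "x \<in> R a"
    then obtain s where s: "s \<in> S" "x = s ** a" by (auto simp: R_def)
    define m where "m = s ** a ** matrix_inv b"
    have c: "s \<in> carrier SL2R" "a \<in> carrier SL2R" "b \<in> carrier SL2R" "s \<in> \<Gamma>" using s ab Sc S sub by auto
    have mG: "m \<in> \<Gamma>" using sub c ab by (simp add: m_def)
    have m1: "cj m \<gamma> = cj (matrix_inv b) (cj a \<gamma>)"
      using c S2[OF s(1)] by (simp add: m_def cj_mult SL2R_mult SL2R_inv)
    have m2: "cj a \<gamma> \<in> quad (cj b \<gamma>)" using quad_self[of "cj a \<gamma>"] unfolding eq .
    have "quad (cj m \<gamma>) = quad (cj (matrix_inv b) (cj b \<gamma>))"
      unfolding m1 by (rule quad_cj_eq[OF SL2R_inv[OF c(3)] cj_carrier[OF c(3) gc] m2])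
    then have "m \<in> S" using S1[OF mG] cj_inv_cancel(2)[OF c(3)] by simp
    moreover have "x = m ** b" using c s by (simp add: m_def SL2R_cancel)
    ultimately show "x \<in> R b" by (auto simp: R_def)
  qed
  show "bij_betw (\<lambda>C. quad (cj (SOME \<eta>. \<eta> \<in> C) \<gamma>)) (rcosets\<^bsub>SL2R\<lparr>carrier := \<Gamma>\<rparr>\<^esub> S) (cls \<Gamma> \<gamma>)"
    unfolding bij_betw_def RC
  proof
    show "inj_on (\<lambda>C. quad (cj (SOME \<eta>. \<eta> \<in> C) \<gamma>)) (R ` \<Gamma>)"
    proof (rule inj_onI, clarify)
      fix a b assume "a \<in> \<Gamma>" "b \<in> \<Gamma>" "quad (cj (SOME \<eta>. \<eta> \<in> R a) \<gamma>) = quad (cj (SOME \<eta>. \<eta> \<in> R b) \<gamma>)"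
      then show "R a = R b" using RR q by (metis subset_antisym)
    qed
    show "(\<lambda>C. quad (cj (SOME \<eta>. \<eta> \<in> C) \<gamma>)) ` R ` \<Gamma> = cls \<Gamma> \<gamma>"
      unfolding cls_def image_image using q by (intro image_cong) auto
  qed
qed

lemma of_real_divide_powr:
  assumes "0 < a" "0 < b"
  shows "of_real (a / b) powr s = of_real a powr s * of_real b powr (- s :: complex)"
proof -
  have "Ln (of_real (a / b)) = of_real (ln a - ln b)"
    using assms Ln_of_real[of "a / b"] by (simp add: ln_div del: of_real_divide)
  then have "of_real (a / b) powr s = exp (s * of_real (ln a - ln b))"
    using assms unfolding powr_def by auto
  also have "\<dots> = exp (s * of_real (ln a)) * exp (- s * of_real (ln b))"
    by (simp add: exp_diff exp_minus algebra_simps divide_inverse)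
  finally show ?thesis using assms by (simp add: powr_def Ln_of_real)
qed

text \<open>Primitivity puts every element that preserves the axis into the group generated by
  \<open>\<gamma>\<close> and -1, which commutes with \<open>\<gamma>\<close>; in particular none
  reverses the axis. Conversely, elements with the same \<open>quad\<close> have the same
  displacement and |trace|, hence the same axis.\<close>

lemma axis_stab_iff:
  assumes G: "subgroup \<Gamma> SL2R" and p: "primitive_hyp \<Gamma> \<gamma>" and e: "\<eta> \<in> \<Gamma>"
  shows "\<eta> \<in> axis_stab \<Gamma> \<gamma> \<longleftrightarrow> quad (cj \<eta> \<gamma>) = quad \<gamma>"
    and "\<eta> \<in> axis_stab \<Gamma> \<gamma> \<Longrightarrow> cj \<eta> \<gamma> = \<gamma>"
proof -
  have h: "hyperbolic \<gamma>" and gc: "\<gamma> \<in> carrier SL2R" and st: "axis_stab \<Gamma> \<gamma> = generate SL2R {\<gamma>, - mat 1}"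
    using p by (auto simp: primitive_hyp_def hyperbolic_def)
  have ec: "\<eta> \<in> carrier SL2R" using e subgroup_SL2R_D[OF G] by blast
  show 1: "\<eta> \<in> axis_stab \<Gamma> \<gamma> \<Longrightarrow> cj \<eta> \<gamma> = \<gamma>"
    using generate_commute[OF gc] unfolding st by (simp add: cj_commute)
  show "\<eta> \<in> axis_stab \<Gamma> \<gamma> \<longleftrightarrow> quad (cj \<eta> \<gamma>) = quad \<gamma>"
  proof
    show "\<eta> \<in> axis_stab \<Gamma> \<gamma> \<Longrightarrow> quad (cj \<eta> \<gamma>) = quad \<gamma>" using 1 by simp
    assume q: "quad (cj \<eta> \<gamma>) = quad \<gamma>"
    have qe: "cj \<eta> \<gamma> \<in> quad \<gamma>" using quad_self[of "cj \<eta> \<gamma>"] unfolding q .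
    then have "geod_axis (cj \<eta> \<gamma>) = geod_axis \<gamma>"
      unfolding geod_axis_eq[OF h] geod_axis_eq[OF axis_image(1)[OF h ec]] by (simp add: trace_cj ec disp_quad[OF gc qe])
    then have "mob \<eta> ` geod_axis \<gamma> = geod_axis \<gamma>" using axis_image(2)[OF h ec] by simp
    then show "\<eta> \<in> axis_stab \<Gamma> \<gamma>" using e by (simp add: axis_stab_def)
  qed
qed

text \<open>Membership gives commutation with p because the stabilizer is generated by p and -1.
  Conversely, an element preserving the displacement function of p preserves heights in a frame,
  which forces its lower left entry there to vanish.\<close>

lemma cusp_stab_iff:
  assumes G: "subgroup \<Gamma> SL2R" and p: "cusp_gen \<Gamma> p" and e: "\<eta> \<in> \<Gamma>"
  shows "\<eta> \<in> cusp_stab \<Gamma> p \<longleftrightarrow> quad (cj \<eta> p) = quad p"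
    and "\<eta> \<in> cusp_stab \<Gamma> p \<Longrightarrow> cj \<eta> p = p"
proof -
  have h: "parabolic p" and gc: "p \<in> carrier SL2R" and st: "cusp_stab \<Gamma> p = generate SL2R {p, - mat 1}"
    using p by (auto simp: cusp_gen_def parabolic_def)
  have ec: "\<eta> \<in> carrier SL2R" using e subgroup_SL2R_D[OF G] by blast
  show 1: "\<eta> \<in> cusp_stab \<Gamma> p \<Longrightarrow> cj \<eta> p = p"
    using generate_commute[OF gc] unfolding st by (simp add: cj_commute)
  show "\<eta> \<in> cusp_stab \<Gamma> p \<longleftrightarrow> quad (cj \<eta> p) = quad p"
  proof
    show "\<eta> \<in> cusp_stab \<Gamma> p \<Longrightarrow> quad (cj \<eta> p) = quad p" using 1 by simp
    assume q: "quad (cj \<eta> p) = quad p"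
    obtain \<sigma> \<omega> where f: "par_frame p \<sigma> \<omega>" using par_frame_exists[OF h] by blast
    have sc: "\<sigma> \<in> carrier SL2R" using f by (simp add: par_frame_def)
    define N where "N = \<sigma> ** \<eta> ** matrix_inv \<sigma>"
    have Nc: "N \<in> carrier SL2R" by (simp add: N_def SL2R_mult SL2R_inv sc ec)
    have ImN: "Im (mob N w) = Im w" if w: "w \<in> uhp" for w
    proof -
      define z where "z = mob (matrix_inv \<sigma>) w"
      have z: "z \<in> uhp" "mob \<sigma> z = w" by (simp_all add: z_def mob_uhp SL2R_inv sc w mob_inv_cancel)
      have "disp p (mob \<eta> z) = disp (cj \<eta> p) z" by (simp add: disp_cj gc ec z)
      also have "\<dots> = disp p z" using quad_self[of "cj \<eta> p"] unfolding q by (rule disp_quad[OF gc])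
      finally have "\<omega> / Im (mob \<sigma> (mob \<eta> z)) = \<omega> / Im (mob \<sigma> z)"
        using par_frame_disp(1)[OF f gc] z mob_uhp[OF ec z(1)] by simp
      then have "Im (mob \<sigma> (mob \<eta> z)) = Im w"
        using par_frame_disp(2)[OF f gc z(1)] par_frame_disp(3)[OF f gc] z mob_uhp[OF ec z(1)]
        by (metis divide_cancel_left less_irrefl)
      moreover have "mob N w = mob \<sigma> (mob \<eta> z)"
        by (simp add: N_def mob_mult SL2R_mult SL2R_inv sc ec w z_def mob_uhp)
      ultimately show ?thesis by simp
    qed
    have "(cmod (of_real (N$2$1) * w + of_real (N$2$2)))\<^sup>2 = 1" if w: "w \<in> uhp" for w
    proof -
      have "Im w / (cmod (of_real (N$2$1) * w + of_real (N$2$2)))\<^sup>2 = Im w" using ImN[OF w] Im_mob[OF Nc w] by simp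
      then show ?thesis using w uhp_denom_nz[OF Nc w] by (simp add: uhp_def divide_eq_eq)
    qed
    \<comment> \<open>Two heights suffice: with lower row c, d, the values at \<open>\<i>\<close>
      and \<open>2 * \<i>\<close> give c^2 + d^2 = 1 and 4 c^2 + d^2 = 1.\<close>
    from this[of "\<i>"] this[of "2 * \<i>"] have "(N$2$1)\<^sup>2 + (N$2$2)\<^sup>2 = 1" "(N$2$1 * 2)\<^sup>2 + (N$2$2)\<^sup>2 = 1"
      by (simp_all add: uhp_def cmod_power2 add.commute)
    moreover from this have "4 * (N$2$1)\<^sup>2 + (N$2$2)\<^sup>2 = 1" by (simp add: power_mult_distrib)
    ultimately have "(N$2$1)\<^sup>2 = 0" by linarith
    then have "N$2$1 = 0" by simp
    then show "\<eta> \<in> cusp_stab \<Gamma> p" using e f unfolding cusp_stab_def N_def by blast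
  qed
qed

text \<open>In a frame the sine of the angle is Im w / |w|, that is 2 sinh (l/2) divided by the
  displacement. The constant leaves the sum, and the rest depends on the group only through the
  conjugates of \<gamma>.\<close>

theorem E_hyp_eq_esum:
  assumes G: "subgroup \<Gamma> SL2R" and p: "primitive_hyp \<Gamma> \<gamma>" and z: "z \<in> uhp"
  shows "E_hyp \<Gamma> \<gamma> s z = of_real (sqrt ((trace \<gamma>)\<^sup>2 - 4)) powr s * esum (cls \<Gamma> \<gamma>) s z"
proof -
  have h: "hyperbolic \<gamma>" and g: "\<gamma> \<in> \<Gamma>" "\<gamma> \<in> carrier SL2R" using p by (auto simp: primitive_hyp_def hyperbolic_def)
  define \<sigma> where "\<sigma> = (SOME \<sigma>. \<exists>l. hyp_frame \<gamma> \<sigma> l)"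
  have "\<exists>l. hyp_frame \<gamma> \<sigma> l" unfolding \<sigma>_def using hyp_frame_exists[OF h] by (rule someI_ex)
  then obtain l where f: "hyp_frame \<gamma> \<sigma> l" by blast
  have sc: "\<sigma> \<in> carrier SL2R" using f by (simp add: hyp_frame_def)
  define t where "t = sqrt ((trace \<gamma>)\<^sup>2 - 4)"
  have t: "t = 2 * sinh (l/2)" "0 < t" using hyp_frame_trace[OF f] by (simp_all add: t_def)
  have S: "axis_stab \<Gamma> \<gamma> \<subseteq> \<Gamma>" by (auto simp: axis_stab_def)
  note bij = rcosets_cls_bij[OF G g(1) S axis_stab_iff(1)[OF G p] axis_stab_iff(2)[OF G p]]
  have "E_hyp \<Gamma> \<gamma> s z = (\<Sum>\<^sub>\<infinity>C\<in>rcosets\<^bsub>SL2R\<lparr>carrier := \<Gamma>\<rparr>\<^esub> (axis_stab \<Gamma> \<gamma>).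
        of_real t powr s * of_real (val (quad (cj (SOME \<eta>. \<eta> \<in> C) \<gamma>)) z) powr (- s))"
    unfolding E_hyp_def Let_def \<sigma>_def[symmetric]
  proof (rule infsum_cong)
    fix C assume "C \<in> rcosets\<^bsub>SL2R\<lparr>carrier := \<Gamma>\<rparr>\<^esub> (axis_stab \<Gamma> \<gamma>)"
    then have eG: "(SOME \<eta>. \<eta> \<in> C) \<in> \<Gamma>" using bij(2) S by blast
    define \<eta> where "\<eta> = (SOME \<eta>. \<eta> \<in> C)"
    have ec: "\<eta> \<in> carrier SL2R" using eG subgroup_SL2R_D[OF G] by (simp add: \<eta>_def)
    have ez: "mob \<eta> z \<in> uhp" by (rule mob_uhp[OF ec z])
    have w: "0 < Im (mob \<sigma> (mob \<eta> z))" using mob_uhp[OF sc ez] by (simp add: uhp_def)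
    then have nz: "mob \<sigma> (mob \<eta> z) \<noteq> 0" by auto
    have v: "val (quad (cj \<eta> \<gamma>)) z = disp \<gamma> (mob \<eta> z)"
      by (simp add: val_quad cj_carrier ec g disp_cj z)
    have "sin (Arg (mob \<sigma> (mob \<eta> z))) = t / disp \<gamma> (mob \<eta> z)"
      using hyp_frame_coords(2)[OF f g(2) ez] t nz w by (simp add: sin_Arg)
    then show "of_real (sin (Arg (mob \<sigma> (mob (SOME \<eta>. \<eta> \<in> C) z)))) powr s =
      of_real t powr s * of_real (val (quad (cj (SOME \<eta>. \<eta> \<in> C) \<gamma>)) z) powr (- s)"
      unfolding \<eta>_def[symmetric] v using of_real_divide_powr[OF t(2) hyperbolic_disp_pos[OF h ez]] by simp
  qed
  also have "\<dots> = of_real t powr s * (\<Sum>\<^sub>\<infinity>C\<in>rcosets\<^bsub>SL2R\<lparr>carrier := \<Gamma>\<rparr>\<^esub> (axis_stab \<Gamma> \<gamma>).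
        of_real (val (quad (cj (SOME \<eta>. \<eta> \<in> C) \<gamma>)) z) powr (- s))"
    by (rule infsum_cmult_right')
  also have "(\<Sum>\<^sub>\<infinity>C\<in>rcosets\<^bsub>SL2R\<lparr>carrier := \<Gamma>\<rparr>\<^esub> (axis_stab \<Gamma> \<gamma>).
        of_real (val (quad (cj (SOME \<eta>. \<eta> \<in> C) \<gamma>)) z) powr (- s)) = esum (cls \<Gamma> \<gamma>) s z"
    unfolding esum_def using S by (intro infsum_reindex_bij_betw bij(1)) auto
  finally show ?thesis unfolding t_def .
qed

text \<open>Height divided by width is the inverse of the displacement, so the normalizing power of
  the width is absorbed into the terms and no factor remains.\<close>

theorem E_par_eq_esum:
  assumes G: "subgroup \<Gamma> SL2R" and p: "cusp_gen \<Gamma> p" and z: "z \<in> uhp"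
  shows "E_par \<Gamma> p s z = esum (cls \<Gamma> p) s z"
proof -
  have h: "parabolic p" and g: "p \<in> \<Gamma>" "p \<in> carrier SL2R" using p by (auto simp: cusp_gen_def parabolic_def)
  obtain \<sigma> \<omega> where so: "(SOME (\<sigma>, \<omega>). par_frame p \<sigma> \<omega>) = (\<sigma>, \<omega>)" by fastforce
  have "\<exists>x. (case x of (\<sigma>, \<omega>) \<Rightarrow> par_frame p \<sigma> \<omega>)" using par_frame_exists[OF h] by auto
  from someI_ex[OF this] have f: "par_frame p \<sigma> \<omega>" using so by simp
  have S: "cusp_stab \<Gamma> p \<subseteq> \<Gamma>" by (auto simp: cusp_stab_def)
  note bij = rcosets_cls_bij[OF G g(1) S cusp_stab_iff(1)[OF G p] cusp_stab_iff(2)[OF G p]]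
  have "E_par \<Gamma> p s z = (\<Sum>\<^sub>\<infinity>C\<in>rcosets\<^bsub>SL2R\<lparr>carrier := \<Gamma>\<rparr>\<^esub> (cusp_stab \<Gamma> p).
        of_real \<omega> powr (- s) * of_real (Im (mob \<sigma> (mob (SOME \<eta>. \<eta> \<in> C) z))) powr s)"
    unfolding E_par_def so Let_def prod.case by (rule infsum_cmult_right'[symmetric])
  also have "\<dots> = (\<Sum>\<^sub>\<infinity>C\<in>rcosets\<^bsub>SL2R\<lparr>carrier := \<Gamma>\<rparr>\<^esub> (cusp_stab \<Gamma> p).
        of_real (val (quad (cj (SOME \<eta>. \<eta> \<in> C) p)) z) powr (- s))"
  proof (rule infsum_cong)
    fix C assume "C \<in> rcosets\<^bsub>SL2R\<lparr>carrier := \<Gamma>\<rparr>\<^esub> (cusp_stab \<Gamma> p)"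
    then have eG: "(SOME \<eta>. \<eta> \<in> C) \<in> \<Gamma>" using bij(2) S by blast
    define \<eta> where "\<eta> = (SOME \<eta>. \<eta> \<in> C)"
    have ec: "\<eta> \<in> carrier SL2R" using eG subgroup_SL2R_D[OF G] by (simp add: \<eta>_def)
    have ez: "mob \<eta> z \<in> uhp" by (rule mob_uhp[OF ec z])
    note d = par_frame_disp[OF f g(2) ez]
    have v: "val (quad (cj \<eta> p)) z = \<omega> / Im (mob \<sigma> (mob \<eta> z))"
      by (simp add: val_quad cj_carrier ec g disp_cj z d)
    show "of_real \<omega> powr (- s) * of_real (Im (mob \<sigma> (mob (SOME \<eta>. \<eta> \<in> C) z))) powr s =
      of_real (val (quad (cj (SOME \<eta>. \<eta> \<in> C) p)) z) powr (- s)"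
      unfolding \<eta>_def[symmetric] v using of_real_divide_powr[OF d(2,3), of "- s"] by simp
  qed
  also have "\<dots> = esum (cls \<Gamma> p) s z"
    unfolding esum_def using S by (intro infsum_reindex_bij_betw bij(1)) auto
  finally show ?thesis .
qed

text \<open>In a frame of width w the neighbourhood of area \<epsilon>/2 is where the height exceeds
  2 w / \<epsilon>, that is, where a conjugate of the parabolic generator has \<open>disp\<close>
  below \<epsilon>/2. On K such displacements are bounded below, so metric convergence becomes
  available on every compact set.\<close>

lemma compact_avoids_developing_nbhd:
  fixes \<Gamma>0 :: "'c::finite \<Rightarrow> mat22 set" and cmp :: "'p \<Rightarrow> 2 \<Rightarrow> 'c"
  assumes G: "\<And>c. subgroup (\<Gamma>0 c) SL2R" "\<And>c. discrete (\<Gamma>0 c)"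
    and q: "\<And>j k. cusp_gen (\<Gamma>0 (cmp j k)) (q j k)" and K: "compact K" "K \<subseteq> uhp"
  obtains \<epsilon> where "0 < \<epsilon>" "\<epsilon> < 1/2" "\<And>c. K \<subseteq> uhp - developing_nbhd \<Gamma>0 cmp q \<epsilon> c"
proof -
  have "\<exists>b>0. \<forall>g z. g \<in> \<Gamma>0 c \<longrightarrow> (\<forall>u\<in>uhp. mob g u \<noteq> u) \<longrightarrow> z \<in> K \<longrightarrow> b \<le> hdist z (mob g z)" for c
    using discrete_displacement_lower_bound[OF G K] by metis
  then obtain b where b: "\<And>c. 0 < b c" 
    "\<And>c g z. g \<in> \<Gamma>0 c \<Longrightarrow> \<forall>u\<in>uhp. mob g u \<noteq> u \<Longrightarrow> z \<in> K \<Longrightarrow> b c \<le> hdist z (mob g z)" by metis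
  \<comment> \<open>The entry 1/4 keeps \<epsilon> below the 1/2 required in
    \<open>metric_convergence\<close>; the minimum exists because there are finitely many
    components.\<close>
  define \<epsilon> where "\<epsilon> = Min (insert (1/4) (range b))"
  have e: "0 < \<epsilon>" "\<epsilon> \<le> 1/4" unfolding \<epsilon>_def using b(1) by (auto simp: Min_gr_iff)
  have eb: "\<epsilon> \<le> b c" for c unfolding \<epsilon>_def by (rule Min_le) auto
  have "z \<notin> developing_nbhd \<Gamma>0 cmp q \<epsilon> c" if z: "z \<in> K" for z c
  proof
    assume "z \<in> developing_nbhd \<Gamma>0 cmp q \<epsilon> c"
    then obtain j k g \<sigma> \<omega> where jk: "cmp j k = c" "g \<in> \<Gamma>0 c" "par_frame (q j k) \<sigma> \<omega>"
      "\<omega> / (\<epsilon>/2) < Im (mob \<sigma> (mob g z))"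
      by (auto simp: developing_nbhd_def cusp_nbhd_def)
    have qG: "q j k \<in> \<Gamma>0 c" "parabolic (q j k)" "q j k \<in> carrier SL2R" using q[of j k] jk(1) by (auto simp: cusp_gen_def parabolic_def)
    have zu: "z \<in> uhp" using z K by blast
    have gc: "g \<in> carrier SL2R" using subgroup_SL2R_D(1)[OF G(1) jk(2)] .
    define h where "h = cj g (q j k)"
    have hG: "h \<in> \<Gamma>0 c" "h \<in> carrier SL2R" using cj_subgroup[OF G(1) jk(2) qG(1)] cj_carrier[OF gc qG(3)] by (simp_all add: h_def)
    have dh: "disp h u = disp (q j k) (mob g u)" if "u \<in> uhp" for u
      by (simp add: h_def disp_cj qG gc that)
    have nofix: "\<forall>u\<in>uhp. mob h u \<noteq> u"
      using disp_pos_iff[OF hG(2)] dh parabolic_disp_pos[OF qG(2)] mob_uhp[OF gc] by auto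
    note fr = par_frame_disp[OF jk(3) qG(3) mob_uhp[OF gc zu]]
    have "disp h z < \<epsilon> / 2"
      unfolding dh[OF zu] fr(1) using jk(4) fr(2,3) e(1) by (simp add: field_simps)
    moreover have "hdist z (mob h z) \<le> disp h z"
      using le_sinh[of "hdist z (mob h z) / 2"] hdist_nonneg[OF zu mob_uhp[OF hG(2) zu]]
      by (simp add: disp_eq_hdist[OF hG(2) zu])
    moreover have "b c \<le> hdist z (mob h z)" by (rule b(2)[OF hG(1) nofix z])
    ultimately show False using e(1) eb[of c] by linarith
  qed
  then show thesis using that[of \<epsilon>] e K by auto
qed

text \<open>By Cayley-Hamilton A^2 differs from trace A times A by a scalar matrix, which
  contributes nothing to the fixed-point quadratic. Thus |trace A| is a quotient of displacements,
  and \<open>trace_tendsto\<close> obtains it from distances.\<close>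

lemma disp_square:
  "disp (A ** A) z = \<bar>trace A\<bar> * disp A z"
proof -
  have "of_real ((A ** A)$2$1) * z\<^sup>2 + of_real ((A ** A)$2$2 - (A ** A)$1$1) * z - of_real ((A ** A)$1$2) =
    of_real (trace A) * (of_real (A$2$1) * z\<^sup>2 + of_real (A$2$2 - A$1$1) * z - of_real (A$1$2))"
    by (simp add: mult_entry trace_mat22 algebra_simps)
  then have "cmod (of_real ((A ** A)$2$1) * z\<^sup>2 + of_real ((A ** A)$2$2 - (A ** A)$1$1) * z - of_real ((A ** A)$1$2)) =
    \<bar>trace A\<bar> * cmod (of_real (A$2$1) * z\<^sup>2 + of_real (A$2$2 - A$1$1) * z - of_real (A$1$2))"
    by (simp only: norm_mult norm_of_real)
  then show ?thesis unfolding disp_def by (simp only: times_divide_eq_right)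
qed

lemma trace_quad_abs: "h \<in> carrier SL2R \<Longrightarrow> h' \<in> quad h \<Longrightarrow> \<bar>trace h'\<bar> = \<bar>trace h\<bar>"
  by (auto simp: quad_def trace_minus_mat22 trace_mat22 matrix_inv_SL2R)

lemma hyperbolic_length:
  assumes "hyperbolic \<gamma>"
  shows "0 < geod_length \<gamma>" "sqrt ((trace \<gamma>)\<^sup>2 - 4) = 2 * sinh (geod_length \<gamma> / 2)"
proof -
  obtain \<sigma> l where f: "hyp_frame \<gamma> \<sigma> l" using hyp_frame_exists[OF assms] by blast
  show "0 < geod_length \<gamma>" "sqrt ((trace \<gamma>)\<^sup>2 - 4) = 2 * sinh (geod_length \<gamma> / 2)"
    using f hyp_frame_trace(3)[OF f] by (simp_all add: geod_length_eq[OF f] hyp_frame_def)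
qed

lemma geod_length_cong:
  assumes "hyperbolic \<gamma>" "hyperbolic \<gamma>'" "\<bar>trace \<gamma>\<bar> = \<bar>trace \<gamma>'\<bar>"
  shows "geod_length \<gamma> = geod_length \<gamma>'"
proof -
  have "(trace \<gamma>)\<^sup>2 = (trace \<gamma>')\<^sup>2" using assms(3) by (metis power2_abs)
  then have "sinh (geod_length \<gamma> / 2) = sinh (geod_length \<gamma>' / 2)"
    using hyperbolic_length(2)[OF assms(1)] hyperbolic_length(2)[OF assms(2)] by simp
  then show ?thesis by (simp add: sinh_real_eq_iff)
qed

text \<open>In a frame of \<gamma> the generators act as multiplication by exp l and as the
  identity. The exponent n of a word is what \<open>axis_multiple\<close> compares with
  lengths.\<close>

lemma generate_dilation:
  assumes f: "hyp_frame \<gamma> \<sigma> l" and g: "\<gamma> \<in> carrier SL2R" and e: "\<eta> \<in> generate SL2R {\<gamma>, - mat 1}"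
  shows "\<exists>n::int. \<forall>x\<in>uhp. mob \<sigma> (mob \<eta> x) = of_real (exp (of_int n * l)) * mob \<sigma> x"
  using e
proof (induction rule: generate.induct)
  case one
  show ?case by (intro exI[of _ 0]) (simp add: SL2R_sel)
next
  case (incl h)
  then consider "h = \<gamma>" | "h = - mat 1" by blast
  then show ?case
  proof cases
    case 1 then show ?thesis using hyp_frame_coords(1)[OF f g] by (intro exI[of _ 1]) simp
  next
    case 2 then show ?thesis by (intro exI[of _ 0]) simp
  qed
next
  case (inv h)
  then consider "h = \<gamma>" | "h = - mat 1" by blast
  then show ?case
  proof cases
    case 1
    have "mob \<sigma> (mob (matrix_inv \<gamma>) x) = of_real (exp (- l)) * mob \<sigma> x" if x: "x \<in> uhp" for x
    proof -
      have "mob \<sigma> x = of_real (exp l) * mob \<sigma> (mob (matrix_inv \<gamma>) x)"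
        using hyp_frame_coords(1)[OF f g mob_uhp[OF SL2R_inv[OF g] x]] by (simp add: mob_inv_cancel g x)
      moreover have "of_real (exp (- l)) * (of_real (exp l) * w) = w" for w :: complex
        by (simp add: exp_minus flip: of_real_mult mult.assoc)
      ultimately show ?thesis by simp
    qed
    then show ?thesis using 1 g by (intro exI[of _ "-1"]) (simp add: m_inv_SL2R)
  next
    case 2 then show ?thesis
      by (intro exI[of _ 0]) (simp add: m_inv_SL2R SL2R_minus SL2R_one matrix_inv_minus SL2R_inv_unique[of "mat 1" "mat 1"] matrix_mul_lid)
  qed
next
  case (eng h1 h2)
  then obtain n m :: int where nm: "\<forall>x\<in>uhp. mob \<sigma> (mob h1 x) = of_real (exp (of_int n * l)) * mob \<sigma> x"
    "\<forall>x\<in>uhp. mob \<sigma> (mob h2 x) = of_real (exp (of_int m * l)) * mob \<sigma> x" by blast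
  have c: "h1 \<in> carrier SL2R" "h2 \<in> carrier SL2R" using generate_commute[OF g] eng by auto
  show ?case
    using nm c mob_uhp[OF c(2)] by (intro exI[of _ "n + m"])
      (simp add: SL2R_sel mob_mult distrib_right exp_add)
qed

lemma mob_inj:
  assumes "\<sigma> \<in> carrier SL2R" "x \<in> uhp" "y \<in> uhp" "mob \<sigma> x = mob \<sigma> y"
  shows "x = y"
  using assms mob_inv_cancel(1) by metis

lemma mob_eq_all_imp:
  assumes "A \<in> carrier SL2R" "B \<in> carrier SL2R" "\<And>x. x \<in> uhp \<Longrightarrow> mob A x = mob B x"
  shows "A = B \<or> A = - B"
  by (rule mob_eq2_imp[OF assms(1,2), of \<i> "2 * \<i>"]) (auto simp: uhp_def assms(3))

lemma geod_axis_nonempty: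
  assumes "hyperbolic \<gamma>"
  obtains x where "x \<in> geod_axis \<gamma>"
proof -
  obtain \<sigma> l where f: "hyp_frame \<gamma> \<sigma> l" using hyp_frame_exists[OF assms] by blast
  then have s: "\<sigma> \<in> carrier SL2R" by (simp add: hyp_frame_def)
  have i: "\<i> \<in> uhp" by (simp add: uhp_def)
  have "mob (matrix_inv \<sigma>) \<i> \<in> geod_axis \<gamma>"
    unfolding geod_axis_def using f mob_uhp[OF SL2R_inv[OF s] i] mob_inv_cancel(2)[OF s i]
    by (auto intro!: exI[of _ \<sigma>] exI[of _ l])
  then show thesis using that by blast
qed

lemma hdist_axis:
  assumes h: "hyperbolic \<gamma>" and x: "x \<in> geod_axis \<gamma>"
  shows "hdist x (mob \<gamma> x) = geod_length \<gamma>"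
proof -
  have c: "\<gamma> \<in> carrier SL2R" using h by (simp add: hyperbolic_def)
  have "x \<in> uhp" "2 * sinh (hdist x (mob \<gamma> x) / 2) = 2 * sinh (geod_length \<gamma> / 2)"
    using x hyperbolic_length(2)[OF h] disp_eq_hdist[OF c, of x] by (simp_all add: geod_axis_eq[OF h])
  then show ?thesis by (simp add: sinh_real_eq_iff)
qed

text \<open>The strip between b and T is one box of ratio T / b. An integral shift brings the
  coordinates within 1 of each other, and b <= 1 makes this at most the permitted 1 / b.\<close>

lemma strip_near:
  assumes sc: "strip_coords \<Gamma> \<gamma> side \<tau>" and G: "subgroup \<Gamma> SL2R" and gam: "\<gamma> \<in> carrier SL2R"
    and xy: "x \<in> uhp" "y \<in> uhp" "side x = side y"
    and d: "disp \<gamma> x \<in> {b..T}" "disp \<gamma> y \<in> {b..T}" and b: "0 < b" "b \<le> 1"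
  shows "\<exists>g\<in>\<Gamma>. g ** \<gamma> = \<gamma> ** g \<and> hdist x (mob g y) \<le> box_radius (T / b)"
proof -
  obtain g where g: "g \<in> \<Gamma>" "g ** \<gamma> = \<gamma> ** g"
    "\<forall>u\<in>uhp. \<tau> (mob g u) = \<tau> u + of_int \<lfloor>\<tau> x - \<tau> y\<rfloor> \<and> side (mob g u) = side u"
    using strip_coordsD(1)[OF sc, of "\<lfloor>\<tau> x - \<tau> y\<rfloor>"] by blast
  have gc: "g \<in> carrier SL2R" using subgroup_SL2R_D(1)[OF G g(1)] .
  have gy: "\<tau> (mob g y) = \<tau> y + of_int \<lfloor>\<tau> x - \<tau> y\<rfloor>" "side (mob g y) = side y" using g(3) xy by auto
  have "\<bar>\<tau> x - \<tau> (mob g y)\<bar> \<le> 1" unfolding gy(1) by linarith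
  also have "1 \<le> 1 / b" using b by simp
  finally have t: "\<bar>\<tau> x - \<tau> (mob g y)\<bar> \<le> 1 / b" .
  have "disp \<gamma> (mob g y) = disp \<gamma> y" using disp_cj[OF gam gc xy(2)] by (simp add: cj_commute gc g(2))
  then show ?thesis using g t gy b d xy mob_uhp[OF gc xy(2)]
    by (intro bexI[of _ g] conjI strip_coordsD(2)[OF sc, of b]) auto
qed

text \<open>Uniform continuity of x powr s on a compact interval around r0 times S. The interval
  stays inside the positive reals, away from 0 and from the branch cut.\<close>

lemma powr_uniform_limit:
  fixes S :: "complex set"
  assumes S: "compact S" and r: "(r \<longlongrightarrow> r0) F" and r0: "0 < (r0::real)"
  shows "uniform_limit S (\<lambda>l s. of_real (r l) powr s) (\<lambda>s. of_real r0 powr s) F"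
proof (rule uniform_limitI)
  fix e :: real assume e: "0 < e"
  define C where "C = {r0/2..2*r0} \<times> S"
  have "continuous_on C (\<lambda>(x, s). of_real x powr s)"
    unfolding C_def case_prod_unfold using r0
    by (intro continuous_intros continuous_on_powr_complex) (auto simp: complex_nonpos_Reals_iff)
  moreover have "compact C" unfolding C_def by (intro compact_Times S compact_Icc)
  ultimately have "uniformly_continuous_on C (\<lambda>(x, s). of_real x powr s)" by (rule compact_uniformly_continuous)
  then obtain d where d: "0 < d" "\<And>x y. x \<in> C \<Longrightarrow> y \<in> C \<Longrightarrow> dist y x < d \<Longrightarrow>
      dist ((\<lambda>(x, s). of_real x powr s) y) ((\<lambda>(x, s). of_real x powr s :: complex) x) < e"
    unfolding uniformly_continuous_on_def using e by blast
  have "\<forall>\<^sub>F l in F. dist (r l) r0 < min d (r0/2)" using r d(1) r0 by (intro tendstoD) auto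
  then show "\<forall>\<^sub>F l in F. \<forall>s\<in>S. dist (of_real (r l) powr s) (of_real r0 powr s :: complex) < e"
  proof (eventually_elim, intro ballI)
    fix l s assume l: "dist (r l) r0 < min d (r0/2)" and s: "s \<in> S"
    have "r l \<in> {r0/2..2*r0}" using l r0 unfolding dist_real_def atLeastAtMost_iff by linarith
    then have "(r l, s) \<in> C" "(r0, s) \<in> C" using s r0 by (auto simp: C_def)
    from d(2)[OF this(2,1)] show "dist (of_real (r l) powr s) (of_real r0 powr s :: complex) < e"
      using l by (simp add: dist_Pair_Pair)
  qed
qed

lemma quad_subset_cusp_stab:
  assumes p: "cusp_gen \<Gamma> p"
  shows "quad p \<subseteq> cusp_stab \<Gamma> p"
proof -
  have pc: "p \<in> carrier SL2R" using p by (auto simp: cusp_gen_def parabolic_def)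
  have inv: "matrix_inv p \<in> generate SL2R {p, - mat 1}" using generate.inv[of p "{p, - mat 1}" SL2R] by (simp add: m_inv_SL2R pc)
  have m: "- h \<in> generate SL2R {p, - mat 1}" if "h \<in> generate SL2R {p, - mat 1}" for h
    using generate.eng[OF generate.incl[of "- mat 1" "{p, - mat 1}" SL2R] that] by (simp add: SL2R_sel matrix_mul_lid)
  show ?thesis using p inv m generate.incl[of p "{p, - mat 1}" SL2R] unfolding quad_def cusp_gen_def by auto
qed

text \<open>A common class yields a group element that conjugates p into \<open>quad p'\<close>,
  hence into the stabilizer of the second cusp, and then the cusps agree.\<close>

lemma cls_disjoint:
  assumes G: "subgroup \<Gamma> SL2R" and p: "cusp_gen \<Gamma> p" and p': "cusp_gen \<Gamma> p'" and ns: "\<not> same_cusp \<Gamma> p p'"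
  shows "cls \<Gamma> p \<inter> cls \<Gamma> p' = {}"
proof (rule ccontr)
  note sub = subgroup_SL2R_D[OF G]
  assume "cls \<Gamma> p \<inter> cls \<Gamma> p' \<noteq> {}"
  then obtain a b where ab: "a \<in> \<Gamma>" "b \<in> \<Gamma>" "quad (cj a p) = quad (cj b p')" by (auto simp: cls_def)
  have c: "a \<in> carrier SL2R" "b \<in> carrier SL2R" using ab sub by auto
  have pc: "p \<in> carrier SL2R" "p' \<in> carrier SL2R" using p p' by (auto simp: cusp_gen_def parabolic_def)
  define m where "m = a ** matrix_inv b"
  have mG: "m \<in> \<Gamma>" using ab sub by (simp add: m_def)
  have "cj a p \<in> quad (cj b p')" using quad_self[of "cj a p"] unfolding ab(3) .
  from quad_cj[OF SL2R_inv[OF c(2)] cj_carrier[OF c(2) pc(2)] this]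
  have "cj m p \<in> quad p'" by (simp add: m_def cj_mult c SL2R_inv cj_inv_cancel)
  then have "matrix_inv m ** p ** matrix_inv (matrix_inv m) \<in> cusp_stab \<Gamma> p'"
    using quad_subset_cusp_stab[OF p'] mG sub by (auto simp: cj_def matrix_inv_inv)
  then show False using ns mG sub unfolding same_cusp_def by blast
qed

section \<open>Degenerating families\<close>

context degenerating_family
begin

lemma limit_group: "subgroup (\<Gamma>0 c) SL2R" "discrete (\<Gamma>0 c)"
  using limit_surface[of c] by (auto simp: fuchsian_first_kind_def)

lemma group_l: "l \<in> L \<Longrightarrow> subgroup (\<Gamma> l) SL2R"
  using surface[of l] by (auto simp: fuchsian_first_kind_def)

lemma gamma0_carrier: "g \<in> \<Gamma>0 c \<Longrightarrow> g \<in> carrier SL2R"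
  using subgroup_SL2R_D(1)[OF limit_group(1)] .

lemma gamma_carrier: "l \<in> L \<Longrightarrow> g \<in> \<Gamma> l \<Longrightarrow> g \<in> carrier SL2R"
  using subgroup_SL2R_D(1)[OF group_l] .

lemma gamma_minus: "l \<in> L \<Longrightarrow> g \<in> \<Gamma> l \<Longrightarrow> - g \<in> \<Gamma> l"
proof -
  assume l: "l \<in> L" and g: "g \<in> \<Gamma> l"
  have "- mat 1 \<in> \<Gamma> l" using surface[OF l] by (auto simp: fuchsian_first_kind_def)
  from subgroup_SL2R_D(3)[OF group_l[OF l] this g] show "- g \<in> \<Gamma> l" by (simp add: matrix_mul_lid)
qed

lemma phi_uhp:
  assumes "l \<in> L" "z \<in> uhp"
  shows "\<phi> l c z \<in> uhp"
proof -
  have "mob (mat 1) (\<phi> l c z) \<in> (\<Union>c. \<Union>h\<in>\<Gamma> l. mob h ` \<phi> l c ` uhp)"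
    using subgroup_SL2R_D(2)[OF group_l[OF assms(1)]] assms(2) by blast
  then show ?thesis using phi_image[OF assms(1)] by simp
qed

lemma phi_continuous: "l \<in> L \<Longrightarrow> continuous_on uhp (\<phi> l c)"
  using phi_diff by (auto intro!: continuous_at_imp_continuous_on differentiable_imp_continuous_within)

text \<open>\<open>rel l c g h\<close>: \<open>h\<close> is, up to sign, the image of \<open>g\<close> under the homomorphism of groups induced by \<open>\<phi> l c\<close>.\<close>

definition rel :: "real^'p \<Rightarrow> 'c \<Rightarrow> mat22 \<Rightarrow> mat22 \<Rightarrow> bool" where
  "rel l c g h \<longleftrightarrow> g \<in> \<Gamma>0 c \<and> h \<in> \<Gamma> l \<and> (\<forall>z\<in>uhp. \<phi> l c (mob g z) = mob h (\<phi> l c z))"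

lemma relD: "rel l c g h \<Longrightarrow> z \<in> uhp \<Longrightarrow> \<phi> l c (mob g z) = mob h (\<phi> l c z)"
  by (simp add: rel_def)

lemma rel_carrier: "l \<in> L \<Longrightarrow> rel l c g h \<Longrightarrow> g \<in> carrier SL2R" "l \<in> L \<Longrightarrow> rel l c g h \<Longrightarrow> h \<in> carrier SL2R"
  using gamma0_carrier gamma_carrier by (auto simp: rel_def)

lemma rel_exists: "l \<in> L \<Longrightarrow> g \<in> \<Gamma>0 c \<Longrightarrow> \<exists>h. rel l c g h"
  using phi_equivariant[of l g c] by (auto simp: rel_def)

lemma rel_mult:
  assumes l: "l \<in> L" and "rel l c g h" "rel l c g' h'"
  shows "rel l c (g ** g') (h ** h')"
  using assms subgroup_SL2R_D(3)[OF limit_group(1)] subgroup_SL2R_D(3)[OF group_l[OF l]]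
    rel_carrier[OF l assms(2)] rel_carrier[OF l assms(3)] mob_uhp phi_uhp[OF l]
  by (auto simp: rel_def mob_mult)

lemma rel_inv:
  assumes l: "l \<in> L" and r: "rel l c g h"
  shows "rel l c (matrix_inv g) (matrix_inv h)"
proof -
  note c = rel_carrier[OF l r]
  have "\<phi> l c (mob (matrix_inv g) z) = mob (matrix_inv h) (\<phi> l c z)" if z: "z \<in> uhp" for z
  proof -
    have gz: "mob (matrix_inv g) z \<in> uhp" by (rule mob_uhp[OF SL2R_inv[OF c(1)] z])
    have "\<phi> l c z = mob h (\<phi> l c (mob (matrix_inv g) z))"
      using relD[OF r gz] by (simp add: mob_inv_cancel c z)
    then show ?thesis using mob_inv_cancel(1)[OF c(2) phi_uhp[OF l gz]] by simp
  qed
  then show ?thesis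
    using r subgroup_SL2R_D(4)[OF limit_group(1)] subgroup_SL2R_D(4)[OF group_l[OF l]] by (simp add: rel_def)
qed

lemma rel_minus: "l \<in> L \<Longrightarrow> rel l c g h \<Longrightarrow> rel l c g (- h)"
  using gamma_minus by (simp add: rel_def)

lemma rel_cj: "l \<in> L \<Longrightarrow> rel l c k m \<Longrightarrow> rel l c g h \<Longrightarrow> rel l c (cj k g) (cj m h)"
  unfolding cj_def by (intro rel_mult rel_inv)

lemma rel_quad:
  assumes "l \<in> L" "rel l c g h" "h' \<in> quad h"
  shows "\<exists>g'\<in>quad g. rel l c g' h'"
  using assms rel_minus rel_inv unfolding quad_def by blast

lemma phi_neq: "l \<in> L \<Longrightarrow> z \<in> uhp \<Longrightarrow> w \<in> uhp \<Longrightarrow> z \<noteq> w \<Longrightarrow> \<phi> l c z \<noteq> \<phi> l c w"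
  using phi_inj[of l c] by (auto dest: inj_onD)

lemma rel_unique_left:
  assumes l: "l \<in> L" and r: "rel l c g h" "rel l c g' h"
  shows "g' = g \<or> g' = - g"
proof (rule mob_eq_all_imp)
  show "g' \<in> carrier SL2R" "g \<in> carrier SL2R" using rel_carrier[OF l] r by auto
  then show "mob g' z = mob g z" if "z \<in> uhp" for z
    using relD[OF r(1) that] relD[OF r(2) that] phi_neq[OF l] mob_uhp that by metis
qed

text \<open>Only points in the image of \<open>\<phi> l c\<close> can serve as test points for h and
  h'; by injectivity the images of \<open>\<i>\<close> and \<open>2 * \<i>\<close> are distinct, and
  two points fix a matrix up to sign.\<close>

lemma rel_unique_right:
  assumes l: "l \<in> L" and r: "rel l c g h" "rel l c g h'"
  shows "h' = h \<or> h' = - h"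
proof (rule mob_eq2_imp)
  have u: "\<i> \<in> uhp" "2 * \<i> \<in> uhp" by (simp_all add: uhp_def)
  show "h' \<in> carrier SL2R" "h \<in> carrier SL2R" using rel_carrier[OF l] r by auto
  show "\<phi> l c \<i> \<in> uhp" "\<phi> l c (2 * \<i>) \<in> uhp" using u phi_uhp[OF l] by auto
  show "\<phi> l c \<i> \<noteq> \<phi> l c (2 * \<i>)" using phi_neq[OF l u] by simp
  show "mob h' (\<phi> l c \<i>) = mob h (\<phi> l c \<i>)" "mob h' (\<phi> l c (2 * \<i>)) = mob h (\<phi> l c (2 * \<i>))"
    using relD[OF r(1)] relD[OF r(2)] u by metis+
qed

lemma rel_quad_right:
  assumes l: "l \<in> L" and r: "rel l c g h" "rel l c g' h'" and q: "quad g = quad g'"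
  shows "quad h = quad h'"
proof -
  note c = rel_carrier[OF l r(1)] rel_carrier[OF l r(2)]
  have "rel l c g h \<or> rel l c g (- h)" using r by blast
  have "g \<in> quad g'" using quad_self[of g] unfolding q .
  then consider "g = g'" | "g = - g'" | "g = matrix_inv g'" | "g = - matrix_inv g'" by (auto simp: quad_def)
  then have "\<exists>h''\<in>quad h'. rel l c g h''"
  proof cases
    case 1 then show ?thesis using r(2) by auto
  next
    case 2 then show ?thesis using r(1,2) by (auto simp: rel_def intro!: bexI[of _ h'])
  next
    case 3 then show ?thesis using rel_inv[OF l r(2)] by (auto simp: quad_def)
  next
    case 4 then show ?thesis using rel_inv[OF l r(2)] r(1) by (auto simp: rel_def quad_def)
  qed
  then obtain h'' where h: "h'' \<in> quad h'" "rel l c g h''" by blast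
  have h''c: "h'' \<in> carrier SL2R" using rel_carrier(2)[OF l h(2)] .
  have "h \<in> quad h''" using rel_unique_right[OF l h(2) r(1)] by (auto simp: quad_def)
  then show ?thesis using quad_eq[OF h''c, of h] quad_eq[OF c(4) h(1)] by simp
qed

lemma rel_quad_left:
  assumes l: "l \<in> L" and r: "rel l c g h" "rel l c g' h'" and q: "quad h = quad h'"
  shows "quad g = quad g'"
proof -
  note c = rel_carrier[OF l r(1)] rel_carrier[OF l r(2)]
  have "h \<in> quad h'" using quad_self[of h] unfolding q .
  then obtain g'' where g: "g'' \<in> quad g'" "rel l c g'' h" using rel_quad[OF l r(2)] by blast
  have "g \<in> quad g''" using rel_unique_left[OF l g(2) r(1)] by (auto simp: quad_def)
  then show ?thesis using quad_eq[OF rel_carrier(1)[OF l g(2)], of g] quad_eq[OF c(3) g(1)] by simp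
qed

lemma rel_disp:
  assumes "l \<in> L" "rel l c g h" "z \<in> uhp"
  shows "disp h (\<phi> l c z) = 2 * sinh (hdist (\<phi> l c z) (\<phi> l c (mob g z)) / 2)"
  using disp_eq_hdist[OF rel_carrier(2)[OF assms(1,2)] phi_uhp[OF assms(1,3)]] relD[OF assms(2,3)] by simp

text \<open>On the open set N of points that h keeps inside the image of \<open>\<phi>\<close>,
  injectivity on the quotient supplies an element g of the limit group, which may depend on the
  point. As N is uncountable and the group countable, one g serves two distinct points, and then h
  agrees up to sign with an image of g.\<close>

lemma rel_from_point:
  assumes l: "l \<in> L" and h: "h \<in> \<Gamma> l" and z: "z \<in> uhp" and w: "w \<in> uhp"
    and eq: "\<phi> l c' w = mob h (\<phi> l c z)"
  shows "c' = c \<and> (\<exists>g. rel l c g h)"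
proof -
  have cc: "c' = c" using phi_quotient_inj[OF l h z w eq] by simp
  have hc: "h \<in> carrier SL2R" using gamma_carrier[OF l h] .
  define N where "N = uhp \<inter> (\<lambda>z. mob h (\<phi> l c z)) -` (\<phi> l c ` uhp)"
  have "open (\<phi> l c ` uhp)"
    by (rule invariance_of_domain[OF phi_continuous[OF l] open_uhp phi_inj[OF l]])
  moreover have "continuous_on uhp (\<lambda>z. mob h (\<phi> l c z))"
    by (rule continuous_on_compose2[OF continuous_on_mob[OF hc order_refl] phi_continuous[OF l]])
       (use phi_uhp[OF l] in auto)
  ultimately have "open N" unfolding N_def using open_uhp by (simp add: continuous_open_preimage)
  moreover have zN: "z \<in> N" using z w eq by (auto simp: N_def cc intro!: image_eqI[of _ _ w])
  ultimately obtain r where r: "0 < r" "ball z r \<subseteq> N" using open_contains_ball by blast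
  then have unc: "uncountable N" using uncountable_ball[OF r(1), of z] countable_subset by blast
  define A where "A g = {z \<in> N. \<phi> l c (mob g z) = mob h (\<phi> l c z)}" for g
  have "N \<subseteq> (\<Union>g\<in>\<Gamma>0 c. A g)"
  proof
    fix u assume u: "u \<in> N"
    then obtain v where v: "u \<in> uhp" "v \<in> uhp" "\<phi> l c v = mob h (\<phi> l c u)" by (auto simp: N_def)
    then obtain g where "g \<in> \<Gamma>0 c" "v = mob g u" using phi_quotient_inj[OF l h v(1,2,3)] by blast
    then show "u \<in> (\<Union>g\<in>\<Gamma>0 c. A g)" using u v by (auto simp: A_def)
  qed
  then have "\<exists>g\<in>\<Gamma>0 c. uncountable (A g)"
    using unc discrete_countable[OF limit_group] by (meson countable_UN countable_subset)
  then obtain g where g: "g \<in> \<Gamma>0 c" "uncountable (A g)" by blast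
  then obtain u where u: "u \<in> A g" by (metis countable_empty ex_in_conv)
  have "uncountable (A g - {u})" using g(2) by (simp add: uncountable_minus_countable)
  then obtain v where v: "v \<in> A g" "v \<noteq> u" by (metis countable_empty ex_in_conv Diff_iff singletonI)
  obtain k where k: "rel l c g k" using rel_exists[OF l g(1)] by blast
  have uv: "u \<in> uhp" "v \<in> uhp" using u v by (auto simp: A_def N_def)
  have "h = k \<or> h = - k"
  proof (rule mob_eq2_imp[OF hc rel_carrier(2)[OF l k]])
    show "\<phi> l c u \<in> uhp" "\<phi> l c v \<in> uhp" using uv phi_uhp[OF l] by auto
    show "\<phi> l c u \<noteq> \<phi> l c v" using phi_neq[OF l uv] v(2) by simp
    show "mob h (\<phi> l c u) = mob k (\<phi> l c u)" "mob h (\<phi> l c v) = mob k (\<phi> l c v)"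
      using u v relD[OF k uv(1)] relD[OF k uv(2)] by (auto simp: A_def)
  qed
  then show ?thesis using cc k rel_minus[OF l k] by auto
qed

text \<open>Besides a Lipschitz bound, points near \<open>\<phi> l c z\<close> must have preimages
  at a controlled distance. With injectivity this yields the reverse Lipschitz bound
  (\<open>almost_iso_lower\<close>), and the preimages are what brings elements of
  \<open>\<Gamma> l\<close> back to the limit group.\<close>

definition almost_iso :: "real^'p \<Rightarrow> real \<Rightarrow> real \<Rightarrow> complex set \<Rightarrow> bool" where
  "almost_iso l R M K \<longleftrightarrow> l \<in> L \<and> (\<forall>c. \<forall>z\<in>K.
     (\<forall>w\<in>uhp. hdist z w \<le> R \<longrightarrow> hdist (\<phi> l c z) (\<phi> l c w) \<le> M * hdist z w) \<and>
     (\<forall>x\<in>uhp. M * hdist (\<phi> l c z) x < R \<longrightarrow> (\<exists>w\<in>uhp. \<phi> l c w = x \<and> hdist z w \<le> M * hdist (\<phi> l c z) x)))"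

lemma eventually_almost_iso:
  assumes K: "compact K" "K \<subseteq> uhp" and M: "1 < M"
  shows "\<forall>\<^sub>F l in at 0 within L. almost_iso l R M K"
proof -
  \<comment> \<open>The geodesics used leave K, so the metrics are compared on its
    R-neighbourhood.\<close>
  obtain K' where K': "compact K'" "K' \<subseteq> uhp" "\<And>z w. z \<in> K \<Longrightarrow> w \<in> uhp \<Longrightarrow> hdist z w \<le> R \<Longrightarrow> w \<in> K'"
    using hdist_neighborhood_compact[OF K] by metis
  obtain \<epsilon> where \<epsilon>: "0 < \<epsilon>" "\<epsilon> < 1/2" "\<And>c. K' \<subseteq> uhp - developing_nbhd \<Gamma>0 cmp q \<epsilon> c"
    using compact_avoids_developing_nbhd[of \<Gamma>0 cmp q K', OF limit_group developing K'(1,2)] by metis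
  \<comment> \<open>Metric convergence compares squared lengths, so e has to satisfy both 1 + e <=
    M^2 and 1 - e >= 1 / M^2.\<close>
  define e where "e = min (M\<^sup>2 - 1) (1 - 1 / M\<^sup>2)"
  have M2: "1 < M\<^sup>2" using M by (simp add: one_less_power)
  then have "1 / M\<^sup>2 < 1 / 1" by (intro divide_strict_left_mono) auto
  with M2 have e: "0 < e" "1 + e \<le> M\<^sup>2" "1 / M\<^sup>2 \<le> 1 - e" by (auto simp: e_def)
  have "\<forall>\<^sub>F l in at 0 within L. l \<in> L" by (simp add: eventually_at_filter)
  then show ?thesis using metric_convergence[OF \<epsilon>(1,2) e(1)]
  proof eventually_elim
    fix l assume l: "l \<in> L"
      and mc: "\<forall>c. \<forall>z \<in> uhp - developing_nbhd \<Gamma>0 cmp q \<epsilon> c. \<forall>v.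
            \<bar>(norm (frechet_derivative (\<phi> l c) (at z) v))\<^sup>2 / (Im (\<phi> l c z))\<^sup>2 - (norm v)\<^sup>2 / (Im z)\<^sup>2\<bar>
              \<le> e * ((norm v)\<^sup>2 / (Im z)\<^sup>2)"
    have bnd: "cmod (frechet_derivative (\<phi> l c) (at u) v) / Im (\<phi> l c u) \<le> M * (cmod v / Im u) \<and>
       cmod v / Im u \<le> M * (cmod (frechet_derivative (\<phi> l c) (at u) v) / Im (\<phi> l c u))" if u: "u \<in> K'" for c u v
    proof -
      define A where "A = cmod (frechet_derivative (\<phi> l c) (at u) v) / Im (\<phi> l c u)"
      define B where "B = cmod v / Im u"
      have uu: "u \<in> uhp" using u K' by blast
      have pos: "0 < Im u" "0 < Im (\<phi> l c u)" using uu phi_uhp[OF l uu] by (auto simp: uhp_def)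
      have AB: "0 \<le> A" "0 \<le> B" using pos by (simp_all add: A_def B_def)
      have "\<bar>A\<^sup>2 - B\<^sup>2\<bar> \<le> e * B\<^sup>2"
        using mc \<epsilon>(3)[of c] u unfolding A_def B_def power_divide by blast
      then have "A\<^sup>2 \<le> (1 + e) * B\<^sup>2" "(1 - e) * B\<^sup>2 \<le> A\<^sup>2" by (simp_all add: algebra_simps abs_le_iff)
      moreover have "(1 + e) * B\<^sup>2 \<le> M\<^sup>2 * B\<^sup>2" "1 / M\<^sup>2 * B\<^sup>2 \<le> (1 - e) * B\<^sup>2"
        using e by (intro mult_right_mono; simp)+
      ultimately have "A\<^sup>2 \<le> (M * B)\<^sup>2" "B\<^sup>2 / M\<^sup>2 \<le> A\<^sup>2" by (simp_all add: power_mult_distrib)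
      moreover from this have "B\<^sup>2 \<le> (M * A)\<^sup>2" using M M2 pos_divide_le_eq[of "M\<^sup>2" "B\<^sup>2" "A\<^sup>2"]
        by (simp add: power_mult_distrib mult.commute)
      ultimately have "A \<le> M * B" "B \<le> M * A" using AB M by (auto intro: power2_le_imp_le)
      then show ?thesis by (simp add: A_def B_def)
    qed
    show "almost_iso l R M K"
      unfolding almost_iso_def
    proof (intro conjI l allI ballI impI)
      fix c z w assume z: "z \<in> K" and w: "w \<in> uhp" and R: "hdist z w \<le> R"
      have zu: "z \<in> uhp" using z K by blast
      show "hdist (\<phi> l c z) (\<phi> l c w) \<le> M * hdist z w"
        by (rule hdist_image_le[where f = "\<phi> l c" and M = M and R = R, OF zu w R]) (use phi_uhp[OF l] phi_diff[OF l] bnd K'(3)[OF z] in auto)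
    next
      fix c z x assume z: "z \<in> K" and x: "x \<in> uhp" and R: "M * hdist (\<phi> l c z) x < R"
      have zu: "z \<in> uhp" using z K by blast
      obtain w where "w \<in> uhp" "\<phi> l c w = x" "hdist z w \<le> M * hdist (\<phi> l c z) x"
        by (rule hdist_lift[where f = "\<phi> l c" and M = M and R = R, OF zu x R]) (use M phi_uhp[OF l] phi_diff[OF l] phi_inj[OF l] bnd K'(3)[OF z] in auto)
      then show "\<exists>w\<in>uhp. \<phi> l c w = x \<and> hdist z w \<le> M * hdist (\<phi> l c z) x" by blast
    qed
  qed
qed

lemma almost_isoD:
  assumes "almost_iso l R M K" "z \<in> K" "w \<in> uhp"
  shows "l \<in> L" "hdist z w \<le> R \<Longrightarrow> hdist (\<phi> l c z) (\<phi> l c w) \<le> M * hdist z w"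
    "M * hdist (\<phi> l c z) w < R \<Longrightarrow> \<exists>u\<in>uhp. \<phi> l c u = w \<and> hdist z u \<le> M * hdist (\<phi> l c z) w"
  using assms unfolding almost_iso_def by auto

lemma almost_iso_lower:
  assumes a: "almost_iso l R M K" and z: "z \<in> K" and w: "w \<in> uhp" and R: "hdist z w \<le> R"
  shows "hdist z w \<le> M * hdist (\<phi> l c z) (\<phi> l c w)"
proof (cases "M * hdist (\<phi> l c z) (\<phi> l c w) < R")
  case True
  note l = almost_isoD(1)[OF a z w]
  obtain u where u: "u \<in> uhp" "\<phi> l c u = \<phi> l c w" "hdist z u \<le> M * hdist (\<phi> l c z) (\<phi> l c w)"
    using almost_isoD(3)[OF a z phi_uhp[OF l w] True] by blast
  then have "u = w" using phi_neq[OF l] w by blast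
  then show ?thesis using u by simp
qed (use R in simp)

lemma eventually_hdist_close:
  assumes K: "compact K" "K \<subseteq> uhp" and r: "0 < r"
  shows "\<forall>\<^sub>F l in at 0 within L. \<forall>c. \<forall>z\<in>K. \<forall>w\<in>uhp. hdist z w \<le> R \<longrightarrow>
    \<bar>hdist (\<phi> l c z) (\<phi> l c w) - hdist z w\<bar> < r"
proof (cases "R < 0")
  case True
  then show ?thesis using K hdist_nonneg by (intro always_eventually) force
next
  case False
  \<comment> \<open>The relative error M - 1 then costs less than r on distances up to R; R + 1
    keeps the denominator positive when R = 0.\<close>
  define M where "M = 1 + r / (2 * (R + 1))"
  have "R / (2 * (R + 1)) < 1" "0 < R + 1" using False by (simp_all add: field_simps)
  then have M: "1 < M" "(M - 1) * R < r"
    using r mult_strict_left_mono[of "R / (2 * (R + 1))" 1 r] by (simp_all add: M_def)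
  from eventually_almost_iso[OF K M(1), of R] show ?thesis
  proof (eventually_elim, intro allI ballI impI)
    fix l c z w assume a: "almost_iso l R M K" and z: "z \<in> K" and w: "w \<in> uhp" and R: "hdist z w \<le> R"
    define D where "D = hdist z w"
    define D' where "D' = hdist (\<phi> l c z) (\<phi> l c w)"
    note l = almost_isoD(1)[OF a z w]
    have zu: "z \<in> uhp" using z K by blast
    have D: "0 \<le> D" "0 \<le> D'" "D \<le> R" using hdist_nonneg zu w phi_uhp[OF l] R by (auto simp: D_def D'_def)
    have 1: "D' \<le> M * D" using almost_isoD(2)[OF a z w R] by (simp add: D_def D'_def)
    have 2: "D \<le> M * D'" using almost_iso_lower[OF a z w R] by (simp add: D_def D'_def)
    have "(M - 1) * D \<le> (M - 1) * R" using D M by (intro mult_left_mono) auto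
    then have up: "D' - D < r" using 1 M by (simp add: algebra_simps)
    have "D - D' < r"
    proof (cases "D' \<le> D")
      case True
      have "D - D' \<le> (M - 1) * D'" using 2 by (simp add: algebra_simps)
      also have "\<dots> \<le> (M - 1) * R" using True D M by (intro mult_left_mono) auto
      finally show ?thesis using M by simp
    qed (use r in simp)
    then show "\<bar>hdist (\<phi> l c z) (\<phi> l c w) - hdist z w\<bar> < r" using up by (simp add: D_def D'_def)
  qed
qed

lemma hdist_tendsto:
  assumes "z \<in> uhp" "w \<in> uhp"
  shows "((\<lambda>l. hdist (\<phi> l c z) (\<phi> l c w)) \<longlongrightarrow> hdist z w) (at 0 within L)"
proof (rule tendstoI)
  fix e :: real assume "0 < e"
  from eventually_hdist_close[of "{z}", OF _ _ this, of "hdist z w"] assms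
  show "\<forall>\<^sub>F l in at 0 within L. dist (hdist (\<phi> l c z) (\<phi> l c w)) (hdist z w) < e"
    by (auto simp: dist_real_def elim!: eventually_mono)
qed

text \<open>The displaced point is close enough to have a preimage, and
  \<open>rel_from_point\<close> identifies h from that single value. So elements of small
  displacement over K come from the limit group, whatever else \<open>\<Gamma> l\<close>
  contains.\<close>

lemma rel_of_small_disp:
  assumes a: "almost_iso l R M K" and z: "z \<in> K" "z \<in> uhp" and h: "h \<in> \<Gamma> l"
    and R: "M * hdist (\<phi> l c z) (mob h (\<phi> l c z)) < R"
  shows "\<exists>g. rel l c g h \<and> hdist z (mob g z) \<le> M * hdist (\<phi> l c z) (mob h (\<phi> l c z))"
proof -
  note l = almost_isoD(1)[OF a z]
  have hz: "mob h (\<phi> l c z) \<in> uhp" using mob_uhp[OF gamma_carrier[OF l h] phi_uhp[OF l z(2)]] .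
  obtain w where w: "w \<in> uhp" "\<phi> l c w = mob h (\<phi> l c z)" "hdist z w \<le> M * hdist (\<phi> l c z) (mob h (\<phi> l c z))"
    using almost_isoD(3)[OF a z(1) hz R] by blast
  obtain g where g: "rel l c g h" using rel_from_point[OF l h z(2) w(1,2)] by blast
  have "\<phi> l c (mob g z) = \<phi> l c w" using relD[OF g z(2)] w(2) by simp
  then have "mob g z = w" using phi_neq[OF l mob_uhp[OF rel_carrier(1)[OF l g] z(2)] w(1)] by blast
  then show ?thesis using g w(3) by blast
qed

text \<open>Here the two points may a priori lie on different components; being close in the surface
  of l forces the components to agree.\<close>

lemma rel_of_near:
  assumes a: "almost_iso l R M {z1}" and z: "z1 \<in> uhp" "z \<in> uhp" and k: "k \<in> \<Gamma> l"
    and R: "M * hdist (\<phi> l c1 z1) (mob k (\<phi> l c z)) < R"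
  shows "c1 = c \<and> (\<exists>g. rel l c g k)"
proof -
  note l = almost_isoD(1)[OF a singletonI z(1)]
  have kz: "mob k (\<phi> l c z) \<in> uhp" using mob_uhp[OF gamma_carrier[OF l k] phi_uhp[OF l z(2)]] .
  obtain w where w: "w \<in> uhp" "\<phi> l c1 w = mob k (\<phi> l c z)"
    using almost_isoD(3)[OF a singletonI kz R] by blast
  show ?thesis by (rule rel_from_point[OF l k z(2) w])
qed

text \<open>A very small displacement over K would come from the limit group with at most twice the
  size, against the lower bound there. So the shortness of pinching elements is not seen over
  K.\<close>

lemma eventually_hdist_bounded_below:
  assumes K: "compact K" "K \<subseteq> uhp"
  obtains b where "0 < b" "b \<le> 1"
    "\<forall>\<^sub>F l in at 0 within L. \<forall>c. \<forall>z\<in>K. \<forall>h\<in>\<Gamma> l. (\<forall>u\<in>uhp. mob h u \<noteq> u) \<longrightarrow> b \<le> hdist (\<phi> l c z) (mob h (\<phi> l c z))"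
proof -
  have "\<exists>b>0. \<forall>g z. g \<in> \<Gamma>0 c \<longrightarrow> (\<forall>u\<in>uhp. mob g u \<noteq> u) \<longrightarrow> z \<in> K \<longrightarrow> b \<le> hdist z (mob g z)" for c
    using discrete_displacement_lower_bound[OF limit_group K] by metis
  then obtain b0 where b0: "\<And>c. 0 < b0 c"
    "\<And>c g z. g \<in> \<Gamma>0 c \<Longrightarrow> \<forall>u\<in>uhp. mob g u \<noteq> u \<Longrightarrow> z \<in> K \<Longrightarrow> b0 c \<le> hdist z (mob g z)" by metis
  \<comment> \<open>Division by 2 compensates the factor M = 2, and the entry 1 keeps the
    displacements within the radius 3 of \<open>almost_iso\<close> below.\<close>
  define b where "b = Min (insert 1 (range b0)) / 2"
  have b: "0 < b" "b \<le> 1" and bb: "2 * b \<le> b0 c" for c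
  proof -
    have "0 < Min (insert 1 (range b0))" using b0(1) by (subst Min_gr_iff) auto
    moreover have "Min (insert 1 (range b0)) \<le> 1" "Min (insert 1 (range b0)) \<le> b0 c" by (rule Min_le; simp)+
    ultimately show "0 < b" "b \<le> 1" "2 * b \<le> b0 c" by (simp_all add: b_def)
  qed
  have "\<forall>\<^sub>F l in at 0 within L. almost_iso l 3 2 K" by (rule eventually_almost_iso[OF K]) simp
  then have "\<forall>\<^sub>F l in at 0 within L. \<forall>c. \<forall>z\<in>K. \<forall>h\<in>\<Gamma> l. (\<forall>u\<in>uhp. mob h u \<noteq> u) \<longrightarrow> b \<le> hdist (\<phi> l c z) (mob h (\<phi> l c z))"
  proof (eventually_elim, intro allI ballI impI)
    fix l c z h assume a: "almost_iso l 3 2 K" and z: "z \<in> K" and h: "h \<in> \<Gamma> l" and nf: "\<forall>u\<in>uhp. mob h u \<noteq> u"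
    have zu: "z \<in> uhp" using z K by blast
    note l = almost_isoD(1)[OF a z zu]
    show "b \<le> hdist (\<phi> l c z) (mob h (\<phi> l c z))"
    proof (rule ccontr)
      assume small: "\<not> b \<le> hdist (\<phi> l c z) (mob h (\<phi> l c z))"
      obtain g where g: "rel l c g h" "hdist z (mob g z) \<le> 2 * hdist (\<phi> l c z) (mob h (\<phi> l c z))"
        using rel_of_small_disp[OF a z zu h, of c] small b by auto
      have "\<forall>u\<in>uhp. mob g u \<noteq> u" using relD[OF g(1)] nf phi_uhp[OF l] by metis
      then have "b0 c \<le> hdist z (mob g z)" using b0(2)[of g c] g(1) z by (simp add: rel_def)
      then show False using g(2) small bb[of c] by linarith
    qed
  qed
  then show thesis using that b by blast
qed

text \<open>
  The element \<open>\<kappa>\<^sup>-\<^sup>1 g0\<^sup>-\<^sup>1 k\<close> moves \<open>\<phi> l c z\<close> close to \<open>\<phi> l c1 z1\<close>, so it comes from the limit group; it conjugates \<open>h1\<close> to \<open>h\<close>.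
\<close>

lemma conj_transfer:
  assumes a: "almost_iso l R M {z1}" and z: "z1 \<in> uhp" "z \<in> uhp" and g: "\<gamma> \<in> \<Gamma> l"
    and r1: "rel l c1 \<gamma>1 h1" and h1: "\<kappa> \<in> \<Gamma> l" "h1 \<in> quad (cj \<kappa> \<gamma>)"
    and h: "k \<in> \<Gamma> l" "h \<in> quad (cj k \<gamma>)" and g0: "g0 \<in> \<Gamma> l" "g0 ** \<gamma> = \<gamma> ** g0"
    and R: "M * hdist (mob k (\<phi> l c z)) (mob g0 (mob \<kappa> (\<phi> l c1 z1))) < R"
  shows "c1 = c \<and> (\<exists>g. rel l c g h \<and> quad g \<in> cls (\<Gamma>0 c) \<gamma>1)"
proof -
  note l = almost_isoD(1)[OF a singletonI z(1)]
  note sub = subgroup_SL2R_D[OF group_l[OF l]]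
  have cr: "\<gamma> \<in> carrier SL2R" "\<kappa> \<in> carrier SL2R" "k \<in> carrier SL2R" "g0 \<in> carrier SL2R" using sub g h1 h g0 by auto
  have u: "\<phi> l c1 z1 \<in> uhp" "\<phi> l c z \<in> uhp" using phi_uhp[OF l] z by auto
  define m where "m = matrix_inv \<kappa> ** (matrix_inv g0 ** k)"
  have m: "m \<in> \<Gamma> l" using sub h1 g0 h by (simp add: m_def)
  have mc: "m \<in> carrier SL2R" using sub(1)[OF m] .
  have "mob m (\<phi> l c z) = mob (matrix_inv \<kappa>) (mob (matrix_inv g0) (mob k (\<phi> l c z)))"
    by (simp add: m_def mob_mult SL2R_mult SL2R_inv cr u mob_uhp)
  then have "hdist (\<phi> l c1 z1) (mob m (\<phi> l c z)) = hdist (mob (matrix_inv \<kappa>) (mob (matrix_inv g0) (mob k (\<phi> l c z)))) (\<phi> l c1 z1)"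
    by (simp add: hdist_commute)
  also have "\<dots> = hdist (mob k (\<phi> l c z)) (mob g0 (mob \<kappa> (\<phi> l c1 z1)))"
    by (simp add: hdist_mob_inv cr u mob_uhp SL2R_inv)
  finally have "M * hdist (\<phi> l c1 z1) (mob m (\<phi> l c z)) < R" using R by simp
  from rel_of_near[OF a z m this] obtain g' where cc: "c1 = c" and g': "rel l c g' m" by blast
  have r1': "rel l c (cj g' \<gamma>1) (cj m h1)" using rel_cj[OF l g'] r1 cc by simp
  \<comment> \<open>Conjugating by m cancels \<kappa> and brings in k, and g0 disappears because it
    commutes with \<gamma>.\<close>
  have "cj m h1 \<in> quad (cj m (cj \<kappa> \<gamma>))" by (rule quad_cj[OF mc cj_carrier[OF cr(2,1)] h1(2)])
  also have "cj m (cj \<kappa> \<gamma>) = cj (\<kappa> ** m) \<gamma>" by (simp add: cj_mult cr mc)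
  also have "\<kappa> ** m = matrix_inv g0 ** k" by (simp add: m_def SL2R_cancel cr)
  also have "cj (matrix_inv g0 ** k) \<gamma> = cj k (cj (matrix_inv g0) \<gamma>)" by (simp add: cj_mult SL2R_inv cr)
  also have "cj (matrix_inv g0) \<gamma> = \<gamma>" using cj_inv_cancel(2)[OF cr(4), of \<gamma>] cj_commute[OF cr(4) g0(2)] by simp
  finally have mq: "cj m h1 \<in> quad (cj k \<gamma>)" .
  have "h \<in> quad (cj m h1)" using h(2) quad_eq[OF cj_carrier[OF cr(3,1)] mq] by simp
  then obtain g where g: "g \<in> quad (cj g' \<gamma>1)" "rel l c g h" using rel_quad[OF l r1'] by blast
  have "quad g = quad (cj g' \<gamma>1)" by (rule quad_eq[OF rel_carrier(1)[OF l r1'] g(1)])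
  moreover have "g' \<in> \<Gamma>0 c" using g' by (simp add: rel_def)
  ultimately show ?thesis using cc g(2) by (auto simp: cls_def)
qed

end

section \<open>Splitting the series into a finite head and a uniformly small tail\<close>

lemma le_disp:
  assumes "h \<in> carrier SL2R" "z \<in> uhp"
  shows "hdist z (mob h z) \<le> disp h z"
  using le_sinh[of "hdist z (mob h z) / 2"] hdist_nonneg[OF assms(2) mob_uhp[OF assms]]
  by (simp add: disp_eq_hdist[OF assms])

lemma cls_union_shell_count:
  assumes G: "subgroup \<Gamma> SL2R" and Q: "finite Q" "Q \<subseteq> \<Gamma>" and sc: "\<And>p. p \<in> Q \<Longrightarrow> \<exists>side \<tau>. strip_coords \<Gamma> p side \<tau>"
    and x: "x \<in> uhp" and fin: "finite {h \<in> \<Gamma>. hdist x (mob h x) \<le> box_radius 2}"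
    and m: "card {h \<in> \<Gamma>. hdist x (mob h x) \<le> box_radius 2} \<le> m"
  shows "finite {X \<in> (\<Union>p\<in>Q. cls \<Gamma> p). val X x \<in> {2 ^ k..2 * 2 ^ k}} \<and>
    card {X \<in> (\<Union>p\<in>Q. cls \<Gamma> p). val X x \<in> {2 ^ k..2 * 2 ^ k}} \<le> (card Q * (2 * m)) * 2 ^ k"
proof -
  define A where "A p = {X \<in> cls \<Gamma> p. val X x \<in> {2 ^ k..2 * 2 ^ k}}" for p
  have A: "finite (A p) \<and> card (A p) \<le> 2 * 2 ^ k * m" if p: "p \<in> Q" for p
  proof -
    obtain side \<tau> where "strip_coords \<Gamma> p side \<tau>" using sc[OF p] by blast
    from cls_count[OF this G _ x fin m, of "2 ^ k"] p Q show ?thesis by (auto simp: A_def)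
  qed
  have eq: "{X \<in> (\<Union>p\<in>Q. cls \<Gamma> p). val X x \<in> {2 ^ k..2 * 2 ^ k}} = (\<Union>p\<in>Q. A p)" by (auto simp: A_def)
  have "card (\<Union>p\<in>Q. A p) \<le> (\<Sum>p\<in>Q. card (A p))" by (rule card_UN_le[OF Q(1)])
  also have "\<dots> \<le> (\<Sum>p\<in>Q. 2 * 2 ^ k * m)" using A by (intro sum_mono) auto
  also have "\<dots> = (card Q * (2 * m)) * 2 ^ k" by simp
  finally show ?thesis unfolding eq using A Q by auto
qed

lemma esum_split:
  assumes cnt: "\<And>k. k0 \<le> k \<Longrightarrow> finite {X \<in> I. val X z \<in> {2 ^ k..2 * 2 ^ k}} \<and> card {X \<in> I. val X z \<in> {2 ^ k..2 * 2 ^ k}} \<le> C * 2 ^ k"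
    and A: "finite A" "A \<subseteq> I" "\<And>X. X \<in> I - A \<Longrightarrow> 2 ^ k0 \<le> val X z" and \<delta>: "0 < \<delta>" "1 + \<delta> \<le> Re s"
  shows "(\<lambda>X. of_real (val X z) powr (- s)) summable_on I"
    "cmod (esum I s z - (\<Sum>X\<in>A. of_real (val X z) powr (- s))) \<le> real C * (2 powr - \<delta>) ^ k0 / (1 - 2 powr - \<delta>)"
proof -
  define f where "f X = (of_real (val X z) powr (- s) :: complex)" for X
  have B: "f summable_on (I - A)" "cmod (infsum f (I - A)) \<le> real C * (2 powr - \<delta>) ^ k0 / (1 - 2 powr - \<delta>)"
    unfolding f_def by (rule dyadic_tail_powr[OF cnt Diff_subset A(3) \<delta>]; assumption)+
  have fA: "f summable_on A" using A(1) by simp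
  have I: "A \<union> (I - A) = I" using A(2) by blast
  have "f summable_on (A \<union> (I - A))" using fA B(1) by (intro summable_on_Un_disjoint) auto
  then show "(\<lambda>X. of_real (val X z) powr (- s)) summable_on I" unfolding I f_def[abs_def] .
  have "infsum f (A \<union> (I - A)) = infsum f A + infsum f (I - A)" using fA B(1) by (intro infsum_Un_disjoint) auto
  then have "esum I s z = (\<Sum>X\<in>A. f X) + infsum f (I - A)"
    unfolding I infsum_finite[OF A(1)] esum_def f_def[abs_def] .
  then show "cmod (esum I s z - (\<Sum>X\<in>A. of_real (val X z) powr (- s))) \<le> real C * (2 powr - \<delta>) ^ k0 / (1 - 2 powr - \<delta>)"
    using B(2) by (simp add: f_def)
qed

lemma continuous_on_val_powr:
  assumes "0 < a"
  shows "continuous_on ({a..b} \<times> S) (\<lambda>(v, s). of_real v powr (- s :: complex))"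
  unfolding case_prod_unfold using assms
  by (intro continuous_intros continuous_on_powr_complex) (auto simp: complex_nonpos_Reals_iff)

lemma cls_elem:
  assumes "subgroup \<Gamma> SL2R" "p \<in> \<Gamma>" "X \<in> cls \<Gamma> p"
  obtains g \<eta> where "g = cj \<eta> p" "\<eta> \<in> \<Gamma>" "g \<in> \<Gamma>" "X = quad g"
  using assms cj_subgroup by (auto simp: cls_def)

context degenerating_family
begin

text \<open>By \<open>le_disp\<close> a bounded value bounds the displacement, which leaves finitely
  many elements. The bounds b and D then keep the bases of the powers in a compact set of positive
  reals, where powr is uniformly continuous.\<close>

lemma limit_head:
  fixes V :: real
  assumes Q: "finite Q" "Q \<subseteq> \<Gamma>0 c" "\<And>p u. p \<in> Q \<Longrightarrow> u \<in> uhp \<Longrightarrow> 0 < disp p u" and K: "compact K" "K \<subseteq> uhp"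
  defines "I \<equiv> (\<Union>p\<in>Q. cls (\<Gamma>0 c) p)"
  defines "A \<equiv> {X \<in> I. \<exists>z\<in>K. val X z \<le> V}"
  shows "finite A" "\<exists>b D. 0 < b \<and> (\<forall>g z. g \<in> \<Gamma>0 c \<longrightarrow> quad g \<in> A \<longrightarrow> z \<in> K \<longrightarrow> b \<le> hdist z (mob g z) \<and> hdist z (mob g z) \<le> D)"
proof -
  note G = limit_group
  define H where "H = {g \<in> \<Gamma>0 c. \<exists>z\<in>K. hdist z (mob g z) \<le> V}"
  have finH: "finite H" unfolding H_def by (rule discrete_displacement_finite[OF G K])
  have memH: "g \<in> H" if g: "g \<in> \<Gamma>0 c" "quad g \<in> A" for g
  proof -
    have gc: "g \<in> carrier SL2R" using gamma0_carrier[OF g(1)] .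
    obtain z where z: "z \<in> K" "disp g z \<le> V" using g(2) val_quad[OF gc] by (auto simp: A_def)
    then have "hdist z (mob g z) \<le> V" using le_disp[OF gc, of z] K by fastforce
    then show ?thesis using g z by (auto simp: H_def)
  qed
  show "finite A"
  proof (rule finite_subset)
    show "A \<subseteq> quad ` H"
    proof
      fix X assume X: "X \<in> A"
      then obtain p where p: "p \<in> Q" "X \<in> cls (\<Gamma>0 c) p" by (auto simp: A_def I_def)
      obtain g \<eta> where "g \<in> \<Gamma>0 c" "X = quad g" using cls_elem[OF G(1) _ p(2)] Q(2) p(1) by blast
      then show "X \<in> quad ` H" using memH X by blast
    qed
  qed (use finH in simp)
  have nofix: "\<forall>u\<in>uhp. mob g u \<noteq> u" if g: "g \<in> \<Gamma>0 c" "quad g \<in> A" for g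
  proof
    fix u assume u: "u \<in> uhp"
    have gc: "g \<in> carrier SL2R" using gamma0_carrier[OF g(1)] .
    obtain p where p: "p \<in> Q" "quad g \<in> cls (\<Gamma>0 c) p" using g(2) by (auto simp: A_def I_def)
    have pG: "p \<in> \<Gamma>0 c" "p \<in> carrier SL2R" using p Q gamma0_carrier by auto
    obtain \<eta> where e: "\<eta> \<in> \<Gamma>0 c" "g \<in> quad (cj \<eta> p)" using cls_memD[OF G(1) pG(1) p(2)] by blast
    have ec: "\<eta> \<in> carrier SL2R" using gamma0_carrier[OF e(1)] .
    have "disp g u = disp p (mob \<eta> u)"
      using disp_quad[OF cj_carrier[OF ec pG(2)] e(2)] disp_cj[OF pG(2) ec u] by simp
    then show "mob g u \<noteq> u" using Q(3)[OF p(1) mob_uhp[OF ec u]] disp_pos_iff[OF gc u] by simp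
  qed
  obtain b where b: "0 < b" "\<And>g z. g \<in> \<Gamma>0 c \<Longrightarrow> \<forall>u\<in>uhp. mob g u \<noteq> u \<Longrightarrow> z \<in> K \<Longrightarrow> b \<le> hdist z (mob g z)"
    using discrete_displacement_lower_bound[OF G K] by metis
  have "\<exists>D. \<forall>z\<in>K. hdist z (mob g z) \<le> D" if "g \<in> H" for g
  proof -
    have gc: "g \<in> carrier SL2R" using that gamma0_carrier by (auto simp: H_def)
    have "continuous_on K (\<lambda>z. hdist z (mob g z))"
      using K mob_uhp[OF gc] by (intro continuous_on_hdist continuous_on_mob gc) (auto intro: continuous_intros)
    then have "bounded ((\<lambda>z. hdist z (mob g z)) ` K)"
      using K(1) compact_continuous_image compact_imp_bounded by blast
    then obtain B where "\<forall>x\<in>(\<lambda>z. hdist z (mob g z)) ` K. norm x \<le> B" unfolding bounded_iff by blast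
    then show ?thesis by (intro exI[of _ B]) (auto simp: abs_le_iff)
  qed
  then obtain D where D: "\<And>g z. g \<in> H \<Longrightarrow> z \<in> K \<Longrightarrow> hdist z (mob g z) \<le> D g" by metis
  have "hdist z (mob g z) \<le> Max (insert 0 (D ` H))" if "g \<in> H" "z \<in> K" for g z
    using D[OF that] finH that(1) by (meson Max_ge finite_imageI finite_insert image_eqI insertI2 order_trans)
  then show "\<exists>b D. 0 < b \<and> (\<forall>g z. g \<in> \<Gamma>0 c \<longrightarrow> quad g \<in> A \<longrightarrow> z \<in> K \<longrightarrow> b \<le> hdist z (mob g z) \<and> hdist z (mob g z) \<le> D)"
    using b nofix memH by blast
qed

text \<open>The number m enters the tail bound and therefore must not depend on l. Up to sign, the
  elements of \<open>\<Gamma> l\<close> counted here come from elements of the limit group of at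
  most twice the displacement.\<close>

lemma eventually_orbit_count:
  assumes K: "compact K" "K \<subseteq> uhp"
  shows "\<exists>m. (\<forall>z\<in>K. finite {h \<in> \<Gamma>0 c. hdist z (mob h z) \<le> B} \<and> card {h \<in> \<Gamma>0 c. hdist z (mob h z) \<le> B} \<le> m) \<and>
    (\<forall>\<^sub>F l in at 0 within L. \<forall>z\<in>K. finite {h \<in> \<Gamma> l. hdist (\<phi> l c z) (mob h (\<phi> l c z)) \<le> B} \<and>
       card {h \<in> \<Gamma> l. hdist (\<phi> l c z) (mob h (\<phi> l c z)) \<le> B} \<le> m)"
proof -
  define H where "H = {g \<in> \<Gamma>0 c. \<exists>z\<in>K. hdist z (mob g z) \<le> 2 * \<bar>B\<bar>}"
  have finH: "finite H" unfolding H_def by (rule discrete_displacement_finite[OF limit_group K])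
  have 1: "finite {h \<in> \<Gamma>0 c. hdist z (mob h z) \<le> B} \<and> card {h \<in> \<Gamma>0 c. hdist z (mob h z) \<le> B} \<le> card H * 2" if "z \<in> K" for z
  proof -
    have s: "{h \<in> \<Gamma>0 c. hdist z (mob h z) \<le> B} \<subseteq> H" using that by (force simp: H_def)
    then show ?thesis using finite_subset[OF s finH] card_mono[OF finH s] by simp
  qed
  have "\<forall>\<^sub>F l in at 0 within L. almost_iso l (2 * \<bar>B\<bar> + 1) 2 K" by (rule eventually_almost_iso[OF K]) simp
  then have 2: "\<forall>\<^sub>F l in at 0 within L. \<forall>z\<in>K. finite {h \<in> \<Gamma> l. hdist (\<phi> l c z) (mob h (\<phi> l c z)) \<le> B} \<and>
       card {h \<in> \<Gamma> l. hdist (\<phi> l c z) (mob h (\<phi> l c z)) \<le> B} \<le> card H * 2"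
  proof (eventually_elim, intro ballI)
    fix l z assume a: "almost_iso l (2 * \<bar>B\<bar> + 1) 2 K" and z: "z \<in> K"
    have zu: "z \<in> uhp" using z K by blast
    note l = almost_isoD(1)[OF a z zu]
    \<comment> \<open>An element g is related to at most two matrices, which differ by sign; this is
      the factor 2 in the count.\<close>
    have fib: "finite {h. rel l c g h} \<and> card {h. rel l c g h} \<le> 2" for g
    proof (cases "\<exists>h. rel l c g h")
      case True
      then obtain h where h: "rel l c g h" by blast
      have "{h. rel l c g h} \<subseteq> {h, - h}" using rel_unique_right[OF l h] by blast
      moreover have "card {h, - h} \<le> 2" by (simp add: card_insert_if)
      ultimately show ?thesis by (meson card_mono finite.emptyI finite.insertI finite_subset le_trans)
    qed simp
    have sub: "{h \<in> \<Gamma> l. hdist (\<phi> l c z) (mob h (\<phi> l c z)) \<le> B} \<subseteq> (\<Union>g\<in>H. {h. rel l c g h})"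
    proof
      fix h assume "h \<in> {h \<in> \<Gamma> l. hdist (\<phi> l c z) (mob h (\<phi> l c z)) \<le> B}"
      then have h: "h \<in> \<Gamma> l" "hdist (\<phi> l c z) (mob h (\<phi> l c z)) \<le> \<bar>B\<bar>" by auto
      then obtain g where "rel l c g h" "hdist z (mob g z) \<le> 2 * hdist (\<phi> l c z) (mob h (\<phi> l c z))"
        using rel_of_small_disp[OF a z zu h(1), of c] by auto
      then show "h \<in> (\<Union>g\<in>H. {h. rel l c g h})" using h z by (force simp: H_def rel_def)
    qed
    have "finite (\<Union>g\<in>H. {h. rel l c g h})" using finH fib by auto
    moreover have "card (\<Union>g\<in>H. {h. rel l c g h}) \<le> card H * 2"
    proof -
      have "card (\<Union>g\<in>H. {h. rel l c g h}) \<le> (\<Sum>g\<in>H. card {h. rel l c g h})" by (rule card_UN_le[OF finH])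
      also have "\<dots> \<le> (\<Sum>g\<in>H. 2)" using fib by (intro sum_mono) auto
      finally show ?thesis by simp
    qed
    ultimately show "finite {h \<in> \<Gamma> l. hdist (\<phi> l c z) (mob h (\<phi> l c z)) \<le> B} \<and>
       card {h \<in> \<Gamma> l. hdist (\<phi> l c z) (mob h (\<phi> l c z)) \<le> B} \<le> card H * 2"
      using sub by (meson card_mono finite_subset le_trans)
  qed
  show ?thesis using 1 2 by blast
qed

text \<open>The head is cut at the value 1, so that the tail bound applies with k0 = 0. Boundedness
  is what products of uniform limits require in \<open>scaled_uniform_limit\<close>.\<close>

lemma limit_esum_summable_bounded:
  assumes Q: "finite Q" "Q \<subseteq> \<Gamma>0 c" "\<And>p u. p \<in> Q \<Longrightarrow> u \<in> uhp \<Longrightarrow> 0 < disp p u"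
    and sc: "\<And>p. p \<in> Q \<Longrightarrow> \<exists>side \<tau>. strip_coords (\<Gamma>0 c) p side \<tau>"
    and K: "compact K" "K \<subseteq> uhp" and S: "compact S" and \<delta>: "0 < \<delta>" "\<And>s. s \<in> S \<Longrightarrow> 1 + \<delta> \<le> Re s"
  defines "I \<equiv> (\<Union>p\<in>Q. cls (\<Gamma>0 c) p)"
  shows "\<And>z s. z \<in> K \<Longrightarrow> s \<in> S \<Longrightarrow> (\<lambda>X. of_real (val X z) powr (- s)) summable_on I"
    "bounded ((\<lambda>(z, s). esum I s z) ` (K \<times> S))"
proof -
  define A where "A = {X \<in> I. \<exists>z\<in>K. val X z \<le> 1}"
  have head: "finite A" unfolding A_def I_def by (rule limit_head(1)[OF Q K])
  have "\<exists>b D. 0 < b \<and> (\<forall>g z. g \<in> \<Gamma>0 c \<longrightarrow> quad g \<in> A \<longrightarrow> z \<in> K \<longrightarrow> b \<le> hdist z (mob g z) \<and> hdist z (mob g z) \<le> D)"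
    unfolding A_def I_def by (rule limit_head(2)[OF Q K])
  then obtain b D where bD: "0 < b" "\<And>g z. g \<in> \<Gamma>0 c \<Longrightarrow> quad g \<in> A \<Longrightarrow> z \<in> K \<Longrightarrow> b \<le> hdist z (mob g z) \<and> hdist z (mob g z) \<le> D" by metis
  obtain m where m: "\<forall>z\<in>K. finite {h \<in> \<Gamma>0 c. hdist z (mob h z) \<le> box_radius 2} \<and> card {h \<in> \<Gamma>0 c. hdist z (mob h z) \<le> box_radius 2} \<le> m"
    using eventually_orbit_count[where c = c and B = "box_radius 2", OF K] by blast
  define C where "C = card Q * (2 * m)"
  have cnt: "finite {X \<in> I. val X z \<in> {2 ^ k..2 * 2 ^ k}} \<and> card {X \<in> I. val X z \<in> {2 ^ k..2 * 2 ^ k}} \<le> C * 2 ^ k" if "z \<in> K" for z k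
    unfolding I_def C_def using m[rule_format, OF that] that K by (intro cls_union_shell_count[OF limit_group(1) Q(1,2) sc]) auto
  have big: "2 ^ 0 \<le> val X z" if "X \<in> I - A" "z \<in> K" for X z using that by (force simp: A_def)
  have AI: "A \<subseteq> I" by (auto simp: A_def)
  note split = esum_split[of 0 I _ C A, OF cnt head AI big \<delta>(1) \<delta>(2)]
  show "\<And>z s. z \<in> K \<Longrightarrow> s \<in> S \<Longrightarrow> (\<lambda>X. of_real (val X z) powr (- s)) summable_on I" using split(1) by blast
  define a where "a = 2 * sinh (b/2)"
  have a0: "0 < a" using bD(1) by (simp add: a_def)
  define E where "E = {a..2 * sinh (D/2)} \<times> S"
  have "compact ((\<lambda>(v, s). of_real v powr (- s :: complex)) ` E)"
    unfolding E_def using a0 S by (intro compact_continuous_image continuous_on_val_powr compact_Times) auto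
  then have "bounded ((\<lambda>(v, s). of_real v powr (- s :: complex)) ` E)" by (rule compact_imp_bounded)
  then obtain B where B0: "\<forall>x\<in>(\<lambda>(v, s). of_real v powr (- s :: complex)) ` E. cmod x \<le> B"
    unfolding bounded_iff by blast
  have B: "cmod (of_real v powr - s) \<le> B" if "(v, s) \<in> E" for v s
    using bspec[OF B0 imageI[OF that]] by simp
  have val_in: "val X z \<in> {a..2 * sinh (D/2)}" if X: "X \<in> A" and z: "z \<in> K" for X z
  proof -
    obtain p where p: "p \<in> Q" "X \<in> cls (\<Gamma>0 c) p" using X by (auto simp: A_def I_def)
    obtain g \<eta> where g: "g \<in> \<Gamma>0 c" "X = quad g" using cls_elem[OF limit_group(1) _ p(2)] Q(2) p(1) by blast
    have zu: "z \<in> uhp" using z K by blast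
    have "val X z = 2 * sinh (hdist z (mob g z) / 2)"
      using val_quad[OF gamma0_carrier[OF g(1)]] disp_eq_hdist[OF gamma0_carrier[OF g(1)] zu] g(2) by simp
    then show ?thesis using bD(2)[OF g(1) _ z] X g(2) by (simp add: a_def)
  qed
  have "cmod (esum I s z) \<le> real (card A) * B + real C * (2 powr - \<delta>) ^ 0 / (1 - 2 powr - \<delta>)" if zs: "z \<in> K" "s \<in> S" for z s
  proof -
    have "cmod (of_real (val X z) powr (- s)) \<le> B" if "X \<in> A" for X
      using B[of "val X z" s] val_in[OF that zs(1)] zs(2) by (simp add: E_def)
    then have "cmod (\<Sum>X\<in>A. of_real (val X z) powr (- s)) \<le> real (card A) * B"
      by (intro order_trans[OF norm_sum] sum_bounded_above) auto
    moreover have "cmod (esum I s z - (\<Sum>X\<in>A. of_real (val X z) powr (- s))) \<le> real C * (2 powr - \<delta>) ^ 0 / (1 - 2 powr - \<delta>)"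
      using split(2) zs by blast
    ultimately show ?thesis
      using norm_triangle_ineq[of "esum I s z - (\<Sum>X\<in>A. of_real (val X z) powr (- s))" "\<Sum>X\<in>A. of_real (val X z) powr (- s)"] by simp
  qed
  then show "bounded ((\<lambda>(z, s). esum I s z) ` (K \<times> S))" unfolding bounded_iff by auto
qed

text \<open>
  The heads of the series correspond to each other and converge term by term; the tails are uniformly
  small by \<open>cls_count\<close>.
\<close>

theorem esum_converges:
  assumes Q: "finite Q" "Q \<subseteq> \<Gamma>0 c" "\<And>p u. p \<in> Q \<Longrightarrow> u \<in> uhp \<Longrightarrow> 0 < disp p u"
    and sc0: "\<And>p. p \<in> Q \<Longrightarrow> \<exists>side \<tau>. strip_coords (\<Gamma>0 c) p side \<tau>"
    and gl: "\<And>l. l \<in> L \<Longrightarrow> \<gamma> l \<in> \<Gamma> l" and scl: "\<And>l. l \<in> L \<Longrightarrow> \<exists>side \<tau>. strip_coords (\<Gamma> l) (\<gamma> l) side \<tau>"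
    and sub: "\<And>l p. l \<in> L \<Longrightarrow> p \<in> Q \<Longrightarrow> \<exists>h. rel l c p h \<and> quad h \<in> cls (\<Gamma> l) (\<gamma> l)"
    and sup: "\<And>T. \<forall>\<^sub>F l in at 0 within L. \<forall>z\<in>K. \<forall>h\<in>\<Gamma> l. quad h \<in> cls (\<Gamma> l) (\<gamma> l) \<longrightarrow> disp h (\<phi> l c z) \<le> T \<longrightarrow>
       (\<exists>g. rel l c g h \<and> quad g \<in> (\<Union>p\<in>Q. cls (\<Gamma>0 c) p))"
    and K: "compact K" "K \<subseteq> uhp" and S: "compact S" and \<delta>: "0 < \<delta>" "\<And>s. s \<in> S \<Longrightarrow> 1 + \<delta> \<le> Re s"
  shows "uniform_limit (K \<times> S) (\<lambda>l (z, s). esum (cls (\<Gamma> l) (\<gamma> l)) s (\<phi> l c z))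
    (\<lambda>(z, s). esum (\<Union>p\<in>Q. cls (\<Gamma>0 c) p) s z) (at 0 within L)"
proof (rule uniform_limitI)
  fix e :: real assume e: "0 < e"
  define I where "I = (\<Union>p\<in>Q. cls (\<Gamma>0 c) p)"
  obtain m where m: "\<forall>z\<in>K. finite {h \<in> \<Gamma>0 c. hdist z (mob h z) \<le> box_radius 2} \<and> card {h \<in> \<Gamma>0 c. hdist z (mob h z) \<le> box_radius 2} \<le> m"
    "\<forall>\<^sub>F l in at 0 within L. \<forall>z\<in>K. finite {h \<in> \<Gamma> l. hdist (\<phi> l c z) (mob h (\<phi> l c z)) \<le> box_radius 2} \<and>
       card {h \<in> \<Gamma> l. hdist (\<phi> l c z) (mob h (\<phi> l c z)) \<le> box_radius 2} \<le> m"
    using eventually_orbit_count[where c = c and B = "box_radius 2", OF K] by blast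
  \<comment> \<open>One constant for both series: the limit has card Q conjugacy classes, the
    surface of l a single one.\<close>
  define C where "C = (card Q + 1) * (2 * m)"
  define r where "r = (2::real) powr - \<delta>"
  have r: "0 < r" "r < 1" using \<delta>(1) by (auto simp: r_def powr_less_one)
  have "(\<lambda>n. real C * r ^ n / (1 - r)) \<longlonglongrightarrow> real C * 0 / (1 - r)"
    using r by (intro tendsto_intros LIMSEQ_realpow_zero) auto
  then have "\<forall>\<^sub>F n in sequentially. real C * r ^ n / (1 - r) < e / 3"
    using e by (intro order_tendstoD(2)) auto
  then obtain k0 where k0: "real C * r ^ k0 / (1 - r) < e / 3" by (auto simp: eventually_sequentially)
  define T where "T = (2::real) ^ k0"
  have T1: "1 \<le> T" by (simp add: T_def)
  \<comment> \<open>The cut is at 2 sinh T and not at T: an element of \<open>\<Gamma> l\<close>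
    with \<open>disp\<close> below T moves its point by less than T, so it comes from an element
    moving z by at most 2 T, whose \<open>disp\<close> is at most 2 sinh T. Hence every term for l
    with value below T belongs to the image of the head.\<close>
  define A where "A = {X \<in> I. \<exists>z\<in>K. val X z \<le> 2 * sinh T}"
  have AI: "A \<subseteq> I" by (auto simp: A_def)
  have head: "finite A" unfolding A_def I_def by (rule limit_head(1)[OF Q K])
  have "\<exists>b D. 0 < b \<and> (\<forall>g z. g \<in> \<Gamma>0 c \<longrightarrow> quad g \<in> A \<longrightarrow> z \<in> K \<longrightarrow> b \<le> hdist z (mob g z) \<and> hdist z (mob g z) \<le> D)"
    unfolding A_def I_def by (rule limit_head(2)[OF Q K])
  then obtain b D where bD: "0 < b" "\<And>g z. g \<in> \<Gamma>0 c \<Longrightarrow> quad g \<in> A \<Longrightarrow> z \<in> K \<Longrightarrow> b \<le> hdist z (mob g z) \<and> hdist z (mob g z) \<le> D" by metis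
  \<comment> \<open>The representative g is fixed before l, so that only its image in
    \<open>\<Gamma> l\<close> varies.\<close>
  have "\<exists>g. g \<in> \<Gamma>0 c \<and> X = quad g \<and> (\<forall>l\<in>L. \<exists>h. rel l c g h \<and> quad h \<in> cls (\<Gamma> l) (\<gamma> l))" if X: "X \<in> I" for X
  proof -
    obtain p where p: "p \<in> Q" "X \<in> cls (\<Gamma>0 c) p" using X by (auto simp: I_def)
    obtain g \<eta> where g: "g = cj \<eta> p" "\<eta> \<in> \<Gamma>0 c" "g \<in> \<Gamma>0 c" "X = quad g"
      using cls_elem[OF limit_group(1) _ p(2)] Q(2) p(1) by blast
    have "\<exists>h. rel l c g h \<and> quad h \<in> cls (\<Gamma> l) (\<gamma> l)" if l: "l \<in> L" for l
    proof -
      obtain h where h: "rel l c p h" "quad h \<in> cls (\<Gamma> l) (\<gamma> l)" using sub[OF l p(1)] by blast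
      obtain k where k: "rel l c \<eta> k" using rel_exists[OF l g(2)] by blast
      have kG: "k \<in> \<Gamma> l" "k \<in> carrier SL2R" using k rel_carrier(2)[OF l k] by (auto simp: rel_def)
      have gc: "\<gamma> l \<in> carrier SL2R" using gamma_carrier[OF l gl[OF l]] .
      obtain \<kappa> where \<kappa>: "\<kappa> \<in> \<Gamma> l" "h \<in> quad (cj \<kappa> (\<gamma> l))" using cls_memD[OF group_l[OF l] gl[OF l] h(2)] by blast
      have \<kappa>c: "\<kappa> \<in> carrier SL2R" using gamma_carrier[OF l \<kappa>(1)] .
      have "quad (cj k h) = quad (cj k (cj \<kappa> (\<gamma> l)))" by (rule quad_cj_eq[OF kG(2) cj_carrier[OF \<kappa>c gc] \<kappa>(2)])
      also have "\<dots> = quad (cj (\<kappa> ** k) (\<gamma> l))" by (simp add: cj_mult \<kappa>c kG)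
      also have "\<dots> \<in> cls (\<Gamma> l) (\<gamma> l)" using subgroup_SL2R_D(3)[OF group_l[OF l] \<kappa>(1) kG(1)] by (auto simp: cls_def)
      finally show ?thesis using rel_cj[OF l k h(1)] g(1) by blast
    qed
    then show ?thesis using g by blast
  qed
  then have "\<forall>X\<in>I. \<exists>g. g \<in> \<Gamma>0 c \<and> X = quad g \<and> (\<forall>l\<in>L. \<exists>h. rel l c g h \<and> quad h \<in> cls (\<Gamma> l) (\<gamma> l))" by blast
  from bchoice[OF this] obtain G where G': "\<forall>X\<in>I. G X \<in> \<Gamma>0 c \<and> X = quad (G X) \<and>
    (\<forall>l\<in>L. \<exists>h. rel l c (G X) h \<and> quad h \<in> cls (\<Gamma> l) (\<gamma> l))" ..
  then have G: "G X \<in> \<Gamma>0 c" "X = quad (G X)" if "X \<in> I" for X using that by blast+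
  \<comment> \<open>The image of \<open>G X\<close> is determined up to sign, so every choice has
    the same \<open>quad\<close>.\<close>
  define H where "H l X = (SOME h. rel l c (G X) h \<and> quad h \<in> cls (\<Gamma> l) (\<gamma> l))" for l X
  have H: "rel l c (G X) (H l X)" "quad (H l X) \<in> cls (\<Gamma> l) (\<gamma> l)" if X: "X \<in> I" and l: "l \<in> L" for l X
  proof -
    have "\<exists>h. rel l c (G X) h \<and> quad h \<in> cls (\<Gamma> l) (\<gamma> l)" using G' X l by blast
    from someI_ex[OF this] show "rel l c (G X) (H l X)" "quad (H l X) \<in> cls (\<Gamma> l) (\<gamma> l)"
      by (simp_all add: H_def)
  qed
  define j where "j l X = quad (H l X)" for l X
  define \<eta> where "\<eta> = e / (3 * (real (card A) + 1))"
  have \<eta>: "0 < \<eta>" "real (card A) * \<eta> \<le> e / 3"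
  proof -
    have n: "0 < 3 * (real (card A) + 1)" by (intro mult_pos_pos add_nonneg_pos) auto
    show "0 < \<eta>" using e n by (simp add: \<eta>_def)
    have "real (card A) * \<eta> \<le> (real (card A) + 1) * \<eta>" using \<open>0 < \<eta>\<close> by (intro mult_right_mono) auto
    also have "\<dots> = e / 3" using n by (simp add: \<eta>_def field_simps)
    finally show "real (card A) * \<eta> \<le> e / 3" .
  qed
  \<comment> \<open>Distances in the limit lie between b and D; the margins b/2 and 1 leave room for
    those at l, since \<rho> is at most either.\<close>
  define E where "E = {b/2..D+1} \<times> S"
  have "continuous_on E (\<lambda>x. (\<lambda>(v, s). of_real v powr (- s :: complex)) (2 * sinh (fst x / 2), snd x))"
    unfolding E_def
    by (rule continuous_on_compose2[OF continuous_on_val_powr[of "2 * sinh (b/4)" "2 * sinh ((D+1)/2)" S]])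
       (use bD(1) in \<open>auto intro!: continuous_intros\<close>)
  moreover have "compact E" unfolding E_def by (intro compact_Times S compact_Icc)
  ultimately have "uniformly_continuous_on E (\<lambda>x. (\<lambda>(v, s). of_real v powr (- s :: complex)) (2 * sinh (fst x / 2), snd x))"
    by (rule compact_uniformly_continuous)
  then obtain \<rho>0 where \<rho>0: "0 < \<rho>0" "\<And>x y. x \<in> E \<Longrightarrow> y \<in> E \<Longrightarrow> dist y x < \<rho>0 \<Longrightarrow>
      dist ((\<lambda>x. (\<lambda>(v, s). of_real v powr (- s :: complex)) (2 * sinh (fst x / 2), snd x)) y)
       ((\<lambda>x. (\<lambda>(v, s). of_real v powr (- s :: complex)) (2 * sinh (fst x / 2), snd x)) x) < \<eta>"
    unfolding uniformly_continuous_on_def using \<eta>(1) by blast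
  define \<rho> where "\<rho> = min \<rho>0 (min (b/2) 1)"
  have \<rho>: "0 < \<rho>" "\<rho> \<le> \<rho>0" "\<rho> \<le> b/2" "\<rho> \<le> 1" using \<rho>0(1) bD(1) by (auto simp: \<rho>_def)
  have "\<forall>\<^sub>F l in at 0 within L. almost_iso l (2 * T + 1) 2 K" by (rule eventually_almost_iso[OF K]) simp
  then show "\<forall>\<^sub>F l in at 0 within L. \<forall>x\<in>K \<times> S.
      dist (case x of (z, s) \<Rightarrow> esum (cls (\<Gamma> l) (\<gamma> l)) s (\<phi> l c z))
       (case x of (z, s) \<Rightarrow> esum (\<Union>p\<in>Q. cls (\<Gamma>0 c) p) s z) < e"
    using m(2) sup[of T] eventually_hdist_close[OF K \<rho>(1), of D]
  proof (eventually_elim, clarify)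
    fix l z s
    assume a: "almost_iso l (2 * T + 1) 2 K"
      and ml: "\<forall>z\<in>K. finite {h \<in> \<Gamma> l. hdist (\<phi> l c z) (mob h (\<phi> l c z)) \<le> box_radius 2} \<and>
       card {h \<in> \<Gamma> l. hdist (\<phi> l c z) (mob h (\<phi> l c z)) \<le> box_radius 2} \<le> m"
      and sp: "\<forall>z\<in>K. \<forall>h\<in>\<Gamma> l. quad h \<in> cls (\<Gamma> l) (\<gamma> l) \<longrightarrow> disp h (\<phi> l c z) \<le> T \<longrightarrow>
       (\<exists>g. rel l c g h \<and> quad g \<in> (\<Union>p\<in>Q. cls (\<Gamma>0 c) p))"
      and close: "\<forall>c. \<forall>z\<in>K. \<forall>w\<in>uhp. hdist z w \<le> D \<longrightarrow> \<bar>hdist (\<phi> l c z) (\<phi> l c w) - hdist z w\<bar> < \<rho>"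
      and z: "z \<in> K" and s: "s \<in> S"
    have zu: "z \<in> uhp" using z K by blast
    note l = almost_isoD(1)[OF a z zu]
    have fu: "\<phi> l c z \<in> uhp" by (rule phi_uhp[OF l zu])
    define Il where "Il = cls (\<Gamma> l) (\<gamma> l)"
    define t where "t w X = (of_real (val X w) powr (- s) :: complex)" for w X
    have GA: "X \<in> I" "G X \<in> carrier SL2R" "val X z = 2 * sinh (hdist z (mob (G X) z) / 2)"
      "val (j l X) (\<phi> l c z) = 2 * sinh (hdist (\<phi> l c z) (\<phi> l c (mob (G X) z)) / 2)" if X: "X \<in> A" for X
    proof -
      show XI: "X \<in> I" using X AI by blast
      show gc: "G X \<in> carrier SL2R" using gamma0_carrier[OF G(1)[OF XI]] .
      show "val X z = 2 * sinh (hdist z (mob (G X) z) / 2)"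
        using val_quad[OF gc, of z] disp_eq_hdist[OF gc zu] G(2)[OF XI] by simp
      show "val (j l X) (\<phi> l c z) = 2 * sinh (hdist (\<phi> l c z) (\<phi> l c (mob (G X) z)) / 2)"
        unfolding j_def using val_quad[OF rel_carrier(2)[OF l H(1)[OF XI l]]] rel_disp[OF l H(1)[OF XI l] zu] by simp
    qed
    have inj: "inj_on (j l) A"
    proof (rule inj_onI)
      fix X Y assume X: "X \<in> A" and Y: "Y \<in> A" and eq: "j l X = j l Y"
      have "quad (G X) = quad (G Y)"
        using rel_quad_left[OF l H(1)[OF GA(1)[OF X] l] H(1)[OF GA(1)[OF Y] l]] eq by (simp add: j_def)
      then show "X = Y" using G(2)[OF GA(1)[OF X]] G(2)[OF GA(1)[OF Y]] by simp
    qed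
    have termwise: "dist (t (\<phi> l c z) (j l X)) (t z X) < \<eta>" if X: "X \<in> A" for X
    proof -
      define d where "d = hdist z (mob (G X) z)"
      define d' where "d' = hdist (\<phi> l c z) (\<phi> l c (mob (G X) z))"
      have "quad (G X) \<in> A" using G(2)[OF GA(1)[OF X]] X by simp
      then have d: "b \<le> d" "d \<le> D" using bD(2)[OF G(1)[OF GA(1)[OF X]] _ z] by (auto simp: d_def)
      then have "\<bar>d' - d\<bar> < \<rho>" using close z mob_uhp[OF GA(2)[OF X] zu] by (simp add: d_def d'_def)
      then have "(d', s) \<in> E" "(d, s) \<in> E" "dist (d', s) (d, s) < \<rho>0"
        using d \<rho> bD(1) s unfolding E_def dist_Pair_Pair by (auto simp: dist_real_def abs_less_iff)
      from \<rho>0(2)[OF this(2,1,3)] show ?thesis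
        unfolding t_def GA(3)[OF X] GA(4)[OF X] by (simp add: d_def d'_def)
    qed
    have big0: "2 ^ k0 \<le> val X z" if "X \<in> I - A" for X
    proof -
      have "2 * sinh T < val X z" using that z by (force simp: A_def)
      then show ?thesis using le_sinh[of T] T1 unfolding T_def[symmetric] by linarith
    qed
    have bigl: "2 ^ k0 \<le> val Y (\<phi> l c z)" if Y: "Y \<in> Il - j l ` A" for Y
    proof (rule ccontr)
      assume small: "\<not> 2 ^ k0 \<le> val Y (\<phi> l c z)"
      obtain h where h: "h \<in> \<Gamma> l" "Y = quad h"
        using cls_elem[OF group_l[OF l] gl[OF l], of Y] Y by (auto simp: Il_def)
      have hc: "h \<in> carrier SL2R" using gamma_carrier[OF l h(1)] .
      have dT: "disp h (\<phi> l c z) < T" using small val_quad[OF hc] h(2) by (simp add: T_def)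
      have "quad h \<in> cls (\<Gamma> l) (\<gamma> l)" using Y h(2) by (simp add: Il_def)
      then obtain g where g: "rel l c g h" "quad g \<in> I"
        using sp[rule_format, OF z h(1)] dT unfolding I_def by force
      have gc: "g \<in> carrier SL2R" using rel_carrier(1)[OF l g(1)] .
      have hT: "hdist (\<phi> l c z) (mob h (\<phi> l c z)) < T" using le_disp[OF hc fu] dT by linarith
      then obtain g' where g': "rel l c g' h" "hdist z (mob g' z) \<le> 2 * hdist (\<phi> l c z) (mob h (\<phi> l c z))"
        using rel_of_small_disp[OF a z zu h(1), of c] by auto
      have "mob g' z = mob g z" using rel_unique_left[OF l g(1) g'(1)] by auto
      then have "hdist z (mob g z) \<le> 2 * T" using g'(2) hT by simp
      then have "disp g z \<le> 2 * sinh T" unfolding disp_eq_hdist[OF gc zu] by simp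
      then have A: "quad g \<in> A" using g(2) z val_quad[OF gc] by (auto simp: A_def)
      have "quad g = quad (G (quad g))" using G(2)[OF g(2)] .
      then have "quad h = quad (H l (quad g))" by (rule rel_quad_right[OF l g(1) H(1)[OF g(2) l]])
      then have "Y = j l (quad g)" using h(2) by (simp add: j_def)
      then show False using Y A by blast
    qed
    have cnt0: "finite {X \<in> I. val X z \<in> {2 ^ k..2 * 2 ^ k}} \<and> card {X \<in> I. val X z \<in> {2 ^ k..2 * 2 ^ k}} \<le> C * 2 ^ k" for k
    proof -
      have "finite {X \<in> I. val X z \<in> {2 ^ k..2 * 2 ^ k}} \<and> card {X \<in> I. val X z \<in> {2 ^ k..2 * 2 ^ k}} \<le> (card Q * (2 * m)) * 2 ^ k"
        unfolding I_def using m(1)[rule_format, OF z] by (intro cls_union_shell_count[OF limit_group(1) Q(1,2) sc0 zu]) auto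
      moreover have "(card Q * (2 * m)) * 2 ^ k \<le> C * 2 ^ k" by (simp add: C_def)
      ultimately show ?thesis by linarith
    qed
    have cntl: "finite {X \<in> Il. val X (\<phi> l c z) \<in> {2 ^ k..2 * 2 ^ k}} \<and> card {X \<in> Il. val X (\<phi> l c z) \<in> {2 ^ k..2 * 2 ^ k}} \<le> C * 2 ^ k" for k
    proof -
      have U: "(\<Union>p\<in>{\<gamma> l}. cls (\<Gamma> l) p) = Il" by (simp add: Il_def)
      have *: "finite {X \<in> Il. val X (\<phi> l c z) \<in> {2 ^ k..2 * 2 ^ k}} \<and>
        card {X \<in> Il. val X (\<phi> l c z) \<in> {2 ^ k..2 * 2 ^ k}} \<le> (card {\<gamma> l} * (2 * m)) * 2 ^ k"
        unfolding U[symmetric]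
        using ml z gl[OF l] scl[OF l] by (intro cls_union_shell_count[OF group_l[OF l] _ _ _ fu]) auto
      have "(card {\<gamma> l} * (2 * m)) * 2 ^ k \<le> C * 2 ^ k" by (simp add: C_def)
      from conjI[OF conjunct1[OF *] order_trans[OF conjunct2[OF *] this]] show ?thesis .
    qed
    have jA: "finite (j l ` A)" "j l ` A \<subseteq> Il" using head H(2)[OF GA(1) l] by (auto simp: j_def Il_def)
    have d1: "cmod (esum I s z - (\<Sum>X\<in>A. t z X)) < e / 3"
      using esum_split(2)[OF cnt0 head AI big0 \<delta>(1) \<delta>(2)[OF s]] k0 unfolding t_def r_def by linarith
    have d2: "cmod (esum Il s (\<phi> l c z) - (\<Sum>Y\<in>j l ` A. t (\<phi> l c z) Y)) < e / 3"
      using esum_split(2)[OF cntl jA bigl \<delta>(1) \<delta>(2)[OF s]] k0 unfolding t_def r_def by linarith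
    have d3: "cmod ((\<Sum>Y\<in>j l ` A. t (\<phi> l c z) Y) - (\<Sum>X\<in>A. t z X)) \<le> e / 3"
    proof -
      have "(\<Sum>Y\<in>j l ` A. t (\<phi> l c z) Y) - (\<Sum>X\<in>A. t z X) = (\<Sum>X\<in>A. t (\<phi> l c z) (j l X) - t z X)"
        by (simp add: sum.reindex[OF inj] sum_subtractf)
      also have "cmod \<dots> \<le> real (card A) * \<eta>"
        using termwise by (intro order_trans[OF norm_sum] sum_bounded_above) (auto simp: dist_norm less_imp_le)
      also have "\<dots> \<le> e / 3" by (rule \<eta>(2))
      finally show ?thesis .
    qed
    have d4: "esum Il s (\<phi> l c z) - esum I s z = (esum Il s (\<phi> l c z) - (\<Sum>Y\<in>j l ` A. t (\<phi> l c z) Y)) +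
      ((\<Sum>Y\<in>j l ` A. t (\<phi> l c z) Y) - (\<Sum>X\<in>A. t z X)) - (esum I s z - (\<Sum>X\<in>A. t z X))" by simp
    have tri: "cmod (u + v - w) \<le> cmod u + cmod v + cmod w" for u v w
      using norm_triangle_ineq4[of "u + v" w] norm_triangle_ineq[of u v] by linarith
    have "cmod (esum Il s (\<phi> l c z) - esum I s z) < e"
      unfolding d4 using d1 d2 d3 by (intro le_less_trans[OF tri]) linarith
    then show "dist (esum (cls (\<Gamma> l) (\<gamma> l)) s (\<phi> l c z)) (esum (\<Union>p\<in>Q. cls (\<Gamma>0 c) p) s z) < e"
      by (simp add: dist_norm Il_def I_def)
  qed
qed

end

text \<open>\<beta>' preserves the axis of \<beta>, so primitivity makes it a word in \<beta> and
  -1, that is, a dilation by exp (n l) in a frame. Its displacement at a point of the common axis is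
  |n| l.\<close>

lemma axis_multiple:
  assumes p: "primitive_hyp \<Gamma> \<beta>" and h: "hyperbolic \<beta>'" "\<beta>' \<in> \<Gamma>" and ax: "geod_axis \<beta> = geod_axis \<beta>'"
  shows "\<exists>n::int. geod_length \<beta>' = \<bar>of_int n\<bar> * geod_length \<beta> \<and>
     (\<exists>\<sigma>. hyp_frame \<beta> \<sigma> (geod_length \<beta>) \<and> (\<forall>x\<in>uhp. mob \<sigma> (mob \<beta>' x) = of_real (exp (of_int n * geod_length \<beta>)) * mob \<sigma> x))"
proof -
  have hb: "hyperbolic \<beta>" "hyperbolic \<beta>'" "\<beta> \<in> carrier SL2R" "\<beta>' \<in> carrier SL2R" "\<beta>' \<in> \<Gamma>"
    using p h by (auto simp: primitive_hyp_def hyperbolic_def)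
  have self: "mob \<beta>' ` geod_axis \<beta>' = geod_axis \<beta>'"
    using axis_image(2)[OF hb(2,4)] by (simp add: cj_commute hb)
  obtain \<sigma> l where f: "hyp_frame \<beta> \<sigma> l" using hyp_frame_exists[OF hb(1)] by blast
  have l: "geod_length \<beta> = l" "0 < l" and s: "\<sigma> \<in> carrier SL2R" using geod_length_eq[OF f] f by (auto simp: hyp_frame_def)
  have "\<beta>' \<in> axis_stab \<Gamma> \<beta>" using self hb(5) by (simp add: axis_stab_def ax)
  then have "\<beta>' \<in> generate SL2R {\<beta>, - mat 1}" using p by (simp add: primitive_hyp_def)
  then obtain n :: int where n: "\<forall>x\<in>uhp. mob \<sigma> (mob \<beta>' x) = of_real (exp (of_int n * l)) * mob \<sigma> x"
    using generate_dilation[OF f hb(3)] by blast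
  obtain x where x: "x \<in> geod_axis \<beta>'" using geod_axis_nonempty[OF hb(2)] by blast
  have xu: "x \<in> uhp" using x by (simp add: geod_axis_def)
  have "x \<in> geod_axis \<beta>" using x ax by simp
  then obtain \<sigma>' l' where "hyp_frame \<beta> \<sigma>' l'" "Re (mob \<sigma>' x) = 0" by (auto simp: geod_axis_def)
  have Re0: "Re (mob \<sigma> x) = 0"
  proof -
    have "disp \<beta> x = sqrt ((trace \<beta>)\<^sup>2 - 4)" using \<open>x \<in> geod_axis \<beta>\<close> by (simp add: geod_axis_eq[OF hb(1)])
    then have "2 * sinh (l/2) * cmod (mob \<sigma> x) / Im (mob \<sigma> x) = 2 * sinh (l/2)"
      using hyp_frame_coords(2)[OF f hb(3) xu] hyp_frame_trace(3)[OF f] by simp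
    moreover have "0 < Im (mob \<sigma> x)" using mob_uhp[OF s xu] by (simp add: uhp_def)
    ultimately have "cmod (mob \<sigma> x) = Im (mob \<sigma> x)" using hyp_frame_trace(2)[OF f] by (simp add: field_simps)
    then have "(cmod (mob \<sigma> x))\<^sup>2 = (Im (mob \<sigma> x))\<^sup>2" by simp
    then show ?thesis by (simp add: cmod_power2)
  qed
  define r where "r = Im (mob \<sigma> x)"
  have r: "0 < r" "mob \<sigma> x = \<i> * of_real r" using mob_uhp[OF s xu] Re0 by (simp_all add: r_def uhp_def complex_eq_iff)
  define k where "k = exp (of_int n * l)"
  have ku: "\<i> * of_real r \<in> uhp" "\<i> * of_real (k * r) \<in> uhp" using r by (simp_all add: uhp_def k_def)
  have "hdist x (mob \<beta>' x) = hdist (mob \<sigma> x) (mob \<sigma> (mob \<beta>' x))"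
    using hdist_mob[OF s xu mob_uhp[OF hb(4) xu]] by simp
  also have "\<dots> = hdist (\<i> * of_real r) (\<i> * of_real (k * r))" using n xu r by (simp add: k_def mult_ac)
  finally have "hdist x (mob \<beta>' x) = hdist (\<i> * of_real r) (\<i> * of_real (k * r))" .
  then have "cosh (geod_length \<beta>') = 1 + (cmod (\<i> * of_real r - \<i> * of_real (k * r)))\<^sup>2 / (2 * r * (k * r))"
    using cosh_hdist[OF ku] hdist_axis[OF hb(2) x] by simp
  also have "(cmod (\<i> * of_real r - \<i> * of_real (k * r)))\<^sup>2 = (r - k * r)\<^sup>2" by (simp add: cmod_power2)
  also have "1 + (r - k * r)\<^sup>2 / (2 * r * (k * r)) = (k + inverse k) / 2"
  proof -
    have "0 < k" by (simp add: k_def)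
    have "(r - k * r)\<^sup>2 / (2 * r * (k * r)) = (1 - k)\<^sup>2 / (2 * k)"
    proof -
      have *: "(r - k * r)\<^sup>2 = r\<^sup>2 * (1 - k)\<^sup>2" "2 * r * (k * r) = r\<^sup>2 * (2 * k)"
        by (simp_all add: power2_eq_square algebra_simps)
      show ?thesis unfolding * using r(1) by simp
    qed
    then show ?thesis using \<open>0 < k\<close> by (simp add: field_simps power2_eq_square)
  qed
  also have "\<dots> = cosh (of_int n * l)" by (simp add: k_def cosh_field_def exp_minus)
  also have "\<dots> = cosh \<bar>of_int n * l\<bar>" by (simp add: cosh_real_abs)
  finally have "geod_length \<beta>' = \<bar>of_int n * l\<bar>"
    using hyperbolic_length(1)[OF hb(2)] arcosh_cosh_real[of "geod_length \<beta>'"] arcosh_cosh_real[of "\<bar>of_int n * l\<bar>"] by simp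
  then have "geod_length \<beta>' = \<bar>of_int n\<bar> * l" using l(2) by (simp add: abs_mult)
  then show ?thesis using f n unfolding l(1) by blast
qed

text \<open>
  An element of the stabilizer of the axis of a primitive \<open>\<gamma>\<close> translates along this axis by a multiple of
  the length of \<open>\<gamma>\<close>; for two primitive elements both multiples must be \<open>\<plusminus>1\<close>.
\<close>

lemma primitive_axis_image:
  assumes G: "subgroup \<Gamma> SL2R" and p: "primitive_hyp \<Gamma> \<gamma>" and pb: "primitive_hyp \<Gamma> \<beta>" and k: "k \<in> \<Gamma>"
    and ax: "geod_axis \<beta> = mob k ` geod_axis \<gamma>"
  shows "cj k \<beta> \<in> quad \<gamma>"
proof -
  define \<gamma>' where "\<gamma>' = cj k \<beta>"
  have gb: "\<gamma> \<in> \<Gamma>" "\<beta> \<in> \<Gamma>" "hyperbolic \<gamma>" "hyperbolic \<beta>" using p pb by (auto simp: primitive_hyp_def)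
  have kc: "k \<in> carrier SL2R" using subgroup_SL2R_D(1)[OF G k] .
  have h: "hyperbolic \<gamma>" "hyperbolic \<gamma>'" using gb axis_image(1)[OF gb(4) kc] by (auto simp: \<gamma>'_def)
  have sub: "geod_axis g \<subseteq> uhp" for g by (auto simp: geod_axis_def)
  have ax1: "geod_axis \<gamma> = geod_axis \<gamma>'"
  proof -
    have "mob k ` geod_axis \<gamma> = mob k ` geod_axis \<gamma>'" using axis_image(2)[OF gb(4) kc] ax by (simp add: \<gamma>'_def)
    moreover have "inj_on (mob k) uhp" using mob_inj[OF kc] by (auto intro: inj_onI)
    ultimately show ?thesis using inj_on_image_eq_iff[of "mob k" uhp] sub by metis
  qed
  \<comment> \<open>The same comparison with exchanged roles: \<gamma> is conjugated to the axis of
    \<beta>, which gives the reverse divisibility of lengths.\<close>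
  define \<beta>' where "\<beta>' = cj (matrix_inv k) \<gamma>"
  have kic: "matrix_inv k \<in> carrier SL2R" "matrix_inv k \<in> \<Gamma>" using SL2R_inv[OF kc] subgroup_SL2R_D(4)[OF G k] by auto
  have hb': "hyperbolic \<beta>'" unfolding \<beta>'_def by (rule axis_image(1)[OF gb(3) kic(1)])
  have ax2: "geod_axis \<beta> = geod_axis \<beta>'"
  proof -
    have "mob k ` mob (matrix_inv k) ` geod_axis \<beta>' = mob k ` geod_axis \<gamma>"
      using axis_image(2)[OF gb(3) kic(1)] by (simp add: \<beta>'_def)
    moreover have "mob k ` mob (matrix_inv k) ` geod_axis \<beta>' = geod_axis \<beta>'"
      using sub[of \<beta>'] mob_inv_cancel(2)[OF kc] by (force simp: image_image)
    ultimately show ?thesis using ax by simp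
  qed
  have trg: "\<gamma>' \<in> \<Gamma>" "\<beta>' \<in> \<Gamma>" using cj_subgroup[OF G] k kic gb by (auto simp: \<gamma>'_def \<beta>'_def)
  have len': "geod_length \<gamma>' = geod_length \<beta>" "geod_length \<beta>' = geod_length \<gamma>"
    by (rule geod_length_cong[OF h(2) gb(4)], simp add: \<gamma>'_def trace_cj kc)
      (rule geod_length_cong[OF hb' gb(3)], simp add: \<beta>'_def trace_cj kic)
  obtain n \<sigma> where n: "geod_length \<gamma>' = \<bar>of_int n\<bar> * geod_length \<gamma>" and f: "hyp_frame \<gamma> \<sigma> (geod_length \<gamma>)"
    and nx: "\<forall>x\<in>uhp. mob \<sigma> (mob \<gamma>' x) = of_real (exp (of_int n * geod_length \<gamma>)) * mob \<sigma> x"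
    using axis_multiple[OF p h(2) trg(1) ax1] by blast
  obtain m :: int where m: "geod_length \<gamma> = \<bar>of_int m\<bar> * geod_length \<gamma>'"
    using axis_multiple[OF pb hb' trg(2) ax2] unfolding len' by blast
  have len: "0 < geod_length \<gamma>" by (rule hyperbolic_length(1)[OF h(1)])
  \<comment> \<open>Each length is an integer multiple of the other and both are positive, so both
    integers are 1 up to sign.\<close>
  have "geod_length \<gamma> = (\<bar>of_int m\<bar> * \<bar>of_int n\<bar>) * geod_length \<gamma>"
    using m unfolding n by (simp only: mult.assoc)
  then have "(of_int (\<bar>m\<bar> * \<bar>n\<bar>) :: real) = 1" using len by simp
  then have "\<bar>m\<bar> * \<bar>n\<bar> = 1" using of_int_eq_1_iff by blast
  then have "\<bar>n\<bar> = 1" by (metis abs_ge_zero zmult_eq_1_iff mult_eq_0_iff abs_mult abs_zmult_eq_1)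
  then have n1: "n = 1 \<or> n = -1" by linarith
  have c: "\<gamma> \<in> carrier SL2R" "\<gamma>' \<in> carrier SL2R" "\<sigma> \<in> carrier SL2R" using h f by (auto simp: hyperbolic_def hyp_frame_def)
  have "\<exists>\<beta>\<in>{\<gamma>, matrix_inv \<gamma>}. \<forall>x\<in>uhp. mob \<gamma>' x = mob \<beta> x"
  proof (cases "n = 1")
    case True
    have "mob \<gamma>' x = mob \<gamma> x" if "x \<in> uhp" for x
      by (rule mob_inj[OF c(3)]) (use nx that True hyp_frame_coords(1)[OF f c(1) that] c mob_uhp in auto)
    then show ?thesis by blast
  next
    case False
    then have n: "n = -1" using n1 by blast
    have "mob \<gamma>' x = mob (matrix_inv \<gamma>) x" if x: "x \<in> uhp" for x
    proof (rule mob_inj[OF c(3)])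
      have "mob \<sigma> x = of_real (exp (geod_length \<gamma>)) * mob \<sigma> (mob (matrix_inv \<gamma>) x)"
        using hyp_frame_coords(1)[OF f c(1) mob_uhp[OF SL2R_inv[OF c(1)] x]] by (simp add: mob_inv_cancel c x)
      moreover have "of_real (exp (- geod_length \<gamma>)) * (of_real (exp (geod_length \<gamma>)) * w) = w" for w :: complex
        by (simp add: exp_minus flip: of_real_mult mult.assoc)
      ultimately show "mob \<sigma> (mob \<gamma>' x) = mob \<sigma> (mob (matrix_inv \<gamma>) x)" using nx x n by simp
    qed (use c x mob_uhp SL2R_inv in auto)
    then show ?thesis by blast
  qed
  then obtain \<beta> where b: "\<beta> \<in> {\<gamma>, matrix_inv \<gamma>}" "\<And>x. x \<in> uhp \<Longrightarrow> mob \<gamma>' x = mob \<beta> x" by blast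
  have "\<beta> \<in> carrier SL2R" using b(1) c SL2R_inv by auto
  then have "\<gamma>' = \<beta> \<or> \<gamma>' = - \<beta>" using mob_eq_all_imp[OF c(2)] b(2) by blast
  then show ?thesis using b(1) by (auto simp: quad_def \<gamma>'_def)
qed

lemma arcosh_mono: "1 \<le> a \<Longrightarrow> a \<le> b \<Longrightarrow> arcosh a \<le> arcosh (b::real)"
  using arcosh_less_iff_real[of b a] by linarith

text \<open>A lower bound on trace^2 - 4 takes the place of a condition on the sides, so that one
  radius works for a whole family of elements whose lengths do not shrink.\<close>

lemma hyperbolic_near:
  assumes G: "subgroup \<Gamma> SL2R" and g: "\<gamma> \<in> \<Gamma>" and h: "hyperbolic \<gamma>" and t: "0 < t0" "t0 \<le> (trace \<gamma>)\<^sup>2 - 4"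
    and x: "x \<in> uhp" and y: "y \<in> uhp" and d: "disp \<gamma> x \<le> T" "disp \<gamma> y \<le> T"
  shows "\<exists>k\<in>\<Gamma>. k ** \<gamma> = \<gamma> ** k \<and> hdist x (mob k y) \<le> arcosh (1 + T\<^sup>2 / 2 * (1 + 4 / t0))"
proof -
  have gc: "\<gamma> \<in> carrier SL2R" using subgroup_SL2R_D(1)[OF G g] .
  obtain side \<tau> where sc: "strip_coords \<Gamma> \<gamma> side \<tau>"
    and near: "\<And>x y b. x \<in> uhp \<Longrightarrow> y \<in> uhp \<Longrightarrow> disp \<gamma> x \<le> b \<Longrightarrow> disp \<gamma> y \<le> b \<Longrightarrow> \<bar>\<tau> x - \<tau> y\<bar> \<le> 1 \<Longrightarrow>
       hdist x y \<le> arcosh (1 + b\<^sup>2 / 2 * (1 + 4 / ((trace \<gamma>)\<^sup>2 - 4)))"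
    using hyperbolic_strip_coords[OF G g h] by blast
  obtain k where k: "k \<in> \<Gamma>" "k ** \<gamma> = \<gamma> ** k"
    "\<forall>u\<in>uhp. \<tau> (mob k u) = \<tau> u + of_int \<lfloor>\<tau> x - \<tau> y\<rfloor> \<and> side (mob k u) = side u"
    using strip_coordsD(1)[OF sc, of "\<lfloor>\<tau> x - \<tau> y\<rfloor>"] by blast
  have kc: "k \<in> carrier SL2R" using subgroup_SL2R_D(1)[OF G k(1)] .
  have ty: "\<tau> (mob k y) = \<tau> y + of_int \<lfloor>\<tau> x - \<tau> y\<rfloor>" using k(3) y by blast
  have "\<bar>\<tau> x - \<tau> (mob k y)\<bar> \<le> 1" unfolding ty by linarith
  moreover have "disp \<gamma> (mob k y) = disp \<gamma> y" using disp_cj[OF gc kc y] by (simp add: cj_commute kc k(2))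
  ultimately have "hdist x (mob k y) \<le> arcosh (1 + T\<^sup>2 / 2 * (1 + 4 / ((trace \<gamma>)\<^sup>2 - 4)))"
    using near[OF x mob_uhp[OF kc y]] d by simp
  also have "\<dots> \<le> arcosh (1 + T\<^sup>2 / 2 * (1 + 4 / t0))"
    using t by (intro arcosh_mono add_left_mono mult_left_mono divide_left_mono) auto
  finally show ?thesis using k by blast
qed

lemma scaled_uniform_limit:
  fixes S :: "complex set"
  assumes U: "uniform_limit (K \<times> S) f g F" and b: "bounded (g ` (K \<times> S))"
    and S: "compact S" and r: "(r \<longlongrightarrow> r0) F" "0 < (r0::real)"
  shows "uniform_limit (K \<times> S) (\<lambda>l x. of_real (r l) powr snd x * f l x) (\<lambda>x. of_real r0 powr snd x * g x) F"
proof (rule uniform_lim_mult[OF _ U _ b])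
  show "uniform_limit (K \<times> S) (\<lambda>l x. of_real (r l) powr snd x) (\<lambda>x. of_real r0 powr snd x :: complex) F"
  proof (rule uniform_limitI)
    fix e :: real assume "0 < e"
    from uniform_limitD[OF powr_uniform_limit[OF S r] this]
    show "\<forall>\<^sub>F l in F. \<forall>x\<in>K \<times> S. dist (of_real (r l) powr snd x) (of_real r0 powr snd x :: complex) < e"
      by eventually_elim auto
  qed
  have "continuous_on S (\<lambda>s. of_real r0 powr s :: complex)"
    using r(2) by (intro continuous_on_powr_complex continuous_intros) (auto simp: complex_nonpos_Reals_iff)
  then have "bounded ((\<lambda>s. of_real r0 powr s :: complex) ` S)"
    using S compact_continuous_image compact_imp_bounded by blast
  then show "bounded ((\<lambda>x. of_real r0 powr snd x :: complex) ` (K \<times> S))"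
    by (rule bounded_subset) auto
qed

lemma esum_disjoint_union:
  assumes "finite J" "\<And>i j. i \<in> J \<Longrightarrow> j \<in> J \<Longrightarrow> i \<noteq> j \<Longrightarrow> I i \<inter> I j = {}"
    and "\<And>i. i \<in> J \<Longrightarrow> (\<lambda>X. of_real (val X z) powr (- s)) summable_on I i"
  shows "esum (\<Union>i\<in>J. I i) s z = (\<Sum>i\<in>J. esum (I i) s z) \<and> (\<lambda>X. of_real (val X z) powr (- s) :: complex) summable_on (\<Union>i\<in>J. I i)"
  using assms
proof (induction J rule: finite_induct)
  case empty
  show ?case by (simp add: esum_def)
next
  case (insert i J)
  have IH: "esum (\<Union>i\<in>J. I i) s z = (\<Sum>i\<in>J. esum (I i) s z)" "(\<lambda>X. of_real (val X z) powr (- s) :: complex) summable_on (\<Union>i\<in>J. I i)"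
    using insert by auto
  have d: "I i \<inter> (\<Union>i\<in>J. I i) = {}" using insert.prems(1) insert.hyps by blast
  have si: "(\<lambda>X. of_real (val X z) powr (- s) :: complex) summable_on I i" using insert.prems(2) by blast
  have U: "(\<Union>i\<in>insert i J. I i) = I i \<union> (\<Union>i\<in>J. I i)" by blast
  have "esum (\<Union>i\<in>insert i J. I i) s z = esum (I i) s z + esum (\<Union>i\<in>J. I i) s z"
    unfolding U esum_def by (rule infsum_Un_disjoint[OF si IH(2) d])
  moreover have "(\<lambda>X. of_real (val X z) powr (- s) :: complex) summable_on (\<Union>i\<in>insert i J. I i)"
    unfolding U by (rule summable_on_Un_disjoint[OF si IH(2) d])
  ultimately show ?case using IH(1) insert.hyps by simp
qed

context degenerating_family
begin

section \<open>Which conjugates survive in the limit\<close>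

lemma in_L: "\<forall>\<^sub>F l in at 0 within L. l \<in> L"
  by (simp add: eventually_at_filter)

text \<open>Pointwise convergence is the case of one-element sets K and S, with \<delta> = Re s -
  1.\<close>

lemma convergesI:
  assumes U: "\<And>c K S \<delta>. compact K \<Longrightarrow> K \<subseteq> uhp \<Longrightarrow> compact S \<Longrightarrow> 0 < \<delta> \<Longrightarrow> (\<And>s. s \<in> S \<Longrightarrow> 1 + \<delta> \<le> Re s) \<Longrightarrow>
    uniform_limit (K \<times> S) (\<lambda>l (z, s). F l s (\<phi> l c z)) (\<lambda>(z, s). F0 c s z) (at 0 within L)"
  shows "converges_pointwise L \<phi> F F0 \<and> converges_uniformly L \<Gamma>0 \<phi> cmp q F F0"
proof
  show "converges_pointwise L \<phi> F F0"
    unfolding converges_pointwise_def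
  proof (intro allI ballI impI)
    fix c z and s :: complex assume z: "z \<in> uhp" and s: "1 < Re s"
    have "uniform_limit ({z} \<times> {s}) (\<lambda>l (z, s). F l s (\<phi> l c z)) (\<lambda>(z, s). F0 c s z) (at 0 within L)"
      by (rule U[where \<delta> = "Re s - 1"]) (use z s in auto)
    from tendsto_uniform_limitI[OF this, of "(z, s)"]
    show "((\<lambda>l. F l s (\<phi> l c z)) \<longlongrightarrow> F0 c s z) (at 0 within L)" by simp
  qed
  show "converges_uniformly L \<Gamma>0 \<phi> cmp q F F0"
    unfolding converges_uniformly_def
  proof (intro allI impI)
    fix c K and S :: "complex set" and \<epsilon> \<delta> :: real
    assume "compact K" "K \<subseteq> uhp - developing_nbhd \<Gamma>0 cmp q \<epsilon> c" "compact S" "0 < \<delta>" "S \<subseteq> {s. 1 + \<delta> \<le> Re s}"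
    then show "uniform_limit (K \<times> S) (\<lambda>l (z, s). F l s (\<phi> l c z)) (\<lambda>(z, s). F0 c s z) (at 0 within L)"
      by (intro U[where \<delta> = \<delta>]) auto
  qed
qed

text \<open>Translates \<open>corresponds\<close> into the language of \<open>rel\<close>: its
  conjugator k enters \<open>cj\<close> through the inverse, and the possible inversion of \<gamma>
  stays inside \<open>quad\<close>.\<close>

lemma corresponds_rel:
  assumes l: "l \<in> L" and g: "\<gamma>0 \<in> \<Gamma>0 c" "\<gamma> \<in> \<Gamma> l" and c: "corresponds (\<Gamma> l) (\<phi> l c) \<gamma>0 \<gamma>"
  obtains h \<kappa> where "\<kappa> \<in> \<Gamma> l" "rel l c \<gamma>0 h" "h \<in> quad (cj \<kappa> \<gamma>)"
proof -
  note sub = subgroup_SL2R_D[OF group_l[OF l]]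
  obtain k h' where k: "k \<in> \<Gamma> l" "h' \<in> {\<gamma>, matrix_inv \<gamma>}" "\<forall>z\<in>uhp. \<phi> l c (mob \<gamma>0 z) = mob (k ** h' ** matrix_inv k) (\<phi> l c z)"
    using c unfolding corresponds_def by blast
  have kc: "k \<in> carrier SL2R" "\<gamma> \<in> carrier SL2R" using sub k g by auto
  have h': "h' \<in> quad \<gamma>" "h' \<in> \<Gamma> l" using k(2) sub g by (auto simp: quad_def)
  have eq: "k ** h' ** matrix_inv k = cj (matrix_inv k) h'" by (simp add: cj_def matrix_inv_inv kc)
  show thesis
  proof (rule that)
    show "matrix_inv k \<in> \<Gamma> l" using sub k by blast
    show "rel l c \<gamma>0 (cj (matrix_inv k) h')"
      using k(3) g(1) h' cj_subgroup[OF group_l[OF l] sub(4)[OF k(1)] h'(2)] by (simp add: rel_def eq)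
    show "cj (matrix_inv k) h' \<in> quad (cj (matrix_inv k) \<gamma>)" by (rule quad_cj[OF SL2R_inv[OF kc(1)] kc(2) h'(1)])
  qed
qed

text \<open>\<open>disp\<close> involves half the distance, so the doubling allowed by M = 2 yields
  2 sinh of the limit distance. The point \<open>\<i>\<close> is an arbitrary base point, used on
  every component.\<close>

lemma eventually_rel_disp_bound:
  assumes g: "g \<in> \<Gamma>0 c"
  shows "\<forall>\<^sub>F l in at 0 within L. \<forall>h. rel l c g h \<longrightarrow> disp h (\<phi> l c \<i>) \<le> 2 * sinh (hdist \<i> (mob g \<i>))"
proof -
  have i: "\<i> \<in> uhp" by (simp add: uhp_def)
  have gi: "mob g \<i> \<in> uhp" by (rule mob_uhp[OF gamma0_carrier[OF g] i])
  have "\<forall>\<^sub>F l in at 0 within L. almost_iso l (hdist \<i> (mob g \<i>)) 2 {\<i>}"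
    by (rule eventually_almost_iso) (use i in auto)
  then show ?thesis
  proof (eventually_elim, intro allI impI)
    fix l h assume a: "almost_iso l (hdist \<i> (mob g \<i>)) 2 {\<i>}" and r: "rel l c g h"
    note l = almost_isoD(1)[OF a singletonI i]
    have "hdist (\<phi> l c \<i>) (\<phi> l c (mob g \<i>)) \<le> 2 * hdist \<i> (mob g \<i>)"
      using almost_isoD(2)[OF a singletonI gi] by simp
    then show "disp h (\<phi> l c \<i>) \<le> 2 * sinh (hdist \<i> (mob g \<i>))"
      unfolding rel_disp[OF l r i] by simp
  qed
qed

lemma eventually_disp_bounded_below:
  assumes K: "compact K" "K \<subseteq> uhp"
  obtains b where "0 < b" "b \<le> 1"
    "\<forall>\<^sub>F l in at 0 within L. \<forall>c. \<forall>z\<in>insert \<i> K. \<forall>h\<in>\<Gamma> l. (\<forall>u\<in>uhp. 0 < disp h u) \<longrightarrow> b \<le> disp h (\<phi> l c z)"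
proof -
  have i: "\<i> \<in> uhp" by (simp add: uhp_def)
  have iK: "compact (insert \<i> K)" "insert \<i> K \<subseteq> uhp" using K i by auto
  obtain b where b: "0 < b" "b \<le> 1" and
    ev: "\<forall>\<^sub>F l in at 0 within L. \<forall>c. \<forall>z\<in>insert \<i> K. \<forall>h\<in>\<Gamma> l. (\<forall>u\<in>uhp. mob h u \<noteq> u) \<longrightarrow> b \<le> hdist (\<phi> l c z) (mob h (\<phi> l c z))"
    by (rule eventually_hdist_bounded_below[OF iK])
  have "\<forall>\<^sub>F l in at 0 within L. \<forall>c. \<forall>z\<in>insert \<i> K. \<forall>h\<in>\<Gamma> l. (\<forall>u\<in>uhp. 0 < disp h u) \<longrightarrow> b \<le> disp h (\<phi> l c z)"
    using ev in_L
  proof (eventually_elim, intro allI ballI impI)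
    fix l c z h
    assume ev: "\<forall>c. \<forall>z\<in>insert \<i> K. \<forall>h\<in>\<Gamma> l. (\<forall>u\<in>uhp. mob h u \<noteq> u) \<longrightarrow> b \<le> hdist (\<phi> l c z) (mob h (\<phi> l c z))"
      and l: "l \<in> L" and z: "z \<in> insert \<i> K" and h: "h \<in> \<Gamma> l" and pos: "\<forall>u\<in>uhp. 0 < disp h u"
    have hc: "h \<in> carrier SL2R" by (rule gamma_carrier[OF l h])
    have "\<forall>u\<in>uhp. mob h u \<noteq> u" using pos disp_pos_iff[OF hc] by blast
    then have "b \<le> hdist (\<phi> l c z) (mob h (\<phi> l c z))" using ev z h by blast
    also have "\<dots> \<le> disp h (\<phi> l c z)" by (rule le_disp[OF hc phi_uhp[OF l]]) (use z iK in blast)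
    finally show "b \<le> disp h (\<phi> l c z)" .
  qed
  with b show thesis by (rule that)
qed

lemma disp_quad_cj_pos:
  assumes "\<gamma> \<in> carrier SL2R" "k \<in> carrier SL2R" "h \<in> quad (cj k \<gamma>)" "\<forall>u\<in>uhp. 0 < disp \<gamma> u" "u \<in> uhp"
  shows "disp h u = disp \<gamma> (mob k u)" "0 < disp h u"
proof -
  show "disp h u = disp \<gamma> (mob k u)"
    using disp_quad[OF cj_carrier[OF assms(2,1)] assms(3)] disp_cj[OF assms(1,2,5)] by simp
  then show "0 < disp h u" using assms(4) mob_uhp[OF assms(2,5)] by simp
qed

text \<open>A conjugate of bounded displacement at z and the image of \<open>\<gamma>0\<close> at
  the base point \<open>\<i>\<close> give two points in one strip of \<open>\<gamma> l\<close>. By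
  \<open>near\<close> they are at bounded distance modulo the centralizer, and
  \<open>conj_transfer\<close> turns this into conjugacy in the limit group.\<close>

lemma eventually_conjugate_in_limit:
  assumes g0: "\<gamma>0 \<in> \<Gamma>0 c0" and g: "\<And>l. l \<in> L \<Longrightarrow> \<gamma> l \<in> \<Gamma> l" "\<And>l u. l \<in> L \<Longrightarrow> u \<in> uhp \<Longrightarrow> 0 < disp (\<gamma> l) u"
    and cor: "\<And>l. l \<in> L \<Longrightarrow> corresponds (\<Gamma> l) (\<phi> l c0) \<gamma>0 (\<gamma> l)"
    and near: "\<And>b T. 0 < b \<Longrightarrow> b \<le> 1 \<Longrightarrow> \<exists>R. \<forall>\<^sub>F l in at 0 within L. \<forall>x\<in>uhp. \<forall>y\<in>uhp.
      disp (\<gamma> l) x \<in> {b..T} \<longrightarrow> disp (\<gamma> l) y \<in> {b..T} \<longrightarrow> (\<exists>k\<in>\<Gamma> l. k ** \<gamma> l = \<gamma> l ** k \<and> hdist x (mob k y) \<le> R)"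
    and K: "compact K" "K \<subseteq> uhp"
  shows "\<forall>\<^sub>F l in at 0 within L. \<forall>z\<in>K. \<forall>h\<in>\<Gamma> l. quad h \<in> cls (\<Gamma> l) (\<gamma> l) \<longrightarrow> disp h (\<phi> l c z) \<le> T \<longrightarrow>
       c0 = c \<and> (\<exists>g. rel l c g h \<and> quad g \<in> cls (\<Gamma>0 c) \<gamma>0)"
proof -
  have i: "\<i> \<in> uhp" by (simp add: uhp_def)
  obtain b where b: "0 < b" "b \<le> 1" and
    low: "\<forall>\<^sub>F l in at 0 within L. \<forall>c. \<forall>z\<in>insert \<i> K. \<forall>h\<in>\<Gamma> l. (\<forall>u\<in>uhp. 0 < disp h u) \<longrightarrow> b \<le> disp h (\<phi> l c z)"
    by (rule eventually_disp_bounded_below[OF K])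
  define T' where "T' = max T (2 * sinh (hdist \<i> (mob \<gamma>0 \<i>)))"
  obtain R where nr: "\<forall>\<^sub>F l in at 0 within L. \<forall>x\<in>uhp. \<forall>y\<in>uhp.
      disp (\<gamma> l) x \<in> {b..T'} \<longrightarrow> disp (\<gamma> l) y \<in> {b..T'} \<longrightarrow> (\<exists>k\<in>\<Gamma> l. k ** \<gamma> l = \<gamma> l ** k \<and> hdist x (mob k y) \<le> R)"
    using near[OF b] by blast
  have "\<forall>\<^sub>F l in at 0 within L. almost_iso l (2 * R + 1) 2 {\<i>}" by (rule eventually_almost_iso) (use i in auto)
  then show ?thesis using low nr eventually_rel_disp_bound[OF g0]
  proof (eventually_elim, intro ballI impI)
    fix l z h
    assume a: "almost_iso l (2 * R + 1) 2 {\<i>}"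
      and low: "\<forall>c. \<forall>z\<in>insert \<i> K. \<forall>h\<in>\<Gamma> l. (\<forall>u\<in>uhp. 0 < disp h u) \<longrightarrow> b \<le> disp h (\<phi> l c z)"
      and nr: "\<forall>x\<in>uhp. \<forall>y\<in>uhp. disp (\<gamma> l) x \<in> {b..T'} \<longrightarrow> disp (\<gamma> l) y \<in> {b..T'} \<longrightarrow>
        (\<exists>k\<in>\<Gamma> l. k ** \<gamma> l = \<gamma> l ** k \<and> hdist x (mob k y) \<le> R)"
      and up: "\<forall>h. rel l c0 \<gamma>0 h \<longrightarrow> disp h (\<phi> l c0 \<i>) \<le> 2 * sinh (hdist \<i> (mob \<gamma>0 \<i>))"
      and z: "z \<in> K" and h: "h \<in> \<Gamma> l" "quad h \<in> cls (\<Gamma> l) (\<gamma> l)" and T: "disp h (\<phi> l c z) \<le> T"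
    note l = almost_isoD(1)[OF a singletonI i]
    have zu: "z \<in> uhp" using z K by blast
    have gc: "\<gamma> l \<in> carrier SL2R" by (rule gamma_carrier[OF l g(1)[OF l]])
    obtain h1 \<kappa> where h1: "\<kappa> \<in> \<Gamma> l" "rel l c0 \<gamma>0 h1" "h1 \<in> quad (cj \<kappa> (\<gamma> l))"
      by (rule corresponds_rel[OF l g0 g(1)[OF l] cor[OF l]])
    obtain k where k: "k \<in> \<Gamma> l" "h \<in> quad (cj k (\<gamma> l))" using cls_memD[OF group_l[OF l] g(1)[OF l] h(2)] by blast
    have cr: "k \<in> carrier SL2R" "\<kappa> \<in> carrier SL2R" using gamma_carrier[OF l] k h1 by auto
    have pos: "\<forall>u\<in>uhp. 0 < disp (\<gamma> l) u" using g(2)[OF l] by blast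
    note dh = disp_quad_cj_pos[OF gc cr(1) k(2) pos]
    note dh1 = disp_quad_cj_pos[OF gc cr(2) h1(3) pos]
    have h1G: "h1 \<in> \<Gamma> l" using h1(2) by (simp add: rel_def)
    have u: "\<phi> l c z \<in> uhp" "\<phi> l c0 \<i> \<in> uhp" using phi_uhp[OF l] zu i by auto
    have bh: "b \<le> disp h (\<phi> l c z)" using low z h(1) dh(2) by blast
    have bh1: "b \<le> disp h1 (\<phi> l c0 \<i>)" using low h1G dh1(2) by blast
    have dx: "disp (\<gamma> l) (mob k (\<phi> l c z)) \<in> {b..T'}"
      unfolding dh(1)[OF u(1), symmetric] using bh T by (simp add: T'_def)
    have dy: "disp (\<gamma> l) (mob \<kappa> (\<phi> l c0 \<i>)) \<in> {b..T'}"
      unfolding dh1(1)[OF u(2), symmetric] using bh1 up h1(2) by (force simp: T'_def)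
    obtain m where m: "m \<in> \<Gamma> l" "m ** \<gamma> l = \<gamma> l ** m" "hdist (mob k (\<phi> l c z)) (mob m (mob \<kappa> (\<phi> l c0 \<i>))) \<le> R"
      using nr mob_uhp[OF cr(1) u(1)] mob_uhp[OF cr(2) u(2)] dx dy by blast
    show "c0 = c \<and> (\<exists>g. rel l c g h \<and> quad g \<in> cls (\<Gamma>0 c) \<gamma>0)"
      by (rule conj_transfer[OF a i zu g(1)[OF l] h1(2,1,3) k m(1,2)]) (use m(3) in simp)
  qed
qed

text \<open>By \<open>disp_square\<close> the absolute trace is the \<open>disp\<close> of the
  square divided by that of the element. Both are given by distances among the images of
  \<open>\<i>\<close> and its translates under \<gamma>0 and its square, and those distances
  converge.\<close>

lemma trace_tendsto:
  assumes g0: "\<gamma>0 \<in> \<Gamma>0 c0" "\<And>u. u \<in> uhp \<Longrightarrow> 0 < disp \<gamma>0 u" and g: "\<And>l. l \<in> L \<Longrightarrow> \<gamma> l \<in> \<Gamma> l" "\<And>l u. l \<in> L \<Longrightarrow> u \<in> uhp \<Longrightarrow> 0 < disp (\<gamma> l) u"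
    and cor: "\<And>l. l \<in> L \<Longrightarrow> corresponds (\<Gamma> l) (\<phi> l c0) \<gamma>0 (\<gamma> l)"
  shows "((\<lambda>l. \<bar>trace (\<gamma> l)\<bar>) \<longlongrightarrow> \<bar>trace \<gamma>0\<bar>) (at 0 within L)"
proof -
  have i: "\<i> \<in> uhp" by (simp add: uhp_def)
  define D where "D l w = 2 * sinh (hdist (\<phi> l c0 \<i>) (\<phi> l c0 w) / 2)" for l w
  have gc: "\<gamma>0 \<in> carrier SL2R" "\<gamma>0 ** \<gamma>0 \<in> carrier SL2R" using gamma0_carrier[OF g0(1)] SL2R_mult by auto
  have gi: "mob \<gamma>0 \<i> \<in> uhp" "mob (\<gamma>0 ** \<gamma>0) \<i> \<in> uhp" using mob_uhp gc i by auto
  have lim: "((\<lambda>l. D l w) \<longlongrightarrow> 2 * sinh (hdist \<i> w / 2)) (at 0 within L)" if "w \<in> uhp" for w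
    unfolding D_def by (intro tendsto_intros hdist_tendsto i that) simp
  have "((\<lambda>l. D l (mob (\<gamma>0 ** \<gamma>0) \<i>) / D l (mob \<gamma>0 \<i>)) \<longlongrightarrow>
    2 * sinh (hdist \<i> (mob (\<gamma>0 ** \<gamma>0) \<i>) / 2) / (2 * sinh (hdist \<i> (mob \<gamma>0 \<i>) / 2))) (at 0 within L)"
    using g0(2)[OF i] by (intro tendsto_divide lim gi) (simp add: disp_eq_hdist[OF gc(1) i])
  also have "2 * sinh (hdist \<i> (mob (\<gamma>0 ** \<gamma>0) \<i>) / 2) / (2 * sinh (hdist \<i> (mob \<gamma>0 \<i>) / 2)) = \<bar>trace \<gamma>0\<bar>"
    unfolding disp_eq_hdist[OF gc(1) i, symmetric] disp_eq_hdist[OF gc(2) i, symmetric]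
    using g0(2)[OF i] by (simp add: disp_square)
  finally have main: "((\<lambda>l. D l (mob (\<gamma>0 ** \<gamma>0) \<i>) / D l (mob \<gamma>0 \<i>)) \<longlongrightarrow> \<bar>trace \<gamma>0\<bar>) (at 0 within L)" .
  have "\<forall>\<^sub>F l in at 0 within L. D l (mob (\<gamma>0 ** \<gamma>0) \<i>) / D l (mob \<gamma>0 \<i>) = \<bar>trace (\<gamma> l)\<bar>"
    using in_L
  proof eventually_elim
    fix l assume l: "l \<in> L"
    have glc: "\<gamma> l \<in> carrier SL2R" by (rule gamma_carrier[OF l g(1)[OF l]])
    obtain h \<kappa> where h: "\<kappa> \<in> \<Gamma> l" "rel l c0 \<gamma>0 h" "h \<in> quad (cj \<kappa> (\<gamma> l))"
      by (rule corresponds_rel[OF l g0(1) g(1)[OF l] cor[OF l]])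
    have kc: "\<kappa> \<in> carrier SL2R" by (rule gamma_carrier[OF l h(1)])
    have tr: "\<bar>trace h\<bar> = \<bar>trace (\<gamma> l)\<bar>"
      using trace_quad_abs[OF cj_carrier[OF kc glc] h(3)] by (simp add: trace_cj kc)
    have "0 < disp h (\<phi> l c0 \<i>)" by (rule disp_quad_cj_pos(2)[OF glc kc h(3) _ phi_uhp[OF l i]]) (use g(2)[OF l] in blast)
    moreover have "D l (mob \<gamma>0 \<i>) = disp h (\<phi> l c0 \<i>)" "D l (mob (\<gamma>0 ** \<gamma>0) \<i>) = disp (h ** h) (\<phi> l c0 \<i>)"
      using rel_disp[OF l h(2) i] rel_disp[OF l rel_mult[OF l h(2,2)] i] by (simp_all add: D_def)
    ultimately show "D l (mob (\<gamma>0 ** \<gamma>0) \<i>) / D l (mob \<gamma>0 \<i>) = \<bar>trace (\<gamma> l)\<bar>"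
      by (simp add: disp_square tr)
  qed
  from tendsto_cong[OF this] main show ?thesis by simp
qed

end

section \<open>Convergence for the three kinds of Eisenstein series\<close>

lemma hyperbolic_strip_exists:
  assumes "subgroup \<Gamma> SL2R" "\<gamma> \<in> \<Gamma>" "hyperbolic \<gamma>"
  shows "\<exists>side \<tau>. strip_coords \<Gamma> \<gamma> side \<tau>"
  by (rule hyperbolic_strip_coords[OF assms]) blast

lemma parabolic_strip_exists:
  assumes "subgroup \<Gamma> SL2R" "p \<in> \<Gamma>" "parabolic p"
  shows "\<exists>side \<tau>. strip_coords \<Gamma> p side \<tau>"
  by (rule parabolic_strip_coords[OF assms]) blast

context degenerating_family
begin

lemma cls_mem_of_quad_cj:
  assumes "\<gamma> \<in> carrier SL2R" "\<kappa> \<in> carrier SL2R" "\<kappa> \<in> \<Gamma>'" "h \<in> quad (cj \<kappa> \<gamma>)"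
  shows "quad h \<in> cls \<Gamma>' \<gamma>"
  using quad_eq[OF cj_carrier[OF assms(2,1)] assms(4)] assms(3) by (simp add: cls_def)

lemma single_class_converges:
  assumes g0: "\<gamma>0 \<in> \<Gamma>0 c0" "\<And>u. u \<in> uhp \<Longrightarrow> 0 < disp \<gamma>0 u" "\<exists>side \<tau>. strip_coords (\<Gamma>0 c0) \<gamma>0 side \<tau>"
    and g: "\<And>l. l \<in> L \<Longrightarrow> \<gamma> l \<in> \<Gamma> l" "\<And>l u. l \<in> L \<Longrightarrow> u \<in> uhp \<Longrightarrow> 0 < disp (\<gamma> l) u"
      "\<And>l. l \<in> L \<Longrightarrow> \<exists>side \<tau>. strip_coords (\<Gamma> l) (\<gamma> l) side \<tau>"
    and cor: "\<And>l. l \<in> L \<Longrightarrow> corresponds (\<Gamma> l) (\<phi> l c0) \<gamma>0 (\<gamma> l)"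
    and near: "\<And>b T. 0 < b \<Longrightarrow> b \<le> 1 \<Longrightarrow> \<exists>R. \<forall>\<^sub>F l in at 0 within L. \<forall>x\<in>uhp. \<forall>y\<in>uhp.
      disp (\<gamma> l) x \<in> {b..T} \<longrightarrow> disp (\<gamma> l) y \<in> {b..T} \<longrightarrow> (\<exists>k\<in>\<Gamma> l. k ** \<gamma> l = \<gamma> l ** k \<and> hdist x (mob k y) \<le> R)"
    and K: "compact K" "K \<subseteq> uhp" and S: "compact S" and \<delta>: "0 < \<delta>" "\<And>s. s \<in> S \<Longrightarrow> 1 + \<delta> \<le> Re s"
  shows "uniform_limit (K \<times> S) (\<lambda>l (z, s). esum (cls (\<Gamma> l) (\<gamma> l)) s (\<phi> l c z))
    (\<lambda>(z, s). if c = c0 then esum (cls (\<Gamma>0 c0) \<gamma>0) s z else 0) (at 0 within L)"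
    "bounded ((\<lambda>(z, s). if c = c0 then esum (cls (\<Gamma>0 c0) \<gamma>0) s z else 0) ` (K \<times> S))"
proof -
  \<comment> \<open>On a component other than c0 the empty set makes the limit sum 0, as the
    convention requires; there \<open>eventually_conjugate_in_limit\<close> excludes conjugates of
    bounded displacement altogether.\<close>
  define Q where "Q = (if c = c0 then {\<gamma>0} else {})"
  have lim: "(\<lambda>(z, s). esum (\<Union>p\<in>Q. cls (\<Gamma>0 c) p) s z) = (\<lambda>(z, s). if c = c0 then esum (cls (\<Gamma>0 c0) \<gamma>0) s z else 0)"
    by (auto simp: Q_def esum_def fun_eq_iff)
  have Q: "finite Q" "Q \<subseteq> \<Gamma>0 c" "\<And>p u. p \<in> Q \<Longrightarrow> u \<in> uhp \<Longrightarrow> 0 < disp p u"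
    "\<And>p. p \<in> Q \<Longrightarrow> \<exists>side \<tau>. strip_coords (\<Gamma>0 c) p side \<tau>"
    using g0 by (auto simp: Q_def split: if_splits)
  show "uniform_limit (K \<times> S) (\<lambda>l (z, s). esum (cls (\<Gamma> l) (\<gamma> l)) s (\<phi> l c z))
    (\<lambda>(z, s). if c = c0 then esum (cls (\<Gamma>0 c0) \<gamma>0) s z else 0) (at 0 within L)"
    unfolding lim[symmetric]
  proof (rule esum_converges[OF Q g(1,3) _ _ K S \<delta>])
    fix l p assume l: "l \<in> L" and p: "p \<in> Q"
    then have pc: "c = c0" "p = \<gamma>0" by (auto simp: Q_def split: if_splits)
    obtain h \<kappa> where h: "\<kappa> \<in> \<Gamma> l" "rel l c0 \<gamma>0 h" "h \<in> quad (cj \<kappa> (\<gamma> l))"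
      by (rule corresponds_rel[OF l g0(1) g(1)[OF l] cor[OF l]])
    have "quad h \<in> cls (\<Gamma> l) (\<gamma> l)"
      by (rule cls_mem_of_quad_cj[OF gamma_carrier[OF l g(1)[OF l]] gamma_carrier[OF l h(1)] h(1,3)])
    then show "\<exists>h. rel l c p h \<and> quad h \<in> cls (\<Gamma> l) (\<gamma> l)" using h(2) pc by blast
  next
    fix T
    show "\<forall>\<^sub>F l in at 0 within L. \<forall>z\<in>K. \<forall>h\<in>\<Gamma> l. quad h \<in> cls (\<Gamma> l) (\<gamma> l) \<longrightarrow> disp h (\<phi> l c z) \<le> T \<longrightarrow>
       (\<exists>g. rel l c g h \<and> quad g \<in> (\<Union>p\<in>Q. cls (\<Gamma>0 c) p))"
    proof -
      have "\<forall>\<^sub>F l in at 0 within L. \<forall>z\<in>K. \<forall>h\<in>\<Gamma> l. quad h \<in> cls (\<Gamma> l) (\<gamma> l) \<longrightarrow> disp h (\<phi> l c z) \<le> T \<longrightarrow>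
       c0 = c \<and> (\<exists>g. rel l c g h \<and> quad g \<in> cls (\<Gamma>0 c) \<gamma>0)"
        by (rule eventually_conjugate_in_limit[OF g0(1) g(1,2) cor near K])
      then show ?thesis
      proof eventually_elim
      fix l assume "\<forall>z\<in>K. \<forall>h\<in>\<Gamma> l. quad h \<in> cls (\<Gamma> l) (\<gamma> l) \<longrightarrow> disp h (\<phi> l c z) \<le> T \<longrightarrow>
       c0 = c \<and> (\<exists>g. rel l c g h \<and> quad g \<in> cls (\<Gamma>0 c) \<gamma>0)"
      then show "\<forall>z\<in>K. \<forall>h\<in>\<Gamma> l. quad h \<in> cls (\<Gamma> l) (\<gamma> l) \<longrightarrow> disp h (\<phi> l c z) \<le> T \<longrightarrow>
       (\<exists>g. rel l c g h \<and> quad g \<in> (\<Union>p\<in>Q. cls (\<Gamma>0 c) p))" by (force simp: Q_def)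
    qed
    qed
  qed
  show "bounded ((\<lambda>(z, s). if c = c0 then esum (cls (\<Gamma>0 c0) \<gamma>0) s z else 0) ` (K \<times> S))"
    unfolding lim[symmetric] by (rule limit_esum_summable_bounded(2)[OF Q K S \<delta>])
qed

theorem hyperbolic_converges:
  assumes p0: "primitive_hyp (\<Gamma>0 c0) \<gamma>0"
    and p: "\<And>l. l \<in> L \<Longrightarrow> primitive_hyp (\<Gamma> l) (\<gamma> l)" and cor: "\<And>l. l \<in> L \<Longrightarrow> corresponds (\<Gamma> l) (\<phi> l c0) \<gamma>0 (\<gamma> l)"
    and K: "compact K" "K \<subseteq> uhp" and S: "compact S" and \<delta>: "0 < \<delta>" "\<And>s. s \<in> S \<Longrightarrow> 1 + \<delta> \<le> Re s"
  shows "uniform_limit (K \<times> S) (\<lambda>l (z, s). E_hyp (\<Gamma> l) (\<gamma> l) s (\<phi> l c z))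
    (\<lambda>(z, s). if c = c0 then E_hyp (\<Gamma>0 c0) \<gamma>0 s z else 0) (at 0 within L)"
proof -
  have h0: "\<gamma>0 \<in> \<Gamma>0 c0" "hyperbolic \<gamma>0" using p0 by (auto simp: primitive_hyp_def)
  have h: "\<gamma> l \<in> \<Gamma> l" "hyperbolic (\<gamma> l)" if "l \<in> L" for l using p[OF that] by (auto simp: primitive_hyp_def)
  have g0: "\<gamma>0 \<in> \<Gamma>0 c0" "\<And>u. u \<in> uhp \<Longrightarrow> 0 < disp \<gamma>0 u" "\<exists>side \<tau>. strip_coords (\<Gamma>0 c0) \<gamma>0 side \<tau>"
    by (rule h0(1), erule hyperbolic_disp_pos[OF h0(2)], rule hyperbolic_strip_exists[OF limit_group(1) h0])
  have g: "\<And>l. l \<in> L \<Longrightarrow> \<gamma> l \<in> \<Gamma> l" "\<And>l u. l \<in> L \<Longrightarrow> u \<in> uhp \<Longrightarrow> 0 < disp (\<gamma> l) u"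
      "\<And>l. l \<in> L \<Longrightarrow> \<exists>side \<tau>. strip_coords (\<Gamma> l) (\<gamma> l) side \<tau>"
    using h hyperbolic_disp_pos hyperbolic_strip_exists group_l by simp_all
  define t0 where "t0 = (trace \<gamma>0)\<^sup>2 - 4"
  have t0: "0 < t0"
  proof -
    have "2\<^sup>2 < \<bar>trace \<gamma>0\<bar>\<^sup>2" using h0(2) by (intro power_strict_mono) (auto simp: hyperbolic_def)
    then show ?thesis by (simp add: t0_def)
  qed
  have "((\<lambda>l. \<bar>trace (\<gamma> l)\<bar>\<^sup>2 - 4) \<longlongrightarrow> \<bar>trace \<gamma>0\<bar>\<^sup>2 - 4) (at 0 within L)"
    by (intro tendsto_intros trace_tendsto[OF g0(1,2) g(1,2) cor])
  then have tl: "((\<lambda>l. (trace (\<gamma> l))\<^sup>2 - 4) \<longlongrightarrow> t0) (at 0 within L)" by (simp add: t0_def)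
  \<comment> \<open>The traces converge to that of the hyperbolic limit element, so trace^2 - 4 is
    eventually above t0 / 2 and \<open>hyperbolic_near\<close> applies on both sides of the
    axis.\<close>
  have near: "\<exists>R. \<forall>\<^sub>F l in at 0 within L. \<forall>x\<in>uhp. \<forall>y\<in>uhp.
      disp (\<gamma> l) x \<in> {b..T} \<longrightarrow> disp (\<gamma> l) y \<in> {b..T} \<longrightarrow> (\<exists>k\<in>\<Gamma> l. k ** \<gamma> l = \<gamma> l ** k \<and> hdist x (mob k y) \<le> R)" for b T
  proof (intro exI)
    have "\<forall>\<^sub>F l in at 0 within L. t0 / 2 < (trace (\<gamma> l))\<^sup>2 - 4" using t0 by (intro order_tendstoD(1)[OF tl]) simp
    then show "\<forall>\<^sub>F l in at 0 within L. \<forall>x\<in>uhp. \<forall>y\<in>uhp.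
      disp (\<gamma> l) x \<in> {b..T} \<longrightarrow> disp (\<gamma> l) y \<in> {b..T} \<longrightarrow>
      (\<exists>k\<in>\<Gamma> l. k ** \<gamma> l = \<gamma> l ** k \<and> hdist x (mob k y) \<le> arcosh (1 + T\<^sup>2 / 2 * (1 + 4 / (t0 / 2))))"
      using in_L
    proof (eventually_elim, intro ballI impI)
      fix l x y assume t: "t0 / 2 < (trace (\<gamma> l))\<^sup>2 - 4" and l: "l \<in> L" and xy: "x \<in> uhp" "y \<in> uhp"
        "disp (\<gamma> l) x \<in> {b..T}" "disp (\<gamma> l) y \<in> {b..T}"
      show "\<exists>k\<in>\<Gamma> l. k ** \<gamma> l = \<gamma> l ** k \<and> hdist x (mob k y) \<le> arcosh (1 + T\<^sup>2 / 2 * (1 + 4 / (t0 / 2)))"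
        by (rule hyperbolic_near[OF group_l[OF l] h[OF l]]) (use t t0 xy in auto)
    qed
  qed
  have U: "uniform_limit (K \<times> S) (\<lambda>l (z, s). esum (cls (\<Gamma> l) (\<gamma> l)) s (\<phi> l c z))
    (\<lambda>(z, s). if c = c0 then esum (cls (\<Gamma>0 c0) \<gamma>0) s z else 0) (at 0 within L)"
    by (rule single_class_converges(1)[OF g0 g cor near K S \<delta>])
  have Ub: "bounded ((\<lambda>(z, s). if c = c0 then esum (cls (\<Gamma>0 c0) \<gamma>0) s z else 0) ` (K \<times> S))"
    by (rule single_class_converges(2)[OF g0 g cor near K S \<delta>])
  have "((\<lambda>l. sqrt ((trace (\<gamma> l))\<^sup>2 - 4)) \<longlongrightarrow> sqrt t0) (at 0 within L)" by (intro tendsto_intros tl)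
  from scaled_uniform_limit[OF U Ub S this] t0
  have lim: "uniform_limit (K \<times> S) (\<lambda>l x. of_real (sqrt ((trace (\<gamma> l))\<^sup>2 - 4)) powr snd x * (case x of (z, s) \<Rightarrow> esum (cls (\<Gamma> l) (\<gamma> l)) s (\<phi> l c z)))
    (\<lambda>x. of_real (sqrt t0) powr snd x * (case x of (z, s) \<Rightarrow> if c = c0 then esum (cls (\<Gamma>0 c0) \<gamma>0) s z else 0)) (at 0 within L)"
    by simp
  show ?thesis
  proof (rule iffD1[OF uniform_limit_cong lim])
    show "\<forall>\<^sub>F l in at 0 within L. \<forall>x\<in>K \<times> S. of_real (sqrt ((trace (\<gamma> l))\<^sup>2 - 4)) powr snd x * (case x of (z, s) \<Rightarrow> esum (cls (\<Gamma> l) (\<gamma> l)) s (\<phi> l c z)) =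
      (case x of (z, s) \<Rightarrow> E_hyp (\<Gamma> l) (\<gamma> l) s (\<phi> l c z))"
      using in_L
    proof (eventually_elim, clarify)
      fix l z s assume l: "l \<in> L" and "z \<in> K" "s \<in> S"
      then have "\<phi> l c z \<in> uhp" using phi_uhp[OF l] K by blast
      from E_hyp_eq_esum[OF group_l[OF l] p[OF l] this]
      show "of_real (sqrt ((trace (\<gamma> l))\<^sup>2 - 4)) powr snd (z, s) * esum (cls (\<Gamma> l) (\<gamma> l)) s (\<phi> l c z) = E_hyp (\<Gamma> l) (\<gamma> l) s (\<phi> l c z)"
        by simp
    qed
    show "of_real (sqrt t0) powr snd x * (case x of (z, s) \<Rightarrow> if c = c0 then esum (cls (\<Gamma>0 c0) \<gamma>0) s z else 0) =
      (case x of (z, s) \<Rightarrow> if c = c0 then E_hyp (\<Gamma>0 c0) \<gamma>0 s z else 0)" if "x \<in> K \<times> S" for x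
      using that K E_hyp_eq_esum[OF limit_group(1) p0] by (auto simp: t0_def)
  qed
qed

theorem parabolic_converges:
  assumes p0: "cusp_gen (\<Gamma>0 c0) p0"
    and p: "\<And>l. l \<in> L \<Longrightarrow> cusp_gen (\<Gamma> l) (p l)" and cor: "\<And>l. l \<in> L \<Longrightarrow> corresponds (\<Gamma> l) (\<phi> l c0) p0 (p l)"
    and K: "compact K" "K \<subseteq> uhp" and S: "compact S" and \<delta>: "0 < \<delta>" "\<And>s. s \<in> S \<Longrightarrow> 1 + \<delta> \<le> Re s"
  shows "uniform_limit (K \<times> S) (\<lambda>l (z, s). E_par (\<Gamma> l) (p l) s (\<phi> l c z))
    (\<lambda>(z, s). if c = c0 then E_par (\<Gamma>0 c0) p0 s z else 0) (at 0 within L)"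
proof -
  have h0: "p0 \<in> \<Gamma>0 c0" "parabolic p0" using p0 by (auto simp: cusp_gen_def)
  have h: "p l \<in> \<Gamma> l" "parabolic (p l)" if "l \<in> L" for l using p[OF that] by (auto simp: cusp_gen_def)
  have g0: "p0 \<in> \<Gamma>0 c0" "\<And>u. u \<in> uhp \<Longrightarrow> 0 < disp p0 u" "\<exists>side \<tau>. strip_coords (\<Gamma>0 c0) p0 side \<tau>"
    by (rule h0(1), erule parabolic_disp_pos[OF h0(2)], rule parabolic_strip_exists[OF limit_group(1) h0])
  have g: "\<And>l. l \<in> L \<Longrightarrow> p l \<in> \<Gamma> l" "\<And>l u. l \<in> L \<Longrightarrow> u \<in> uhp \<Longrightarrow> 0 < disp (p l) u"
      "\<And>l. l \<in> L \<Longrightarrow> \<exists>side \<tau>. strip_coords (\<Gamma> l) (p l) side \<tau>"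
    using h parabolic_disp_pos parabolic_strip_exists group_l by simp_all
  \<comment> \<open>A parabolic element has a single side, so \<open>strip_near\<close> gives the
    radius directly, with ratio T / b.\<close>
  have near: "\<exists>R. \<forall>\<^sub>F l in at 0 within L. \<forall>x\<in>uhp. \<forall>y\<in>uhp.
      disp (p l) x \<in> {b..T} \<longrightarrow> disp (p l) y \<in> {b..T} \<longrightarrow> (\<exists>k\<in>\<Gamma> l. k ** p l = p l ** k \<and> hdist x (mob k y) \<le> R)"
    if b: "0 < b" "b \<le> 1" for b T
  proof (intro exI)
    show "\<forall>\<^sub>F l in at 0 within L. \<forall>x\<in>uhp. \<forall>y\<in>uhp.
      disp (p l) x \<in> {b..T} \<longrightarrow> disp (p l) y \<in> {b..T} \<longrightarrow> (\<exists>k\<in>\<Gamma> l. k ** p l = p l ** k \<and> hdist x (mob k y) \<le> box_radius (T / b))"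
      using in_L
    proof (eventually_elim, intro ballI impI)
      fix l x y assume l: "l \<in> L" and xy: "x \<in> uhp" "y \<in> uhp" "disp (p l) x \<in> {b..T}" "disp (p l) y \<in> {b..T}"
      obtain \<tau> where sc: "strip_coords (\<Gamma> l) (p l) (\<lambda>_. True) \<tau>"
        by (rule parabolic_strip_coords[OF group_l[OF l] h[OF l]])
      show "\<exists>k\<in>\<Gamma> l. k ** p l = p l ** k \<and> hdist x (mob k y) \<le> box_radius (T / b)"
        by (rule strip_near[OF sc group_l[OF l] gamma_carrier[OF l h(1)[OF l]] xy(1,2) refl xy(3,4) b])
    qed
  qed
  have lim: "uniform_limit (K \<times> S) (\<lambda>l (z, s). esum (cls (\<Gamma> l) (p l)) s (\<phi> l c z))
    (\<lambda>(z, s). if c = c0 then esum (cls (\<Gamma>0 c0) p0) s z else 0) (at 0 within L)"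
    by (rule single_class_converges(1)[OF g0 g cor near K S \<delta>])
  show ?thesis
  proof (rule iffD1[OF uniform_limit_cong lim])
    show "\<forall>\<^sub>F l in at 0 within L. \<forall>x\<in>K \<times> S. (case x of (z, s) \<Rightarrow> esum (cls (\<Gamma> l) (p l)) s (\<phi> l c z)) =
      (case x of (z, s) \<Rightarrow> E_par (\<Gamma> l) (p l) s (\<phi> l c z))"
      using in_L
    proof (eventually_elim, clarify)
      fix l z s assume l: "l \<in> L" and "z \<in> K" "s \<in> S"
      then have "\<phi> l c z \<in> uhp" using phi_uhp[OF l] K by blast
      from E_par_eq_esum[OF group_l[OF l] p[OF l] this]
      show "esum (cls (\<Gamma> l) (p l)) s (\<phi> l c z) = E_par (\<Gamma> l) (p l) s (\<phi> l c z)" by simp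
    qed
    show "(case x of (z, s) \<Rightarrow> if c = c0 then esum (cls (\<Gamma>0 c0) p0) s z else 0) =
      (case x of (z, s) \<Rightarrow> if c = c0 then E_par (\<Gamma>0 c0) p0 s z else 0)" if "x \<in> K \<times> S" for x
      using that K E_par_eq_esum[OF limit_group(1) p0] by auto
  qed
qed

text \<open>
  The base points of the two developing cusps lie on different sides of the pinching geodesic: otherwise
  they would be close modulo \<open>\<Gamma> l\<close>, and the two cusps would agree.
\<close>

lemma eventually_conjugate_to_developing:
  assumes g: "\<And>l. l \<in> L \<Longrightarrow> \<gamma> l \<in> \<Gamma> l" "\<And>l. l \<in> L \<Longrightarrow> hyperbolic (\<gamma> l)"
    and rl: "\<And>l k. l \<in> L \<Longrightarrow> \<exists>h \<kappa>. \<kappa> \<in> \<Gamma> l \<and> rel l (cmp j k) (q j k) h \<and> h \<in> quad (cj \<kappa> (\<gamma> l))"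
    and K: "compact K" "K \<subseteq> uhp"
  shows "\<forall>\<^sub>F l in at 0 within L. \<forall>z\<in>K. \<forall>h\<in>\<Gamma> l. quad h \<in> cls (\<Gamma> l) (\<gamma> l) \<longrightarrow> disp h (\<phi> l c z) \<le> T \<longrightarrow>
       (\<exists>k. cmp j k = c \<and> (\<exists>g. rel l c g h \<and> quad g \<in> cls (\<Gamma>0 c) (q j k)))"
proof -
  have i: "\<i> \<in> uhp" by (simp add: uhp_def)
  have qG: "q j k \<in> \<Gamma>0 (cmp j k)" for k using developing[of j k] by (simp add: cusp_gen_def)
  obtain b where b: "0 < b" "b \<le> 1" and
    low: "\<forall>\<^sub>F l in at 0 within L. \<forall>c. \<forall>z\<in>insert \<i> K. \<forall>h\<in>\<Gamma> l. (\<forall>u\<in>uhp. 0 < disp h u) \<longrightarrow> b \<le> disp h (\<phi> l c z)"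
    by (rule eventually_disp_bounded_below[OF K])
  define V where "V k = 2 * sinh (hdist \<i> (mob (q j k) \<i>))" for k
  define T' where "T' = max T (max (V 1) (V 2))"
  have VT: "V k \<le> T'" for k using exhaust_2[of k] by (auto simp: T'_def)
  define R where "R = box_radius (T' / b)"
  have "\<forall>\<^sub>F l in at 0 within L. almost_iso l (2 * R + 1) 2 {\<i>}" by (rule eventually_almost_iso) (use i in auto)
  then show ?thesis using low eventually_rel_disp_bound[OF qG[of 1]] eventually_rel_disp_bound[OF qG[of 2]]
  proof eventually_elim
    fix l
    assume a: "almost_iso l (2 * R + 1) 2 {\<i>}"
      and low: "\<forall>c. \<forall>z\<in>insert \<i> K. \<forall>h\<in>\<Gamma> l. (\<forall>u\<in>uhp. 0 < disp h u) \<longrightarrow> b \<le> disp h (\<phi> l c z)"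
      and up1: "\<forall>h. rel l (cmp j 1) (q j 1) h \<longrightarrow> disp h (\<phi> l (cmp j 1) \<i>) \<le> 2 * sinh (hdist \<i> (mob (q j 1) \<i>))"
      and up2: "\<forall>h. rel l (cmp j 2) (q j 2) h \<longrightarrow> disp h (\<phi> l (cmp j 2) \<i>) \<le> 2 * sinh (hdist \<i> (mob (q j 2) \<i>))"
    note l = almost_isoD(1)[OF a singletonI i]
    have gc: "\<gamma> l \<in> carrier SL2R" by (rule gamma_carrier[OF l g(1)[OF l]])
    have pos: "\<forall>u\<in>uhp. 0 < disp (\<gamma> l) u" using hyperbolic_disp_pos[OF g(2)[OF l]] by blast
    obtain side \<tau> where sc: "strip_coords (\<Gamma> l) (\<gamma> l) side \<tau>"
      using hyperbolic_strip_exists[OF group_l[OF l] g(1)[OF l] g(2)[OF l]] by blast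
    have "\<forall>k. \<exists>h \<kappa>. \<kappa> \<in> \<Gamma> l \<and> rel l (cmp j k) (q j k) h \<and> h \<in> quad (cj \<kappa> (\<gamma> l))" using rl[OF l] by blast
    then obtain hh \<kappa> where hk: "\<And>k. \<kappa> k \<in> \<Gamma> l" "\<And>k. rel l (cmp j k) (q j k) (hh k)" "\<And>k. hh k \<in> quad (cj (\<kappa> k) (\<gamma> l))"
      by metis
    define y where "y k = mob (\<kappa> k) (\<phi> l (cmp j k) \<i>)" for k
    have kc: "\<kappa> k \<in> carrier SL2R" for k by (rule gamma_carrier[OF l hk(1)])
    have yu: "y k \<in> uhp" for k unfolding y_def by (rule mob_uhp[OF kc phi_uhp[OF l i]])
    have hhG: "hh k \<in> \<Gamma> l" for k using hk(2) by (simp add: rel_def)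
    have dy: "disp (\<gamma> l) (y k) \<in> {b..T'}" for k
    proof -
      note d = disp_quad_cj_pos[OF gc kc hk(3) pos]
      have "b \<le> disp (hh k) (\<phi> l (cmp j k) \<i>)" using low hhG d(2) by blast
      moreover have "disp (hh k) (\<phi> l (cmp j k) \<i>) \<le> V k"
        using up1 up2 hk(2) exhaust_2[of k] unfolding V_def by metis
      ultimately show ?thesis using VT[of k] d(1)[OF phi_uhp[OF l i]] by (simp add: y_def)
    qed
    \<comment> \<open>Lying on the same side as the base point \<open>y k\<close> suffices to
      recognize a conjugate as coming from the cusp k.\<close>
    have transfer: "cmp j k = c \<and> (\<exists>g. rel l c g h \<and> quad g \<in> cls (\<Gamma>0 c) (q j k))"
      if z: "z \<in> uhp" and m: "m \<in> \<Gamma> l" "h \<in> quad (cj m (\<gamma> l))" and dx: "disp (\<gamma> l) (mob m (\<phi> l c z)) \<in> {b..T'}"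
        and side: "side (mob m (\<phi> l c z)) = side (y k)" for z m h c k
    proof -
      have xu: "mob m (\<phi> l c z) \<in> uhp" by (rule mob_uhp[OF gamma_carrier[OF l m(1)] phi_uhp[OF l z]])
      obtain n where n: "n \<in> \<Gamma> l" "n ** \<gamma> l = \<gamma> l ** n" "hdist (mob m (\<phi> l c z)) (mob n (y k)) \<le> R"
        using strip_near[OF sc group_l[OF l] gc xu yu side dx dy b] unfolding R_def by blast
      show ?thesis
        by (rule conj_transfer[OF a i z g(1)[OF l] hk(2,1,3) m n(1,2)]) (use n(3) in \<open>simp add: y_def\<close>)
    qed
    have sides: "side (y 1) \<noteq> side (y 2)"
    proof
      assume s: "side (y 1) = side (y 2)"
      have t: "cmp j 2 = cmp j 1 \<and> (\<exists>g. rel l (cmp j 1) g (hh 1) \<and> quad g \<in> cls (\<Gamma>0 (cmp j 1)) (q j 2))"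
        by (rule transfer[OF i hk(1)[of 1] hk(3)[of 1]]) (use dy[of 1] s in \<open>simp_all add: y_def\<close>)
      then obtain g where gg: "rel l (cmp j 1) g (hh 1)" "quad g \<in> cls (\<Gamma>0 (cmp j 1)) (q j 2)" by blast
      have "quad g = quad (q j 1)" by (rule rel_quad_left[OF l gg(1) hk(2)[of 1] refl])
      moreover have "quad (q j 1) \<in> cls (\<Gamma>0 (cmp j 1)) (q j 1)"
        unfolding cls_def using subgroup_SL2R_D(2)[OF limit_group(1)] by (intro image_eqI[of _ _ "mat 1"]) simp_all
      moreover have "cls (\<Gamma>0 (cmp j 1)) (q j 1) \<inter> cls (\<Gamma>0 (cmp j 1)) (q j 2) = {}"
      proof (rule cls_disjoint[OF limit_group(1)])
        show "cusp_gen (\<Gamma>0 (cmp j 1)) (q j 1)" by (rule developing)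
        show "cusp_gen (\<Gamma>0 (cmp j 1)) (q j 2)" using developing[of j 2] t by simp
        show "\<not> same_cusp (\<Gamma>0 (cmp j 1)) (q j 1) (q j 2)"
          by (rule developing_distinct) (use t in auto)
      qed
      ultimately show False using gg(2) by auto
    qed
    show "\<forall>z\<in>K. \<forall>h\<in>\<Gamma> l. quad h \<in> cls (\<Gamma> l) (\<gamma> l) \<longrightarrow> disp h (\<phi> l c z) \<le> T \<longrightarrow>
       (\<exists>k. cmp j k = c \<and> (\<exists>g. rel l c g h \<and> quad g \<in> cls (\<Gamma>0 c) (q j k)))"
    proof (intro ballI impI)
      fix z h assume z: "z \<in> K" and h: "h \<in> \<Gamma> l" "quad h \<in> cls (\<Gamma> l) (\<gamma> l)" and T: "disp h (\<phi> l c z) \<le> T"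
      have zu: "z \<in> uhp" using z K by blast
      obtain m where m: "m \<in> \<Gamma> l" "h \<in> quad (cj m (\<gamma> l))" using cls_memD[OF group_l[OF l] g(1)[OF l] h(2)] by blast
      note d = disp_quad_cj_pos[OF gc gamma_carrier[OF l m(1)] m(2) pos]
      have "b \<le> disp h (\<phi> l c z)" using low z h(1) d(2) by blast
      then have dx: "disp (\<gamma> l) (mob m (\<phi> l c z)) \<in> {b..T'}"
        unfolding d(1)[OF phi_uhp[OF l zu], symmetric] using T by (simp add: T'_def)
      \<comment> \<open>\<open>side\<close> takes two values, and \<open>y 1\<close> and
        \<open>y 2\<close> realize both of them.\<close>
      have "side (mob m (\<phi> l c z)) = side (y 1) \<or> side (mob m (\<phi> l c z)) = side (y 2)" using sides by blast
      then show "\<exists>k. cmp j k = c \<and> (\<exists>g. rel l c g h \<and> quad g \<in> cls (\<Gamma>0 c) (q j k))"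
        using transfer[OF zu m dx] by blast
    qed
  qed
qed

text \<open>Lengths shrink here, so sides have to be respected, and the limit runs over the classes
  of the developing cusps on c. These classes are disjoint by \<open>developing_distinct\<close>,
  which splits the limit sum into parabolic Eisenstein series.\<close>

theorem pinching_converges:
  assumes p: "\<And>l. l \<in> L \<Longrightarrow> primitive_hyp (\<Gamma> l) (\<gamma> l)"
    and ax: "\<And>l. l \<in> L \<Longrightarrow> \<exists>h\<in>\<Gamma> l. geod_axis (\<gamma> l) = mob h ` geod_axis (d l j)"
    and K: "compact K" "K \<subseteq> uhp" and S: "compact S" and \<delta>: "0 < \<delta>" "\<And>s. s \<in> S \<Longrightarrow> 1 + \<delta> \<le> Re s"
  shows "uniform_limit (K \<times> S) (\<lambda>l (z, s). of_real (geod_length (\<gamma> l)) powr (- s) * E_hyp (\<Gamma> l) (\<gamma> l) s (\<phi> l c z))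
    (\<lambda>(z, s). \<Sum>k\<in>{k. cmp j k = c}. E_par (\<Gamma>0 c) (q j k) s z) (at 0 within L)"
proof -
  have h: "\<gamma> l \<in> \<Gamma> l" "hyperbolic (\<gamma> l)" if "l \<in> L" for l using p[OF that] by (auto simp: primitive_hyp_def)
  \<comment> \<open>An axis equivalent to that of \<open>d l j\<close> determines a primitive
    element up to conjugacy, sign and inverse.\<close>
  have qd: "\<exists>k\<in>\<Gamma> l. cj k (\<gamma> l) \<in> quad (d l j)" if l: "l \<in> L" for l
    using ax[OF l] primitive_axis_image[OF group_l[OF l] _ p[OF l]] geodesics[OF l] by blast
  have len: "geod_length (\<gamma> l) = l $ j" if l: "l \<in> L" for l
  proof -
    obtain k where k: "k \<in> \<Gamma> l" "cj k (\<gamma> l) \<in> quad (d l j)" using qd[OF l] by blast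
    have kc: "k \<in> carrier SL2R" by (rule gamma_carrier[OF l k(1)])
    have dl: "hyperbolic (d l j)" "d l j \<in> carrier SL2R" "geod_length (d l j) = l $ j"
      using geodesics[OF l, of j] by (auto simp: primitive_hyp_def hyperbolic_def)
    have "\<bar>trace (\<gamma> l)\<bar> = \<bar>trace (d l j)\<bar>" using trace_quad_abs[OF dl(2) k(2)] by (simp add: trace_cj kc)
    then show ?thesis using geod_length_cong[OF h(2)[OF l] dl(1)] dl(3) by simp
  qed
  have rl: "\<exists>h \<kappa>. \<kappa> \<in> \<Gamma> l \<and> rel l (cmp j k) (q j k) h \<and> h \<in> quad (cj \<kappa> (\<gamma> l))" if l: "l \<in> L" for l k
  proof -
    obtain m where m: "m \<in> \<Gamma> l" "cj m (\<gamma> l) \<in> quad (d l j)" using qd[OF l] by blast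
    have dG: "d l j \<in> \<Gamma> l" "d l j \<in> carrier SL2R" using geodesics[OF l, of j] gamma_carrier[OF l] by (auto simp: primitive_hyp_def)
    have qG: "q j k \<in> \<Gamma>0 (cmp j k)" using developing[of j k] by (simp add: cusp_gen_def)
    obtain h \<kappa> where hk: "\<kappa> \<in> \<Gamma> l" "rel l (cmp j k) (q j k) h" "h \<in> quad (cj \<kappa> (d l j))"
      by (rule corresponds_rel[OF l qG dG(1) developing_corresponds[OF l]])
    have c: "\<kappa> \<in> carrier SL2R" "m \<in> carrier SL2R" using gamma_carrier[OF l] hk m by auto
    have "quad (cj \<kappa> (cj m (\<gamma> l))) = quad (cj \<kappa> (d l j))" by (rule quad_cj_eq[OF c(1) dG(2) m(2)])
    then have "h \<in> quad (cj (m ** \<kappa>) (\<gamma> l))" using hk(3) by (simp add: cj_mult c)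
    then show ?thesis using hk(2) subgroup_SL2R_D(3)[OF group_l[OF l] m(1) hk(1)] by blast
  qed
  define J where "J = {k. cmp j k = c}"
  define Q where "Q = q j ` J"
  have cg: "cusp_gen (\<Gamma>0 c) (q j k)" if "k \<in> J" for k using developing[of j k] that by (simp add: J_def)
  have pq: "q j k \<in> \<Gamma>0 c" "parabolic (q j k)" if "k \<in> J" for k using cg[OF that] by (auto simp: cusp_gen_def)
  have Q: "finite Q" "Q \<subseteq> \<Gamma>0 c" "\<And>p u. p \<in> Q \<Longrightarrow> u \<in> uhp \<Longrightarrow> 0 < disp p u"
    "\<And>p. p \<in> Q \<Longrightarrow> \<exists>side \<tau>. strip_coords (\<Gamma>0 c) p side \<tau>"
    using pq parabolic_disp_pos parabolic_strip_exists[OF limit_group(1) pq] by (auto simp: Q_def)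
  have QJ: "(\<Union>p\<in>Q. cls (\<Gamma>0 c) p) = (\<Union>k\<in>J. cls (\<Gamma>0 c) (q j k))" by (simp add: Q_def)
  have scl: "\<exists>side \<tau>. strip_coords (\<Gamma> l) (\<gamma> l) side \<tau>" if "l \<in> L" for l
    by (rule hyperbolic_strip_exists[OF group_l[OF that] h[OF that]])
  have U: "uniform_limit (K \<times> S) (\<lambda>l (z, s). esum (cls (\<Gamma> l) (\<gamma> l)) s (\<phi> l c z))
    (\<lambda>(z, s). esum (\<Union>p\<in>Q. cls (\<Gamma>0 c) p) s z) (at 0 within L)"
  proof (rule esum_converges[OF Q h(1) scl _ _ K S \<delta>])
    fix l p assume l: "l \<in> L" and "p \<in> Q"
    then obtain k where k: "cmp j k = c" "p = q j k" by (auto simp: Q_def J_def)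
    obtain g \<kappa> where hk: "\<kappa> \<in> \<Gamma> l" "rel l (cmp j k) (q j k) g" "g \<in> quad (cj \<kappa> (\<gamma> l))" using rl[OF l] by blast
    have "quad g \<in> cls (\<Gamma> l) (\<gamma> l)"
      by (rule cls_mem_of_quad_cj[OF gamma_carrier[OF l h(1)[OF l]] gamma_carrier[OF l hk(1)] hk(1,3)])
    then show "\<exists>h. rel l c p h \<and> quad h \<in> cls (\<Gamma> l) (\<gamma> l)" using hk(2) k by blast
  next
    fix T
    show "\<forall>\<^sub>F l in at 0 within L. \<forall>z\<in>K. \<forall>h\<in>\<Gamma> l. quad h \<in> cls (\<Gamma> l) (\<gamma> l) \<longrightarrow> disp h (\<phi> l c z) \<le> T \<longrightarrow>
       (\<exists>g. rel l c g h \<and> quad g \<in> (\<Union>p\<in>Q. cls (\<Gamma>0 c) p))"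
    proof -
      have "\<forall>\<^sub>F l in at 0 within L. \<forall>z\<in>K. \<forall>h\<in>\<Gamma> l. quad h \<in> cls (\<Gamma> l) (\<gamma> l) \<longrightarrow> disp h (\<phi> l c z) \<le> T \<longrightarrow>
       (\<exists>k. cmp j k = c \<and> (\<exists>g. rel l c g h \<and> quad g \<in> cls (\<Gamma>0 c) (q j k)))"
        by (rule eventually_conjugate_to_developing[OF h rl K])
      then show ?thesis
      proof eventually_elim
      fix l assume ev: "\<forall>z\<in>K. \<forall>h\<in>\<Gamma> l. quad h \<in> cls (\<Gamma> l) (\<gamma> l) \<longrightarrow> disp h (\<phi> l c z) \<le> T \<longrightarrow>
       (\<exists>k. cmp j k = c \<and> (\<exists>g. rel l c g h \<and> quad g \<in> cls (\<Gamma>0 c) (q j k)))"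
      show "\<forall>z\<in>K. \<forall>h\<in>\<Gamma> l. quad h \<in> cls (\<Gamma> l) (\<gamma> l) \<longrightarrow> disp h (\<phi> l c z) \<le> T \<longrightarrow>
       (\<exists>g. rel l c g h \<and> quad g \<in> (\<Union>p\<in>Q. cls (\<Gamma>0 c) p))"
      proof (intro ballI impI)
        fix z h assume "z \<in> K" "h \<in> \<Gamma> l" "quad h \<in> cls (\<Gamma> l) (\<gamma> l)" "disp h (\<phi> l c z) \<le> T"
        then obtain k g where "cmp j k = c" "rel l c g h" "quad g \<in> cls (\<Gamma>0 c) (q j k)" using ev by blast
        then show "\<exists>g. rel l c g h \<and> quad g \<in> (\<Union>p\<in>Q. cls (\<Gamma>0 c) p)" unfolding QJ J_def by blast
      qed
    qed
    qed
  qed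
  have bd: "bounded ((\<lambda>(z, s). esum (\<Union>p\<in>Q. cls (\<Gamma>0 c) p) s z) ` (K \<times> S))"
    by (rule limit_esum_summable_bounded(2)[OF Q K S \<delta>])
  \<comment> \<open>The base 2 sinh (l/2) from \<open>E_hyp_eq_esum\<close> divided by the length
    from the prefactor; it tends to 1, the derivative of sinh at 0.\<close>
  define r where "r l = 2 * sinh (l $ j / 2) / l $ j" for l :: "real^'p"
  have r: "(r \<longlongrightarrow> 1) (at 0 within L)"
  proof -
    have "(sinh has_real_derivative 1) (at 0)" by (auto intro!: derivative_eq_intros)
    from DERIV_D[OF this] have s: "((\<lambda>x::real. sinh x / x) \<longlongrightarrow> 1) (at 0)" by simp
    have "filterlim (\<lambda>l::real^'p. l $ j / 2) (at 0) (at 0 within L)"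
    proof (rule filterlim_atI)
      have "((\<lambda>l::real^'p. l $ j / 2) \<longlongrightarrow> (0::real^'p) $ j / 2) (at 0 within L)" by (intro tendsto_intros) simp
      then show "((\<lambda>l::real^'p. l $ j / 2) \<longlongrightarrow> 0) (at 0 within L)" by simp
      show "\<forall>\<^sub>F l in at 0 within L. l $ j / 2 \<noteq> 0"
        using in_L
      proof eventually_elim
        fix l assume "l \<in> L"
        from lengths_pos[OF this, of j] show "l $ j / 2 \<noteq> 0" by simp
      qed
    qed
    from filterlim_compose[OF s this]
    have "((\<lambda>l. sinh (l $ j / 2) / (l $ j / 2)) \<longlongrightarrow> 1) (at 0 within L)" .
    then show ?thesis by (simp add: r_def[abs_def] mult.commute)
  qed
  from scaled_uniform_limit[OF U bd S r]
  have lim: "uniform_limit (K \<times> S) (\<lambda>l x. of_real (r l) powr snd x * (case x of (z, s) \<Rightarrow> esum (cls (\<Gamma> l) (\<gamma> l)) s (\<phi> l c z)))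
    (\<lambda>x. of_real 1 powr snd x * (case x of (z, s) \<Rightarrow> esum (\<Union>p\<in>Q. cls (\<Gamma>0 c) p) s z)) (at 0 within L)"
    by simp
  show ?thesis
  proof (rule iffD1[OF uniform_limit_cong lim])
    show "\<forall>\<^sub>F l in at 0 within L. \<forall>x\<in>K \<times> S. of_real (r l) powr snd x * (case x of (z, s) \<Rightarrow> esum (cls (\<Gamma> l) (\<gamma> l)) s (\<phi> l c z)) =
      (case x of (z, s) \<Rightarrow> of_real (geod_length (\<gamma> l)) powr (- s) * E_hyp (\<Gamma> l) (\<gamma> l) s (\<phi> l c z))"
      using in_L
    proof (eventually_elim, clarify)
      fix l z s assume l: "l \<in> L" and "z \<in> K" "s \<in> S"
      then have pu: "\<phi> l c z \<in> uhp" using phi_uhp[OF l] K by blast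
      have lp: "0 < l $ j" by (rule lengths_pos[OF l])
      have t: "sqrt ((trace (\<gamma> l))\<^sup>2 - 4) = 2 * sinh (l $ j / 2)" using hyperbolic_length(2)[OF h(2)[OF l]] len[OF l] by simp
      have "of_real (r l) powr s = of_real (2 * sinh (l $ j / 2)) powr s * of_real (l $ j) powr (- s)"
        unfolding r_def by (rule of_real_divide_powr) (use lp in auto)
      then show "of_real (r l) powr snd (z, s) * esum (cls (\<Gamma> l) (\<gamma> l)) s (\<phi> l c z) =
        of_real (geod_length (\<gamma> l)) powr (- s) * E_hyp (\<Gamma> l) (\<gamma> l) s (\<phi> l c z)"
        unfolding E_hyp_eq_esum[OF group_l[OF l] p[OF l] pu] t len[OF l] by (simp add: mult_ac)
    qed
    show "of_real 1 powr snd x * (case x of (z, s) \<Rightarrow> esum (\<Union>p\<in>Q. cls (\<Gamma>0 c) p) s z) =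
      (case x of (z, s) \<Rightarrow> \<Sum>k\<in>{k. cmp j k = c}. E_par (\<Gamma>0 c) (q j k) s z)" if x: "x \<in> K \<times> S" for x
    proof -
      obtain z s where zs: "x = (z, s)" "z \<in> K" "s \<in> S" using x by blast
      have zu: "z \<in> uhp" using zs K by blast
      have dis: "cls (\<Gamma>0 c) (q j i) \<inter> cls (\<Gamma>0 c) (q j k) = {}" if ik: "i \<in> J" "k \<in> J" "i \<noteq> k" for i k
      proof (rule cls_disjoint[OF limit_group(1) cg[OF ik(1)] cg[OF ik(2)]])
        show "\<not> same_cusp (\<Gamma>0 c) (q j i) (q j k)" using developing_distinct[of j i j k] ik by (simp add: J_def)
      qed
      have "(\<lambda>X. of_real (val X z) powr (- s) :: complex) summable_on (\<Union>p\<in>Q. cls (\<Gamma>0 c) p)"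
        by (rule limit_esum_summable_bounded(1)[OF Q K S \<delta> zs(2,3)])
      then have summ: "(\<lambda>X. of_real (val X z) powr (- s) :: complex) summable_on cls (\<Gamma>0 c) (q j k)" if k: "k \<in> J" for k
        by (rule summable_on_subset_banach) (use k in \<open>auto simp: QJ\<close>)
      have "esum (\<Union>k\<in>J. cls (\<Gamma>0 c) (q j k)) s z = (\<Sum>k\<in>J. esum (cls (\<Gamma>0 c) (q j k)) s z)"
        by (rule conjunct1[OF esum_disjoint_union[OF _ dis summ]]) simp_all
      also have "\<dots> = (\<Sum>k\<in>J. E_par (\<Gamma>0 c) (q j k) s z)"
        using E_par_eq_esum[OF limit_group(1) cg zu] by (intro sum.cong) auto
      finally show ?thesis unfolding zs QJ J_def by simp
    qed
  qed
qed

end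

theorem mainTheorem1:
  fixes L :: "(real^'p::finite) set"
    and \<Gamma> :: "real^'p \<Rightarrow> mat22 set"
    and d :: "real^'p \<Rightarrow> 'p \<Rightarrow> mat22"
    and \<Gamma>0 :: "'c::finite \<Rightarrow> mat22 set"
    and \<phi> :: "real^'p \<Rightarrow> 'c \<Rightarrow> complex \<Rightarrow> complex"
    and cmp :: "'p \<Rightarrow> 2 \<Rightarrow> 'c"
    and q :: "'p \<Rightarrow> 2 \<Rightarrow> mat22"
  assumes "degenerating_family L \<Gamma> d \<Gamma>0 \<phi> cmp q"
  shows "
    (\<forall>c0 \<gamma>0 \<gamma>.
       primitive_hyp (\<Gamma>0 c0) \<gamma>0 \<and>
       (\<forall>l\<in>L. primitive_hyp (\<Gamma> l) (\<gamma> l) \<and> corresponds (\<Gamma> l) (\<phi> l c0) \<gamma>0 (\<gamma> l)) \<longrightarrow>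
       (let F = (\<lambda>l s w. E_hyp (\<Gamma> l) (\<gamma> l) s w);
            F0 = (\<lambda>c s z. if c = c0 then E_hyp (\<Gamma>0 c0) \<gamma>0 s z else 0)
        in converges_pointwise L \<phi> F F0 \<and> converges_uniformly L \<Gamma>0 \<phi> cmp q F F0)) \<and>
    (\<forall>c0 p0 p.
       cusp_gen (\<Gamma>0 c0) p0 \<and>
       (\<forall>l\<in>L. cusp_gen (\<Gamma> l) (p l) \<and> corresponds (\<Gamma> l) (\<phi> l c0) p0 (p l)) \<longrightarrow>
       (let F = (\<lambda>l s w. E_par (\<Gamma> l) (p l) s w);
            F0 = (\<lambda>c s z. if c = c0 then E_par (\<Gamma>0 c0) p0 s z else 0)
        in converges_pointwise L \<phi> F F0 \<and> converges_uniformly L \<Gamma>0 \<phi> cmp q F F0)) \<and>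
    (\<forall>j \<gamma>.
       (\<forall>l\<in>L. primitive_hyp (\<Gamma> l) (\<gamma> l) \<and> (\<exists>h\<in>\<Gamma> l. geod_axis (\<gamma> l) = mob h ` geod_axis (d l j))) \<longrightarrow>
       (let F = (\<lambda>l s w. of_real (geod_length (\<gamma> l)) powr (- s) * E_hyp (\<Gamma> l) (\<gamma> l) s w);
            F0 = (\<lambda>c s z. \<Sum>k\<in>{k. cmp j k = c}. E_par (\<Gamma>0 c) (q j k) s z)
        in converges_pointwise L \<phi> F F0 \<and> converges_uniformly L \<Gamma>0 \<phi> cmp q F F0))"
proof -
  interpret degenerating_family L \<Gamma> d \<Gamma>0 \<phi> cmp q by (rule assms)
  have 1: "converges_pointwise L \<phi> (\<lambda>l s w. E_hyp (\<Gamma> l) (\<gamma> l) s w) (\<lambda>c s z. if c = c0 then E_hyp (\<Gamma>0 c0) \<gamma>0 s z else 0) \<and>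
      converges_uniformly L \<Gamma>0 \<phi> cmp q (\<lambda>l s w. E_hyp (\<Gamma> l) (\<gamma> l) s w) (\<lambda>c s z. if c = c0 then E_hyp (\<Gamma>0 c0) \<gamma>0 s z else 0)"
    if "primitive_hyp (\<Gamma>0 c0) \<gamma>0 \<and> (\<forall>l\<in>L. primitive_hyp (\<Gamma> l) (\<gamma> l) \<and> corresponds (\<Gamma> l) (\<phi> l c0) \<gamma>0 (\<gamma> l))" for c0 \<gamma>0 \<gamma>
    using that by (intro convergesI hyperbolic_converges) auto
  have 2: "converges_pointwise L \<phi> (\<lambda>l s w. E_par (\<Gamma> l) (p l) s w) (\<lambda>c s z. if c = c0 then E_par (\<Gamma>0 c0) p0 s z else 0) \<and>
      converges_uniformly L \<Gamma>0 \<phi> cmp q (\<lambda>l s w. E_par (\<Gamma> l) (p l) s w) (\<lambda>c s z. if c = c0 then E_par (\<Gamma>0 c0) p0 s z else 0)"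
    if "cusp_gen (\<Gamma>0 c0) p0 \<and> (\<forall>l\<in>L. cusp_gen (\<Gamma> l) (p l) \<and> corresponds (\<Gamma> l) (\<phi> l c0) p0 (p l))" for c0 p0 p
    using that by (intro convergesI parabolic_converges) auto
  have 3: "converges_pointwise L \<phi> (\<lambda>l s w. of_real (geod_length (\<gamma> l)) powr (- s) * E_hyp (\<Gamma> l) (\<gamma> l) s w)
        (\<lambda>c s z. \<Sum>k\<in>{k. cmp j k = c}. E_par (\<Gamma>0 c) (q j k) s z) \<and>
      converges_uniformly L \<Gamma>0 \<phi> cmp q (\<lambda>l s w. of_real (geod_length (\<gamma> l)) powr (- s) * E_hyp (\<Gamma> l) (\<gamma> l) s w)
        (\<lambda>c s z. \<Sum>k\<in>{k. cmp j k = c}. E_par (\<Gamma>0 c) (q j k) s z)"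
    if "\<forall>l\<in>L. primitive_hyp (\<Gamma> l) (\<gamma> l) \<and> (\<exists>h\<in>\<Gamma> l. geod_axis (\<gamma> l) = mob h ` geod_axis (d l j))" for j \<gamma>
    using that by (intro convergesI pinching_converges) auto
  show ?thesis
    unfolding Let_def
    by (intro conjI allI impI; erule 1[THEN conjunct1] 1[THEN conjunct2] 2[THEN conjunct1] 2[THEN conjunct2]
      3[THEN conjunct1] 3[THEN conjunct2])
qed

end
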